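(* For every integer $s\ge0$, let $n_s=5(2^s-1)+42\cdot2^s$. Then $$\dim_{\mathbb Z_2}(QP_6)_{n_{s+5}}=(2^6-1)\dim_{\mathbb Z_2}(QP_5)_{n_s}=158760,$$ where $n_{s+5}=5(2^{s+5}-1)+42\cdot2^{s+5}$.
   Context: $\mathbb Z_2$ is the field with two elements, $\mathcal A_2$ the mod 2 Steenrod algebra, and $P_t=\mathbb Z_2[x_1,\dots,x_t]$ with $\deg x_i=1$, a left $\mathcal A_2$-module via $Sq^i(x_j^a)=\binom{a}{i}x_j^{a+i}$ and the Cartan formula. $(P_t)_n$ is the space of homogeneous polynomials of degree $n$, and $(QP_t)_n=(\mathbb Z_2\otimes_{\mathcal A_2}P_t)_n=(P_t)_n/\sum_{i>0}\mathrm{Im}(Sq^i:(P_t)_{n-i}\to(P_t)_n)$. *)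

theory Defs
  imports
    "HOL-Library.Poly_Mapping"
    "HOL-Library.Z2"
    "HOL-Algebra.AbelCoset"
    "Jordan_Normal_Form.VS_Connect"
begin

section \<open>Polynomials over the field with two elements\<close>

text \<open>
  A monomial is given by its exponent vector: \<open>m\<close> stands for the product of the powers of
  the variables \<open>x\<^sub>j\<close> with exponents \<open>m\<^sub>j\<close>, so monomials are multiplied by \<open>+\<close>. With the
  convolution product of \<^theory>\<open>HOL-Library.Poly_Mapping\<close>, the type \<open>poly2\<close> is the
  polynomial ring over \<^typ>\<open>bit\<close> in countably many variables.
\<close>

type_synonym monomial = "nat \<Rightarrow>\<^sub>0 nat"
type_synonym poly2 = "monomial \<Rightarrow>\<^sub>0 bit"

definition monom_deg :: "monomial \<Rightarrow> nat"
  where "monom_deg m = (\<Sum>j\<in>Poly_Mapping.keys m. Poly_Mapping.lookup m j)"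

definition hom_polys :: "nat \<Rightarrow> nat \<Rightarrow> poly2 set"
  where "hom_polys t n = {p. \<forall>m\<in>Poly_Mapping.keys p. Poly_Mapping.keys m \<subseteq> {1..t} \<and> monom_deg m = n}"

definition hom_space :: "nat \<Rightarrow> nat \<Rightarrow> (bit, poly2) module"
  where "hom_space t n =
    \<lparr>carrier = hom_polys t n, mult = undefined, one = undefined, zero = 0, add = (+),
     smult = (\<lambda>c p. Poly_Mapping.single 0 c * p)\<rparr>"


section \<open>Steenrod squares\<close>

text \<open>
  Iterating the Cartan formula over the variables of a monomial \<open>m\<close> shows that \<open>Sq\<^sup>k m\<close> is the
  sum, over the exponent vectors \<open>d\<close> of degree \<open>k\<close> in these variables, of \<open>m + d\<close> with
  coefficient the product of the \<open>m\<^sub>j choose d\<^sub>j\<close>. Conversely, the lemmas \<open>Sq_add\<close>,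
  \<open>Sq_var_power\<close> and \<open>Sq_Cartan\<close> below determine the action.
\<close>

definition Sq :: "nat \<Rightarrow> poly2 \<Rightarrow> poly2"
  where "Sq k p =
    (\<Sum>m\<in>Poly_Mapping.keys p. \<Sum>d | Poly_Mapping.keys d \<subseteq> Poly_Mapping.keys m \<and> monom_deg d = k.
       Poly_Mapping.single (m + d) (Poly_Mapping.lookup p m * of_nat (\<Prod>j\<in>Poly_Mapping.keys m. Poly_Mapping.lookup m j choose Poly_Mapping.lookup d j)))"

lemma monom_deg_superset:
  assumes "finite A" "Poly_Mapping.keys m \<subseteq> A"
  shows "monom_deg m = (\<Sum>j\<in>A. Poly_Mapping.lookup m j)"
  unfolding monom_deg_def
  using assms by (intro sum.mono_neutral_left) (auto simp: in_keys_iff)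

lemma monom_deg_add: "monom_deg (m + d) = monom_deg m + monom_deg d"
proof -
  let ?A = "Poly_Mapping.keys m \<union> Poly_Mapping.keys d"
  have "Poly_Mapping.keys (m + d) \<subseteq> ?A" by (rule Poly_Mapping.keys_add)
  then show ?thesis
    by (simp add: monom_deg_superset[of ?A] lookup_add sum.distrib)
qed

lemma finite_monomials:
  assumes "finite A"
  shows "finite {d. Poly_Mapping.keys d \<subseteq> A \<and> monom_deg d = k}"
proof (rule finite_imageD)
  show "inj_on Poly_Mapping.lookup {d. Poly_Mapping.keys d \<subseteq> A \<and> monom_deg d = k}"
    by (intro inj_onI) (simp only: poly_mapping_eq_iff)
  have "Poly_Mapping.lookup d i \<le> monom_deg d" if "Poly_Mapping.keys d \<subseteq> A" "i \<in> A" for d i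
    using member_le_sum[of i A "Poly_Mapping.lookup d"] that assms by (simp add: monom_deg_superset[of A])
  then have "Poly_Mapping.lookup ` {d. Poly_Mapping.keys d \<subseteq> A \<and> monom_deg d = k}
    \<subseteq> {f. \<forall>x. (x \<in> A \<longrightarrow> f x \<in> {..k}) \<and> (x \<notin> A \<longrightarrow> f x = 0)}"
    by (auto simp: in_keys_iff)
  then show "finite (Poly_Mapping.lookup ` {d. Poly_Mapping.keys d \<subseteq> A \<and> monom_deg d = k})"
    by (rule finite_subset) (rule finite_set_of_finite_funs[OF assms finite_atMost])
qed

lemma Sq_superset:
  assumes "finite B" "Poly_Mapping.keys p \<subseteq> B"
  shows "Sq k p =
    (\<Sum>m\<in>B. \<Sum>d | Poly_Mapping.keys d \<subseteq> Poly_Mapping.keys m \<and> monom_deg d = k.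
       Poly_Mapping.single (m + d) (Poly_Mapping.lookup p m * of_nat (\<Prod>j\<in>Poly_Mapping.keys m. Poly_Mapping.lookup m j choose Poly_Mapping.lookup d j)))"
  unfolding Sq_def
  using assms by (intro sum.mono_neutral_left) (auto simp: in_keys_iff)

lemma Sq_zero [simp]: "Sq k 0 = 0"
  by (simp add: Sq_def)

lemma Sq_add: "Sq k (p + q) = Sq k p + Sq k q"
proof -
  let ?B = "Poly_Mapping.keys p \<union> Poly_Mapping.keys q"
  have B: "finite ?B" "Poly_Mapping.keys p \<subseteq> ?B" "Poly_Mapping.keys q \<subseteq> ?B" by auto
  have "Poly_Mapping.keys (p + q) \<subseteq> ?B" by (rule Poly_Mapping.keys_add)
  then show ?thesis
    by (simp only: Sq_superset[OF B(1)] B lookup_add distrib_right single_add sum.distrib)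
qed

lemma Sq_sum: "Sq k (\<Sum>x\<in>X. f x) = (\<Sum>x\<in>X. Sq k (f x))"
  by (induction X rule: infinite_finite_induct) (simp_all add: Sq_add)

lemma Sq_single:
  assumes "finite A" "Poly_Mapping.keys m \<subseteq> A"
  shows "Sq k (Poly_Mapping.single m c) =
    (\<Sum>d | Poly_Mapping.keys d \<subseteq> A \<and> monom_deg d = k.
       Poly_Mapping.single (m + d) (c * of_nat (\<Prod>j\<in>A. Poly_Mapping.lookup m j choose Poly_Mapping.lookup d j)))"
proof -
  have "Sq k (Poly_Mapping.single m c) =
    (\<Sum>d | Poly_Mapping.keys d \<subseteq> Poly_Mapping.keys m \<and> monom_deg d = k.
       Poly_Mapping.single (m + d) (c * of_nat (\<Prod>j\<in>Poly_Mapping.keys m. Poly_Mapping.lookup m j choose Poly_Mapping.lookup d j)))"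
    by (subst Sq_superset[of "{m}"]) simp_all
  also have "\<dots> = (\<Sum>d | Poly_Mapping.keys d \<subseteq> Poly_Mapping.keys m \<and> monom_deg d = k.
       Poly_Mapping.single (m + d) (c * of_nat (\<Prod>j\<in>A. Poly_Mapping.lookup m j choose Poly_Mapping.lookup d j)))"
  proof (intro sum.cong refl)
    fix d assume "d \<in> {d. Poly_Mapping.keys d \<subseteq> Poly_Mapping.keys m \<and> monom_deg d = k}"
    then have "Poly_Mapping.lookup d j = 0" if "j \<notin> Poly_Mapping.keys m" for j
      using that by (auto simp: in_keys_iff)
    then have "(\<Prod>j\<in>Poly_Mapping.keys m. Poly_Mapping.lookup m j choose Poly_Mapping.lookup d j)
        = (\<Prod>j\<in>A. Poly_Mapping.lookup m j choose Poly_Mapping.lookup d j)"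
      using assms by (intro prod.mono_neutral_left) auto
    then show "Poly_Mapping.single (m + d) (c * of_nat (\<Prod>j\<in>Poly_Mapping.keys m. Poly_Mapping.lookup m j choose Poly_Mapping.lookup d j)) =
        Poly_Mapping.single (m + d) (c * of_nat (\<Prod>j\<in>A. Poly_Mapping.lookup m j choose Poly_Mapping.lookup d j))"
      by simp
  qed
  also have "\<dots> = (\<Sum>d | Poly_Mapping.keys d \<subseteq> A \<and> monom_deg d = k.
       Poly_Mapping.single (m + d) (c * of_nat (\<Prod>j\<in>A. Poly_Mapping.lookup m j choose Poly_Mapping.lookup d j)))"
  proof (rule sum.mono_neutral_left)
    show "finite {d. Poly_Mapping.keys d \<subseteq> A \<and> monom_deg d = k}"
      using finite_monomials assms(1) .
    show "{d. Poly_Mapping.keys d \<subseteq> Poly_Mapping.keys m \<and> monom_deg d = k} \<subseteq> {d. Poly_Mapping.keys d \<subseteq> A \<and> monom_deg d = k}"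
      using assms by auto
    show "\<forall>d\<in>{d. Poly_Mapping.keys d \<subseteq> A \<and> monom_deg d = k} - {d. Poly_Mapping.keys d \<subseteq> Poly_Mapping.keys m \<and> monom_deg d = k}.
        Poly_Mapping.single (m + d) (c * of_nat (\<Prod>j\<in>A. Poly_Mapping.lookup m j choose Poly_Mapping.lookup d j)) = 0"
    proof
      fix d assume d: "d \<in> {d. Poly_Mapping.keys d \<subseteq> A \<and> monom_deg d = k}
          - {d. Poly_Mapping.keys d \<subseteq> Poly_Mapping.keys m \<and> monom_deg d = k}"
      then obtain j where j: "j \<in> Poly_Mapping.keys d" "j \<notin> Poly_Mapping.keys m" by auto
      have "j \<in> A" using d j by auto
      moreover have "Poly_Mapping.lookup m j choose Poly_Mapping.lookup d j = 0"
        using j by (simp add: in_keys_iff)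
      ultimately have "(\<Prod>j\<in>A. Poly_Mapping.lookup m j choose Poly_Mapping.lookup d j) = 0"
        using assms(1) by (meson prod_zero)
      then show "Poly_Mapping.single (m + d) (c * of_nat (\<Prod>j\<in>A. Poly_Mapping.lookup m j choose Poly_Mapping.lookup d j)) = 0"
        by simp
    qed
  qed
  finally show ?thesis .
qed

lemma Sq_var_power:
  "Sq i (Poly_Mapping.single (Poly_Mapping.single j a) 1) = Poly_Mapping.single (Poly_Mapping.single j (a + i)) (of_nat (a choose i))"
proof -
  have deg: "monom_deg (Poly_Mapping.single j i) = i" for i
    by (simp add: monom_deg_def)
  have "{d. Poly_Mapping.keys d \<subseteq> {j} \<and> monom_deg d = i} = {Poly_Mapping.single j i}"
  proof (intro Set.set_eqI iffI)
    fix d assume "d \<in> {d. Poly_Mapping.keys d \<subseteq> {j} \<and> monom_deg d = i}"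
    then have "Poly_Mapping.keys d \<subseteq> {j}" "Poly_Mapping.lookup d j = i"
      by (auto simp: monom_deg_superset[of "{j}"])
    then show "d \<in> {Poly_Mapping.single j i}"
      by (auto intro!: poly_mapping_eqI simp: lookup_single when_def in_keys_iff)
  qed (auto simp: deg)
  then show ?thesis
    by (subst Sq_single[of "{j}"]) (auto simp: single_add)
qed

lemma prod_vandermonde:
  fixes a b d :: monomial
  assumes "finite A" "Poly_Mapping.keys d \<subseteq> A"
  shows "(\<Sum>(e, f) | Poly_Mapping.keys e \<subseteq> A \<and> Poly_Mapping.keys f \<subseteq> A \<and> e + f = d.
      (\<Prod>j\<in>A. Poly_Mapping.lookup a j choose Poly_Mapping.lookup e j) * (\<Prod>j\<in>A. Poly_Mapping.lookup b j choose Poly_Mapping.lookup f j))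
    = (\<Prod>j\<in>A. Poly_Mapping.lookup (a + b) j choose Poly_Mapping.lookup d j)"
proof -
  let ?P = "PiE A (\<lambda>j. {..Poly_Mapping.lookup d j})"
  let ?S = "{(e, f). Poly_Mapping.keys e \<subseteq> A \<and> Poly_Mapping.keys f \<subseteq> A \<and> e + f = d}"
  let ?up = "\<lambda>g. Abs_poly_mapping (\<lambda>j. if j \<in> A then g j else 0) :: monomial"
  have up: "Poly_Mapping.lookup (?up g) j = (if j \<in> A then g j else 0)" for g j
    by (subst Abs_poly_mapping_inverse) (auto intro: finite_subset[OF _ assms(1)])
  have out: "Poly_Mapping.lookup e j = 0" if "Poly_Mapping.keys e \<subseteq> A" "j \<notin> A" for e :: monomial and j
    using that by (auto simp: in_keys_iff)
  have "(\<Prod>j\<in>A. Poly_Mapping.lookup (a + b) j choose Poly_Mapping.lookup d j)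
      = (\<Prod>j\<in>A. \<Sum>i\<in>{..Poly_Mapping.lookup d j}. (Poly_Mapping.lookup a j choose i) * (Poly_Mapping.lookup b j choose (Poly_Mapping.lookup d j - i)))"
    by (intro prod.cong refl) (simp add: lookup_add vandermonde)
  also have "\<dots> = (\<Sum>g\<in>?P. \<Prod>j\<in>A.
      (Poly_Mapping.lookup a j choose g j) * (Poly_Mapping.lookup b j choose (Poly_Mapping.lookup d j - g j)))"
    using assms(1) by (subst prod_sum_PiE) auto
  also have "\<dots> = (\<Sum>(e, f)\<in>?S.
      (\<Prod>j\<in>A. Poly_Mapping.lookup a j choose Poly_Mapping.lookup e j) * (\<Prod>j\<in>A. Poly_Mapping.lookup b j choose Poly_Mapping.lookup f j))"
  proof (rule sum.reindex_bij_witness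
      [where i = "\<lambda>(e, f). restrict (Poly_Mapping.lookup e) A" and j = "\<lambda>g. (?up g, d - ?up g)"])
    fix g assume g: "g \<in> ?P"
    show "(case (?up g, d - ?up g) of (e, f) \<Rightarrow> restrict (Poly_Mapping.lookup e) A) = g"
      using g by (auto simp: fun_eq_iff up PiE_def extensional_def)
    have "?up g + (d - ?up g) = d"
      using g by (intro poly_mapping_eqI) (auto simp: lookup_add lookup_minus up PiE_def Pi_def)
    moreover have "Poly_Mapping.keys (?up g) \<subseteq> A" "Poly_Mapping.keys (d - ?up g) \<subseteq> A"
      using assms(2) by (auto simp: in_keys_iff up lookup_minus split: if_splits)
    ultimately show "(?up g, d - ?up g) \<in> ?S" by simp
    show "(case (?up g, d - ?up g) of (e, f) \<Rightarrow>
        (\<Prod>j\<in>A. Poly_Mapping.lookup a j choose Poly_Mapping.lookup e j) * (\<Prod>j\<in>A. Poly_Mapping.lookup b j choose Poly_Mapping.lookup f j))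
      = (\<Prod>j\<in>A. (Poly_Mapping.lookup a j choose g j) * (Poly_Mapping.lookup b j choose (Poly_Mapping.lookup d j - g j)))"
      by (simp add: up lookup_minus prod.distrib)
  next
    fix x assume "x \<in> ?S"
    then obtain e f where x: "x = (e, f)" "Poly_Mapping.keys e \<subseteq> A" "Poly_Mapping.keys f \<subseteq> A" "e + f = d" by auto
    have *: "?up (restrict (Poly_Mapping.lookup e) A) = e"
      by (intro poly_mapping_eqI) (use x out[of e] in \<open>auto simp: up\<close>)
    show "(?up (case x of (e, f) \<Rightarrow> restrict (Poly_Mapping.lookup e) A),
        d - ?up (case x of (e, f) \<Rightarrow> restrict (Poly_Mapping.lookup e) A)) = x"
      using x * by auto
    show "(case x of (e, f) \<Rightarrow> restrict (Poly_Mapping.lookup e) A) \<in> ?P"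
      using x by (auto simp: lookup_add)
  qed
  finally show ?thesis by simp
qed

lemma Sq_Cartan_single:
  "Sq k (Poly_Mapping.single a c * Poly_Mapping.single b c') = (\<Sum>i\<le>k. Sq i (Poly_Mapping.single a c) * Sq (k - i) (Poly_Mapping.single b c'))"
proof -
  define A where "A = Poly_Mapping.keys a \<union> Poly_Mapping.keys b"
  have A: "finite A" "Poly_Mapping.keys a \<subseteq> A" "Poly_Mapping.keys b \<subseteq> A" "Poly_Mapping.keys (a + b) \<subseteq> A"
    using Poly_Mapping.keys_add[of a b] by (auto simp: A_def)
  define D where "D i = {d :: monomial. Poly_Mapping.keys d \<subseteq> A \<and> monom_deg d = i}" for i
  have finD: "finite (D i)" for i
    unfolding D_def by (rule finite_monomials[OF A(1)])
  define C where "C m d = (\<Prod>j\<in>A. Poly_Mapping.lookup m j choose Poly_Mapping.lookup d j)" for m d :: monomial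
  define T where "T = (\<lambda>(e, f). Poly_Mapping.single (a + b + (e + f)) (c * c' * of_nat (C a e * C b f)))"
  have Sq: "Sq i (Poly_Mapping.single m c) = (\<Sum>d\<in>D i. Poly_Mapping.single (m + d) (c * of_nat (C m d)))"
    if "Poly_Mapping.keys m \<subseteq> A" for i m c
    unfolding D_def C_def by (rule Sq_single[OF A(1) that])
  have "(\<Sum>i\<le>k. Sq i (Poly_Mapping.single a c) * Sq (k - i) (Poly_Mapping.single b c'))
      = (\<Sum>i\<le>k. \<Sum>x\<in>D i \<times> D (k - i). T x)"
    by (simp add: Sq A sum_product sum.cartesian_product mult_single T_def ac_simps
        case_prod_beta)
  also have "\<dots> = (\<Sum>x\<in>(\<Union>i\<le>k. D i \<times> D (k - i)). T x)"
    by (subst sum.UNION_disjoint) (auto simp: finD, auto simp: D_def)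
  also have "(\<Union>i\<le>k. D i \<times> D (k - i))
      = (\<Union>d\<in>D k. {(e, f). Poly_Mapping.keys e \<subseteq> A \<and> Poly_Mapping.keys f \<subseteq> A \<and> e + f = d})"
    (is "?L = ?R")
  proof (intro Set.set_eqI iffI)
    fix x assume "x \<in> ?L"
    then obtain e f where "x = (e, f)" "Poly_Mapping.keys e \<subseteq> A" "Poly_Mapping.keys f \<subseteq> A" "monom_deg e + monom_deg f = k"
      by (auto simp: D_def)
    then show "x \<in> ?R"
      using Poly_Mapping.keys_add[of e f] by (auto simp: D_def monom_deg_add)
  next
    fix x assume "x \<in> ?R"
    then show "x \<in> ?L" by (auto simp: D_def monom_deg_add)
  qed
  also have "sum T \<dots>
      = (\<Sum>d\<in>D k. \<Sum>x | case x of (e, f) \<Rightarrow> Poly_Mapping.keys e \<subseteq> A \<and> Poly_Mapping.keys f \<subseteq> A \<and> e + f = d. T x)"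
  proof (rule sum.UNION_disjoint)
    have "{(e, f). Poly_Mapping.keys e \<subseteq> A \<and> Poly_Mapping.keys f \<subseteq> A \<and> e + f = d} \<subseteq> (\<Union>i\<le>k. D i \<times> D (k - i))"
      if "d \<in> D k" for d
      using that by (auto simp: D_def monom_deg_add)
    then show "\<forall>d\<in>D k. finite {(e, f). Poly_Mapping.keys e \<subseteq> A \<and> Poly_Mapping.keys f \<subseteq> A \<and> e + f = d}"
      using finD by (meson finite_SigmaI finite_UN_I finite_atMost finite_subset)
  qed (auto simp: finD)
  also have "\<dots> = (\<Sum>d\<in>D k. Poly_Mapping.single (a + b + d) (c * c' * of_nat (C (a + b) d)))"
  proof (intro sum.cong refl)
    fix d assume "d \<in> D k"
    then have d: "Poly_Mapping.keys d \<subseteq> A" by (simp add: D_def)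
    let ?S = "{(e, f). Poly_Mapping.keys e \<subseteq> A \<and> Poly_Mapping.keys f \<subseteq> A \<and> e + f = d}"
    have "(\<Sum>x\<in>?S. T x)
        = (\<Sum>x\<in>?S. Poly_Mapping.single (a + b + d) (c * c' * of_nat (case x of (e, f) \<Rightarrow> C a e * C b f)))"
      by (intro sum.cong refl) (auto simp: T_def)
    also have "\<dots> = Poly_Mapping.single (a + b + d)
        (\<Sum>x\<in>?S. c * c' * of_nat (case x of (e, f) \<Rightarrow> C a e * C b f))"
      by (rule poly_mapping_eqI) (simp add: lookup_sum lookup_single when_def)
    also have "(\<Sum>x\<in>?S. c * c' * of_nat (case x of (e, f) \<Rightarrow> C a e * C b f))
        = c * c' * of_nat (\<Sum>x\<in>?S. case x of (e, f) \<Rightarrow> C a e * C b f)"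
      by (simp only: of_nat_sum sum_distrib_left)
    also have "(\<Sum>x\<in>?S. case x of (e, f) \<Rightarrow> C a e * C b f) = C (a + b) d"
      unfolding C_def using prod_vandermonde[OF A(1) d] .
    finally show "sum T ?S = Poly_Mapping.single (a + b + d) (c * c' * of_nat (C (a + b) d))" .
  qed
  also have "\<dots> = Sq k (Poly_Mapping.single a c * Poly_Mapping.single b c')"
    by (simp add: mult_single Sq A)
  finally show ?thesis ..
qed

lemma poly_mapping_sum_singles: "(\<Sum>m\<in>Poly_Mapping.keys p. Poly_Mapping.single m (Poly_Mapping.lookup p m)) = p"
  by (rule poly_mapping_eqI) (auto simp: lookup_sum lookup_single when_def in_keys_iff)

lemma Sq_Cartan: "Sq k (p * q) = (\<Sum>i\<le>k. Sq i p * Sq (k - i) q)"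
proof -
  let ?s = "\<lambda>p m. Poly_Mapping.single m (Poly_Mapping.lookup p m)"
  have "Sq k ((\<Sum>m\<in>Poly_Mapping.keys p. ?s p m) * (\<Sum>m\<in>Poly_Mapping.keys q. ?s q m))
      = (\<Sum>m\<in>Poly_Mapping.keys p. \<Sum>m'\<in>Poly_Mapping.keys q. \<Sum>i\<le>k. Sq i (?s p m) * Sq (k - i) (?s q m'))"
    by (simp only: sum_product Sq_sum Sq_Cartan_single)
  also have "\<dots> = (\<Sum>i\<le>k. \<Sum>m\<in>Poly_Mapping.keys p. \<Sum>m'\<in>Poly_Mapping.keys q. Sq i (?s p m) * Sq (k - i) (?s q m'))"
    by (simp add: sum.swap[of _ "{..k}"])
  also have "\<dots> = (\<Sum>i\<le>k. Sq i (\<Sum>m\<in>Poly_Mapping.keys p. ?s p m) * Sq (k - i) (\<Sum>m\<in>Poly_Mapping.keys q. ?s q m))"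
    by (simp only: sum_product Sq_sum)
  finally show ?thesis
    by (simp only: poly_mapping_sum_singles)
qed

lemma Sq_hom_polys:
  assumes "p \<in> hom_polys t n"
  shows "Sq k p \<in> hom_polys t (n + k)"
proof -
  have "Poly_Mapping.keys x \<subseteq> {1..t} \<and> monom_deg x = n + k" if "x \<in> Poly_Mapping.keys (Sq k p)" for x
  proof -
    have "\<exists>m\<in>Poly_Mapping.keys p. \<exists>d. Poly_Mapping.keys d \<subseteq> Poly_Mapping.keys m \<and> monom_deg d = k \<and> x = m + d"
    proof (rule ccontr)
      assume *: "\<not> ?thesis"
      have "Poly_Mapping.lookup (Sq k p) x = 0"
        unfolding Sq_def lookup_sum
        by (intro sum.neutral ballI) (use * in \<open>auto simp: lookup_single when_def\<close>)
      then show False using that by (simp add: in_keys_iff)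
    qed
    then obtain m d where m: "m \<in> Poly_Mapping.keys p" "Poly_Mapping.keys d \<subseteq> Poly_Mapping.keys m" "monom_deg d = k" "x = m + d"
      by blast
    with assms have "Poly_Mapping.keys m \<subseteq> {1..t}" "monom_deg m = n" by (auto simp: hom_polys_def)
    then show ?thesis
      using m Poly_Mapping.keys_add[of m d] by (auto simp: monom_deg_add)
  qed
  then show ?thesis by (simp add: hom_polys_def)
qed


section \<open>Quotient modules and the hit quotient\<close>

definition quot_module :: "('a, 'b, 'c) module_scheme \<Rightarrow> 'b set \<Rightarrow> ('a, 'b set) module"
  where "quot_module M N =
    \<lparr>carrier = a_rcosets\<^bsub>M\<^esub> N, mult = undefined, one = undefined,
     zero = N, add = (<+>\<^bsub>M\<^esub>),
     smult = (\<lambda>a X. \<Union>x\<in>X. N +>\<^bsub>M\<^esub> (a \<odot>\<^bsub>M\<^esub> x))\<rparr>"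

lemma submodule_abelian_subgroup:
  assumes "submodule R N M"
  shows "abelian_subgroup N M"
proof -
  interpret submodule R N M by fact
  interpret M: Module.module R M by (rule module)
  have "subgroup N (add_monoid M)"
  proof
    fix x assume x: "x \<in> N"
    then have "\<ominus>\<^bsub>M\<^esub> x = (\<ominus>\<^bsub>R\<^esub> \<one>\<^bsub>R\<^esub>) \<odot>\<^bsub>M\<^esub> x"
      using subset by (auto simp: M.smult_l_minus)
    also have "\<dots> \<in> N" using x by (intro smult_closed) auto
    finally show "inv\<^bsub>add_monoid M\<^esub> x \<in> N" by (simp add: a_inv_def)
  qed (use subset in auto)
  then show ?thesis
    by (intro abelian_subgroupI3 additive_subgroupI M.abelian_group_axioms)
qed

lemma module_quot_module:
  assumes "submodule R N M"
  shows "module R (quot_module M N)"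
proof -
  interpret submodule R N M by fact
  interpret M: Module.module R M by (rule module)
  interpret N: abelian_subgroup N M by (rule submodule_abelian_subgroup[OF assms])
  let ?Q = "quot_module M N"
  let ?c = "a_r_coset M N"
  have carr: "X \<in> carrier ?Q \<longleftrightarrow> (\<exists>x\<in>carrier M. X = ?c x)" for X
    by (auto simp: quot_module_def A_RCOSETS_def' )
  have add: "?c x \<oplus>\<^bsub>?Q\<^esub> ?c y = ?c (x \<oplus>\<^bsub>M\<^esub> y)" if "x \<in> carrier M" "y \<in> carrier M" for x y
    using N.a_rcos_sum[OF that] by (simp add: quot_module_def)
  have smult: "a \<odot>\<^bsub>?Q\<^esub> ?c x = ?c (a \<odot>\<^bsub>M\<^esub> x)" if a: "a \<in> carrier R" and x: "x \<in> carrier M" for a x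
  proof -
    have "?c (a \<odot>\<^bsub>M\<^esub> y) = ?c (a \<odot>\<^bsub>M\<^esub> x)" if y: "y \<in> ?c x" for y
    proof -
      obtain h where h: "h \<in> N" "y = h \<oplus>\<^bsub>M\<^esub> x"
        using y by (auto simp: a_r_coset_def')
      then have "a \<odot>\<^bsub>M\<^esub> y = a \<odot>\<^bsub>M\<^esub> h \<oplus>\<^bsub>M\<^esub> a \<odot>\<^bsub>M\<^esub> x"
        using a x subset by (auto simp: M.smult_r_distr)
      then have "a \<odot>\<^bsub>M\<^esub> y \<in> ?c (a \<odot>\<^bsub>M\<^esub> x)"
        using h smult_closed[OF a h(1)] by (auto simp: a_r_coset_def')
      then show ?thesis
        using N.a_repr_independence'[of "a \<odot>\<^bsub>M\<^esub> y" "a \<odot>\<^bsub>M\<^esub> x"] a x by auto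
    qed
    then have "(\<Union>y\<in>?c x. ?c (a \<odot>\<^bsub>M\<^esub> y)) = (\<Union>y\<in>?c x. ?c (a \<odot>\<^bsub>M\<^esub> x))"
      by (rule SUP_cong[OF refl])
    also have "\<dots> = ?c (a \<odot>\<^bsub>M\<^esub> x)"
      using N.a_rcos_self[OF x] by blast
    finally show ?thesis by (simp add: quot_module_def)
  qed
  have zero: "\<zero>\<^bsub>?Q\<^esub> = ?c \<zero>\<^bsub>M\<^esub>"
    using M.a_coset_add_zero[OF subset] by (simp add: quot_module_def)
  have reps: "\<exists>x\<in>carrier M. X = ?c x" if "X \<in> carrier ?Q" for X
    using that carr by blast
  have closed: "?c x \<in> carrier ?Q" if "x \<in> carrier M" for x
    using that carr by blast
  have "abelian_group ?Q"
  proof (rule abelian_groupI)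
    fix X assume "X \<in> carrier ?Q"
    then obtain x where x: "x \<in> carrier M" "X = ?c x" using reps by blast
    then have "?c (\<ominus>\<^bsub>M\<^esub> x) \<in> carrier ?Q" "?c (\<ominus>\<^bsub>M\<^esub> x) \<oplus>\<^bsub>?Q\<^esub> X = \<zero>\<^bsub>?Q\<^esub>"
      by (simp_all add: closed add zero M.l_neg)
    then show "\<exists>Y\<in>carrier ?Q. Y \<oplus>\<^bsub>?Q\<^esub> X = \<zero>\<^bsub>?Q\<^esub>" by blast
  qed (auto dest!: reps simp: closed add zero M.a_ac)
  then show ?thesis
    by (rule Module.moduleI[OF M.R.is_cring])
      (auto dest!: reps simp: closed add smult M.smult_l_distr M.smult_r_distr M.smult_assoc1)
qed

text \<open>
  The sum of the images of \<open>Sq\<^sup>i\<close> for \<open>i > 0\<close> in degree \<open>n\<close>. Nothing is homogeneous of degree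
  \<open>n - i < 0\<close>, so \<open>i\<close> is bounded by \<open>n\<close>; truncated subtraction makes the bound necessary.
\<close>

definition hit :: "nat \<Rightarrow> nat \<Rightarrow> poly2 set"
  where "hit t n =
    LinearCombinations.module.span class_ring (hom_space t n)
      (\<Union>i\<in>{1..n}. Sq i ` hom_polys t (n - i))"

definition QP :: "nat \<Rightarrow> nat \<Rightarrow> (bit, poly2 set) module"
  where "QP t n = quot_module (hom_space t n) (hit t n)"

lemma hom_polys_add: "p \<in> hom_polys t n \<Longrightarrow> q \<in> hom_polys t n \<Longrightarrow> p + q \<in> hom_polys t n"
  using Poly_Mapping.keys_add[of p q] unfolding hom_polys_def by blast

lemma hom_space_module: "module class_ring (hom_space t n)"
proof -
  have smult: "Poly_Mapping.single 0 c * p \<in> hom_polys t n" if "p \<in> hom_polys t n" for c :: bit and p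
  proof (cases "c = 0")
    case False
    then have "Poly_Mapping.single 0 c = (1 :: poly2)" by (simp add: single_one)
    then show ?thesis using that by simp
  qed (simp add: hom_polys_def)
  have self: "p + p = 0" for p :: poly2
    by (rule poly_mapping_eqI) (simp only: lookup_add, simp)
  have "abelian_group (hom_space t n)"
  proof (rule abelian_groupI)
    fix p assume "p \<in> carrier (hom_space t n)"
    then show "\<exists>q\<in>carrier (hom_space t n). q \<oplus>\<^bsub>hom_space t n\<^esub> p = \<zero>\<^bsub>hom_space t n\<^esub>"
      using self[of p] by (intro bexI[of _ p]) (simp_all only: hom_space_def ring.simps partial_object.simps)
  qed (auto simp: hom_space_def hom_polys_add ac_simps, simp add: hom_polys_def)
  then show ?thesis
  proof (rule Module.moduleI[OF domain.axioms(1)[OF field.axioms(1)[OF VS_Connect.class_field]]])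
    fix a b p
    show "(a \<oplus>\<^bsub>class_ring\<^esub> b) \<odot>\<^bsub>hom_space t n\<^esub> p
        = a \<odot>\<^bsub>hom_space t n\<^esub> p \<oplus>\<^bsub>hom_space t n\<^esub> b \<odot>\<^bsub>hom_space t n\<^esub> p"
      by (simp only: hom_space_def ring.simps partial_object.simps module.simps
          single_add distrib_right)
  qed (simp_all add: hom_space_def smult mult_single distrib_left flip: mult.assoc)
qed

lemma submodule_hit: "submodule class_ring (hit t n) (hom_space t n)"
proof -
  have "(\<Union>i\<in>{1..n}. Sq i ` hom_polys t (n - i)) \<subseteq> carrier (hom_space t n)"
  proof (intro UN_least image_subsetI)
    fix i p assume "i \<in> {1..n}" "p \<in> hom_polys t (n - i)"
    then show "Sq i p \<in> carrier (hom_space t n)"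
      using Sq_hom_polys[of p t "n - i" i] by (simp add: hom_space_def)
  qed
  then show ?thesis
    unfolding hit_def by (rule module.span_is_submodule[OF hom_space_module])
qed

lemma vectorspace_QP: "vectorspace class_ring (QP t n)"
  unfolding QP_def vectorspace_def
  by (intro conjI module_quot_module submodule_hit VS_Connect.class_field)

lemma finite_hom_polys: "finite (hom_polys t n)"
proof -
  let ?D = "{d. Poly_Mapping.keys d \<subseteq> {1..t} \<and> monom_deg d = n}"
  have "p = q" if "Poly_Mapping.keys p = Poly_Mapping.keys q" for p q :: poly2
  proof (rule poly_mapping_eqI)
    fix m show "Poly_Mapping.lookup p m = Poly_Mapping.lookup q m"
      using that by (cases "Poly_Mapping.lookup p m"; cases "Poly_Mapping.lookup q m") (auto simp: set_eq_iff in_keys_iff)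
  qed
  then have "inj_on Poly_Mapping.keys (hom_polys t n)" by (auto intro: inj_onI)
  moreover have "Poly_Mapping.keys ` hom_polys t n \<subseteq> Pow ?D" by (auto simp: hom_polys_def)
  ultimately show ?thesis
    using finite_monomials[of "{1..t}" n] by (meson finite_Pow_iff finite_atLeastAtMost
        finite_imageD finite_subset)
qed

lemma fin_dim_QP: "vectorspace.fin_dim class_ring (QP t n)"
proof -
  interpret vectorspace class_ring "QP t n" by (rule vectorspace_QP)
  have "carrier (QP t n) = a_r_coset (hom_space t n) (hit t n) ` hom_polys t n"
    by (auto simp: QP_def quot_module_def A_RCOSETS_def' hom_space_def)
  then have "finite (carrier (QP t n))" by (simp add: finite_hom_polys)
  moreover have "gen_set (carrier (QP t n))"
    using in_own_span[of "carrier (QP t n)"] span_is_subset2[of "carrier (QP t n)"] by auto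
  ultimately show ?thesis unfolding fin_dim_def by blast
qed

definition deg_seq :: "nat \<Rightarrow> nat"
  where "deg_seq s = 5 * (2 ^ s - 1) + 42 * 2 ^ s"

end

theory Submission
  imports Defs
begin

text \<open>
  A functional on homogeneous polynomials of degree \<open>n\<close> kills the hit polynomials iff it is fixed
  by composition with the total square \<open>St\<close>, the ring homomorphism with \<open>St x = x + x\<^sup>2\<close> on
  variables. By duality the dimension of \<open>QP t n\<close> is the binary logarithm of the number of such
  functionals, which form \<open>K t n\<close>. Every monomial is a product of distinct variables times a
  square, and evaluating functionals on these layers turns invariance under \<open>St\<close> into recursive
  relations.

  Five variables, degree 42: a functional is determined by its values on words, products of
  square-free layers with 4, 3, 2, 1, 1 variables, and a function on words comes from a functional
  iff it satisfies quadratic (Garnir) relations between adjacent layers. Straightening bounds the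
  space of such functions from above and bideterminants bound it from below by the number 2520 of
  semistandard tableaux with these column lengths in five letters.

  In the degrees \<open>deg_seq s\<close> with \<open>s > 0\<close> only layers with five variables survive, since the
  binary expansions involved have too many digits (Wood's argument). For five variables this
  gives Kameko's isomorphism. For six variables a functional in degree \<open>deg_seq (s + 5)\<close> is a family of
  functionals in degree \<open>deg_seq s\<close> indexed by words of length five, which depends only on the set of
  letters of the word. Moebius inversion splits this family into one functional for each of
  the \<open>2\<^sup>6 - 1\<close> nonzero linear forms, subject only to killing the ideal of that form, and thus
  a functional in five variables.
\<close>

text \<open>The shape 4, 3, 2, 1, 1 of the words comes from 42 = 4 + 2*3 + 4*2 + 8*1 + 16*1. In
  degree 42 the hard direction is existence. Besides the layers of a word, a functional may be
  nonzero on a second layer of size 5, a third of size 4 and a fourth of size 3. The relations with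
  the layers to the left force these values, in several ways at once, and the different ways have to
  agree; the agreement is proved by exhibiting explicit sums of relations, because over two elements
  no averaging argument is available.

  In the degree sequence the number that matters is the degree plus five, which is 47 * 2^d. The
  number 46 = 32 + 8 + 4 + 2 is not a sum of three powers of two, and this excludes layers of size
  3.

  In six variables five layers are removed because a word of length five can have any nonempty set
  of at most five letters as its set of letters. The full set of six letters never occurs. The
  functional belonging to it is constructed by dividing by variables
  (\<open>complete_family\<close>), and this is what makes all 63 nonzero linear forms contribute
  equally.\<close>

declare add_bit_eq_xor [simp del] mult_bit_eq_and [simp del] bit_not_zero_iff [simp del]
  bit_not_one_iff [simp del]

section \<open>Arithmetic in characteristic two\<close>

lemma bit_add_self [simp]: "a + a = (0 :: bit)"
  by (metis bit_2_eq_0 mult_2 mult_zero_left)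

lemma bit_add_self' [simp]: "a + (a + b) = (b :: bit)"
  by (simp flip: add.assoc)

lemma bit_add_eq_0: "a + b = 0 \<longleftrightarrow> a = (b :: bit)"
  by (metis bit_add_self bit_add_self' add.right_neutral)

definition mono :: "monomial \<Rightarrow> poly2"
  where "mono m = Poly_Mapping.single m 1"

definition X :: "nat \<Rightarrow> poly2"
  where "X j = mono (Poly_Mapping.single j 1)"

lemma mono_add: "mono (m + m') = mono m * mono m'"
  by (simp add: mono_def mult_single)

lemma mono_0 [simp]: "mono 0 = 1"
  by (simp add: mono_def single_one)

lemma keys_mono [simp]: "Poly_Mapping.keys (mono m) = {m}"
  by (simp add: mono_def)

lemma poly2_char2 [simp]: "p + p = (0 :: poly2)"
  by (rule poly_mapping_eqI) (simp only: lookup_add bit_add_self lookup_zero)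

lemma poly2_two [simp]: "(2 :: poly2) = 0"
  by (metis poly2_char2 one_add_one)

lemma poly2_char2' [simp]: "p + (p + q) = (q :: poly2)"
  by (simp flip: add.assoc)

lemma poly2_uminus [simp]: "- p = (p :: poly2)"
  by (metis poly2_char2 add_eq_0_iff)

lemma poly2_minus [simp]: "p - q = (p + q :: poly2)"
  by (metis diff_conv_add_uminus poly2_uminus)

lemma poly2_expand: "p = (\<Sum>m\<in>Poly_Mapping.keys p. mono m)"
proof -
  have "mono m = Poly_Mapping.single m (Poly_Mapping.lookup p m)" if "m \<in> Poly_Mapping.keys p" for m
    using that by (cases "Poly_Mapping.lookup p m") (auto simp: mono_def in_keys_iff)
  then show ?thesis
    using poly_mapping_sum_singles[of p] by simp
qed

lemma keys_poly2_add: "Poly_Mapping.keys (p + q :: poly2) = sym_diff (Poly_Mapping.keys p) (Poly_Mapping.keys q)"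
proof (rule Set.set_eqI)
  fix m
  show "m \<in> Poly_Mapping.keys (p + q) \<longleftrightarrow> m \<in> sym_diff (Poly_Mapping.keys p) (Poly_Mapping.keys q)"
    by (cases "Poly_Mapping.lookup p m"; cases "Poly_Mapping.lookup q m") (auto simp: in_keys_iff lookup_add)
qed

subsection \<open>Additive maps\<close>

definition lin :: "(monomial \<Rightarrow> 'a::ab_group_add) \<Rightarrow> poly2 \<Rightarrow> 'a"
  where "lin v p = (\<Sum>m\<in>Poly_Mapping.keys p. v m)"

lemma lin_mono [simp]: "lin v (mono m) = v m"
  by (simp add: lin_def)

text \<open>Monomials common to \<open>p\<close> and \<open>q\<close> disappear from
  \<open>p + q\<close>; the assumption cancels their two contributions on the other side.\<close>

lemma additive_lin:
  assumes "\<And>m. v m + v m = 0"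
  shows "additive (lin v)"
proof
  fix p q :: poly2
  let ?P = "Poly_Mapping.keys p" and ?Q = "Poly_Mapping.keys q"
  have I: "sum v (?P \<inter> ?Q) + sum v (?P \<inter> ?Q) = 0"
    by (simp add: assms flip: sum.distrib)
  have "sum v (sym_diff ?P ?Q) = sum v (?P - ?Q) + sum v (?Q - ?P)"
    by (intro sum.union_disjoint) auto
  also have "\<dots> = (sum v (?P - ?Q) + sum v (?P \<inter> ?Q)) + (sum v (?Q - ?P) + sum v (?P \<inter> ?Q))"
    using I by (simp only: add.assoc add.commute add.left_commute add_0_right add_0_left)
  also have "sum v (?P - ?Q) + sum v (?P \<inter> ?Q) = sum v ?P"
    using sum.Int_Diff[of ?P v ?Q] by (simp add: add.commute)
  also have "sum v (?Q - ?P) + sum v (?P \<inter> ?Q) = sum v ?Q"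
    using sum.Int_Diff[of ?Q v ?P] by (simp add: add.commute Int_commute)
  finally show "lin v (p + q) = lin v p + lin v q"
    by (simp add: lin_def keys_poly2_add)
qed

lemma additive_lin_bit [simp]: "additive (lin (v :: monomial \<Rightarrow> bit))"
  by (rule additive_lin) simp

lemma additive_eqI:
  fixes f g :: "poly2 \<Rightarrow> 'a::ab_group_add"
  assumes "additive f" "additive g" "\<And>m. f (mono m) = g (mono m)"
  shows "f p = g p"
proof -
  have "f (\<Sum>m\<in>Poly_Mapping.keys p. mono m) = g (\<Sum>m\<in>Poly_Mapping.keys p. mono m)"
    by (simp add: additive.sum[OF assms(1)] additive.sum[OF assms(2)] assms(3))
  then show ?thesis
    by (simp flip: poly2_expand)
qed

lemma additive_expand:
  fixes f :: "poly2 \<Rightarrow> 'a::ab_group_add"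
  assumes "additive f"
  shows "f p = (\<Sum>m\<in>Poly_Mapping.keys p. f (mono m))"
  by (subst poly2_expand) (rule additive.sum[OF assms])

lemma additive_plus:
  "additive f \<Longrightarrow> additive g \<Longrightarrow> additive (\<lambda>p. f p + g p)"
  by (simp add: additive_def ac_simps)

lemma additive_sum:
  "(\<And>x. x \<in> A \<Longrightarrow> additive (f x)) \<Longrightarrow> additive (\<lambda>p. \<Sum>x\<in>A. f x p)"
  by (simp add: additive_def sum.distrib)

lemma additive_zero [simp]: "additive (\<lambda>p. 0)"
  by (simp add: additive_def)

lemma additive_id [simp]: "additive (\<lambda>p. p)"
  by (simp add: additive_def)

lemma additive_comp:
  "additive f \<Longrightarrow> additive g \<Longrightarrow> additive (\<lambda>p. f (g p))"
  by (simp add: additive_def)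

lemma additive_mult_left [simp]: "additive (\<lambda>p. q * p :: poly2)"
  by (simp add: additive_def distrib_left)

lemma poly2_square_add: "(p + q :: poly2)\<^sup>2 = p\<^sup>2 + q\<^sup>2"
proof -
  have "(p + q)\<^sup>2 = p\<^sup>2 + q\<^sup>2 + (p * q + p * q)"
    by (simp add: power2_eq_square algebra_simps)
  then show ?thesis by simp
qed

lemma additive_square [simp]: "additive (\<lambda>p. p\<^sup>2 :: poly2)"
  by (simp add: additive_def poly2_square_add)

subsection \<open>Ring endomorphisms\<close>

definition ev_mono :: "(nat \<Rightarrow> poly2) \<Rightarrow> monomial \<Rightarrow> poly2"
  where "ev_mono h m = (\<Prod>j\<in>Poly_Mapping.keys m. h j ^ Poly_Mapping.lookup m j)"

definition ev :: "(nat \<Rightarrow> poly2) \<Rightarrow> poly2 \<Rightarrow> poly2"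
  where "ev h = lin (ev_mono h)"

lemma ev_mono_superset:
  assumes "finite A" "Poly_Mapping.keys m \<subseteq> A"
  shows "ev_mono h m = (\<Prod>j\<in>A. h j ^ Poly_Mapping.lookup m j)"
  unfolding ev_mono_def
  using assms by (intro prod.mono_neutral_left) (auto simp: in_keys_iff)

lemma ev_mono_add: "ev_mono h (m + m') = ev_mono h m * ev_mono h m'"
proof -
  let ?A = "Poly_Mapping.keys m \<union> Poly_Mapping.keys m'"
  have "Poly_Mapping.keys (m + m') \<subseteq> ?A" by (rule Poly_Mapping.keys_add)
  then show ?thesis
    by (simp add: ev_mono_superset[of ?A] lookup_add power_add prod.distrib)
qed

lemma additive_ev [simp]: "additive (ev h)"
  unfolding ev_def by (rule additive_lin) simp

lemma ev_add [simp]: "ev h (p + q) = ev h p + ev h q"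
  using additive_ev by (rule additive.add)

lemma ev_zero [simp]: "ev h 0 = 0"
  using additive_ev by (rule additive.zero)

lemma ev_sum: "ev h (sum f A) = (\<Sum>x\<in>A. ev h (f x))"
  using additive_ev by (rule additive.sum)

lemma ev_of_mono: "ev h (mono m) = ev_mono h m"
  by (simp add: ev_def)

lemma ev_mult [simp]: "ev h (p * q) = ev h p * ev h q"
proof -
  have "additive (\<lambda>p. ev h (p * q))" "additive (\<lambda>p. ev h p * ev h q)" for q
    by (simp_all add: additive_def distrib_right)
  moreover have "ev h (mono m * q) = ev h (mono m) * ev h q" for m
  proof -
    have "additive (\<lambda>q. ev h (mono m * q))" "additive (\<lambda>q. ev h (mono m) * ev h q)"
      by (simp_all add: additive_def distrib_left)
    moreover have "ev h (mono m * mono m') = ev h (mono m) * ev h (mono m')" for m'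
      by (simp add: ev_mono_add ev_of_mono flip: mono_add)
    ultimately show ?thesis by (rule additive_eqI)
  qed
  ultimately show ?thesis by (rule additive_eqI)
qed

lemma ev_one [simp]: "ev h 1 = 1"
  by (simp add: ev_def ev_mono_def flip: mono_0)

lemma ev_power [simp]: "ev h (p ^ k) = ev h p ^ k"
  by (induction k) simp_all

lemma ev_prod: "ev h (prod f A) = (\<Prod>x\<in>A. ev h (f x))"
  by (induction A rule: infinite_finite_induct) simp_all

lemma ev_X [simp]: "ev h (X j) = h j"
  by (simp add: X_def ev_of_mono ev_mono_def)

lemma X_power: "X j ^ a = mono (Poly_Mapping.single j a)"
  by (induction a) (simp_all add: X_def mono_add[symmetric] single_add[symmetric])

lemma mono_eq_prod: "mono m = (\<Prod>j\<in>Poly_Mapping.keys m. X j ^ Poly_Mapping.lookup m j)"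
proof -
  have "(\<Prod>j\<in>A. X j ^ f j) = mono (\<Sum>j\<in>A. Poly_Mapping.single j (f j))" for A f
    by (induction A rule: infinite_finite_induct) (simp_all add: X_power mono_add)
  moreover have "(\<Sum>j\<in>Poly_Mapping.keys m. Poly_Mapping.single j (Poly_Mapping.lookup m j)) = m"
    by (rule poly_mapping_eqI) (auto simp: lookup_sum lookup_single when_def in_keys_iff)
  ultimately show ?thesis by simp
qed

lemma ev_ev: "ev h (ev h' p) = ev (\<lambda>j. ev h (h' j)) p"
proof -
  have "ev h (ev h' (mono m)) = ev (\<lambda>j. ev h (h' j)) (mono m)" for m
    by (simp add: ev_of_mono) (simp add: ev_mono_def ev_prod)
  from additive_eqI[OF additive_comp[OF additive_ev additive_ev] additive_ev this] show ?thesis .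
qed

lemma ev_id: "ev X p = p"
proof -
  have "ev X (mono m) = mono m" for m
    by (simp only: ev_of_mono) (simp add: ev_mono_def mono_eq_prod)
  from additive_eqI[OF additive_ev additive_id this] show ?thesis .
qed

subsection \<open>The total square\<close>

definition St :: "poly2 \<Rightarrow> poly2"
  where "St = ev (\<lambda>j. X j + (X j)\<^sup>2)"

lemma St_X [simp]: "St (X j) = X j + (X j)\<^sup>2"
  and St_add [simp]: "St (p + q) = St p + St q"
  and St_mult [simp]: "St (p * q) = St p * St q"
  and St_power [simp]: "St (p ^ k) = St p ^ k"
  and St_zero [simp]: "St 0 = 0"
  and St_one [simp]: "St 1 = 1"
  and St_prod: "St (prod f A) = (\<Prod>x\<in>A. St (f x))"
  and St_sum: "St (sum f A) = (\<Sum>x\<in>A. St (f x))"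
  and additive_St [simp]: "additive St"
  by (simp_all add: St_def ev_prod ev_sum)

lemma Sq_one: "Sq k 1 = (if k = 0 then 1 else 0)"
proof -
  have "{d. Poly_Mapping.keys d \<subseteq> {} \<and> monom_deg d = k} = (if k = 0 then {0} else {})"
    by (auto simp: monom_deg_def)
  then show ?thesis
    using Sq_single[of "{}" 0 k 1] by (simp add: single_one)
qed

lemma Sq_X: "Sq k (X j) = (if k = 0 then X j else if k = 1 then (X j)\<^sup>2 else 0)"
proof -
  have "Sq k (X j) = Poly_Mapping.single (Poly_Mapping.single j (1 + k)) (of_nat (1 choose k))"
    using Sq_var_power[of k j 1] by (simp add: X_def mono_def)
  moreover have "(1 choose k) = (if k \<le> 1 then 1 else 0)"
    by (cases "k = 0"; cases "k = 1") auto
  moreover have "(X j)\<^sup>2 = Poly_Mapping.single (Poly_Mapping.single j 2) 1"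
    by (simp only: X_power mono_def)
  ultimately show ?thesis
    by (auto simp: X_def mono_def numeral_2_eq_2)
qed

lemma Sq_X_mult: "Sq k (X j * p) = X j * Sq k p + (if k = 0 then 0 else (X j)\<^sup>2 * Sq (k - 1) p)"
proof -
  have "Sq k (X j * p) = (\<Sum>i\<in>{..k} \<inter> {0, 1}. Sq i (X j) * Sq (k - i) p)"
    unfolding Sq_Cartan by (intro sum.mono_neutral_right) (auto simp: Sq_X)
  also have "{..k} \<inter> {0, 1} = (if k = 0 then {0} else {0, 1})" by auto
  finally show ?thesis by (auto simp: Sq_X)
qed

lemma monom_deg_single [simp]: "monom_deg (Poly_Mapping.single j a) = a"
  by (simp add: monom_deg_def)

lemma monom_deg_0 [simp]: "monom_deg 0 = 0"
  by (simp add: monom_deg_def)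

lemma mono_induct [case_names zero add]:
  assumes "P 0" "\<And>j m. P m \<Longrightarrow> P (Poly_Mapping.single j 1 + m)"
  shows "P (m :: monomial)"
proof (induction "monom_deg m" arbitrary: m)
  case 0
  then have "m = 0"
    by (intro poly_mapping_eqI) (auto simp: monom_deg_def in_keys_iff)
  then show ?case using assms(1) by simp
next
  case (Suc n)
  then have "m \<noteq> 0" by auto
  then obtain j where j: "Poly_Mapping.lookup m j \<noteq> 0"
    by (metis poly_mapping_eqI lookup_zero)
  define m' where "m' = m - Poly_Mapping.single j 1"
  have m: "m = Poly_Mapping.single j 1 + m'"
    unfolding m'_def using j by (intro poly_mapping_eqI) (auto simp: lookup_add lookup_minus lookup_single when_def)
  then have "monom_deg m = Suc (monom_deg m')" by (simp add: monom_deg_add)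
  with Suc have "P m'" by simp
  then show ?case unfolding m by (rule assms(2))
qed

text \<open>A variable admits only the squares of index 0 and 1, so by the Cartan formula
  multiplication with \<open>X j\<close> multiplies both sides by \<open>X j\<close> plus its
  square. The bound \<open>N\<close> is free because the second of these terms shifts the summation
  by one.\<close>

lemma St_mono: 
  assumes "monom_deg m \<le> N"
  shows "St (mono m) = (\<Sum>k\<le>N. Sq k (mono m))"
  using assms
proof (induction m arbitrary: N rule: mono_induct)
  case zero
  then show ?case by (simp add: Sq_one if_distrib sum.If_cases Int_def)
next
  case (add j m)
  then obtain M where N: "N = Suc M" and M: "monom_deg m \<le> M"
    by (cases N) (auto simp: monom_deg_add)
  have m: "mono (Poly_Mapping.single j 1 + m) = X j * mono m"
    by (simp add: mono_add X_def)
  have "(\<Sum>k\<le>N. Sq k (X j * mono m)) =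
      (\<Sum>k\<le>N. X j * Sq k (mono m)) + (\<Sum>k\<le>N. if k = 0 then 0 else (X j)\<^sup>2 * Sq (k - 1) (mono m))"
    by (simp add: Sq_X_mult sum.distrib)
  also have "(\<Sum>k\<le>N. X j * Sq k (mono m)) = X j * St (mono m)"
    using add.IH[of N] M N by (simp flip: sum_distrib_left)
  also have "(\<Sum>k\<le>N. if k = 0 then 0 else (X j)\<^sup>2 * Sq (k - 1) (mono m)) = (X j)\<^sup>2 * St (mono m)"
    unfolding N by (subst sum.atMost_Suc_shift) (use add.IH[OF M] in \<open>simp flip: sum_distrib_left\<close>)
  finally show ?case unfolding m by (simp add: algebra_simps)
qed

subsection \<open>Functionals\<close>

definition mons :: "nat \<Rightarrow> nat \<Rightarrow> monomial set"
  where "mons t n = {m. Poly_Mapping.keys m \<subseteq> {1..t} \<and> monom_deg m = n}"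

text \<open>Functionals of degree \<open>n\<close> are defined on the whole ring and vanish on all
  other monomials, so that they can be composed with the inhomogeneous map
  \<open>St\<close>.\<close>

definition funcs :: "nat \<Rightarrow> nat \<Rightarrow> (poly2 \<Rightarrow> bit) set"
  where "funcs t n = {\<phi>. additive \<phi> \<and> (\<forall>m. m \<notin> mons t n \<longrightarrow> \<phi> (mono m) = 0)}"

definition K :: "nat \<Rightarrow> nat \<Rightarrow> (poly2 \<Rightarrow> bit) set"
  where "K t n = {\<phi> \<in> funcs t n. \<forall>p. \<phi> (St p) = \<phi> p}"

lemma K_funcs: "\<phi> \<in> K t n \<Longrightarrow> \<phi> \<in> funcs t n"
  by (simp add: K_def)

lemma K_St: "\<phi> \<in> K t n \<Longrightarrow> \<phi> (St p) = \<phi> p"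
  by (simp add: K_def)

lemma funcs_additive: "\<phi> \<in> funcs t n \<Longrightarrow> additive \<phi>"
  by (simp add: funcs_def)

lemma funcs_add: "\<phi> \<in> funcs t n \<Longrightarrow> \<phi> (p + q) = \<phi> p + \<phi> q"
  by (simp add: funcs_def additive_def)

lemma funcs_zero: "\<phi> \<in> funcs t n \<Longrightarrow> \<phi> 0 = 0"
  by (simp add: funcs_def additive.zero)

lemma funcs_mono: "\<phi> \<in> funcs t n \<Longrightarrow> m \<notin> mons t n \<Longrightarrow> \<phi> (mono m) = 0"
  by (simp add: funcs_def)

lemma funcsI: "additive \<phi> \<Longrightarrow> (\<And>m. m \<notin> mons t n \<Longrightarrow> \<phi> (mono m) = 0) \<Longrightarrow> \<phi> \<in> funcs t n"
  by (simp add: funcs_def)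

lemma funcs_vanish:
  assumes "\<phi> \<in> funcs t n" "\<And>m. m \<in> Poly_Mapping.keys p \<Longrightarrow> m \<notin> mons t n"
  shows "\<phi> p = 0"
  using assms additive_expand[of \<phi> p] by (simp add: funcs_def)

lemma funcs_eqI:
  assumes "\<phi> \<in> funcs t n" "\<psi> \<in> funcs t n" "\<And>m. m \<in> mons t n \<Longrightarrow> \<phi> (mono m) = \<psi> (mono m)"
  shows "\<phi> = \<psi>"
proof
  fix p
  have "\<phi> (mono m) = \<psi> (mono m)" for m
    using assms by (cases "m \<in> mons t n") (auto simp: funcs_mono)
  from additive_eqI[OF funcs_additive[OF assms(1)] funcs_additive[OF assms(2)] this]
  show "\<phi> p = \<psi> p" .
qed

lemma zero_K [simp]: "(\<lambda>_. 0) \<in> K t n"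
  by (simp add: K_def funcs_def)

lemma K_add: "\<phi> \<in> K t n \<Longrightarrow> \<psi> \<in> K t n \<Longrightarrow> (\<lambda>p. \<phi> p + \<psi> p) \<in> K t n"
  by (simp add: K_def funcs_def additive_plus)

lemma K_sum: "(\<And>x. x \<in> A \<Longrightarrow> \<phi> x \<in> K t n) \<Longrightarrow> (\<lambda>p. \<Sum>x\<in>A. \<phi> x p) \<in> K t n"
  by (simp add: K_def funcs_def additive_sum)

subsection \<open>Square-free parts\<close>

definition xs :: "nat set \<Rightarrow> poly2"
  where "xs T = (\<Prod>j\<in>T. X j)"

definition indic :: "nat set \<Rightarrow> monomial"
  where "indic T = (\<Sum>j\<in>T. Poly_Mapping.single j 1)"

definition oddset :: "monomial \<Rightarrow> nat set"
  where "oddset m = {j. odd (Poly_Mapping.lookup m j)}"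

definition halfm :: "monomial \<Rightarrow> monomial"
  where "halfm m = Poly_Mapping.map (\<lambda>a. a div 2) m"

lemma lookup_halfm [simp]: "Poly_Mapping.lookup (halfm m) j = Poly_Mapping.lookup m j div 2"
  by (simp add: halfm_def Poly_Mapping.map.rep_eq when_def)

lemma lookup_indic: "finite T \<Longrightarrow> Poly_Mapping.lookup (indic T) j = (if j \<in> T then 1 else 0)"
  by (simp add: indic_def lookup_sum lookup_single when_def)

lemma keys_indic: "finite T \<Longrightarrow> Poly_Mapping.keys (indic T) = T"
  by (auto simp: in_keys_iff lookup_indic split: if_splits)

lemma xs_mono: "xs T = mono (indic T)"
  unfolding xs_def indic_def X_def
  by (induction T rule: infinite_finite_induct) (simp_all add: mono_add)

lemma deg_indic: "monom_deg (indic T) = card T"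
  unfolding indic_def
  by (induction T rule: infinite_finite_induct) (simp_all add: monom_deg_add)

lemma oddset_subset: "oddset m \<subseteq> Poly_Mapping.keys m"
  by (auto simp: oddset_def in_keys_iff intro!: odd_pos)

lemma mem_oddset: "j \<in> oddset m \<longleftrightarrow> odd (Poly_Mapping.lookup m j)"
  by (simp add: oddset_def)

lemma finite_oddset [simp]: "finite (oddset m)"
  using oddset_subset by (rule finite_subset) simp

lemma split_mono: "m = indic (oddset m) + (halfm m + halfm m)"
proof (rule poly_mapping_eqI)
  have "a = (if odd a then 1 else 0) + (a div 2 + a div 2)" for a :: nat
    by (cases "even a") (auto elim: evenE oddE)
  then show "Poly_Mapping.lookup m j = Poly_Mapping.lookup (indic (oddset m) + (halfm m + halfm m)) j" for j
    by (simp only: lookup_add lookup_indic[OF finite_oddset] lookup_halfm mem_oddset)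
qed

lemma xs_square: "xs T * (mono h)\<^sup>2 = mono (indic T + (h + h))"
  by (simp add: xs_mono power2_eq_square mono_add)

lemma mono_split: "mono m = xs (oddset m) * (mono (halfm m))\<^sup>2"
  by (simp add: xs_square flip: split_mono)

lemma oddset_join [simp]: "finite T \<Longrightarrow> oddset (indic T + (h + h)) = T"
  by (auto simp: oddset_def lookup_add lookup_indic split: if_splits)

lemma halfm_join [simp]: "finite T \<Longrightarrow> halfm (indic T + (h + h)) = h"
  by (rule poly_mapping_eqI) (simp add: lookup_add lookup_indic)

lemma join_in_mons: "finite T \<Longrightarrow> indic T + (h + h) \<in> mons t n \<longleftrightarrow>
  T \<subseteq> {1..t} \<and> Poly_Mapping.keys h \<subseteq> {1..t} \<and> card T + 2 * monom_deg h = n"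
proof -
  assume "finite T"
  then have "Poly_Mapping.keys (indic T + (h + h)) = T \<union> Poly_Mapping.keys h"
    by (auto simp: in_keys_iff lookup_add lookup_indic split: if_splits)
  then show ?thesis by (auto simp: mons_def monom_deg_add deg_indic)
qed

lemma xs_empty [simp]: "xs {} = 1"
  by (simp add: xs_def)

lemma xs_insert: "finite T \<Longrightarrow> j \<notin> T \<Longrightarrow> xs (insert j T) = X j * xs T"
  by (simp add: xs_def)

lemma xs_single [simp]: "xs {j} = X j"
  by (simp add: xs_def)

lemma xs_pair: "a \<noteq> b \<Longrightarrow> xs {a, b} = X a * X b"
  by (simp add: xs_insert)

lemma X_xs: "finite T \<Longrightarrow> X j * xs T = (if j \<in> T then xs (T - {j}) * (X j)\<^sup>2 else xs (insert j T))"
  by (auto simp: xs_insert power2_eq_square ac_simps xs_def prod.remove[of T j])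

lemma layer_additive: "additive \<phi> \<Longrightarrow> additive (\<lambda>f. \<phi> (q * f\<^sup>2))" for q :: poly2
  by (simp add: additive_def poly2_square_add distrib_left)

lemma layer_eqI:
  fixes \<phi> \<psi> :: "poly2 \<Rightarrow> bit"
  assumes "additive \<phi>" "additive \<psi>"
    and "\<And>T h. finite T \<Longrightarrow> \<phi> (xs T * (mono h)\<^sup>2) = \<psi> (xs T * (mono h)\<^sup>2)"
  shows "\<phi> p = \<psi> p"
  using assms(1,2)
proof (rule additive_eqI)
  show "\<phi> (mono m) = \<psi> (mono m)" for m
    unfolding mono_split[of m] by (rule assms(3)) simp
qed

lemma prod_X_plus:
  assumes "finite T"
  shows "(\<Prod>i\<in>T. X i + g i) = (\<Sum>J\<in>Pow T. xs (T - J) * (\<Prod>i\<in>J. g i))"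
  using prod_add[OF assms, of g X] by (simp add: xs_def ac_simps)

text \<open>\<open>St\<close> is multiplicative, and each variable of \<open>xs T\<close>
  contributes itself or its square; \<open>J\<close> is the set of variables that contribute the
  square and thereby move to the next layer.\<close>

lemma St_layer:
  assumes "finite T"
  shows "St (xs T * f\<^sup>2) = (\<Sum>J\<in>Pow T. xs (T - J) * (xs J * St f)\<^sup>2)"
proof -
  have "St (xs T) = (\<Sum>J\<in>Pow T. xs (T - J) * (xs J)\<^sup>2)"
    using prod_X_plus[OF assms, of "\<lambda>i. (X i)\<^sup>2"] by (simp add: xs_def St_prod prod_power_distrib)
  then have "St (xs T * f\<^sup>2) = (\<Sum>J\<in>Pow T. xs (T - J) * (xs J)\<^sup>2) * (St f)\<^sup>2"
    by simp
  also have "\<dots> = (\<Sum>J\<in>Pow T. xs (T - J) * (xs J * St f)\<^sup>2)"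
    unfolding sum_distrib_right power_mult_distrib by (simp only: mult.assoc)
  finally show ?thesis .
qed

text \<open>Inverse to restricting a functional to its layers: \<psi> \<open>T\<close> prescribes
  the values on \<open>xs T\<close> times a square. Only its values on monomials enter, hence the
  additivity assumption in \<open>asm_layer\<close>.\<close>

definition asm :: "(nat set \<Rightarrow> poly2 \<Rightarrow> bit) \<Rightarrow> poly2 \<Rightarrow> bit"
  where "asm \<psi> = lin (\<lambda>m. \<psi> (oddset m) (mono (halfm m)))"

lemma asm_layer:
  assumes "finite T" "additive (\<psi> T)"
  shows "asm \<psi> (xs T * f\<^sup>2) = \<psi> T f"
proof -
  have "additive (asm \<psi>)"
    by (simp add: asm_def)
  from additive_eqI[OF layer_additive[OF this] assms(2)]
  show ?thesis
    by (simp add: xs_square asm_def assms(1))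
qed

lemma asm_funcs:
  assumes "\<And>T h. \<psi> T (mono h) \<noteq> 0 \<Longrightarrow> T \<subseteq> {1..t} \<and> Poly_Mapping.keys h \<subseteq> {1..t} \<and> card T + 2 * monom_deg h = n"
  shows "asm \<psi> \<in> funcs t n"
proof (rule funcsI)
  show "additive (asm \<psi>)" by (simp add: asm_def)
  fix m assume m: "m \<notin> mons t n"
  show "asm \<psi> (mono m) = 0"
  proof (rule ccontr)
    assume "asm \<psi> (mono m) \<noteq> 0"
    then have "indic (oddset m) + (halfm m + halfm m) \<in> mons t n"
      by (subst join_in_mons) (use assms in \<open>auto simp: asm_def\<close>)
    with m show False by (simp flip: split_mono)
  qed
qed


lemma funcs_monomult:
  assumes "\<phi> \<in> funcs t n" "\<not> Poly_Mapping.keys m \<subseteq> {1..t}"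
  shows "\<phi> (mono m * p) = 0"
  using assms(1)
proof (rule funcs_vanish)
  fix k assume "k \<in> Poly_Mapping.keys (mono m * p)"
  then obtain k' where "k = m + k'"
    using keys_mult[of "mono m" p] by auto
  then show "k \<notin> mons t n"
    using assms(2) by (auto simp: mons_def in_keys_iff lookup_add subset_iff)
qed

text \<open>By \<open>St_layer\<close>, invariance of the assembled functional is one equation for
  each layer \<open>T\<close>. If \<open>T\<close> leaves the range of variables, all terms of its
  equation vanish by the support condition.\<close>

lemma asm_K:
  assumes add: "\<And>T. additive (\<psi> T)"
    and supp: "\<And>T h. \<psi> T (mono h) \<noteq> 0 \<Longrightarrow> T \<subseteq> {1..t} \<and> Poly_Mapping.keys h \<subseteq> {1..t} \<and> card T + 2 * monom_deg h = n"
    and St: "\<And>T f. T \<subseteq> {1..t} \<Longrightarrow> (\<Sum>J\<in>Pow T. \<psi> (T - J) (xs J * St f)) = \<psi> T f"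
  shows "asm \<psi> \<in> K t n"
proof -
  have F: "asm \<psi> \<in> funcs t n"
    using supp by (rule asm_funcs)
  note A = funcs_additive[OF F]
  have zero: "\<psi> T (mono m * p) = 0" if "\<not> (T \<union> Poly_Mapping.keys m) \<subseteq> {1..t}" for T m p
  proof -
    have "\<psi> T (mono m * mono h) = 0" for h
    proof (rule ccontr)
      assume "\<psi> T (mono m * mono h) \<noteq> 0"
      then have "T \<subseteq> {1..t}" "Poly_Mapping.keys (m + h) \<subseteq> {1..t}"
        using supp[of T "m + h"] by (auto simp: mono_add)
      with that show False
        by (auto simp: in_keys_iff lookup_add subset_iff)
    qed
    with additive_eqI[OF additive_comp[OF add additive_mult_left] additive_zero]
    show ?thesis by blast
  qed
  have "asm \<psi> (St p) = asm \<psi> p" for p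
  proof (rule layer_eqI[OF additive_comp[OF A additive_St] A])
    fix T :: "nat set" and h assume T: "finite T"
    let ?f = "mono h"
    have "asm \<psi> (St (xs T * ?f\<^sup>2)) = (\<Sum>J\<in>Pow T. \<psi> (T - J) (xs J * St ?f))"
      unfolding St_layer[OF T] additive.sum[OF A]
      by (intro sum.cong refl asm_layer add) (use T in auto)
    also have "\<dots> = \<psi> T ?f"
    proof (cases "T \<subseteq> {1..t}")
      case True
      then show ?thesis by (rule St)
    next
      case False
      have "\<psi> (T - J) (xs J * St ?f) = 0" if "J \<in> Pow T" for J
        unfolding xs_mono using False that finite_subset[of J T] T
        by (intro zero) (auto simp: keys_indic)
      moreover have "\<psi> T ?f = 0"
        using False zero[of T 0 ?f] by simp
      ultimately show ?thesis by simp
    qed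
    also have "\<dots> = asm \<psi> (xs T * ?f\<^sup>2)"
      using T add by (simp add: asm_layer)
    finally show "asm \<psi> (St (xs T * ?f\<^sup>2)) = asm \<psi> (xs T * ?f\<^sup>2)" .
  qed
  with F show ?thesis by (simp add: K_def)
qed

lemma K_layer:
  assumes "\<phi> \<in> K t n" "finite T"
  shows "(\<Sum>J\<in>Pow T. \<phi> (xs (T - J) * (xs J * St f)\<^sup>2)) = \<phi> (xs T * f\<^sup>2)"
proof -
  have "\<phi> (\<Sum>J\<in>Pow T. xs (T - J) * (xs J * St f)\<^sup>2) = (\<Sum>J\<in>Pow T. \<phi> (xs (T - J) * (xs J * St f)\<^sup>2))"
    by (rule additive.sum[OF funcs_additive[OF K_funcs[OF assms(1)]]])
  then show ?thesis
    using K_St[OF assms(1), of "xs T * f\<^sup>2"] by (simp only: St_layer[OF assms(2)])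
qed

lemma funcs_layer:
  assumes "\<phi> \<in> funcs t n" "finite T" "card T + 2 * m = n"
  shows "(\<lambda>f. \<phi> (xs T * f\<^sup>2)) \<in> funcs t m"
proof (rule funcsI)
  show "additive (\<lambda>f. \<phi> (xs T * f\<^sup>2))"
    using assms(1) by (intro layer_additive funcs_additive)
  fix h assume "h \<notin> mons t m"
  then show "\<phi> (xs T * (mono h)\<^sup>2) = 0"
    unfolding xs_square
    by (intro funcs_mono[OF assms(1)] notI, unfold join_in_mons[OF assms(2)]) (use assms(3) in \<open>simp add: mons_def\<close>)
qed

lemma funcs_layer_zero:
  assumes "\<phi> \<in> funcs t n" "finite T" "\<not> T \<subseteq> {1..t} \<or> (\<forall>m. card T + 2 * m \<noteq> n)"
  shows "\<phi> (xs T * f\<^sup>2) = 0"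
proof -
  have "\<phi> (xs T * (mono h)\<^sup>2) = 0" for h
    unfolding xs_square using assms by (intro funcs_mono[OF assms(1)]) (auto simp: join_in_mons)
  with additive_eqI[OF layer_additive[OF funcs_additive[OF assms(1)]] additive_zero]
  show ?thesis by blast
qed

lemma funcs_X:
  assumes "\<phi> \<in> funcs t (Suc n)"
  shows "(\<lambda>f. \<phi> (X i * f)) \<in> funcs t n"
proof (rule funcsI)
  show "additive (\<lambda>f. \<phi> (X i * f))"
    using funcs_additive[OF assms] by (rule additive_comp) simp
  fix m assume "m \<notin> mons t n"
  then have "Poly_Mapping.single i 1 + m \<notin> mons t (Suc n)"
    by (auto simp: mons_def monom_deg_add in_keys_iff lookup_add subset_iff)
  then show "\<phi> (X i * mono m) = 0"
    using funcs_mono[OF assms] by (simp add: X_def flip: mono_add)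
qed

subsection \<open>Degrees\<close>

definition deg_lt :: "nat \<Rightarrow> poly2 set"
  where "deg_lt k = {p. \<forall>m\<in>Poly_Mapping.keys p. monom_deg m < k}"

definition deg_ge :: "nat \<Rightarrow> poly2 set"
  where "deg_ge k = {p. \<forall>m\<in>Poly_Mapping.keys p. k \<le> monom_deg m}"

lemma deg_lt_add: "p \<in> deg_lt k \<Longrightarrow> q \<in> deg_lt k \<Longrightarrow> p + q \<in> deg_lt k"
  by (auto simp: deg_lt_def keys_poly2_add)

lemma deg_ge_add: "p \<in> deg_ge k \<Longrightarrow> q \<in> deg_ge k \<Longrightarrow> p + q \<in> deg_ge k"
  by (auto simp: deg_ge_def keys_poly2_add)

lemma deg_ge_sum: "(\<And>x. x \<in> A \<Longrightarrow> f x \<in> deg_ge k) \<Longrightarrow> sum f A \<in> deg_ge k"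
  by (induction A rule: infinite_finite_induct) (auto simp: deg_ge_add, auto simp: deg_ge_def)

lemma deg_lt_mult_mono: "p \<in> deg_lt k \<Longrightarrow> mono m * p \<in> deg_lt (monom_deg m + k)"
  using keys_mult[of "mono m" p] by (fastforce simp: deg_lt_def monom_deg_add)

lemma deg_ge_mult: "p \<in> deg_ge k \<Longrightarrow> q \<in> deg_ge l \<Longrightarrow> p * q \<in> deg_ge (k + l)"
  using keys_mult[of p q] by (fastforce simp: deg_ge_def monom_deg_add)

lemma deg_ge_0 [simp]: "p \<in> deg_ge 0"
  by (simp add: deg_ge_def)

lemma deg_lt_mono: "p \<in> deg_lt k \<Longrightarrow> k \<le> l \<Longrightarrow> p \<in> deg_lt l"
  by (auto simp: deg_lt_def)

lemma deg_ge_mono: "p \<in> deg_ge k \<Longrightarrow> l \<le> k \<Longrightarrow> p \<in> deg_ge l"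
  by (auto simp: deg_ge_def)

lemma mono_deg_lt: "monom_deg m < k \<Longrightarrow> mono m \<in> deg_lt k"
  by (simp add: deg_lt_def)

lemma mono_deg_ge: "k \<le> monom_deg m \<Longrightarrow> mono m \<in> deg_ge k"
  by (simp add: deg_ge_def)

lemma funcs_deg_lt: "\<phi> \<in> funcs t n \<Longrightarrow> p \<in> deg_lt n \<Longrightarrow> \<phi> p = 0"
  by (erule funcs_vanish) (auto simp: deg_lt_def mons_def)

lemma funcs_deg_ge: "\<phi> \<in> funcs t n \<Longrightarrow> p \<in> deg_ge (Suc n) \<Longrightarrow> \<phi> p = 0"
  by (erule funcs_vanish) (auto simp: deg_ge_def mons_def)

lemma St_mono_top: "St (mono m) + (mono m)\<^sup>2 \<in> deg_lt (2 * monom_deg m)"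
proof (induction m rule: mono_induct)
  case zero
  then show ?case by (simp add: deg_lt_def)
next
  case (add j m)
  let ?L = "St (mono m) + (mono m)\<^sup>2" and ?s = "Poly_Mapping.single j 1 :: monomial"
  have X: "X j = mono ?s" and X2: "(X j)\<^sup>2 = mono (Poly_Mapping.single j 2)"
    using X_power[of j 2] by (simp_all add: X_def)
  have "St (mono (?s + m)) + (mono (?s + m))\<^sup>2 = X j * (mono m)\<^sup>2 + X j * ?L + (X j)\<^sup>2 * ?L"
    unfolding mono_add X[symmetric] by (simp add: algebra_simps)
  moreover have "X j * (mono m)\<^sup>2 \<in> deg_lt (2 * monom_deg (?s + m))"
    unfolding X power2_eq_square mono_add[symmetric] by (rule mono_deg_lt) (simp add: monom_deg_add)
  moreover have "X j * ?L \<in> deg_lt (2 * monom_deg (?s + m))"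
    unfolding X by (rule deg_lt_mono[OF deg_lt_mult_mono[OF add]]) (simp add: monom_deg_add)
  moreover have "(X j)\<^sup>2 * ?L \<in> deg_lt (2 * monom_deg (?s + m))"
    unfolding X2 by (rule deg_lt_mono[OF deg_lt_mult_mono[OF add]]) (simp add: monom_deg_add)
  ultimately show ?case by (simp only: deg_lt_add)
qed

lemma St_mono_bot: "St (mono m) + mono m \<in> deg_ge (Suc (monom_deg m))"
proof (induction m rule: mono_induct)
  case zero
  then show ?case by (simp add: deg_ge_def)
next
  case (add j m)
  let ?L = "St (mono m) + mono m" and ?s = "Poly_Mapping.single j 1 :: monomial"
  have X: "X j = mono ?s" and X2: "(X j)\<^sup>2 = mono (Poly_Mapping.single j 2)"
    using X_power[of j 2] by (simp_all add: X_def)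
  have "St (mono (?s + m)) + mono (?s + m) = (X j)\<^sup>2 * mono m + X j * ?L + (X j)\<^sup>2 * ?L"
    unfolding mono_add X[symmetric] by (simp add: algebra_simps)
  moreover have "(X j)\<^sup>2 * mono m \<in> deg_ge (Suc (monom_deg (?s + m)))"
    unfolding X2 mono_add[symmetric] by (rule mono_deg_ge) (simp add: monom_deg_add)
  moreover have "X j * ?L \<in> deg_ge (Suc (monom_deg (?s + m)))"
    unfolding X by (rule deg_ge_mono[OF deg_ge_mult[OF mono_deg_ge[OF order_refl] add]]) (simp add: monom_deg_add)
  moreover have "(X j)\<^sup>2 * ?L \<in> deg_ge (Suc (monom_deg (?s + m)))"
    unfolding X2 by (rule deg_ge_mono[OF deg_ge_mult[OF mono_deg_ge[OF order_refl] add]]) (simp add: monom_deg_add)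
  ultimately show ?case by (simp only: deg_ge_add)
qed

text \<open>\<open>St\<close> is unipotent: to a monomial it only adds terms of higher degree, which
  a functional of degree \<open>n\<close> does not see on a monomial of degree \<open>n\<close>. The
  lemma frees relations proved for \<open>St f\<close> from the \<open>St\<close>.\<close>

lemma funcs_St_zero:
  assumes "\<phi> \<in> funcs t n" "\<And>f. \<phi> (St f) = 0"
  shows "\<phi> f = 0"
proof -
  have "\<phi> (mono m) = 0" for m
  proof (cases "monom_deg m = n")
    case True
    have "\<phi> (mono m) = \<phi> (St (mono m) + (St (mono m) + mono m))" by simp
    also have "\<dots> = \<phi> (St (mono m)) + \<phi> (St (mono m) + mono m)"
      using assms(1) by (rule funcs_add)
    also have "\<dots> = 0"
      using assms St_mono_bot[of m] True by (simp only: funcs_deg_ge) simp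
    finally show ?thesis .
  qed (use assms(1) in \<open>auto simp: funcs_def mons_def\<close>)
  with additive_eqI[OF funcs_additive[OF assms(1)] additive_zero] show ?thesis by blast
qed

subsection \<open>Wood's criterion\<close>

text \<open>For each variable in \<open>T\<close> there is a polynomial \<open>bar\<close> whose
  image under \<open>St\<close> is the variable itself up to a term of very high degree. In the
  product of the \<open>bar i\<close> with \<open>h\<close> no monomial has degree \<open>n\<close>;
  after applying \<open>St\<close>, the only component of degree \<open>n\<close> is
  \<open>xs T\<close> times the square of \<open>h\<close>, since that square is the top component
  of \<open>St h\<close>.\<close>

lemma wood:
  assumes \<phi>: "\<phi> \<in> K t n" and T: "finite T" and rep: "\<And>e. 2 * (\<Sum>i\<in>T. 2 ^ e i) \<noteq> n + card T"
  shows "\<phi> (xs T * f\<^sup>2) = 0"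
proof -
  note F = K_funcs[OF \<phi>]
  note A = funcs_additive[OF F]
  have "\<phi> (xs T * (mono h)\<^sup>2) = 0" for h
  proof (cases "card T + 2 * monom_deg h = n")
    case False
    then show ?thesis unfolding xs_square
      using T by (intro funcs_mono[OF F]) (auto simp: join_in_mons)
  next
    case True
    \<comment> \<open>The image of this sum under \<open>St\<close> telescopes. Stopping at
      \<open>n\<close> suffices because \<open>2 ^ Suc n\<close> exceeds the degree
      \<open>n\<close>.\<close>
    define bar where "bar i = (\<Sum>j\<le>n. X i ^ (2 ^ j))" for i
    have St_bar: "St (bar i) = X i + X i ^ (2 ^ Suc n)" for i
    proof -
      have pow: "(p + q) ^ (2 ^ j) = p ^ (2 ^ j) + q ^ (2 ^ j)" for p q :: poly2 and j
        by (induction j) (simp_all add: power_mult poly2_square_add mult.commute[of 2])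
      have "(\<Sum>j\<le>N. X i ^ (2 ^ j) + X i ^ (2 ^ Suc j)) = X i + X i ^ (2 ^ Suc N)" for N
        by (induction N) (simp_all add: algebra_simps del: power_Suc)
      then show ?thesis
        by (simp add: bar_def St_sum pow flip: power_mult)
    qed
    have "\<phi> ((\<Prod>i\<in>T. bar i) * mono h) = 0"
    proof -
      have "(\<Prod>i\<in>T. bar i) * mono h = (\<Sum>e\<in>PiE T (\<lambda>_. {..n}). (\<Prod>i\<in>T. X i ^ (2 ^ e i)) * mono h)"
        unfolding bar_def using T by (simp add: prod_sum_PiE sum_distrib_right)
      also have "\<phi> \<dots> = (\<Sum>e\<in>PiE T (\<lambda>_. {..n}). \<phi> ((\<Prod>i\<in>T. X i ^ (2 ^ e i)) * mono h))"
        by (rule additive.sum[OF A])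
      also have "\<dots> = 0"
      proof (intro sum.neutral ballI)
        fix e assume "e \<in> PiE T (\<lambda>_. {..n})"
        define k where "k = (\<Sum>i\<in>T. Poly_Mapping.single i (2 ^ e i) :: monomial)"
        have "(\<Prod>i\<in>T. X i ^ (2 ^ e i)) = mono k"
          unfolding k_def by (induction T rule: infinite_finite_induct) (simp_all add: mono_add X_power)
        moreover have "monom_deg k = (\<Sum>i\<in>T. 2 ^ e i)"
          unfolding k_def by (induction T rule: infinite_finite_induct) (simp_all add: monom_deg_add)
        \<comment> \<open>Because \<open>card T + 2 * monom_deg h = n\<close>, equality here would
          double to a representation of \<open>n + card T\<close>, which \<open>rep\<close>
          excludes.\<close>
        then have "monom_deg (k + h) \<noteq> n"
          using rep[of e] True by (auto simp: monom_deg_add)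
        ultimately show "\<phi> ((\<Prod>i\<in>T. X i ^ (2 ^ e i)) * mono h) = 0"
          using F by (auto simp: funcs_def mons_def simp flip: mono_add)
      qed
      finally show ?thesis .
    qed
    then have 0: "\<phi> ((\<Prod>i\<in>T. X i + X i ^ (2 ^ Suc n)) * St (mono h)) = 0"
      using K_St[OF \<phi>, of "(\<Prod>i\<in>T. bar i) * mono h"] by (simp add: St_prod St_bar del: power_Suc)
    have "(\<Prod>i\<in>T. X i + X i ^ (2 ^ Suc n)) + xs T \<in> deg_ge (Suc n)"
    proof -
      let ?t = "\<lambda>J. xs (T - J) * (\<Prod>i\<in>J. X i ^ (2 ^ Suc n))"
      have "(\<Prod>i\<in>T. X i + X i ^ (2 ^ Suc n)) = ?t {} + (\<Sum>J\<in>Pow T - {{}}. ?t J)"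
        unfolding prod_X_plus[OF T] by (subst sum.remove[of _ "{}"]) (use T in auto)
      also have "\<dots> + xs T = (\<Sum>J\<in>Pow T - {{}}. ?t J)"
        by (simp add: ac_simps)
      also have "\<dots> \<in> deg_ge (Suc n)"
      proof (rule deg_ge_sum)
        fix J assume J: "J \<in> Pow T - {{}}"
        then obtain i where i: "i \<in> J" by auto
        have "finite J" using J T finite_subset by auto
        then have "?t J = X i ^ (2 ^ Suc n) * (xs (T - J) * (\<Prod>i\<in>J - {i}. X i ^ (2 ^ Suc n)))"
          using i by (simp only: prod.remove[of J i] ac_simps)
        moreover have "X i ^ (2 ^ Suc n) \<in> deg_ge (Suc n)"
          unfolding X_power by (rule mono_deg_ge) (use less_exp[of "Suc n"] in \<open>simp del: power_Suc\<close>)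
        ultimately show "?t J \<in> deg_ge (Suc n)"
          using deg_ge_mult[OF _ deg_ge_0, of _ "Suc n"] by (metis add_0_right)
      qed
      finally show ?thesis .
    qed
    then have 1: "\<phi> (((\<Prod>i\<in>T. X i + X i ^ (2 ^ Suc n)) + xs T) * St (mono h)) = 0"
      using F deg_ge_mult[OF _ deg_ge_0, of _ "Suc n" "St (mono h)"] by (simp add: funcs_deg_ge del: power_Suc)
    have 2: "\<phi> (xs T * (St (mono h) + (mono h)\<^sup>2)) = 0"
      unfolding xs_mono using deg_lt_mult_mono[OF St_mono_top[of h], of "indic T"] True
      by (intro funcs_deg_lt[OF F]) (simp add: deg_indic)
    have "xs T * (mono h)\<^sup>2 = (\<Prod>i\<in>T. X i + X i ^ (2 ^ Suc n)) * St (mono h)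
        + (((\<Prod>i\<in>T. X i + X i ^ (2 ^ Suc n)) + xs T) * St (mono h) + xs T * (St (mono h) + (mono h)\<^sup>2))"
      by (simp add: algebra_simps del: power_Suc)
    then show ?thesis
      using 0 1 2 by (simp only: funcs_add[OF F]) simp
  qed
  with additive_eqI[OF layer_additive[OF A] additive_zero] show ?thesis by blast
qed

subsection \<open>Relations indexed by five letters\<close>

definition V :: "nat set"
  where "V = {1..5}"

text \<open>The arguments are the five letters in some order. Stating relations for an arbitrary
  enumeration yields all instances by permuting arguments.\<close>

definition five :: "nat \<Rightarrow> nat \<Rightarrow> nat \<Rightarrow> nat \<Rightarrow> nat \<Rightarrow> bool"
  where "five a b c d e \<longleftrightarrow> V = {a, b, c, d, e} \<and> distinct [a, b, c, d, e]"

lemma finite_V [simp]: "finite V" and card_V: "card V = 5"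
  by (simp_all add: V_def)

lemma five_swap:
  "five a b c d e \<Longrightarrow> five b a c d e" "five a b c d e \<Longrightarrow> five a c b d e"
  "five a b c d e \<Longrightarrow> five a b d c e" "five a b c d e \<Longrightarrow> five a b c e d"
  by (auto simp: five_def)

lemma fiveD:
  assumes "five a b c d e"
  shows "a \<in> V" "b \<in> V" "c \<in> V" "d \<in> V" "e \<in> V"
    "a \<noteq> b" "a \<noteq> c" "a \<noteq> d" "a \<noteq> e" "b \<noteq> c" "b \<noteq> d" "b \<noteq> e" "c \<noteq> d" "c \<noteq> e" "d \<noteq> e"
    "b \<noteq> a" "c \<noteq> a" "d \<noteq> a" "e \<noteq> a" "c \<noteq> b" "d \<noteq> b" "e \<noteq> b" "d \<noteq> c" "e \<noteq> c" "e \<noteq> d"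
  using assms by (auto simp: five_def)

lemma five_V: "five a b c d e \<Longrightarrow> V = {a, b, c, d, e}"
  by (simp add: five_def)

lemma V_four:
  assumes "a \<in> V" "b \<in> V" "c \<in> V" "d \<in> V" "distinct [a, b, c, d]"
  obtains e where "five a b c d e"
proof -
  have "card (V - {a, b, c, d}) = 1"
    using assms by (subst card_Diff_subset) (auto simp: card_V)
  then obtain e where "V - {a, b, c, d} = {e}" by (auto simp: card_1_singleton_iff)
  with assms show thesis by (intro that[of e]) (auto simp: five_def)
qed

lemma V_three:
  assumes "a \<in> V" "b \<in> V" "c \<in> V" "distinct [a, b, c]"
  obtains d e where "five a b c d e"
proof -
  have "card (V - {a, b, c}) = 2"
    using assms by (subst card_Diff_subset) (auto simp: card_V)
  then have "V - {a, b, c} \<noteq> {}" by (metis card.empty zero_neq_numeral)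
  then obtain d where "d \<in> V" "d \<notin> {a, b, c}" by auto
  with assms V_four[of a b c d] that show thesis by auto
qed

lemma V_two:
  assumes "a \<in> V" "b \<in> V" "a \<noteq> b"
  obtains c d e where "five a b c d e"
proof -
  have "card (V - {a, b}) = 3"
    using assms by (subst card_Diff_subset) (auto simp: card_V)
  then have "V - {a, b} \<noteq> {}" by (metis card.empty zero_neq_numeral)
  then obtain d where "d \<in> V" "d \<notin> {a, b}" by auto
  with assms V_three[of a b d] that show thesis by auto
qed

lemma V_one:
  assumes "a \<in> V"
  obtains b c d e where "five a b c d e"
proof -
  have "card (V - {a}) = 4"
    using assms by (subst card_Diff_subset) (auto simp: card_V)
  then have "V - {a} \<noteq> {}" by (metis card.empty zero_neq_numeral)
  then obtain d where "d \<in> V" "d \<notin> {a}" by auto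
  with assms V_two[of a d] that show thesis by (metis insertI1)
qed

definition P2 :: "nat set \<Rightarrow> nat set set"
  where "P2 T = {P. P \<subseteq> T \<and> card P = 2}"

lemma P2_iff: "P \<in> P2 T \<longleftrightarrow> (\<exists>a b. P = {a, b} \<and> a \<noteq> b \<and> a \<in> T \<and> b \<in> T)"
  by (auto simp: P2_def card_2_iff)

lemma pair_P2: "a \<in> V \<Longrightarrow> b \<in> V \<Longrightarrow> a \<noteq> b \<Longrightarrow> {a, b} \<in> P2 V"
  by (auto simp: P2_iff)

lemma P2_V_cases:
  assumes "P \<in> P2 V"
  obtains a b c d e where "five a b c d e" "P = {a, b}"
  using assms V_two by (metis P2_iff)

text \<open>Serves to add up a list of relations; the simplifier then cancels equal terms of the
  sum. This is the form of all certificates below.\<close>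

lemma add_zeros: "a = 0 \<Longrightarrow> b = 0 \<Longrightarrow> a + b = (0 :: bit)"
  by simp

section \<open>Values on third layers of size four, forced by a word function\<close>

definition AA :: "(nat \<Rightarrow> nat set \<Rightarrow> nat set \<Rightarrow> nat \<Rightarrow> bit) \<Rightarrow> nat \<Rightarrow> nat \<Rightarrow> nat \<Rightarrow> bit"
  where "AA S i j n = (\<Sum>k\<in>V - {j, n}. S i {j, k} (V - {j, n, k}) k)"

definition BB :: "(nat \<Rightarrow> nat set \<Rightarrow> nat set \<Rightarrow> nat \<Rightarrow> bit) \<Rightarrow> nat \<Rightarrow> nat \<Rightarrow> nat \<Rightarrow> nat \<Rightarrow> bit"
  where "BB S i j m n = (\<Sum>k\<in>V - {j, m, n}. S i {j, k} (V - {m, n, k}) k)"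

definition other :: "nat set \<Rightarrow> nat \<Rightarrow> nat"
  where "other P m = the_elem (P - {m})"

text \<open>The value on the third layer \<open>V - {l}\<close>. For \<open>l\<close> in
  \<open>P\<close> it is read off from the relation between second and third layer. For
  \<open>i = l\<close> it follows by moving \<open>i\<close> with the relation of the first two
  layers, and for \<open>i\<close> in \<open>P\<close> from the previous case and
  \<open>ZZ_B\<close>. In the last case one adds the four relations of the first two layers among
  \<open>i\<close>, \<open>l\<close> and the letters of \<open>P\<close>, and then compares values
  with the same first index by \<open>ZZ_B\<close>. \<open>Min P\<close> merely names an element of
  the pair, as \<open>BB\<close> is symmetric in its last two arguments.\<close>

definition ZZ :: "(nat \<Rightarrow> nat set \<Rightarrow> nat set \<Rightarrow> nat \<Rightarrow> bit) \<Rightarrow> nat \<Rightarrow> nat set \<Rightarrow> nat \<Rightarrow> bit"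
  where "ZZ S i P l =
    (if l \<in> P then AA S i l (other P l)
     else if i = l then \<Sum>m\<in>P. AA S m i (other P m)
     else if i \<in> P then AA S (other P i) i l + AA S l i (other P i) + BB S i (other P i) i l
     else BB S l i (other P (Min P)) (Min P) + (\<Sum>m\<in>P. BB S i m l (other P m) + BB S m i l (other P m)))"

lemma other_pair [simp]: "m \<noteq> n \<Longrightarrow> other {m, n} m = n" "m \<noteq> n \<Longrightarrow> other {m, n} n = m"
  by (simp_all add: other_def insert_Diff_if)

lemma AA_five: "five j n a b c \<Longrightarrow> AA S i j n = S i {j, a} {b, c} a + S i {j, b} {a, c} b + S i {j, c} {a, b} c"
  unfolding AA_def five_V[of j n a b c] by (frule fiveD) (simp add: insert_Diff_if add.assoc fiveD)

lemma BB_five: "five j m n a b \<Longrightarrow> BB S i j m n = S i {j, a} {j, b} a + S i {j, b} {j, a} b"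
  unfolding BB_def five_V[of j m n a b] by (frule fiveD) (simp add: insert_Diff_if fiveD)

lemma BB_sym: "BB S i j m n = BB S i j n m"
  by (simp add: BB_def insert_commute)

lemma ZZ_mem: "l \<noteq> n \<Longrightarrow> ZZ S i {l, n} l = AA S i l n" "l \<noteq> n \<Longrightarrow> ZZ S i {n, l} l = AA S i l n"
  by (simp_all add: ZZ_def)

lemma ZZ_eq: "distinct [i, m, n] \<Longrightarrow> ZZ S i {m, n} i = AA S m i n + AA S n i m"
  by (simp add: ZZ_def)

lemma ZZ_in: "distinct [i, m, n] \<Longrightarrow> ZZ S i {i, m} n = AA S m i n + AA S n i m + BB S i m i n"
  by (simp add: ZZ_def)

lemma ZZ_out:
  assumes "distinct [i, m, n, j]"
  shows "ZZ S i {m, n} j = BB S i n j m + BB S i m j n + BB S j i m n + BB S m i j n + BB S n i j m"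
  using assms by (cases "m < n") (auto simp: ZZ_def BB_sym ac_simps min_def)

text \<open>The argument \<open>x\<close> stands for one more variable factor. \<open>G0\<close>
  relates the first two layers. \<open>G1\<close> and \<open>G1'\<close> relate the second and the
  third layer; they are the same sum over all letters different from \<open>j\<close>, multiplied by
  a single letter \<open>l\<close> or by \<open>j\<close> itself.\<close>

locale two_relations =
  fixes S :: "nat \<Rightarrow> nat set \<Rightarrow> nat set \<Rightarrow> nat \<Rightarrow> bit"
  assumes G0: "\<And>i j k l m T x. five i j k l m \<Longrightarrow> T \<in> P2 V \<Longrightarrow> x \<in> V \<Longrightarrow>
      S i {j, k} T x + S j {i, k} T x + S k {i, j} T x = 0"
    and G1: "\<And>i j l a b c x. five j l a b c \<Longrightarrow> i \<in> V \<Longrightarrow> x \<in> V \<Longrightarrow>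
      S i {j, a} {a, l} x + S i {j, b} {b, l} x + S i {j, c} {c, l} x = 0"
    and G1': "\<And>i j a b c d x. five j a b c d \<Longrightarrow> i \<in> V \<Longrightarrow> x \<in> V \<Longrightarrow>
      S i {j, a} {j, a} x + S i {j, b} {j, b} x + S i {j, c} {j, c} x + S i {j, d} {j, d} x = 0"
begin

text \<open>The six terms are those of two instances of \<open>G1\<close>: one centred at
  \<open>a\<close> with last letter \<open>a\<close>, the other centred at \<open>b\<close> with
  last letter \<open>b\<close>.\<close>

lemma BB_cyclic:
  assumes "five j m n a b" "i \<in> V"
  shows "BB S i j m n + BB S i m j n + BB S i n j m = 0"
proof -
  have 1: "five m j n a b" "five n j m a b" "five a b j m n" "five b a j m n"
    using assms(1) by (auto simp: five_def)
  note D = fiveD[OF assms(1)]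
  show ?thesis
    using add_zeros[OF G1[OF 1(3) assms(2) D(4)] G1[OF 1(4) assms(2) D(5)]]
    by (simp add: BB_five[OF assms(1)] BB_five[OF 1(1)] BB_five[OF 1(2)] insert_commute ac_simps)
qed

lemma ZZ_B:
  assumes "five j m n a b" "i \<in> V"
  shows "ZZ S i {j, m} n + ZZ S i {j, n} m = BB S i j m n"
proof -
  note D = fiveD[OF assms(1)]
  have C: "BB S i j m n + BB S i m j n + BB S i n j m = 0"
    using assms by (rule BB_cyclic)
  consider "i = j" | "i = m" | "i = n" | "i \<notin> {j, m, n}" by auto
  then show ?thesis
  proof cases
    case 1
    have "BB S j j m n = BB S j m j n + BB S j n j m"
      using C 1 by (metis bit_add_eq_0 add.assoc)
    moreover have "ZZ S j {j, m} n = AA S m j n + AA S n j m + BB S j m j n"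
      "ZZ S j {j, n} m = AA S n j m + AA S m j n + BB S j n j m"
      using D by (simp_all add: ZZ_in)
    ultimately show ?thesis
      unfolding 1 by (simp only: ac_simps bit_add_self bit_add_self' add_0_left add_0_right)
  next
    case 2
    then show ?thesis
      using D ZZ_in[of m j n S] ZZ_eq[of m j n S] by (simp add: insert_commute[of j m] ac_simps)
  next
    case 3
    then show ?thesis
      using D ZZ_in[of n j m S] ZZ_eq[of n j m S] by (simp add: insert_commute[of j n] ac_simps BB_sym)
  next
    case 4
    have "BB S i j m n = BB S i m j n + BB S i n j m"
      using C by (metis bit_add_eq_0 add.assoc)
    then show ?thesis
      using 4 D ZZ_out[of i j m n S] ZZ_out[of i j n m S]
      by (simp add: ac_simps BB_sym)
  qed
qed

lemma ZZ_G0: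
  assumes "five i j k a b" "l \<in> V"
  shows "ZZ S i {j, k} l + ZZ S j {i, k} l + ZZ S k {i, j} l = 0"
proof -
  note D = fiveD[OF assms(1)]
  have out: "ZZ S i {j, k} l + ZZ S j {i, k} l + ZZ S k {i, j} l = 0" if "five i j k l m" for m
  proof -
    note E = fiveD[OF that]
    have "BB S l i j k + BB S l j i k + BB S l k i j = 0"
      using that by (rule BB_cyclic) (rule assms)
    then show ?thesis
      using E by (simp add: ZZ_out BB_sym ac_simps)
  qed
  consider "l = i" | "l = j" | "l = k" | "l = a" | "l = b"
    using assms by (auto simp: five_V)
  then show ?thesis
  proof cases
    case 4
    with out assms(1) show ?thesis by blast
  next
    case 5
    with out five_swap(4)[OF assms(1)] show ?thesis by blast
  qed (use D in \<open>simp_all add: ZZ_mem ZZ_eq ac_simps\<close>)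
qed

end

section \<open>Consequences of the relations between adjacent layers of a word\<close>

locale three_relations =
  fixes s :: "nat \<Rightarrow> nat set \<Rightarrow> nat set \<Rightarrow> nat \<Rightarrow> nat \<Rightarrow> bit"
  assumes two: "\<And>y. y \<in> V \<Longrightarrow> two_relations (\<lambda>i P T x. s i P T x y)"
    and sym: "\<And>i P T x y. s i P T x y = s i P T y x"
    and T3: "\<And>i P a b c d e y. five a b c d e \<Longrightarrow> i \<in> V \<Longrightarrow> P \<in> P2 V \<Longrightarrow> y \<in> V \<Longrightarrow>
      s i P {b, c} a y + s i P {a, c} b y + s i P {a, b} c y = 0"
begin

lemmas G0 = two_relations.G0[OF two, rotated]
  and G1 = two_relations.G1[OF two, rotated]
  and G1' = two_relations.G1'[OF two, rotated]

lemma L_out: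
  assumes "five j a b c d" "i \<in> V" "x \<in> V"
  shows "s i {j, a} {c, d} a x + s i {j, b} {c, d} b x + s i {j, c} {c, d} c x + s i {j, d} {c, d} d x = 0"
proof -
  note D = fiveD[OF assms(1)]
  have f: "five j d a b c" "five j c a b d" "five a c d j b" "five b c d j a"
    using assms(1) by (auto simp: five_def)
  have P: "{j, a} \<in> P2 V" "{j, b} \<in> P2 V"
    using D by (auto simp: P2_iff)
  show ?thesis
    using add_zeros[OF G1[OF f(1) assms(2) D(4) assms(3)] add_zeros[OF G1[OF f(2) assms(2) D(5) assms(3)]
      add_zeros[OF T3[OF f(3) assms(2) P(1) assms(3)] T3[OF f(4) assms(2) P(2) assms(3)]]]]
    by (simp add: insert_commute ac_simps)
qed

lemma L_in:
  assumes "five j w a b c" "i \<in> V" "x \<in> V"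
  shows "s i {j, w} {j, w} w x + s i {j, a} {j, w} a x + s i {j, b} {j, w} b x + s i {j, c} {j, w} c x = 0"
proof -
  note D = fiveD[OF assms(1)]
  have f: "five j w a b c" "five j a w b c" "five j b w a c" "five j c w a b"
    using assms(1) by (auto simp: five_def)
  have P: "{j, a} \<in> P2 V" "{j, b} \<in> P2 V" "{j, c} \<in> P2 V"
    using D by (auto simp: P2_iff)
  have g: "five j w a b c" "five j w b a c" "five j w c a b"
    using assms(1) by (auto simp: five_def)
  show ?thesis
    using add_zeros[OF G1[OF f(1) assms(2) D(1) assms(3)] add_zeros[OF G1'[OF f(1) assms(2) D(2) assms(3)]
      add_zeros[OF T3[OF g(1) assms(2) P(1) assms(3)]
      add_zeros[OF T3[OF g(2) assms(2) P(2) assms(3)] T3[OF g(3) assms(2) P(3) assms(3)]]]]]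
    by (simp add: insert_commute ac_simps)
qed

text \<open>A relation between the second and the fourth layer. \<open>T3\<close> carries the letter
  \<open>y\<close> from the fourth layer into the third, and \<open>G1\<close> and
  \<open>G1'\<close> exchange it with the second.\<close>

lemma L:
  assumes "j \<in> V" "T \<in> P2 V" "i \<in> V" "x \<in> V"
  shows "(\<Sum>y\<in>V - {j}. s i {j, y} T y x) = 0"
proof (cases "j \<in> T")
  case True
  with assms obtain w where T: "T = {j, w}" "w \<in> V" "w \<noteq> j" by (auto simp: P2_iff)
  then obtain a b c where f: "five j w a b c" using assms V_two by metis
  show ?thesis
    using L_in[OF f assms(3,4)] by (simp add: T five_V[OF f] insert_Diff_if fiveD[OF f] add.assoc)
next
  case False
  with assms obtain c d where T: "T = {c, d}" "c \<in> V" "d \<in> V" "c \<noteq> d" "j \<noteq> c" "j \<noteq> d" by (auto simp: P2_iff)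
  then obtain a b where "five j c d a b" using assms V_three[of j c d] by auto
  then have f: "five j a b c d" by (auto simp: five_def)
  show ?thesis
    using L_out[OF f assms(3,4)] by (simp add: T five_V[OF f] insert_Diff_if fiveD[OF f] add.assoc)
qed

text \<open>The analogous relation between the first and the fourth layer: \<open>L\<close> at both
  letters of the pair, combined with \<open>G0\<close> for each of the other three letters.\<close>

lemma L0:
  assumes f: "five i j a b c" and T: "T \<in> P2 V" and z: "z \<in> V"
  shows "s i {i, j} T i z + s j {i, j} T j z + s a {i, j} T a z + s b {i, j} T b z + s c {i, j} T c z = 0"
proof -
  note D = fiveD[OF f]
  have g: "five a i j b c" "five b i j a c" "five c i j a b"
    using f by (auto simp: five_def)
  have 1: "s i {i, j} T i z + s i {a, j} T a z + s i {b, j} T b z + s i {c, j} T c z = 0"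
    using L[OF D(2) T D(1) z] by (simp add: five_V[OF f] insert_Diff_if D ac_simps insert_commute)
  have 2: "s j {i, j} T j z + s j {a, i} T a z + s j {b, i} T b z + s j {c, i} T c z = 0"
    using L[OF D(1) T D(2) z] by (simp add: five_V[OF f] insert_Diff_if D ac_simps insert_commute)
  show ?thesis
    using add_zeros[OF 1 add_zeros[OF 2 add_zeros[OF G0[OF g(1) T D(3) z] add_zeros[OF G0[OF g(2) T D(4) z] G0[OF g(3) T D(5) z]]]]]
    by (simp add: insert_commute ac_simps)
qed

text \<open>The obstruction to extending the third layer: invariance in degree 8 on the layer of all
  five letters requires it to vanish, which \<open>Z_\<Omega>\<close> uses after adjoining a further
  variable.\<close>

definition \<Omega> :: "nat \<Rightarrow> nat set \<Rightarrow> bit"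
  where "\<Omega> i P = (\<Sum>l\<in>V. ZZ (\<lambda>i P T x. s i P T x l) i P l)"

text \<open>A linear certificate: expanded into word values, the left side is the sum of three
  instances of \<open>L0\<close>, nine of \<open>G0\<close> and six of \<open>T3\<close>.\<close>

lemma \<Omega>_in:
  assumes f: "five i k a b c"
  shows "\<Omega> i {i, k} = 0"
proof -
  note D = fiveD[OF f]
  have pa: "five i k a b c" "five k i a b c" "five i a k b c" "five i b k a c" "five i c k a b"
    "five k i a b c" "five k i b a c" "five k i c a b"
    using f by (auto simp: five_def)
  have expand: "\<Omega> i {i, k} =
    (s i {a, i} {b, c} a i + s i {b, i} {a, c} b i + s i {c, i} {a, b} c i) +
    (s i {a, k} {b, c} a k + s i {b, k} {a, c} b k + s i {c, k} {a, b} c k) +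
    (s k {i, k} {b, c} a k + s k {b, i} {c, k} a b + s k {c, i} {b, k} a c + s a {a, i} {b, c} a a + s a {b, i} {a, c} a b + s a {c, i} {a, b} a c + s i {b, k} {c, k} a b + s i {c, k} {b, k} a c) +
    (s k {i, k} {a, c} b k + s k {a, i} {c, k} a b + s k {c, i} {a, k} b c + s b {a, i} {b, c} a b + s b {b, i} {a, c} b b + s b {c, i} {a, b} b c + s i {a, k} {c, k} a b + s i {c, k} {a, k} b c) +
    (s k {i, k} {a, b} c k + s k {a, i} {b, k} a c + s k {b, i} {a, k} b c + s c {a, i} {b, c} a c + s c {b, i} {a, c} b c + s c {c, i} {a, b} c c + s i {a, k} {b, k} a c + s i {b, k} {a, k} b c)"
    unfolding \<Omega>_def
    by (simp only: five_V[OF f]) (simp add: D ZZ_mem ZZ_in AA_five[OF pa(1)] AA_five[OF pa(2)] AA_five[OF pa(3)] AA_five[OF pa(4)]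
      AA_five[OF pa(5)] BB_five[OF pa(6)] BB_five[OF pa(7)] BB_five[OF pa(8)] ac_simps insert_commute sym)
  have p: "five i a k b c" "five i b k a c" "five i c k a b" "five i k a b c" "five i k b a c" "five i k c a b" "five k a b i c" "five k a c i b" "five k b c i a"
    using f by (auto simp: five_def)
  have q: "{b, c} \<in> P2 V" "{a, c} \<in> P2 V" "{a, b} \<in> P2 V" "{k, b} \<in> P2 V" "{k, c} \<in> P2 V" "{k, a} \<in> P2 V" "{i, k} \<in> P2 V"
    using D by (auto simp: P2_iff)
  show ?thesis
    unfolding expand
    using add_zeros[OF L0[OF p(1) q(1) D(3)]
      add_zeros[OF L0[OF p(2) q(2) D(4)]
      add_zeros[OF L0[OF p(3) q(3) D(5)]
      add_zeros[OF G0[OF p(4) q(4) D(3) D(5)]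
      add_zeros[OF G0[OF p(4) q(5) D(3) D(4)]
      add_zeros[OF G0[OF p(4) q(1) D(2) D(3)]
      add_zeros[OF G0[OF p(5) q(6) D(4) D(5)]
      add_zeros[OF G0[OF p(5) q(5) D(3) D(4)]
      add_zeros[OF G0[OF p(5) q(2) D(2) D(4)]
      add_zeros[OF G0[OF p(6) q(6) D(4) D(5)]
      add_zeros[OF G0[OF p(6) q(4) D(3) D(5)]
      add_zeros[OF G0[OF p(6) q(3) D(2) D(5)]
      add_zeros[OF T3[OF p(7) D(2) q(7) D(5)]
      add_zeros[OF T3[OF p(8) D(2) q(7) D(4)]
      add_zeros[OF T3[OF p(9) D(2) q(7) D(3)]
      add_zeros[OF T3[OF p(9) D(3) q(7) D(3)]
      add_zeros[OF T3[OF p(8) D(4) q(7) D(4)]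
      T3[OF p(7) D(5) q(7) D(5)]]]]]]]]]]]]]]]]]]
    by (simp add: ac_simps insert_commute sym)
qed

text \<open>Here the certificate consists of ten instances of \<open>G0\<close>, fourteen of
  \<open>T3\<close>, four of \<open>G1\<close> and two of \<open>G1'\<close>.\<close>

lemma \<Omega>_out:
  assumes f: "five a i k b c"
  shows "\<Omega> a {i, k} = 0"
proof -
  note D = fiveD[OF f]
  have pa: "five i k a b c" "five k i a b c" "five a k i b c" "five a i k b c" "five k b i a c" "five i b k a c" "five a i k b c" "five a b k i c" "five a b i k c" "five k c i a b" "five i c k a b" "five a c k i b" "five a c i k b"
    using f by (auto simp: five_def)
  have expand: "\<Omega> a {i, k} =
    (s i {a, i} {b, c} a i + s i {a, b} {c, i} a b + s i {a, c} {b, i} a c + s k {a, k} {b, c} a k + s k {a, b} {c, k} a b + s k {a, c} {b, k} a c) +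
    (s a {a, i} {b, c} a i + s a {b, i} {a, c} b i + s a {c, i} {a, b} c i) +
    (s a {a, k} {b, c} a k + s a {b, k} {a, c} b k + s a {c, k} {a, b} c k) +
    (s a {a, k} {c, k} a b + s a {c, k} {a, k} b c + s a {a, i} {c, i} a b + s a {c, i} {a, i} b c + s b {a, b} {a, c} b b + s b {a, c} {a, b} b c + s i {a, i} {a, c} b i + s i {a, c} {a, i} b c + s k {a, k} {a, c} b k + s k {a, c} {a, k} b c) +
    (s a {a, k} {b, k} a c + s a {b, k} {a, k} b c + s a {a, i} {b, i} a c + s a {b, i} {a, i} b c + s c {a, b} {a, c} b c + s c {a, c} {a, b} c c + s i {a, i} {a, b} c i + s i {a, b} {a, i} b c + s k {a, k} {a, b} c k + s k {a, b} {a, k} b c)"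
    unfolding \<Omega>_def
    by (simp only: five_V[OF f]) (simp add: D ZZ_mem ZZ_eq ZZ_out AA_five[OF pa(1)] AA_five[OF pa(2)] AA_five[OF pa(3)] AA_five[OF pa(4)] BB_five[OF pa(5)] BB_five[OF pa(6)] BB_five[OF pa(7)] BB_five[OF pa(8)] BB_five[OF pa(9)] BB_five[OF pa(10)] BB_five[OF pa(11)] BB_five[OF pa(12)] BB_five[OF pa(13)] ac_simps insert_commute sym)
  have p: "five i a b k c" "five i a c k b" "five k a b i c" "five k a c i b" "five a b c i k" "five i b c a k" "five k b c a i" "five b a i k c" "five c a i k b" "five a i k b c" "five a c i k b" "five a b i k c"
    using f by (auto simp: five_def)
  have q: "{a, i} \<in> P2 V" "{i, c} \<in> P2 V" "{i, b} \<in> P2 V" "{a, k} \<in> P2 V" "{k, c} \<in> P2 V" "{k, b} \<in> P2 V" "{a, b} \<in> P2 V" "{a, c} \<in> P2 V"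
    using D by (auto simp: P2_iff)
  show ?thesis
    unfolding expand
    using add_zeros[OF G0[OF p(1) q(1) D(4) D(5)]
      add_zeros[OF G0[OF p(1) q(2) D(1) D(4)]
      add_zeros[OF G0[OF p(2) q(1) D(4) D(5)]
      add_zeros[OF G0[OF p(2) q(3) D(1) D(5)]
      add_zeros[OF G0[OF p(3) q(4) D(4) D(5)]
      add_zeros[OF G0[OF p(3) q(5) D(1) D(4)]
      add_zeros[OF G0[OF p(4) q(4) D(4) D(5)]
      add_zeros[OF G0[OF p(4) q(6) D(1) D(5)]
      add_zeros[OF G0[OF p(5) q(7) D(4) D(5)]
      add_zeros[OF G0[OF p(5) q(8) D(4) D(5)]
      add_zeros[OF T3[OF p(1) D(2) q(1) D(5)]
      add_zeros[OF T3[OF p(2) D(2) q(1) D(4)]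
      add_zeros[OF T3[OF p(6) D(2) q(1) D(1)]
      add_zeros[OF T3[OF p(3) D(3) q(4) D(5)]
      add_zeros[OF T3[OF p(4) D(3) q(4) D(4)]
      add_zeros[OF T3[OF p(7) D(3) q(4) D(1)]
      add_zeros[OF T3[OF p(6) D(1) q(1) D(1)]
      add_zeros[OF T3[OF p(2) D(1) q(3) D(4)]
      add_zeros[OF T3[OF p(1) D(1) q(2) D(5)]
      add_zeros[OF T3[OF p(7) D(1) q(4) D(1)]
      add_zeros[OF T3[OF p(4) D(1) q(6) D(4)]
      add_zeros[OF T3[OF p(3) D(1) q(5) D(5)]
      add_zeros[OF T3[OF p(5) D(4) q(7) D(4)]
      add_zeros[OF T3[OF p(5) D(5) q(8) D(5)]
      add_zeros[OF G1[OF p(8) D(1) D(4) D(5)]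
      add_zeros[OF G1[OF p(9) D(1) D(4) D(5)]
      add_zeros[OF G1'[OF p(10) D(4) D(4) D(5)]
      add_zeros[OF G1[OF p(11) D(4) D(1) D(4)]
      add_zeros[OF G1'[OF p(10) D(5) D(4) D(5)]
      G1[OF p(12) D(5) D(1) D(5)]]]]]]]]]]]]]]]]]]]]]]]]]]]]]]
    by (simp add: ac_simps insert_commute sym)
qed

lemma \<Omega>_zero:
  assumes "i \<in> V" "P \<in> P2 V"
  shows "\<Omega> i P = 0"
proof -
  obtain j k l m n where f: "five j k l m n" and P: "P = {j, k}"
    using assms(2) by (rule P2_V_cases)
  note D = fiveD[OF f]
  show ?thesis
  proof (cases "i \<in> P")
    case True
    have "\<Omega> j {j, k} = 0" "\<Omega> k {k, j} = 0"
      by (rule \<Omega>_in[OF f], rule \<Omega>_in[OF five_swap(1)[OF f]])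
    with P True show ?thesis by (auto simp: insert_commute)
  next
    case False
    then obtain a b where "five i j k a b"
      using V_three[of i j k] assms(1) D P by auto
    then show ?thesis unfolding P by (rule \<Omega>_out)
  qed
qed

text \<open>The value that \<open>Z i P l\<close>, the functional on the third layer
  \<open>V - {l}\<close>, will take on the square of the variable \<open>x\<close> (see
  \<open>Z_square\<close>).\<close>

definition z :: "nat \<Rightarrow> nat set \<Rightarrow> nat \<Rightarrow> nat \<Rightarrow> bit"
  where "z i P l x = ZZ (\<lambda>i P T y. s i P T y x) i P l"

lemma z_mem: "five l n a b c \<Longrightarrow>
    z i {l, n} l x = s i {l, a} {b, c} a x + s i {l, b} {a, c} b x + s i {l, c} {a, b} c x"
  by (simp add: z_def ZZ_mem AA_five fiveD)

lemma z_B: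
  assumes "five j m n a b" "i \<in> V" "x \<in> V"
  shows "z i {j, m} n x + z i {j, n} m x + (s i {j, a} {j, b} a x + s i {j, b} {j, a} b x) = 0"
  using two_relations.ZZ_B[OF two[OF assms(3)] assms(1,2)] by (simp add: z_def BB_five[OF assms(1)])

lemma z_G0:
  assumes "five i j k l m" "a \<in> V" "x \<in> V"
  shows "z i {j, k} a x + z j {i, k} a x + z k {i, j} a x = 0"
  using two_relations.ZZ_G0[OF two[OF assms(3)] assms(1,2)] by (simp add: z_def)

lemma z_\<Omega>:
  assumes f: "five a b c d e" and "i \<in> V" "P \<in> P2 V"
  shows "z i P a a + z i P b b + z i P c c + z i P d d + z i P e e = 0"
  using \<Omega>_zero[OF assms(2,3)] by (simp add: \<Omega>_def z_def five_V[OF f] fiveD[OF f] add.assoc)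

text \<open>In \<open>z_\<Omega>\<close> for the pair \<open>{j, e}\<close>, \<open>z_B\<close>
  trades each term \<open>z i {j, e} a a\<close> for \<open>z i {j, a} e a\<close>. The word values
  produced by this and by \<open>z_mem\<close> cancel by \<open>T3\<close>.\<close>

lemma z_\<Omega>':
  assumes f: "five j e a b c" and i: "i \<in> V"
  shows "z i {j, e} e e + z i {j, a} e a + z i {j, b} e b + z i {j, c} e c = 0"
proof -
  note D = fiveD[OF f]
  have p: "five j a e b c" "five j b e a c" "five j c e a b" "five j b c a e" "five j a c b e" "five j a b c e"
    using f by (auto simp: five_def)
  have q: "{j, e} \<in> P2 V" "{j, a} \<in> P2 V" "{j, b} \<in> P2 V" "{j, c} \<in> P2 V"
    using D by (auto simp: P2_iff)
  have j: "z i {j, e} j j + (s i {j, a} {b, c} a j + s i {j, b} {a, c} b j + s i {j, c} {a, b} c j) = 0"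
    by (simp add: z_mem[OF f])
  show ?thesis
    using add_zeros[OF z_\<Omega>[OF f i q(1)] add_zeros[OF j
      add_zeros[OF z_B[OF p(1) i D(3)] add_zeros[OF z_B[OF p(2) i D(4)] add_zeros[OF z_B[OF p(3) i D(5)]
      add_zeros[OF T3[OF p(4) i q(2) D(3)] add_zeros[OF T3[OF p(5) i q(3) D(4)] T3[OF p(6) i q(4) D(5)]]]]]]]]
    by (simp add: ac_simps insert_commute sym)
qed

lemma z_diag:
  assumes f: "five j a b c d"
  shows "z i {j, a} a a + z i {j, b} b b + z i {j, c} c c + z i {j, d} d d = 0"
proof -
  have p: "five a j b c d" "five b j a c d" "five c j a b d" "five d j a b c"
    using f by (auto simp: five_def)
  show ?thesis
    using z_mem[OF p(1), of i a] z_mem[OF p(2), of i b] z_mem[OF p(3), of i c] z_mem[OF p(4), of i d]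
    by (simp add: ac_simps insert_commute sym)
qed

end

subsection \<open>Extending word functions to all products of three variables\<close>

text \<open>
  In \<open>s i P T x y\<close>, the letter \<open>i\<close> is omitted in the first factor and the pair \<open>P\<close> in the second
  one, while \<open>T\<close> is the third factor: the word is the product over the five binary layers.
  The values \<open>Y\<close> on a product of three different variables in place of \<open>x y\<^sup>2\<close> are
  forced by the layers to the left.
\<close>

context three_relations
begin

definition Y :: "nat \<Rightarrow> nat set \<Rightarrow> nat set \<Rightarrow> nat set \<Rightarrow> bit"
  where "Y i P T U = (\<Sum>a\<in>T \<inter> U. s i P (U - {a}) (Min T) (Max T)) +
    (if card (T \<inter> U) = 1 then z i P (the_elem (V - T - U)) (the_elem (T \<inter> U))
     else if T \<inter> U = {} then \<Sum>a\<in>T. z i P a a else 0)"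

lemma MinMax: "a \<noteq> b \<Longrightarrow> s i P Q (Min {a, b}) (Max {a, b}) = s i P Q a b"
  by (cases "a < b") (auto simp: min_def max_def sym)

lemma Y_sub:
  assumes "distinct [p, q, r]"
  shows "Y i P {p, q} {p, q, r} = s i P {q, r} p q + s i P {p, r} p q"
proof -
  have "{p, q} \<inter> {p, q, r} = {p, q}" by auto
  then show ?thesis using assms MinMax[of p q] by (simp add: Y_def insert_Diff_if)
qed

lemma Y_one:
  assumes "five p a b q e"
  shows "Y i P {p, a} {p, b, q} = s i P {b, q} p a + z i P e p"
proof -
  note D = fiveD[OF assms]
  have "{p, a} \<inter> {p, b, q} = {p}" "V - {p, a} - {p, b, q} = {e}" using D by (auto simp: five_V[OF assms])
  then show ?thesis using D MinMax[of p a] by (simp add: Y_def insert_Diff_if)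
qed

lemma Y_none:
  assumes "five a b c d e"
  shows "Y i P {a, b} {c, d, e} = z i P a a + z i P b b"
proof -
  have "{a, b} \<inter> {c, d, e} = {}" using fiveD[OF assms] by auto
  then show ?thesis using fiveD[OF assms] by (simp add: Y_def)
qed

text \<open>The value on the product of the variables \<open>p\<close>, \<open>q\<close>,
  \<open>r\<close>. If a letter is repeated, the product is a variable times a square and the value
  is a word value; by \<open>sym\<close> the order of the cases does not matter.\<close>

definition cv :: "nat \<Rightarrow> nat set \<Rightarrow> nat set \<Rightarrow> nat \<Rightarrow> nat \<Rightarrow> nat \<Rightarrow> bit"
  where "cv i P T p q r = (if p = q then s i P T p r else if p = r then s i P T p q
    else if q = r then s i P T q p else Y i P T {p, q, r})"

lemma cv_rep: "cv i P T p p r = s i P T p r" "cv i P T p r p = s i P T p r" "cv i P T r p p = s i P T p r"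
  by (simp_all add: cv_def sym)

lemma cv_dist: "distinct [p, q, r] \<Longrightarrow> cv i P T p q r = Y i P T {p, q, r}"
  by (simp add: cv_def)

lemma cv_swap: "cv i P T p q r = cv i P T q p r" "cv i P T p q r = cv i P T p r q"
  by (auto simp: cv_def insert_commute sym)

lemma Y_G0:
  assumes f: "five i j k l m" and T: "T \<in> P2 V" and U: "U \<subseteq> V" "card U = 3"
  shows "Y i {j, k} T U + Y j {i, k} T U + Y k {i, j} T U = 0"
proof -
  have T': "finite T" "T \<noteq> {}" "T \<subseteq> V" "card T = 2" and fU: "finite U"
    using T U by (auto simp: P2_def card_ge_0_finite)
  then have MM: "Min T \<in> V" "Max T \<in> V"
    using Min_in[of T] Max_in[of T] by blast+
  have "(\<Sum>a\<in>T \<inter> U. s i {j, k} (U - {a}) (Min T) (Max T)) +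
      (\<Sum>a\<in>T \<inter> U. s j {i, k} (U - {a}) (Min T) (Max T)) +
      (\<Sum>a\<in>T \<inter> U. s k {i, j} (U - {a}) (Min T) (Max T)) = 0"
    unfolding sum.distrib[symmetric]
    using U fU by (intro sum.neutral ballI G0[OF f _ MM]) (auto simp: P2_def)
  moreover have "z i {j, k} (the_elem (V - T - U)) (the_elem (T \<inter> U)) +
      z j {i, k} (the_elem (V - T - U)) (the_elem (T \<inter> U)) +
      z k {i, j} (the_elem (V - T - U)) (the_elem (T \<inter> U)) = 0" if c: "card (T \<inter> U) = 1"
  proof -
    have "card (T \<union> U) = 4"
      using card_Un_Int[of T U] T' U fU c by simp
    then have "card (V - (T \<union> U)) = 1"
      using T' U fU by (subst card_Diff_subset) (auto simp: card_V)
    then obtain e where e: "V - T - U = {e}" by (auto simp: card_1_singleton_iff Diff_Un Diff_Int_distrib set_diff_eq)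
    obtain p where p: "T \<inter> U = {p}" using c by (auto simp: card_1_singleton_iff)
    have "e \<in> V" "p \<in> V" using e p T' by auto
    then show ?thesis unfolding e p by (simp add: z_G0[OF f])
  qed
  moreover have "(\<Sum>a\<in>T. z i {j, k} a a) + (\<Sum>a\<in>T. z j {i, k} a a) + (\<Sum>a\<in>T. z k {i, j} a a) = 0"
    unfolding sum.distrib[symmetric]
    using T' by (intro sum.neutral ballI z_G0[OF f]) auto
  ultimately show ?thesis
    unfolding Y_def by (auto simp: ac_simps)
qed

lemma cv_G0:
  assumes f: "five i j k l m" and T: "T \<in> P2 V" and V: "x \<in> V" "q \<in> V" "r \<in> V"
  shows "cv i {j, k} T x q r + cv j {i, k} T x q r + cv k {i, j} T x q r = 0"
proof (cases "distinct [x, q, r]")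
  case True
  then show ?thesis
    using Y_G0[OF f T, of "{x, q, r}"] V by (simp add: cv_def)
next
  case False
  then show ?thesis
    using G0[OF f T] V by (auto simp: cv_def)
qed

lemma cv_T3:
  assumes f: "five a b c d e" and i: "i \<in> V" and P: "P \<in> P2 V" and V: "q \<in> V" "r \<in> V"
  shows "cv i P {b, c} a q r + cv i P {a, c} b q r + cv i P {a, b} c q r = 0"
proof -
  have both: "cv i P {b, c} a a b + cv i P {a, c} b a b + cv i P {a, b} c a b = 0" if "five a b c d e" for a b c d e
    using fiveD[OF that] Y_sub[of a b c i P] by (simp add: cv_rep cv_dist insert_commute ac_simps sym)
  have one: "cv i P {b, c} a a d + cv i P {a, c} b a d + cv i P {a, b} c a d = 0" if f: "five a b c d e" for a b c d e
  proof -
    note D = fiveD[OF f]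
    have p: "five a c b d e" "five a b c d e" "five b c d a e"
      using f by (auto simp: five_def)
    show ?thesis
      using D T3[OF p(3) i P D(1)] Y_one[OF p(1), of i P] Y_one[OF p(2), of i P]
      by (simp add: cv_rep cv_dist insert_commute ac_simps sym)
  qed
  have none: "cv i P {b, c} a d e + cv i P {a, c} b d e + cv i P {a, b} c d e = 0" if f: "five a b c d e" for a b c d e
  proof -
    have p: "five b c a d e" "five a c b d e" "five a b c d e"
      using f by (auto simp: five_def)
    show ?thesis
      using fiveD[OF f] Y_none[OF p(1), of i P] Y_none[OF p(2), of i P] Y_none[OF p(3), of i P]
      by (simp add: cv_dist ac_simps)
  qed
  show ?thesis
  proof (cases "q = r")
    case True
    then show ?thesis using T3[OF f i P V(1)] by (simp add: cv_rep sym)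
  next
    case False
    have p: "five a b c d e" "five a c b d e" "five b c a d e" "five a b c e d" "five b a c d e" "five b a c e d"
      "five c a b d e" "five c a b e d"
      using f by (auto simp: five_def)
    note eqs = both[OF p(1)] both[OF p(2)] both[OF p(3)] one[OF p(1)] one[OF p(4)] one[OF p(5)] one[OF p(6)]
      one[OF p(7)] one[OF p(8)] none[OF p(1)]
    have sw: "cv i P T x q r = cv i P T x r q" for T x q r by (rule cv_swap)
    from V have "q = a \<or> q = b \<or> q = c \<or> q = d \<or> q = e" "r = a \<or> r = b \<or> r = c \<or> r = d \<or> r = e"
      by (auto simp: five_V[OF f])
    then show ?thesis
      using False eqs by (elim disjE) (simp_all add: sw insert_commute ac_simps)
  qed
qed

lemma s_L:
  assumes "five j a b c d" "T \<in> P2 V" "i \<in> V" "x \<in> V"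
  shows "s i {j, a} T a x + s i {j, b} T b x + s i {j, c} T c x + s i {j, d} T d x = 0"
  using L[OF _ assms(2-4), of j] by (simp add: five_V[OF assms(1)] insert_Diff_if fiveD[OF assms(1)] add.assoc)

text \<open>Up to permuting \<open>a\<close>, \<open>b\<close>, \<open>c\<close>, the set
  \<open>U\<close> contains both \<open>j\<close> and \<open>l\<close>, only \<open>l\<close>, only
  \<open>j\<close>, or neither. The case of \<open>j\<close> alone rests on
  \<open>z_\<Omega>'\<close> and thus on the vanishing of \<Omega>.\<close>

lemma Y_G1:
  assumes f: "five j l a b c" and i: "i \<in> V" and U: "U \<subseteq> V" "card U = 3"
  shows "Y i {j, a} {a, l} U + Y i {j, b} {b, l} U + Y i {j, c} {c, l} U = 0"
proof -
  have lj: "Y i {j, a} {a, l} {j, l, a} + Y i {j, b} {b, l} {j, l, a} + Y i {j, c} {c, l} {j, l, a} = 0"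
    if f: "five j l a b c" for a b c
  proof -
    note D = fiveD[OF f]
    have p: "five l b j a c" "five l c j a b" "five j l a b c" "five j b c a l"
      using f by (auto simp: five_def)
    have T: "{j, a} \<in> P2 V" using D by (auto simp: P2_iff)
    show ?thesis
      using D Y_sub[of l a j i "{j, a}"] Y_one[OF p(1), of i "{j, b}"] Y_one[OF p(2), of i "{j, c}"]
        add_zeros[OF s_L[OF p(3) T i D(2)] z_B[OF p(4) i D(2)]]
      by (simp add: insert_commute ac_simps sym)
  qed
  have l: "Y i {j, a} {a, l} {l, a, b} + Y i {j, b} {b, l} {l, a, b} + Y i {j, c} {c, l} {l, a, b} = 0"
    if f: "five j l a b c" for a b c
  proof -
    note D = fiveD[OF f]
    have p: "five l c a b j" "five j l a b c" "five j c l a b"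
      using f by (auto simp: five_def)
    have T: "{a, b} \<in> P2 V" using D by (auto simp: P2_iff)
    show ?thesis
      using D Y_sub[of l a b i "{j, a}"] Y_sub[of l b a i "{j, b}"] Y_one[OF p(1), of i "{j, c}"]
        s_L[OF p(2) T i D(2)] z_mem[OF p(3), of i l]
      by (simp add: insert_commute ac_simps sym)
  qed
  have j: "Y i {j, a} {a, l} {j, a, b} + Y i {j, b} {b, l} {j, a, b} + Y i {j, c} {c, l} {j, a, b} = 0"
    if f: "five j l a b c" for a b c
  proof -
    note D = fiveD[OF f]
    have p: "five a l j b c" "five b l j a c" "five c l j a b" "five j c l a b" "five j l c a b"
      using f by (auto simp: five_def)
    show ?thesis
      using D Y_one[OF p(1), of i "{j, a}"] Y_one[OF p(2), of i "{j, b}"] Y_none[OF p(3), of i "{j, c}"]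
        add_zeros[OF z_\<Omega>'[OF p(4) i] z_B[OF p(5) i D(2)]]
      by (simp add: insert_commute ac_simps sym)
  qed
  have n: "Y i {j, a} {a, l} {a, b, c} + Y i {j, b} {b, l} {a, b, c} + Y i {j, c} {c, l} {a, b, c} = 0"
  proof -
    note D = fiveD[OF f]
    have p: "five a l b c j" "five b l a c j" "five c l a b j" "five j a l b c" "five j b l a c" "five j c l a b"
      "five l b c a j" "five l a c b j" "five l a b c j" "five a b c l j"
      using f by (auto simp: five_def)
    have q: "{j, a} \<in> P2 V" "{j, b} \<in> P2 V" "{j, c} \<in> P2 V" "{j, l} \<in> P2 V"
      using D by (auto simp: P2_iff)
    show ?thesis
      using D Y_one[OF p(1), of i "{j, a}"] Y_one[OF p(2), of i "{j, b}"] Y_one[OF p(3), of i "{j, c}"]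
        z_mem[OF p(4), of i a] z_mem[OF p(5), of i b] z_mem[OF p(6), of i c]
        add_zeros[OF T3[OF p(7) i q(1) D(3)] add_zeros[OF T3[OF p(8) i q(2) D(4)]
          add_zeros[OF T3[OF p(9) i q(3) D(5)] T3[OF p(10) i q(4) D(2)]]]]
      by (simp add: insert_commute ac_simps sym)
  qed
  have p: "five j l a b c" "five j l b c a" "five j l a c b" "five j l b a c" "five j l c a b" "five j l c b a"
    using f by (auto simp: five_def)
  note D = fiveD[OF f]
  have "\<exists>x y. V - U = {x, y}"
  proof -
    have "card (V - U) = 2" using U by (subst card_Diff_subset) (auto simp: card_V finite_subset)
    then show ?thesis by (auto simp: card_2_iff)
  qed
  then obtain x y where "V - U = {x, y}" by blast
  then have UV: "U = V - {x, y}" and "x \<in> V" "y \<in> V" using U by auto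
  then have "x = j \<or> x = l \<or> x = a \<or> x = b \<or> x = c" "y = j \<or> y = l \<or> y = a \<or> y = b \<or> y = c"
    by (auto simp: five_V[OF f])
  moreover have "x \<noteq> y"
    using UV U \<open>x \<in> V\<close> by (auto simp: card_Diff_singleton card_V)
  ultimately show ?thesis
    using D lj[OF p(1)] lj[OF p(4)] lj[OF p(5)] l[OF p(1)] l[OF p(2)] l[OF p(3)] j[OF p(1)] j[OF p(2)] j[OF p(3)] n
    unfolding UV five_V[OF f]
    by (elim disjE) (simp_all add: insert_Diff_if insert_commute ac_simps)
qed

lemma Y_G1':
  assumes f: "five j a b c d" and i: "i \<in> V" and U: "U \<subseteq> V" "card U = 3"
  shows "Y i {j, a} {j, a} U + Y i {j, b} {j, b} U + Y i {j, c} {j, c} U + Y i {j, d} {j, d} U = 0"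
proof -
  have j: "Y i {j, a} {j, a} {j, a, b} + Y i {j, b} {j, b} {j, a, b} + Y i {j, c} {j, c} {j, a, b} + Y i {j, d} {j, d} {j, a, b} = 0"
    if f: "five j a b c d" for a b c d
  proof -
    note D = fiveD[OF f]
    have p: "five j c a b d" "five j d a b c" "five j c d a b" "five j a b c d"
      using f by (auto simp: five_def)
    have T: "{a, b} \<in> P2 V" using D by (auto simp: P2_iff)
    show ?thesis
      using D Y_sub[of j a b i "{j, a}"] Y_sub[of j b a i "{j, b}"] Y_one[OF p(1), of i "{j, c}"] Y_one[OF p(2), of i "{j, d}"]
        add_zeros[OF s_L[OF p(4) T i D(1)] z_B[OF p(3) i D(1)]]
      by (simp add: insert_commute ac_simps sym)
  qed
  have n: "Y i {j, a} {j, a} {a, b, c} + Y i {j, b} {j, b} {a, b, c} + Y i {j, c} {j, c} {a, b, c} + Y i {j, d} {j, d} {a, b, c} = 0"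
    if f: "five j a b c d" for a b c d
  proof -
    note D = fiveD[OF f]
    have p: "five a j b c d" "five b j a c d" "five c j a b d" "five j d a b c"
      using f by (auto simp: five_def)
    show ?thesis
      using D Y_one[OF p(1), of i "{j, a}"] Y_one[OF p(2), of i "{j, b}"] Y_one[OF p(3), of i "{j, c}"] Y_none[OF p(4), of i "{j, d}"]
        z_\<Omega>'[OF p(4) i] z_mem[OF p(4), of i j]
      by (simp add: insert_commute ac_simps sym)
  qed
  have p: "five j a b c d" "five j a c b d" "five j a d b c" "five j b c a d" "five j b d a c" "five j c d a b"
    "five j b c d a"
    using f by (auto simp: five_def)
  note D = fiveD[OF f]
  have "\<exists>x y. V - U = {x, y}"
  proof -
    have "card (V - U) = 2" using U by (subst card_Diff_subset) (auto simp: card_V finite_subset)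
    then show ?thesis by (auto simp: card_2_iff)
  qed
  then obtain x y where "V - U = {x, y}" by blast
  then have UV: "U = V - {x, y}" and "x \<in> V" "y \<in> V" using U by auto
  then have "x = j \<or> x = a \<or> x = b \<or> x = c \<or> x = d" "y = j \<or> y = a \<or> y = b \<or> y = c \<or> y = d"
    by (auto simp: five_V[OF f])
  moreover have "x \<noteq> y"
    using UV U \<open>x \<in> V\<close> by (auto simp: card_Diff_singleton card_V)
  moreover have p': "five j a b c d" "five j a b d c" "five j a c d b" "five j b c d a"
    using f by (auto simp: five_def)
  ultimately show ?thesis
    using D j[OF p(1)] j[OF p(2)] j[OF p(3)] j[OF p(4)] j[OF p(5)] j[OF p(6)] n[OF p'(1)] n[OF p'(2)] n[OF p'(3)] n[OF p'(4)]
    unfolding UV five_V[OF f]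
    by (elim disjE) (simp_all add: insert_Diff_if insert_commute ac_simps)
qed

text \<open>With one variable \<open>r\<close> held fixed, the values on triple products again form
  a word function. Everything derived from \<open>three_relations\<close>, in particular
  \<open>\<Omega>_zero\<close> and \<open>z_diag\<close>, can therefore be reused with an arbitrary
  product of two variables in place of a square.\<close>

lemma cv_three_relations:
  assumes r: "r \<in> V"
  shows "three_relations (\<lambda>i P T x y. cv i P T x y r)"
proof (rule three_relations.intro)
  fix y :: nat assume y: "y \<in> V"
  show "two_relations (\<lambda>i P T x. cv i P T x y r)"
  proof (rule two_relations.intro)
    fix i j l a b c x assume f: "five j l a b c" and V: "i \<in> V" "x \<in> V"
    show "cv i {j, a} {a, l} x y r + cv i {j, b} {b, l} x y r + cv i {j, c} {c, l} x y r = 0"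
    proof (cases "distinct [x, y, r]")
      case True
      then show ?thesis using Y_G1[OF f V(1), of "{x, y, r}"] V y r by (simp add: cv_def)
    next
      case False
      then show ?thesis using G1[OF f V(1)] V y r by (auto simp: cv_def)
    qed
  next
    fix i j a b c d x assume f: "five j a b c d" and V: "i \<in> V" "x \<in> V"
    show "cv i {j, a} {j, a} x y r + cv i {j, b} {j, b} x y r + cv i {j, c} {j, c} x y r + cv i {j, d} {j, d} x y r = 0"
    proof (cases "distinct [x, y, r]")
      case True
      then show ?thesis using Y_G1'[OF f V(1), of "{x, y, r}"] V y r by (simp add: cv_def)
    next
      case False
      then show ?thesis using G1'[OF f V(1)] V y r by (auto simp: cv_def)
    qed
  qed (use y r in \<open>simp add: cv_G0\<close>)
next
  show "cv i P T x y r = cv i P T y x r" for i P T x y by (rule cv_swap)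
qed (use r in \<open>simp add: cv_T3\<close>)

text \<open>This is what invariance on the four-letter layer \<open>V - {l}\<close> requires at a
  single variable (see \<open>Z_St\<close>). The case of the variable \<open>l\<close> itself uses
  \<open>z_\<Omega>\<close>.\<close>

lemma z_square:
  assumes f: "five l a b c d" and P: "P \<in> P2 V" and i: "i \<in> V"
  shows "cv i P {c, d} a b a + cv i P {b, d} a c a + cv i P {b, c} a d a +
    cv i P {a, d} b c a + cv i P {a, c} b d a + cv i P {a, b} c d a = z i P l a"
    and "cv i P {c, d} a b l + cv i P {b, d} a c l + cv i P {b, c} a d l +
    cv i P {a, d} b c l + cv i P {a, c} b d l + cv i P {a, b} c d l = z i P l l"
proof -
  note D = fiveD[OF f]
  have p: "five a d b c l" "five a c b d l" "five a b c d l"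
    "five c d a b l" "five b d a c l" "five b c a d l" "five a d b c l" "five a c b d l" "five a b c d l"
    using f by (auto simp: five_def)
  show "cv i P {c, d} a b a + cv i P {b, d} a c a + cv i P {b, c} a d a +
    cv i P {a, d} b c a + cv i P {a, c} b d a + cv i P {a, b} c d a = z i P l a"
    using D Y_one[OF p(1), of i P] Y_one[OF p(2), of i P] Y_one[OF p(3), of i P]
    by (simp add: cv_rep cv_dist insert_commute ac_simps sym)
  have "cv i P {c, d} a b l + cv i P {b, d} a c l + cv i P {b, c} a d l +
    cv i P {a, d} b c l + cv i P {a, c} b d l + cv i P {a, b} c d l + z i P l l = 0"
    using D Y_none[OF p(4), of i P] Y_none[OF p(5), of i P] Y_none[OF p(6), of i P] Y_none[OF p(7), of i P]
      Y_none[OF p(8), of i P] Y_none[OF p(9), of i P] z_\<Omega>[OF f i P]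
    by (simp add: cv_dist insert_commute ac_simps)
  then show "cv i P {c, d} a b l + cv i P {b, d} a c l + cv i P {b, c} a d l +
    cv i P {a, d} b c l + cv i P {a, c} b d l + cv i P {a, b} c d l = z i P l l"
    by (simp only: bit_add_eq_0)
qed

text \<open>All ten complementary pairs; every \<open>z i P a a\<close> occurs four times.\<close>

lemma Y_total:
  assumes f: "five a b c d e"
  shows "Y i P {a, b} {c, d, e} + Y i P {a, c} {b, d, e} + Y i P {a, d} {b, c, e} + Y i P {a, e} {b, c, d} +
    Y i P {b, c} {a, d, e} + Y i P {b, d} {a, c, e} + Y i P {b, e} {a, c, d} + Y i P {c, d} {a, b, e} +
    Y i P {c, e} {a, b, d} + Y i P {d, e} {a, b, c} = 0"
proof -
  have p: "five a b c d e" "five a c b d e" "five a d b c e" "five a e b c d" "five b c a d e" "five b d a c e"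
    "five b e a c d" "five c d a b e" "five c e a b d" "five d e a b c"
    using f by (auto simp: five_def)
  show ?thesis
    by (simp add: p[THEN Y_none] ac_simps)
qed

end

subsection \<open>Functionals of low degree\<close>

lemma V_eq: "{1..5} = V" "{Suc 0..5} = V"
  by (simp_all add: V_def)

lemma monom_deg_eq_0: "monom_deg m = 0 \<longleftrightarrow> m = 0"
  by (induction m rule: mono_induct) (auto simp: monom_deg_add dest: arg_cong[of _ _ monom_deg])

lemma funcs_plus: "\<phi> \<in> funcs t n \<Longrightarrow> \<psi> \<in> funcs t n \<Longrightarrow> (\<lambda>f. \<phi> f + \<psi> f) \<in> funcs t n"
  by (simp add: funcs_def additive_plus)

lemma funcs_sum: "(\<And>x. x \<in> A \<Longrightarrow> \<phi> x \<in> funcs t n) \<Longrightarrow> (\<lambda>f. \<Sum>x\<in>A. \<phi> x f) \<in> funcs t n"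
  by (simp add: funcs_def additive_sum)

lemma funcs_null [simp]: "(\<lambda>f. 0) \<in> funcs t n"
  by (simp add: funcs_def)

lemma funcs_zeroI:
  assumes "\<phi> \<in> funcs t n" "\<And>m. m \<in> mons t n \<Longrightarrow> \<phi> (mono m) = 0"
  shows "\<phi> f = 0"
  using funcs_eqI[OF assms(1) funcs_null assms(2)] by simp

lemma mons_0: "mons t 0 = {0}"
  by (auto simp: mons_def monom_deg_eq_0)

lemma mons_Suc:
  assumes "m \<in> mons t (Suc n)"
  obtains j m' where "j \<in> {1..t}" "m' \<in> mons t n" "mono m = X j * mono m'"
  using assms
proof (induction m rule: mono_induct)
  case zero
  then show ?case by (simp add: mons_def)
next
  case (add j m)
  then have "j \<in> {1..t}" "m \<in> mons t n"
    by (auto simp: mons_def monom_deg_add in_keys_iff lookup_add subset_iff lookup_single when_def split: if_splits)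
  with add show ?case by (simp add: mono_add X_def)
qed

lemma mons_1:
  assumes "m \<in> mons 5 1"
  obtains a where "a \<in> V" "mono m = X a"
  using assms unfolding One_nat_def by (elim mons_Suc) (simp add: mons_0 V_def)

lemma mons_2:
  assumes "m \<in> mons 5 2"
  obtains a b where "a \<in> V" "b \<in> V" "mono m = X a * X b"
  using assms unfolding numeral_2_eq_2 by (elim mons_Suc) (simp add: mons_0 V_def)

lemma mons_3:
  assumes "m \<in> mons 5 3"
  obtains a b c where "a \<in> V" "b \<in> V" "c \<in> V" "mono m = X a * X b * X c"
  using assms unfolding numeral_3_eq_3 by (elim mons_Suc) (simp add: mons_0 V_def mult.assoc)

lemma mono_St_eq: "St (mono h) = mono h + (St (mono h) + mono h)"
  by (simp add: ac_simps)

lemma X_deg_ge: "X j \<in> deg_ge 1"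
  by (simp add: X_def mono_deg_ge)

lemma xs_deg_ge: "xs J \<in> deg_ge (card J)"
  by (simp add: xs_mono mono_deg_ge deg_indic)

lemma St_deg_ge: "St (mono h) \<in> deg_ge (monom_deg h)"
  by (subst mono_St_eq) (intro deg_ge_add mono_deg_ge order_refl deg_ge_mono[OF St_mono_bot], simp)

lemma xs_St_deg_ge: "xs J * St (mono h) \<in> deg_ge (card J + monom_deg h)"
  by (intro deg_ge_mult xs_deg_ge St_deg_ge)

text \<open>The only monomial of degree below \<open>n\<close> is then the constant 1, which
  \<open>St\<close> fixes; all other monomials acquire only terms of degree above
  \<open>n\<close>.\<close>

lemma funcs_low_St:
  assumes "\<phi> \<in> funcs t n" "n \<le> 1"
  shows "\<phi> (St f) = \<phi> f"
proof -
  have "\<phi> (St (mono h)) = \<phi> (mono h)" for h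
  proof (cases "n \<le> monom_deg h")
    case True
    then have "\<phi> (St (mono h) + mono h) = 0"
      by (intro funcs_deg_ge[OF assms(1)] deg_ge_mono[OF St_mono_bot]) simp
    then show ?thesis by (simp add: funcs_add[OF assms(1)] bit_add_eq_0)
  next
    case False
    with assms(2) have "h = 0" using monom_deg_eq_0[of h] by linarith
    then show ?thesis by simp
  qed
  with additive_eqI[OF additive_comp[OF funcs_additive[OF assms(1)] additive_St] funcs_additive[OF assms(1)]]
  show ?thesis by blast
qed

lemma additive_mult_St: "additive \<phi> \<Longrightarrow> additive (\<lambda>f. \<phi> (q * St f))"
  by (simp add: additive_def distrib_left)

lemma asm_X:
  assumes "\<And>T. additive (\<psi> T)" "finite U"
  shows "asm \<psi> (X i * (xs U * h\<^sup>2)) = (if i \<in> U then \<psi> (U - {i}) (X i * h) else \<psi> (insert i U) h)"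
proof -
  have "X i * (xs U * h\<^sup>2) = (if i \<in> U then xs (U - {i}) * (X i * h)\<^sup>2 else xs (insert i U) * h\<^sup>2)"
    using X_xs[OF assms(2), of i] by (simp add: power_mult_distrib flip: mult.assoc)
  then show ?thesis
    using assms by (simp add: asm_layer)
qed

lemma sum_P2_insert:
  fixes g :: "nat set \<Rightarrow> bit"
  assumes "finite S" "a \<notin> S"
  shows "(\<Sum>P\<in>P2 (insert a S). g P) = (\<Sum>x\<in>S. g {a, x}) + (\<Sum>P\<in>P2 S. g P)"
proof -
  have "P2 (insert a S) = (\<lambda>x. {a, x}) ` S \<union> P2 S"
  proof (intro equalityI subsetI)
    fix P assume "P \<in> P2 (insert a S)"
    then obtain x y where "P = {x, y}" "x \<noteq> y" "x \<in> insert a S" "y \<in> insert a S" by (auto simp: P2_iff)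
    then show "P \<in> (\<lambda>x. {a, x}) ` S \<union> P2 S" by (auto simp: P2_iff insert_commute)
  next
    fix P assume "P \<in> (\<lambda>x. {a, x}) ` S \<union> P2 S"
    then show "P \<in> P2 (insert a S)" using assms(2) by (auto simp: P2_iff)
  qed
  moreover have "(\<lambda>x. {a, x}) ` S \<inter> P2 S = {}" using assms(2) by (auto simp: P2_def)
  moreover have "finite (P2 S)" using assms(1) by (simp add: P2_def)
  moreover have "inj_on (\<lambda>x. {a, x}) S" using assms(2) by (auto simp: inj_on_def doubleton_eq_iff)
  ultimately show ?thesis using assms(1) by (simp add: sum.union_disjoint sum.reindex)
qed

lemma P2_empty [simp]: "P2 {} = {}"
  by (auto simp: P2_iff)

lemma sum_P2_V:
  fixes g :: "nat set \<Rightarrow> bit"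
  assumes "five a b c d e"
  shows "(\<Sum>P\<in>P2 V. g P) = g {a, b} + g {a, c} + g {a, d} + g {a, e} + g {b, c} + g {b, d} + g {b, e}
    + g {c, d} + g {c, e} + g {d, e}"
  unfolding five_V[OF assms] using fiveD[OF assms] by (simp add: sum_P2_insert add.assoc)

lemma sum_P2_four:
  fixes g :: "nat set \<Rightarrow> bit"
  assumes "distinct [a, b, c, d]"
  shows "(\<Sum>P\<in>P2 {a, b, c, d}. g P) = g {a, b} + g {a, c} + g {a, d} + g {b, c} + g {b, d} + g {c, d}"
  using assms by (simp add: sum_P2_insert add.assoc)

lemma sum_Pow_card:
  fixes g :: "nat set \<Rightarrow> bit"
  assumes "finite T" "\<And>J. J \<subseteq> T \<Longrightarrow> card J \<notin> A \<Longrightarrow> g J = 0"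
  shows "(\<Sum>J\<in>Pow T. g J) = (\<Sum>J | J \<subseteq> T \<and> card J \<in> A. g J)"
  using assms by (intro sum.mono_neutral_right) auto

lemma sum_card_1:
  fixes g :: "nat set \<Rightarrow> bit"
  shows "(\<Sum>J | J \<subseteq> T \<and> card J = 1. g J) = (\<Sum>k\<in>T. g {k})"
proof -
  have "{J. J \<subseteq> T \<and> card J = 1} = (\<lambda>k. {k}) ` T"
    by (auto simp: card_1_singleton_iff)
  then show ?thesis by (simp add: sum.reindex)
qed

lemma sum_Pow_0:
  fixes g :: "nat set \<Rightarrow> bit"
  assumes "finite T" "\<And>J. J \<subseteq> T \<Longrightarrow> J \<noteq> {} \<Longrightarrow> g J = 0"
  shows "(\<Sum>J\<in>Pow T. g J) = g {}"
  using assms by (subst sum.mono_neutral_right[of _ "{{}}"]) auto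

lemma sum_Pow_1:
  fixes g :: "nat set \<Rightarrow> bit"
  assumes "finite T" "\<And>J. J \<subseteq> T \<Longrightarrow> card J \<noteq> 1 \<Longrightarrow> g J = 0"
  shows "(\<Sum>J\<in>Pow T. g J) = (\<Sum>k\<in>T. g {k})"
  using sum_Pow_card[where A = "{1}" and g = g, OF assms(1)] assms(2) sum_card_1[of g T] by simp

lemma sum_Pow_02:
  fixes g :: "nat set \<Rightarrow> bit"
  assumes "finite T" "\<And>J. J \<subseteq> T \<Longrightarrow> J \<noteq> {} \<Longrightarrow> card J \<noteq> 2 \<Longrightarrow> g J = 0"
  shows "(\<Sum>J\<in>Pow T. g J) = g {} + (\<Sum>J\<in>P2 T. g J)"
proof -
  have "(\<Sum>J\<in>Pow T. g J) = (\<Sum>J\<in>insert {} (P2 T). g J)"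
    using assms by (intro sum.mono_neutral_right) (auto simp: P2_def)
  also have "\<dots> = g {} + (\<Sum>J\<in>P2 T. g J)"
    using assms(1) by (intro sum.insert) (auto simp: P2_def)
  finally show ?thesis .
qed

subsection \<open>Functionals from word functions\<close>

context three_relations
begin

text \<open>Degree 3 leaves two kinds of layers, 3 = 1 + 2*1 and 3 = 3 + 2*0. The first carries the
  word values, the second the values \<open>Y\<close>.\<close>

definition \<psi>3 :: "nat \<Rightarrow> nat set \<Rightarrow> nat set \<Rightarrow> nat set \<Rightarrow> poly2 \<Rightarrow> bit"
  where "\<psi>3 i P T S =
    (if card S = 1 \<and> S \<subseteq> V
     then lin (\<lambda>m. if m \<in> mons 5 1 then s i P T (the_elem S) (the_elem (Poly_Mapping.keys m)) else 0)
     else if card S = 3 \<and> S \<subseteq> V then lin (\<lambda>m. if m = 0 then Y i P T S else 0) else (\<lambda>f. 0))"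

definition C :: "nat \<Rightarrow> nat set \<Rightarrow> nat set \<Rightarrow> poly2 \<Rightarrow> bit"
  where "C i P T = asm (\<psi>3 i P T)"

lemma additive_\<psi>3 [simp]: "additive (\<psi>3 i P T S)"
  by (simp add: \<psi>3_def)

lemma \<psi>3_X: "p \<in> V \<Longrightarrow> q \<in> V \<Longrightarrow> \<psi>3 i P T {p} (X q) = s i P T p q"
  by (simp add: \<psi>3_def X_def mons_def V_eq)

lemma \<psi>3_one: "card U = 3 \<Longrightarrow> U \<subseteq> V \<Longrightarrow> \<psi>3 i P T U 1 = Y i P T U"
  by (simp add: \<psi>3_def flip: mono_0)

lemma \<psi>3_funcs_1: "card S = 1 \<Longrightarrow> \<psi>3 i P T S \<in> funcs 5 1"
  by (intro funcsI) (auto simp: \<psi>3_def)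

lemma \<psi>3_funcs_3: "card S = 3 \<Longrightarrow> \<psi>3 i P T S \<in> funcs 5 0"
  by (intro funcsI) (auto simp: \<psi>3_def mons_0)

lemma \<psi>3_null: "card S \<noteq> 1 \<Longrightarrow> card S \<noteq> 3 \<Longrightarrow> \<psi>3 i P T S f = 0"
  by (simp add: \<psi>3_def)

lemma \<psi>3_boundary:
  assumes "S \<subseteq> V" "J \<subseteq> S" "J \<noteq> {}" "card S \<noteq> 2"
  shows "\<psi>3 i P T (S - J) (xs J * St (mono h)) = 0"
proof -
  have fin: "finite S" "finite J" using assms finite_subset[of _ V] finite_subset by auto
  then have c: "card (S - J) + card J = card S" "card J \<ge> 1"
    using assms by (auto simp: card_Diff_subset card_mono Suc_le_eq card_gt_0_iff)
  consider "card (S - J) = 1" | "card (S - J) = 3" | "card (S - J) \<noteq> 1" "card (S - J) \<noteq> 3" by auto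
  then show ?thesis
  proof cases
    case 1
    then have "card J \<ge> 2" using c assms by auto
    then show ?thesis
      by (intro funcs_deg_ge[OF \<psi>3_funcs_1[OF 1]] deg_ge_mono[OF xs_St_deg_ge]) simp
  next
    case 2
    then show ?thesis using c
      by (intro funcs_deg_ge[OF \<psi>3_funcs_3[OF 2]] deg_ge_mono[OF xs_St_deg_ge]) simp
  qed (simp add: \<psi>3_null)
qed

text \<open>For layers of size different from two only \<open>J = {}\<close> contributes, by degree.
  On two letters the equation is the symmetry of \<open>s\<close> in its last two arguments.\<close>

lemma C_K: "C i P T \<in> K 5 3"
  unfolding C_def
proof (rule asm_K)
  show "S \<subseteq> {1..5} \<and> Poly_Mapping.keys h \<subseteq> {1..5} \<and> card S + 2 * monom_deg h = 3"
    if "\<psi>3 i P T S (mono h) \<noteq> 0" for S h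
    using that by (auto simp: \<psi>3_def V_eq mons_def split: if_splits)
  fix S :: "nat set" and f assume S: "S \<subseteq> {1..5}"
  then have fin: "finite S" by (auto intro: finite_subset)
  have add: "additive (\<lambda>f. \<Sum>J\<in>Pow S. \<psi>3 i P T (S - J) (xs J * St f))"
    by (intro additive_sum additive_mult_St) simp
  have "(\<Sum>J\<in>Pow S. \<psi>3 i P T (S - J) (xs J * St (mono h))) = \<psi>3 i P T S (mono h)" for h
  proof (cases "card S = 2")
    case False
    have "(\<Sum>J\<in>Pow S. \<psi>3 i P T (S - J) (xs J * St (mono h))) = \<psi>3 i P T S (St (mono h))"
      using fin \<psi>3_boundary[of S _ i P T h] S False by (subst sum_Pow_0) (auto simp: V_eq)
    also have "\<dots> = \<psi>3 i P T S (mono h)"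
      using funcs_low_St[OF \<psi>3_funcs_1] funcs_low_St[OF \<psi>3_funcs_3] \<psi>3_null by (metis le_refl zero_le_one)
    finally show ?thesis .
  next
    case True
    then obtain p q where pq: "S = {p, q}" "p \<noteq> q" by (auto simp: card_2_iff)
    then have V: "p \<in> V" "q \<in> V" using S by (auto simp: V_eq)
    have "(\<Sum>J\<in>Pow S. \<psi>3 i P T (S - J) (xs J * St (mono h))) = (\<Sum>k\<in>S. \<psi>3 i P T (S - {k}) (xs {k} * St (mono h)))"
    proof (rule sum_Pow_1[OF fin])
      fix J assume J: "J \<subseteq> S" "card J \<noteq> 1"
      then have "card (S - J) = 2 - card J" using True fin by (simp add: card_Diff_subset finite_subset)
      then have "card (S - J) \<noteq> 1" "card (S - J) \<noteq> 3" using J by auto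
      then show "\<psi>3 i P T (S - J) (xs J * St (mono h)) = 0" by (rule \<psi>3_null)
    qed
    also have "\<dots> = \<psi>3 i P T {q} (X p * St (mono h)) + \<psi>3 i P T {p} (X q * St (mono h))"
      using pq by (simp add: insert_Diff_if)
    also have "\<dots> = 0"
    proof (cases "h = 0")
      case True
      then show ?thesis using V by (simp add: \<psi>3_X sym)
    next
      case False
      then have "monom_deg h \<ge> 1" using monom_deg_eq_0[of h] by linarith
      then have "\<psi>3 i P T {a} (X b * St (mono h)) = 0" for a b
        by (intro funcs_deg_ge[OF \<psi>3_funcs_1] deg_ge_mono[OF deg_ge_mult[OF X_deg_ge St_deg_ge]]) auto
      then show ?thesis by simp
    qed
    finally show ?thesis using True by (simp add: \<psi>3_null)
  qed
  from additive_eqI[OF add additive_\<psi>3 this]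
  show "(\<Sum>J\<in>Pow S. \<psi>3 i P T (S - J) (xs J * St f)) = \<psi>3 i P T S f" .
qed simp

lemma C_funcs: "C i P T \<in> funcs 5 3"
  using C_K by (rule K_funcs)

lemma C_XXX:
  assumes "p \<in> V" "q \<in> V" "r \<in> V"
  shows "C i P T (X p * X q * X r) = cv i P T p q r"
proof -
  have sq: "C i P T (X r * (X p)\<^sup>2) = s i P T r p" if "p \<in> V" "r \<in> V" for p r
    using asm_layer[of "{r}" "\<psi>3 i P T" "X p"] that by (simp add: C_def \<psi>3_X)
  consider "p = q" | "p = r" | "q = r" | "distinct [p, q, r]" by auto
  then show ?thesis
  proof cases
    case 1
    then have e: "X p * X q * X r = X r * (X p)\<^sup>2" by (simp only: power2_eq_square ac_simps)
    have "C i P T (X p * X q * X r) = s i P T r p"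
      unfolding e by (rule sq) (use assms in auto)
    then show ?thesis using 1 by (simp add: cv_rep sym[of i P T r q])
  next
    case 2
    then have e: "X p * X q * X r = X q * (X p)\<^sup>2" by (simp only: power2_eq_square ac_simps)
    have "C i P T (X p * X q * X r) = s i P T q p"
      unfolding e by (rule sq) (use assms in auto)
    then show ?thesis using 2 by (simp add: cv_rep sym[of i P T q r])
  next
    case 3
    then have e: "X p * X q * X r = X p * (X q)\<^sup>2" by (simp only: power2_eq_square ac_simps)
    have "C i P T (X p * X q * X r) = s i P T p q"
      unfolding e by (rule sq) (use assms in auto)
    then show ?thesis using 3 by (simp add: cv_rep sym[of i P T p r])
  next
    case 4
    then have "X p * X q * X r = xs {p, q, r} * 1\<^sup>2" by (simp add: xs_insert ac_simps)
    then have "C i P T (X p * X q * X r) = \<psi>3 i P T {p, q, r} 1"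
      using asm_layer[of "{p, q, r}" "\<psi>3 i P T" 1] by (simp add: C_def)
    then show ?thesis using 4 assms by (simp add: \<psi>3_one cv_dist)
  qed
qed

lemma C_zeroI:
  assumes "\<phi> \<in> funcs 5 3" "\<And>p q r. p \<in> V \<Longrightarrow> q \<in> V \<Longrightarrow> r \<in> V \<Longrightarrow> \<phi> (X p * X q * X r) = 0"
  shows "\<phi> f = 0"
  using assms(1) by (rule funcs_zeroI) (metis mons_3 assms(2))

lemma zeroI_2:
  assumes "\<phi> \<in> funcs 5 2" "\<And>p q. p \<in> V \<Longrightarrow> q \<in> V \<Longrightarrow> \<phi> (X p * X q) = 0"
  shows "\<phi> f = 0"
  using assms(1) by (rule funcs_zeroI) (metis mons_2 assms(2))

lemma zeroI_1:
  assumes "\<phi> \<in> funcs 5 1" "\<And>p. p \<in> V \<Longrightarrow> \<phi> (X p) = 0"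
  shows "\<phi> f = 0"
  using assms(1) by (rule funcs_zeroI) (metis mons_1 assms(2))

lemma C_X_funcs: "(\<lambda>f. C i P T (X k * f)) \<in> funcs 5 2"
  by (rule funcs_X) (use C_funcs in \<open>simp add: numeral_3_eq_3 numeral_2_eq_2\<close>)

lemma C_G0:
  assumes "five i j k l m" "T \<in> P2 V"
  shows "C i {j, k} T f + C j {i, k} T f + C k {i, j} T f = 0"
proof (rule C_zeroI[where f = f])
  show "(\<lambda>f. C i {j, k} T f + C j {i, k} T f + C k {i, j} T f) \<in> funcs 5 3"
    by (intro funcs_plus C_funcs)
qed (use cv_G0[OF assms] in \<open>simp add: C_XXX\<close>)

lemma C_G1:
  assumes "five j l a b c" "i \<in> V"
  shows "C i {j, a} {a, l} f + C i {j, b} {b, l} f + C i {j, c} {c, l} f = 0"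
proof (rule C_zeroI[where f = f])
  show "(\<lambda>f. C i {j, a} {a, l} f + C i {j, b} {b, l} f + C i {j, c} {c, l} f) \<in> funcs 5 3"
    by (intro funcs_plus C_funcs)
qed (use two_relations.G1[OF three_relations.two[OF cv_three_relations] assms] in \<open>simp add: C_XXX\<close>)

lemma C_G1':
  assumes "five j a b c d" "i \<in> V"
  shows "C i {j, a} {j, a} f + C i {j, b} {j, b} f + C i {j, c} {j, c} f + C i {j, d} {j, d} f = 0"
proof (rule C_zeroI[where f = f])
  show "(\<lambda>f. C i {j, a} {j, a} f + C i {j, b} {j, b} f + C i {j, c} {j, c} f + C i {j, d} {j, d} f) \<in> funcs 5 3"
    by (intro funcs_plus C_funcs)
qed (use two_relations.G1'[OF three_relations.two[OF cv_three_relations] assms] in \<open>simp add: C_XXX\<close>)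

lemma C_two_relations: "two_relations (\<lambda>i P T k. C i P T (X k * f))"
  by (rule two_relations.intro) (rule C_G0 C_G1 C_G1'; assumption)+

lemma C_T3:
  assumes "five a b c d e" "i \<in> V" "P \<in> P2 V"
  shows "C i P {b, c} (X a * f) + C i P {a, c} (X b * f) + C i P {a, b} (X c * f) = 0"
proof (rule zeroI_2[where f = f])
  show "(\<lambda>f. C i P {b, c} (X a * f) + C i P {a, c} (X b * f) + C i P {a, b} (X c * f)) \<in> funcs 5 2"
    by (intro funcs_plus C_X_funcs)
qed (use cv_T3[OF assms] fiveD[OF assms(1)] in \<open>simp add: C_XXX flip: mult.assoc\<close>)

definition Z :: "nat \<Rightarrow> nat set \<Rightarrow> nat \<Rightarrow> poly2 \<Rightarrow> bit"
  where "Z i P l f = ZZ (\<lambda>i P T k. C i P T (X k * f)) i P l"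

lemma ZZ_funcs:
  assumes "\<And>i P T k. (\<lambda>f. S f i P T k) \<in> funcs t n"
  shows "(\<lambda>f. ZZ (S f) i P l) \<in> funcs t n"
proof -
  have "(\<lambda>f. AA (S f) i j n') \<in> funcs t n" "(\<lambda>f. BB (S f) i j m n') \<in> funcs t n" for i j m n'
    unfolding AA_def BB_def by (intro funcs_sum assms)+
  then show ?thesis
    by (cases "l \<in> P"; cases "i = l"; cases "i \<in> P") (simp_all add: ZZ_def funcs_plus funcs_sum)
qed

lemma Z_funcs: "Z i P l \<in> funcs 5 2"
  unfolding Z_def by (rule ZZ_funcs) (rule C_X_funcs)

lemma ZZ_cong:
  assumes "\<And>i P T k. k \<in> V \<Longrightarrow> S i P T k = S' i P T k"
  shows "ZZ S i P l = ZZ S' i P l"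
proof -
  have "AA S = AA S'" "BB S = BB S'"
    by (auto simp: fun_eq_iff AA_def BB_def assms intro!: sum.cong)
  then show ?thesis by (simp add: ZZ_def)
qed

lemma Z_XX:
  assumes "p \<in> V" "q \<in> V"
  shows "Z i P l (X p * X q) = ZZ (\<lambda>i P T k. cv i P T k p q) i P l"
  unfolding Z_def by (rule ZZ_cong) (simp add: C_XXX assms flip: mult.assoc)

lemma Z_square: "a \<in> V \<Longrightarrow> Z i P l (X a * X a) = z i P l a"
  unfolding z_def by (simp only: Z_XX) (rule ZZ_cong, simp add: cv_rep sym[of _ _ _ a])

lemma Z_mem: "five l n a b c \<Longrightarrow>
    Z i {l, n} l f = C i {l, a} {b, c} (X a * f) + C i {l, b} {a, c} (X b * f) + C i {l, c} {a, b} (X c * f)"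
  by (simp add: Z_def ZZ_mem AA_five fiveD)

lemma Z_B:
  assumes "five j m n a b" "i \<in> V"
  shows "Z i {j, m} n f + Z i {j, n} m f + (C i {j, a} {j, b} (X a * f) + C i {j, b} {j, a} (X b * f)) = 0"
  using two_relations.ZZ_B[OF C_two_relations assms] by (simp add: Z_def BB_five[OF assms(1)])

lemma Z_G0:
  assumes "five i j k l m" "a \<in> V"
  shows "Z i {j, k} a f + Z j {i, k} a f + Z k {i, j} a f = 0"
  using two_relations.ZZ_G0[OF C_two_relations assms] by (simp add: Z_def)

text \<open>Both sides have degree one in \<open>f\<close>, so it is enough to test variables
  \<open>f = X r\<close>. There the claim is \<open>z_diag\<close> for the word function with
  \<open>r\<close> held fixed. The next lemma argues in the same way with
  \<open>\<Omega>_zero\<close>.\<close>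

lemma Z_diag:
  assumes f: "five j a b c d" and i: "i \<in> V"
  shows "Z i {j, a} a (X a * f) + Z i {j, b} b (X b * f) + Z i {j, c} c (X c * f) + Z i {j, d} d (X d * f) = 0"
proof -
  have "(\<lambda>f. Z i P l (X k * f)) \<in> funcs 5 1" for i P l k
    by (rule funcs_X) (use Z_funcs in \<open>simp add: numeral_2_eq_2\<close>)
  then have "(\<lambda>f. Z i {j, a} a (X a * f) + Z i {j, b} b (X b * f) + Z i {j, c} c (X c * f) + Z i {j, d} d (X d * f)) \<in> funcs 5 1"
    by (intro funcs_plus)
  then show ?thesis
    by (rule zeroI_1[where f = f]) (use fiveD[OF f] three_relations.z_diag[OF cv_three_relations f, of _ i] in
      \<open>simp add: Z_XX three_relations.z_def[OF cv_three_relations]\<close>)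
qed

lemma Z_\<Omega>:
  assumes i: "i \<in> V" and P: "P \<in> P2 V"
  shows "(\<Sum>l\<in>V. Z i P l (X l * f)) = 0"
proof -
  have "(\<lambda>f. Z i P l (X k * f)) \<in> funcs 5 1" for i P l k
    by (rule funcs_X) (use Z_funcs in \<open>simp add: numeral_2_eq_2\<close>)
  then have "(\<lambda>f. \<Sum>l\<in>V. Z i P l (X l * f)) \<in> funcs 5 1"
    by (intro funcs_sum)
  then show ?thesis
    by (rule zeroI_1[where f = f]) (use three_relations.\<Omega>_zero[OF cv_three_relations i P] in
      \<open>simp add: Z_XX three_relations.\<Omega>_def[OF cv_three_relations]\<close>)
qed

end

lemma five_of_pair:
  assumes "m \<in> V" "n \<in> V" "m \<noteq> n"
  obtains a b c where "five m n a b c" "V - {m, n} = {a, b, c}"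
proof -
  obtain a b c where f: "five m n a b c" using assms V_two by metis
  moreover have "V - {m, n} = {a, b, c}" using fiveD[OF f] by (auto simp: five_V[OF f])
  ultimately show thesis by (rule that)
qed

lemma V_card_cases:
  assumes "U \<subseteq> V"
  obtains "card U \<in> {0, 2, 4}" | w where "w \<in> V" "U = {w}" | m n where "m \<in> V" "n \<in> V" "m \<noteq> n" "U = V - {m, n}" | "U = V"
proof -
  have fin: "finite U" using assms by (rule finite_subset) simp
  have "card U \<le> 5" using card_mono[OF _ assms] by (simp add: card_V)
  then consider "card U \<in> {0, 2, 4}" | "card U = 1" | "card U = 3" | "card U = 5" by force
  then show thesis
  proof cases
    case 2
    then show ?thesis using that(2) assms by (auto simp: card_1_singleton_iff)
  next
    case 3
    then have "card (V - U) = 2" using assms fin by (simp add: card_Diff_subset card_V)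
    then obtain m n where "V - U = {m, n}" "m \<noteq> n" by (auto simp: card_2_iff)
    then show ?thesis using that(3)[of m n] assms by auto
  next
    case 4
    then show ?thesis using that(4) card_subset_eq[OF _ assms] by (simp add: card_V)
  qed (use that in auto)
qed

lemma St_mono_factor: "\<exists>w. St (mono h) = mono h * w"
proof (induction h rule: mono_induct)
  case (add j m)
  then obtain w where "St (mono m) = mono m * w" by blast
  then have "St (mono (Poly_Mapping.single j 1 + m)) = mono (Poly_Mapping.single j 1 + m) * ((1 + X j) * w)"
    using St_X[of j] by (simp add: mono_add algebra_simps power2_eq_square X_def)
  then show ?case by blast
qed simp

lemma funcs_St_out:
  assumes "\<phi> \<in> funcs t n" "\<not> Poly_Mapping.keys h \<subseteq> {1..t}"
  shows "\<phi> (q * St (mono h)) = 0"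
proof -
  obtain w where "St (mono h) = mono h * w" using St_mono_factor by blast
  then have "q * St (mono h) = mono h * (q * w)" by (simp add: ac_simps)
  then show ?thesis by (simp only: funcs_monomult[OF assms])
qed

section \<open>Invariant functionals of degree 8\<close>

context three_relations
begin

lemma z_square_all:
  assumes f: "five l a b c d" and P: "P \<in> P2 V" and i: "i \<in> V" and x: "x \<in> V"
  shows "cv i P {c, d} a b x + cv i P {b, d} a c x + cv i P {b, c} a d x +
    cv i P {a, d} b c x + cv i P {a, c} b d x + cv i P {a, b} c d x = z i P l x"
proof -
  have p: "five l b a c d" "five l c a b d" "five l d a b c"
    using f by (auto simp: five_def)
  have "x = l \<or> x = a \<or> x = b \<or> x = c \<or> x = d" using x by (auto simp: five_V[OF f])
  then show ?thesis
    using z_square[OF f P i] z_square(1)[OF p(1) P i] z_square(1)[OF p(2) P i] z_square(1)[OF p(3) P i]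
    by (elim disjE) (simp_all add: insert_commute cv_swap ac_simps)
qed

definition \<psi>8 :: "nat \<Rightarrow> nat set \<Rightarrow> nat set \<Rightarrow> poly2 \<Rightarrow> bit"
  where "\<psi>8 i P T f = (if T \<subseteq> V \<and> card T = 2 then C i P T f
    else if T \<subseteq> V \<and> card T = 4 then Z i P (the_elem (V - T)) f else 0)"

definition B :: "nat \<Rightarrow> nat set \<Rightarrow> poly2 \<Rightarrow> bit"
  where "B i P = asm (\<psi>8 i P)"

lemma additive_\<psi>8 [simp]: "additive (\<psi>8 i P T)"
proof -
  have "\<psi>8 i P T = (if T \<subseteq> V \<and> card T = 2 then C i P T
    else if T \<subseteq> V \<and> card T = 4 then Z i P (the_elem (V - T)) else (\<lambda>f. 0))"
    by (auto simp: \<psi>8_def fun_eq_iff)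
  then show ?thesis
    using funcs_additive[OF C_funcs] funcs_additive[OF Z_funcs] by simp
qed

lemma \<psi>8_pair: "a \<in> V \<Longrightarrow> b \<in> V \<Longrightarrow> a \<noteq> b \<Longrightarrow> \<psi>8 i P {a, b} f = C i P {a, b} f"
  by (simp add: \<psi>8_def)

lemma \<psi>8_four: "l \<in> V \<Longrightarrow> \<psi>8 i P (V - {l}) f = Z i P l f"
proof -
  assume "l \<in> V"
  then have "V - (V - {l}) = {l}" "card (V - {l}) = 4" by (auto simp: card_V)
  then show ?thesis by (simp add: \<psi>8_def)
qed

lemma \<psi>8_four': "five l a b c d \<Longrightarrow> \<psi>8 i P {a, b, c, d} f = Z i P l f"
proof -
  assume f: "five l a b c d"
  then have "{a, b, c, d} = V - {l}" using fiveD[OF f] by (auto simp: five_V[OF f])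
  then show ?thesis using \<psi>8_four fiveD[OF f] by simp
qed

lemma \<psi>8_null: "\<not> T \<subseteq> V \<or> card T \<notin> {2, 4} \<Longrightarrow> \<psi>8 i P T f = 0"
  by (auto simp: \<psi>8_def)

lemma \<psi>8_C: "T \<subseteq> V \<Longrightarrow> card T = 2 \<Longrightarrow> \<psi>8 i P T f = C i P T f"
  by (simp add: \<psi>8_def)

lemma X_St_low: "\<phi> \<in> funcs 5 3 \<Longrightarrow> 4 \<le> card J + monom_deg h \<Longrightarrow> \<phi> (xs J * St (mono h)) = 0"
  by (erule funcs_deg_ge) (rule deg_ge_mono[OF xs_St_deg_ge], simp)

lemma C_low: "p \<in> deg_lt 3 \<Longrightarrow> C i P T p = 0"
  using C_funcs by (rule funcs_deg_lt)

lemma Z_low: "p \<in> deg_lt 2 \<Longrightarrow> Z i P T p = 0"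
  using Z_funcs by (rule funcs_deg_lt)

lemma Z_high: "p \<in> deg_ge 3 \<Longrightarrow> Z i P T p = 0"
  using funcs_deg_ge[OF Z_funcs] by (simp add: numeral_3_eq_3 numeral_2_eq_2)

lemma C_high: "p \<in> deg_ge 4 \<Longrightarrow> C i P T p = 0"
  by (rule funcs_deg_ge[OF C_funcs]) simp

text \<open>Degrees leave only monomials of degree one to check, where the claim is
  \<open>z_square_all\<close>: for the constant the terms with \<open>C\<close> have too low a
  degree, and in degree at least two they have too high a degree, while \<open>Z\<close> sees only
  the lowest component of \<open>St\<close>.\<close>

lemma Z_St:
  assumes f: "five l a b c d" and P: "P \<in> P2 V" and i: "i \<in> V"
  shows "Z i P l (St g) + (\<Sum>J\<in>P2 {a, b, c, d}. C i P ({a, b, c, d} - J) (xs J * St g)) = Z i P l g"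
proof -
  note D = fiveD[OF f]
  let ?F = "\<lambda>g. Z i P l (St g) + (\<Sum>J\<in>P2 {a, b, c, d}. C i P ({a, b, c, d} - J) (xs J * St g))"
  have add: "additive ?F"
    by (intro additive_plus additive_sum additive_mult_St additive_comp[OF _ additive_St] funcs_additive[OF C_funcs] funcs_additive[OF Z_funcs])
  have Z1: "Z i P l (X x) = 0" for x by (intro Z_low) (simp add: X_def mono_deg_lt)
  have "?F (mono h) = Z i P l (mono h)" for h
  proof (cases "Poly_Mapping.keys h \<subseteq> {1..5}")
    case False
    then have "Z i P l (mono h) = 0" using Z_funcs by (auto simp: funcs_def mons_def)
    with False show ?thesis
      using funcs_St_out[OF Z_funcs False, of i P l 1] funcs_St_out[OF C_funcs False] by simp
  next
    case True
    have 2: "card J = 2" if "J \<in> P2 {a, b, c, d}" for J using that by (simp add: P2_def)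
    consider "monom_deg h = 0" | "monom_deg h = 1" | "monom_deg h \<ge> 2" by linarith
    then show ?thesis
    proof cases
      case 1
      then have "h = 0" by (simp add: monom_deg_eq_0)
      moreover have "C i P T (xs J) = 0" if "J \<in> P2 {a, b, c, d}" for T J
        using 2[OF that] by (intro C_low) (simp add: xs_mono mono_deg_lt deg_indic)
      ultimately show ?thesis by simp
    next
      case 2
      then have "h \<in> mons 5 1" using True by (simp add: mons_def)
      then obtain x where x: "x \<in> V" "mono h = X x" by (rule mons_1)
      have C2: "C i P T (X p * (X q * (X x * X x))) = 0" for T p q
      proof -
        have "X p * (X q * (X x * X x)) \<in> deg_ge (1 + (1 + (1 + 1)))"
          by (intro deg_ge_mult X_deg_ge)
        then show ?thesis by (intro C_high) (simp add: eval_nat_numeral)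
      qed
      have "?F (mono h) = Z i P l (X x * X x) + (cv i P {c, d} a b x + cv i P {b, d} a c x + cv i P {b, c} a d x +
          cv i P {a, d} b c x + cv i P {a, c} b d x + cv i P {a, b} c d x)"
        using D Z1 x C2 by (simp add: sum_P2_four xs_pair insert_Diff_if funcs_add[OF Z_funcs] funcs_add[OF C_funcs]
          distrib_left C_XXX[symmetric] power2_eq_square mult.assoc add.assoc)
      also have "\<dots> = 0"
        using x by (simp add: z_square_all[OF f P i] Z_square)
      also have "\<dots> = Z i P l (mono h)" using Z1 x by simp
      finally show ?thesis .
    next
      case 3
      have "C i P T (xs J * St (mono h)) = 0" if "J \<in> P2 {a, b, c, d}" for T J
        using 3 2[OF that] by (intro X_St_low C_funcs) simp
      moreover have "Z i P l (St (mono h) + mono h) = 0"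
        using 3 by (intro Z_high deg_ge_mono[OF St_mono_bot]) simp
      ultimately show ?thesis
        by (simp add: funcs_add[OF Z_funcs] bit_add_eq_0)
    qed
  qed
  from additive_eqI[OF add funcs_additive[OF Z_funcs] this] show ?thesis .
qed

text \<open>Only the constant monomial is of small enough degree. It turns the summands into the
  values \<open>Y\<close> at all pairs and their complements, which sum to zero by
  \<open>Y_total\<close>.\<close>

lemma C_top_zero: "(\<Sum>J | J \<subseteq> V \<and> card J = 3. C i P (V - J) (xs J * St g)) = 0"
proof -
  let ?F = "\<lambda>g. \<Sum>J | J \<subseteq> V \<and> card J = 3. C i P (V - J) (xs J * St g)"
  have add: "additive ?F"
    by (intro additive_sum additive_mult_St funcs_additive[OF C_funcs])
  have "?F (mono h) = 0" for h
  proof (cases "h = 0")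
    case False
    then have "1 \<le> monom_deg h" using monom_deg_eq_0[of h] by linarith
    then show ?thesis by (intro sum.neutral ballI X_St_low C_funcs) auto
  next
    case True
    have "1 \<in> V" by (simp add: V_def)
    then obtain b c d e where f: "five 1 b c d e" by (rule V_one)
    note D = fiveD[OF f]
    have "C i P (V - J) (xs J) = Y i P (V - J) J" if JV: "J \<subseteq> V" "card J = 3" for J
    proof -
      obtain p q r where J: "J = {p, q, r}" "p \<noteq> q" "q \<noteq> r" "p \<noteq> r" using JV(2) unfolding card_3_iff by blast
      have x: "xs J = X p * X q * X r" unfolding J(1) using J(2-4) by (simp add: xs_insert mult.assoc)
      have V: "p \<in> V" "q \<in> V" "r \<in> V" using JV(1) J by auto
      have "C i P (V - J) (xs J) = cv i P (V - J) p q r"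
        unfolding x by (rule C_XXX[OF V])
      also have "\<dots> = Y i P (V - J) {p, q, r}"
        by (rule cv_dist) (use J in simp)
      finally show ?thesis unfolding J(1) .
    qed
    then have "?F (mono h) = (\<Sum>J | J \<subseteq> V \<and> card J = 3. Y i P (V - J) J)"
      unfolding True by (intro sum.cong) auto
    also have "\<dots> = (\<Sum>Q\<in>P2 V. Y i P Q (V - Q))"
      by (rule sum.reindex_bij_witness[where i = "\<lambda>Q. V - Q" and j = "\<lambda>J. V - J"])
        (auto simp: P2_def card_Diff_subset finite_subset[of _ V] card_V double_diff)
    also have "\<dots> = 0"
      using Y_total[OF f, of i P] D unfolding sum_P2_V[OF f]
      by (simp add: five_V[OF f] insert_Diff_if)
    finally show ?thesis .
  qed
  with additive_eqI[OF add additive_zero] show ?thesis by blast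
qed

text \<open>The equation for three letters is \<open>C_T3\<close>, for four letters
  \<open>Z_St\<close>. For all five letters, the sets \<open>J\<close> of size one and of size three
  give sums that vanish separately, by \<open>Z_\<Omega>\<close> and
  \<open>C_top_zero\<close>.\<close>

lemma B_K:
  assumes i: "i \<in> V" and P: "P \<in> P2 V"
  shows "B i P \<in> K 5 8"
  unfolding B_def
proof (rule asm_K)
  show "T \<subseteq> {1..5} \<and> Poly_Mapping.keys h \<subseteq> {1..5} \<and> card T + 2 * monom_deg h = 8"
    if "\<psi>8 i P T (mono h) \<noteq> 0" for T h
    using that funcs_mono[OF C_funcs, of h] funcs_mono[OF Z_funcs, of h]
    by (fastforce simp: \<psi>8_def V_eq mons_def split: if_splits)
  fix T :: "nat set" and f assume "T \<subseteq> {1..5}"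
  then have T: "T \<subseteq> V" by (simp add: V_eq)
  then have fin: "finite T" by (auto intro: finite_subset)
  have J: "finite J" "card (T - J) = card T - card J" "card J \<le> card T" "J \<noteq> {} \<Longrightarrow> 1 \<le> card J"
    if "J \<subseteq> T" for J
    using that fin by (auto simp: card_Diff_subset finite_subset card_mono Suc_le_eq card_gt_0_iff)
  have le: "card T \<le> 5" using card_mono[OF _ T] by (simp add: card_V)
  then consider "card T \<le> 2" | "card T = 3" | "card T = 4" | "card T = 5" by linarith
  then show "(\<Sum>J\<in>Pow T. \<psi>8 i P (T - J) (xs J * St f)) = \<psi>8 i P T f"
  proof cases
    case 1
    have "(\<Sum>J\<in>Pow T. \<psi>8 i P (T - J) (xs J * St f)) = \<psi>8 i P T (St f)"
    proof (subst sum_Pow_0[OF fin])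
      fix J assume "J \<subseteq> T" "J \<noteq> {}"
      with 1 J[of J] have "card (T - J) < 2" by linarith
      then show "\<psi>8 i P (T - J) (xs J * St f) = 0" by (intro \<psi>8_null) auto
    qed simp
    also have "\<dots> = \<psi>8 i P T f"
      using 1 K_St[OF C_K] by (simp add: \<psi>8_def)
    finally show ?thesis .
  next
    case 2
    then obtain a b c where abc: "T = {a, b, c}" "distinct [a, b, c]" by (auto simp: card_3_iff)
    with T obtain d e where f: "five a b c d e" using V_three[of a b c] by auto
    note D = fiveD[OF f]
    have "(\<Sum>J\<in>Pow T. \<psi>8 i P (T - J) (xs J * St f)) = (\<Sum>k\<in>T. \<psi>8 i P (T - {k}) (xs {k} * St f))"
      using 2 J by (intro sum_Pow_1[OF fin] \<psi>8_null) fastforce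
    also have "\<dots> = 0"
      using D C_T3[OF f i P, of "St f"] by (simp add: abc insert_Diff_if \<psi>8_pair add.assoc)
    finally show ?thesis using 2 by (simp add: \<psi>8_null)
  next
    case 3
    then have "card (V - T) = 1" using T fin by (simp add: card_Diff_subset card_V)
    then obtain l where l: "V - T = {l}" by (auto simp: card_1_singleton_iff)
    then obtain a b c d where f: "five l a b c d" using V_one[of l] by blast
    then have Tabcd: "T = {a, b, c, d}" using l T fiveD[OF f] by (auto simp: five_V[OF f])
    have "(\<Sum>J\<in>Pow T. \<psi>8 i P (T - J) (xs J * St f)) =
        \<psi>8 i P T (St f) + (\<Sum>J\<in>P2 T. \<psi>8 i P (T - J) (xs J * St f))"
    proof (subst sum_Pow_02[OF fin])
      fix J assume JT: "J \<subseteq> T" "J \<noteq> {}" "card J \<noteq> 2"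
      with 3 J[of J] have "card (T - J) \<noteq> 4" "card (T - J) \<noteq> 2" by linarith+
      then show "\<psi>8 i P (T - J) (xs J * St f) = 0" by (intro \<psi>8_null) auto
    qed simp
    also have "(\<Sum>J\<in>P2 T. \<psi>8 i P (T - J) (xs J * St f)) = (\<Sum>J\<in>P2 T. C i P (T - J) (xs J * St f))"
      using T 3 J by (intro sum.cong refl \<psi>8_C) (auto simp: P2_def)
    finally show ?thesis
      using Z_St[OF f P i] \<psi>8_four'[OF f] by (simp add: Tabcd)
  next
    case 4
    then have TV: "T = V" using T by (intro card_subset_eq) (auto simp: card_V)
    have "(\<Sum>J\<in>Pow V. \<psi>8 i P (V - J) (xs J * St f)) =
        (\<Sum>J | J \<subseteq> V \<and> card J \<in> {1, 3}. \<psi>8 i P (V - J) (xs J * St f))"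
      using J 4 unfolding TV by (intro sum_Pow_card \<psi>8_null) fastforce+
    also have "{J. J \<subseteq> V \<and> card J \<in> {1, 3}} = {J. J \<subseteq> V \<and> card J = 1} \<union> {J. J \<subseteq> V \<and> card J = 3}"
      by auto
    also have "(\<Sum>J\<in>\<dots>. \<psi>8 i P (V - J) (xs J * St f)) =
        (\<Sum>J | J \<subseteq> V \<and> card J = 1. \<psi>8 i P (V - J) (xs J * St f)) +
        (\<Sum>J | J \<subseteq> V \<and> card J = 3. \<psi>8 i P (V - J) (xs J * St f))"
      by (intro sum.union_disjoint) auto
    also have "(\<Sum>J | J \<subseteq> V \<and> card J = 1. \<psi>8 i P (V - J) (xs J * St f)) = (\<Sum>k\<in>V. Z i P k (X k * St f))"
      unfolding sum_card_1 by (simp add: \<psi>8_four)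
    also have "\<dots> = 0" using i P by (rule Z_\<Omega>)
    also have "(\<Sum>J | J \<subseteq> V \<and> card J = 3. \<psi>8 i P (V - J) (xs J * St f)) =
        (\<Sum>J | J \<subseteq> V \<and> card J = 3. C i P (V - J) (xs J * St f))"
      using J 4 unfolding TV by (intro sum.cong refl \<psi>8_C) auto
    also have "\<dots> = 0" by (rule C_top_zero)
    finally show ?thesis using 4 by (simp add: TV \<psi>8_null card_V)
  qed
qed simp

lemma B_add: "B i P (p + q) = B i P p + B i P q"
  by (simp add: B_def asm_def additive.add[OF additive_lin_bit])

lemma B_X: "finite U \<Longrightarrow> B i P (X k * (xs U * h\<^sup>2)) =
    (if k \<in> U then \<psi>8 i P (U - {k}) (X k * h) else \<psi>8 i P (insert k U) h)"
  unfolding B_def by (rule asm_X) simp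

lemma B_layer: "finite U \<Longrightarrow> B i P (xs U * h\<^sup>2) = \<psi>8 i P U h"
  unfolding B_def by (rule asm_layer) simp_all

lemma additive_B [simp]: "additive (B i P)"
  by (simp add: B_def asm_def)

lemma additive_X: "additive \<phi> \<Longrightarrow> additive (\<lambda>f. \<phi> (X k * f))"
  by (simp add: additive_def distrib_left)

lemma B_G0:
  assumes f: "five i j k l m"
  shows "B i {j, k} g + B j {i, k} g + B k {i, j} g = 0"
proof (rule layer_eqI[of "\<lambda>g. B i {j, k} g + B j {i, k} g + B k {i, j} g" "\<lambda>g. 0"])
  fix U :: "nat set" and h assume U: "finite U"
  show "B i {j, k} (xs U * (mono h)\<^sup>2) + B j {i, k} (xs U * (mono h)\<^sup>2) + B k {i, j} (xs U * (mono h)\<^sup>2) = 0"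
  proof (cases "U \<in> P2 V")
    case True
    then show ?thesis using C_G0[OF f True] by (simp add: B_layer U \<psi>8_C P2_def)
  next
    case False
    show ?thesis
    proof (cases "U \<subseteq> V \<and> card U = 4")
      case True
      then have "card (V - U) = 1" using U by (simp add: card_Diff_subset card_V)
      then obtain a where a: "V - U = {a}" by (auto simp: card_1_singleton_iff)
      then have "a \<in> V" by auto
      then show ?thesis using Z_G0[OF f, of a] True by (simp add: B_layer U \<psi>8_def a)
    next
      case False
      then show ?thesis using \<open>U \<notin> P2 V\<close> by (auto simp: B_layer U \<psi>8_def P2_def)
    qed
  qed
qed (simp_all add: additive_plus)

text \<open>The claim splits according to the set \<open>U\<close> of odd letters of
  \<open>g\<close>. One letter gives \<open>G1\<close> or \<open>G1'\<close> for \<open>C\<close>,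
  three letters give \<open>Z_mem\<close> or \<open>Z_B\<close>, and all five letters give
  \<open>Z_diag\<close>; an even number of letters contributes nothing.\<close>

lemma B_G1:
  assumes i: "i \<in> V" and j: "j \<in> V"
  shows "(\<Sum>k\<in>V - {j}. B i {j, k} (X k * g)) = 0"
proof (rule layer_eqI[of "\<lambda>g. \<Sum>k\<in>V - {j}. B i {j, k} (X k * g)" "\<lambda>g. 0"])
  fix U :: "nat set" and h assume fin: "finite U"
  let ?g = "xs U * (mono h)\<^sup>2"
  show "(\<Sum>k\<in>V - {j}. B i {j, k} (X k * ?g)) = 0"
  proof (cases "U \<subseteq> V")
    case False
    then have "\<not> U - {k} \<subseteq> V" "\<not> insert k U \<subseteq> V" if "k \<in> V" for k using that by auto
    then show ?thesis by (intro sum.neutral) (auto simp: B_X fin \<psi>8_null)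
  next
    case True
    then show ?thesis
    proof (cases rule: V_card_cases)
      case 1
      then have "card (U - {k}) \<notin> {2, 4}" if "k \<in> U" for k using that fin by (auto simp: card_Diff_singleton)
      moreover have "card (insert k U) \<notin> {2, 4}" if "k \<notin> U" for k using 1 that fin by auto
      ultimately show ?thesis by (intro sum.neutral) (auto simp: B_X fin \<psi>8_null)
    next
      case (2 w)
      show ?thesis
      proof (cases "j = w")
        case True
        obtain a b c d where f: "five j a b c d" using V_one[OF j] by blast
        then have "V - {j} = {a, b, c, d}" using fiveD[OF f] by (auto simp: five_V[OF f])
        then show ?thesis
          using fiveD[OF f] C_G1'[OF f i, of "mono h"] True 2
          by (simp add: B_X \<psi>8_pair insert_commute add.assoc del: xs_single)
      next
        case False
        then obtain a b c where f: "five j w a b c" using V_two[OF j 2(1)] by blast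
        then have "V - {j} = {w, a, b, c}" using fiveD[OF f] by (auto simp: five_V[OF f])
        then show ?thesis
          using fiveD[OF f] C_G1[OF f i, of "mono h"] 2
          by (simp add: B_X \<psi>8_pair \<psi>8_null insert_commute add.assoc del: xs_single)
      qed
    next
      case (3 m n)
      have jn: ?thesis if f: "five j n a b c" and U: "U = {a, b, c}" for n a b c
      proof -
        have p: "five j n a b c" using f .
        have "{n, a, b, c} = V - {j}" using fiveD[OF f] by (auto simp: five_V[OF f])
        then have "\<psi>8 i {j, n} {n, a, b, c} (mono h) = Z i {j, n} j (mono h)"
          using \<psi>8_four[OF j] by simp
        moreover have "V - {j} = {n, a, b, c}" using fiveD[OF f] by (auto simp: five_V[OF f])
        ultimately show ?thesis
          using fiveD[OF f] Z_mem[OF f, of i "mono h"]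
          by (simp add: U B_X insert_Diff_if \<psi>8_pair add.assoc)
      qed
      show ?thesis
      proof (cases "j \<in> {m, n}")
        case True
        then obtain n' where n': "n' \<in> V" "j \<noteq> n'" "U = V - {j, n'}" using 3 by (auto simp: insert_commute)
        from five_of_pair[OF j n'(1,2)] obtain a b c where "five j n' a b c" "V - {j, n'} = {a, b, c}" by blast
        with jn n' show ?thesis by simp
      next
        case False
        then obtain a b where f: "five j m n a b" using V_three[OF j 3(1,2)] 3(3) by auto
        note D = fiveD[OF f]
        have V': "V - {j} = {m, n, a, b}" "U = {j, a, b}" "V - {n} = {j, a, b, m}" "V - {m} = {j, a, b, n}"
          using D 3 by (auto simp: five_V[OF f])
        have "\<psi>8 i {j, m} {m, j, a, b} (mono h) = Z i {j, m} n (mono h)"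
          "\<psi>8 i {j, n} {n, j, a, b} (mono h) = Z i {j, n} m (mono h)"
          using \<psi>8_four[OF D(3), of i "{j, m}" "mono h"] \<psi>8_four[OF D(2), of i "{j, n}" "mono h"]
          by (simp_all add: V' insert_commute)
        then show ?thesis
          using D Z_B[OF f i, of "mono h"]
          by (simp add: V' B_X insert_Diff_if \<psi>8_pair add.assoc)
      qed
    next
      case 4
      obtain a b c d where f: "five j a b c d" using V_one[OF j] by blast
      note D = fiveD[OF f]
      have "V - {j} = {a, b, c, d}" using D by (auto simp: five_V[OF f])
      then show ?thesis
        using D Z_diag[OF f i, of "mono h"]
        by (simp add: 4 B_X \<psi>8_four add.assoc)
    qed
  qed
qed (auto intro!: additive_sum additive_X)

end

definition word :: "nat \<Rightarrow> nat set \<Rightarrow> nat set \<Rightarrow> nat \<Rightarrow> nat \<Rightarrow> poly2"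
  where "word i P T p q = xs (V - {i}) * (xs (V - P) * (xs T * (X p * (X q)\<^sup>2)\<^sup>2)\<^sup>2)\<^sup>2"

section \<open>Invariant functionals of degree 19\<close>

context three_relations
begin

text \<open>The value of \<open>A k\<close> on the layer of all five letters. It is forced by the
  relation \<open>A_sum\<close>, evaluated at \<open>xs (V - {k})\<close> times a square.\<close>

definition \<tau> :: "nat \<Rightarrow> poly2 \<Rightarrow> bit"
  where "\<tau> k f = (\<Sum>i\<in>V - {k}. B i {i, k} (X i * f))"

definition \<psi>19 :: "nat \<Rightarrow> nat set \<Rightarrow> poly2 \<Rightarrow> bit"
  where "\<psi>19 i T f = (if T \<subseteq> V \<and> card T = 3 then B i (V - T) f else if T = V then \<tau> i f else 0)"

definition A :: "nat \<Rightarrow> poly2 \<Rightarrow> bit"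
  where "A i = asm (\<psi>19 i)"

lemma additive_\<tau> [simp]: "additive (\<tau> k)"
  unfolding \<tau>_def[abs_def] by (intro additive_sum additive_X additive_B)

lemma additive_\<psi>19 [simp]: "additive (\<psi>19 i T)"
proof -
  have "\<psi>19 i T = (if T \<subseteq> V \<and> card T = 3 then B i (V - T) else if T = V then \<tau> i else (\<lambda>f. 0))"
    by (auto simp: \<psi>19_def fun_eq_iff)
  then show ?thesis by simp
qed

lemma \<psi>19_null: "\<not> T \<subseteq> V \<or> card T \<notin> {3, 5} \<Longrightarrow> \<psi>19 i T f = 0"
  by (auto simp: \<psi>19_def card_V)

lemma \<psi>19_pair: "P \<in> P2 V \<Longrightarrow> \<psi>19 i (V - P) f = B i P f"
proof -
  assume "P \<in> P2 V"
  then have "card (V - P) = 3" "V - (V - P) = P"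
    by (auto simp: P2_def card_Diff_subset finite_subset[of _ V] card_V double_diff)
  then show ?thesis by (simp add: \<psi>19_def)
qed

lemma \<psi>19_V: "\<psi>19 i V f = \<tau> i f"
  by (simp add: \<psi>19_def card_V)

text \<open>The difference between \<tau> \<open>k\<close> at \<open>St f\<close> and at
  \<open>f\<close> is the left side, and the layer equation for all five letters demands the right
  side. The certificate takes \<open>B_G1\<close> once for each of the five letters and
  \<open>B_G0\<close> once for each pair in \<open>V - {k}\<close>.\<close>

lemma \<tau>_square:
  assumes k: "k \<in> V"
  shows "(\<Sum>i\<in>V - {k}. B i {i, k} (X i * (X i * g))) = (\<Sum>P\<in>P2 V. B k P (xs P * g))"
proof -
  obtain a b c d where f: "five k a b c d" using k by (rule V_one)
  note D = fiveD[OF f]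
  have Vk: "V - {k} = {a, b, c, d}" using D by (auto simp: five_V[OF f])
  have G1: "B i {k, a} (X a * h) + B i {k, b} (X b * h) + B i {k, c} (X c * h) + B i {k, d} (X d * h) = 0"
    if "i \<in> V" for i h
    using B_G1[OF that k, of h] D by (simp add: Vk add.assoc)
  have p: "five k a b c d" "five k a c b d" "five k a d b c" "five k b c a d" "five k b d a c" "five k c d a b"
    using f by (auto simp: five_def)
  have "(\<Sum>i\<in>V - {k}. B i {i, k} (X i * (X i * g))) + (\<Sum>P\<in>P2 V. B k P (xs P * g)) = 0"
    unfolding Vk sum_P2_V[OF f]
    using D add_zeros[OF G1[OF k, of "X k * g"] add_zeros[OF G1[OF D(2), of "X a * g"] add_zeros[OF G1[OF D(3), of "X b * g"]
      add_zeros[OF G1[OF D(4), of "X c * g"] add_zeros[OF G1[OF D(5), of "X d * g"]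
      add_zeros[OF B_G0[OF p(1), of "X a * (X b * g)"] add_zeros[OF B_G0[OF p(2), of "X a * (X c * g)"]
      add_zeros[OF B_G0[OF p(3), of "X a * (X d * g)"] add_zeros[OF B_G0[OF p(4), of "X b * (X c * g)"]
      add_zeros[OF B_G0[OF p(5), of "X b * (X d * g)"] B_G0[OF p(6), of "X c * (X d * g)"]]]]]]]]]]]
    by (simp add: xs_pair ac_simps insert_commute)
  then show ?thesis by (simp only: bit_add_eq_0)
qed

lemma B_funcs: "i \<in> V \<Longrightarrow> P \<in> P2 V \<Longrightarrow> B i P \<in> funcs 5 8"
  by (intro K_funcs B_K)

lemma \<tau>_funcs: "k \<in> V \<Longrightarrow> \<tau> k \<in> funcs 5 7"
  unfolding \<tau>_def[abs_def]
  by (intro funcs_sum funcs_X) (use B_funcs pair_P2 in \<open>simp add: eval_nat_numeral\<close>)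

lemma \<tau>_St:
  assumes k: "k \<in> V"
  shows "\<tau> k (St f) + (\<Sum>P\<in>P2 V. B k P (xs P * St f)) = \<tau> k f"
proof -
  have "\<tau> k f = (\<Sum>i\<in>V - {k}. B i {i, k} (St (X i * f)))"
    unfolding \<tau>_def using k by (intro sum.cong refl K_St[OF B_K, symmetric]) (auto simp: P2_iff)
  also have "\<dots> = (\<Sum>i\<in>V - {k}. B i {i, k} (X i * St f) + B i {i, k} (X i * (X i * St f)))"
    by (simp add: distrib_right B_add power2_eq_square mult.assoc)
  also have "\<dots> = \<tau> k (St f) + (\<Sum>P\<in>P2 V. B k P (xs P * St f))"
    by (simp add: sum.distrib \<tau>_square[OF k] \<tau>_def)
  finally show ?thesis ..
qed

lemma A_K:
  assumes i: "i \<in> V"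
  shows "A i \<in> K 5 19"
  unfolding A_def
proof (rule asm_K)
  show "T \<subseteq> {1..5} \<and> Poly_Mapping.keys h \<subseteq> {1..5} \<and> card T + 2 * monom_deg h = 19"
    if n: "\<psi>19 i T (mono h) \<noteq> 0" for T h
  proof (cases "T \<subseteq> V \<and> card T = 3")
    case True
    then have "V - T \<in> P2 V" by (auto simp: P2_def card_Diff_subset finite_subset[of _ V] card_V)
    then show ?thesis
      using n True funcs_mono[OF B_funcs[OF i], of "V - T" h] by (auto simp: \<psi>19_def V_eq mons_def)
  next
    case False
    with n have "T = V" "\<tau> i (mono h) \<noteq> 0" by (auto simp: \<psi>19_def split: if_splits)
    then show ?thesis
      using funcs_mono[OF \<tau>_funcs[OF i], of h] by (auto simp: V_eq mons_def card_V)
  qed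
  fix T :: "nat set" and f assume "T \<subseteq> {1..5}"
  then have T: "T \<subseteq> V" by (simp add: V_eq)
  then have fin: "finite T" by (auto intro: finite_subset)
  have J: "finite J" "card (T - J) = card T - card J" "card J \<le> card T" "J \<noteq> {} \<Longrightarrow> 1 \<le> card J"
    if "J \<subseteq> T" for J
    using that fin by (auto simp: card_Diff_subset finite_subset card_mono Suc_le_eq card_gt_0_iff)
  have le: "card T \<le> 5" using card_mono[OF _ T] by (simp add: card_V)
  then consider "card T \<le> 3" | "card T = 4" | "card T = 5" by linarith
  then show "(\<Sum>J\<in>Pow T. \<psi>19 i (T - J) (xs J * St f)) = \<psi>19 i T f"
  proof cases
    case 1
    have "(\<Sum>J\<in>Pow T. \<psi>19 i (T - J) (xs J * St f)) = \<psi>19 i T (St f)"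
    proof (subst sum_Pow_0[OF fin])
      fix J assume "J \<subseteq> T" "J \<noteq> {}"
      with 1 J[of J] have "card (T - J) < 3" by linarith
      then show "\<psi>19 i (T - J) (xs J * St f) = 0" by (intro \<psi>19_null) auto
    qed simp
    also have "\<dots> = \<psi>19 i T f"
    proof (cases "card T = 3")
      case True
      then have "V - T \<in> P2 V" using T by (auto simp: P2_def card_Diff_subset finite_subset[of _ V] card_V)
      then show ?thesis using True T K_St[OF B_K[OF i]] by (simp add: \<psi>19_def)
    qed (use 1 in \<open>auto simp: \<psi>19_def card_V\<close>)
    finally show ?thesis .
  next
    case 2
    then have "card (V - T) = 1" using T fin by (simp add: card_Diff_subset card_V)
    then obtain j where j: "V - T = {j}" by (auto simp: card_1_singleton_iff)
    then have jV: "j \<in> V" and Tj: "T = V - {j}" using T by auto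
    have "(\<Sum>J\<in>Pow T. \<psi>19 i (T - J) (xs J * St f)) = (\<Sum>k\<in>T. \<psi>19 i (T - {k}) (xs {k} * St f))"
    proof (rule sum_Pow_1[OF fin])
      fix J assume "J \<subseteq> T" "card J \<noteq> 1"
      with 2 J[of J] have "card (T - J) \<noteq> 3" "card (T - J) \<noteq> 5" by linarith+
      then show "\<psi>19 i (T - J) (xs J * St f) = 0" by (intro \<psi>19_null) auto
    qed
    also have "\<dots> = (\<Sum>k\<in>V - {j}. B i {j, k} (X k * St f))"
    proof (unfold Tj, intro sum.cong refl)
      fix k assume "k \<in> V - {j}"
      then have "{j, k} \<in> P2 V" using jV by (auto simp: P2_iff)
      moreover have "V - {j} - {k} = V - {j, k}" by auto
      ultimately show "\<psi>19 i (V - {j} - {k}) (xs {k} * St f) = B i {j, k} (X k * St f)"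
        by (simp add: \<psi>19_pair)
    qed
    also have "\<dots> = 0" using i jV by (rule B_G1)
    finally show ?thesis using 2 by (simp add: \<psi>19_null)
  next
    case 3
    then have TV: "T = V" using T by (intro card_subset_eq) (auto simp: card_V)
    have "(\<Sum>J\<in>Pow V. \<psi>19 i (V - J) (xs J * St f)) = \<psi>19 i V (St f) + (\<Sum>J\<in>P2 V. \<psi>19 i (V - J) (xs J * St f))"
    proof (subst sum_Pow_02)
      fix J assume JT: "J \<subseteq> V" "J \<noteq> {}" "card J \<noteq> 2"
      with 3 J[of J] have "card (V - J) \<noteq> 3" "card (V - J) \<noteq> 5" unfolding TV by linarith+
      then show "\<psi>19 i (V - J) (xs J * St f) = 0" by (intro \<psi>19_null) auto
    qed simp_all
    also have "\<dots> = \<tau> i (St f) + (\<Sum>J\<in>P2 V. B i J (xs J * St f))"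
      by (simp add: \<psi>19_pair \<psi>19_V)
    finally show ?thesis using \<tau>_St[OF i] by (simp add: TV \<psi>19_V)
  qed
qed simp

lemma additive_A [simp]: "additive (A i)"
  by (simp add: A_def asm_def)

lemma A_X: "finite U \<Longrightarrow> A i (X k * (xs U * h\<^sup>2)) =
    (if k \<in> U then \<psi>19 i (U - {k}) (X k * h) else \<psi>19 i (insert k U) h)"
  unfolding A_def by (rule asm_X) simp

text \<open>On a layer with two letters this is \<open>B_G0\<close> for the three others, and on a
  layer with four letters it is the definition of \<tau>. All other layers lead to sizes on which
  \<open>A\<close> vanishes.\<close>

lemma A_sum: "(\<Sum>i\<in>V. A i (X i * g)) = 0"
proof (rule layer_eqI[of "\<lambda>g. \<Sum>i\<in>V. A i (X i * g)" "\<lambda>g. 0"])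
  fix U :: "nat set" and h assume fin: "finite U"
  let ?g = "xs U * (mono h)\<^sup>2"
  show "(\<Sum>i\<in>V. A i (X i * ?g)) = 0"
  proof (cases "U \<subseteq> V \<and> (card U = 2 \<or> card U = 4)")
    case False
    have "A i (X i * ?g) = 0" if i: "i \<in> V" for i
    proof (cases "U \<subseteq> V")
      case True
      then have "card U \<le> 5" using card_mono[OF _ True] by (simp add: card_V)
      then have "i \<in> U \<Longrightarrow> card (U - {i}) \<notin> {3, 5}" "i \<notin> U \<Longrightarrow> card (insert i U) \<notin> {3, 5}"
        using False True fin by (auto simp: card_Diff_singleton_if)
      then show ?thesis by (auto simp: A_X fin \<psi>19_null)
    next
      case False
      then have "\<not> U - {i} \<subseteq> V" "\<not> insert i U \<subseteq> V" using i by auto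
      then show ?thesis by (simp add: A_X fin \<psi>19_null)
    qed
    then show ?thesis by simp
  next
    case True
    then have UV: "U \<subseteq> V" by simp
    show ?thesis
    proof (cases "card U = 2")
      case True
      then obtain a b where U: "U = {a, b}" "a \<noteq> b" by (auto simp: card_2_iff)
      then obtain i j k where f: "five a b i j k" using V_two[of a b] UV by auto
      note D = fiveD[OF f]
      have p: "five i j k a b" using f by (auto simp: five_def)
      have ins: "insert i {a, b} = V - {j, k}" "insert j {a, b} = V - {i, k}" "insert k {a, b} = V - {i, j}"
        using D by (auto simp: five_V[OF f])
      have "A i (X i * ?g) = B i {j, k} (mono h)" "A j (X j * ?g) = B j {i, k} (mono h)" "A k (X k * ?g) = B k {i, j} (mono h)"
        using D unfolding U by (simp_all add: A_X ins \<psi>19_pair pair_P2)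
      moreover have "A a (X a * ?g) = 0" "A b (X b * ?g) = 0"
        using D unfolding U by (simp_all add: A_X insert_Diff_if \<psi>19_null)
      ultimately show ?thesis
        using D B_G0[OF p, of "mono h"] by (simp add: five_V[OF f] add.assoc)
    next
      case False
      with True have "card (V - U) = 1" using fin by (simp add: card_Diff_subset card_V)
      then obtain k where "V - U = {k}" by (auto simp: card_1_singleton_iff)
      then have k: "k \<in> V" and U: "U = V - {k}" using UV by auto
      have "insert k (V - {k}) = V" using k by auto
      then have "A k (X k * ?g) = \<tau> k (mono h)"
        by (simp add: U A_X \<psi>19_V)
      moreover have "(\<Sum>i\<in>V - {k}. A i (X i * ?g)) = (\<Sum>i\<in>V - {k}. B i {i, k} (X i * mono h))"
      proof (intro sum.cong refl)
        fix i assume i: "i \<in> V - {k}"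
        then have "V - {k} - {i} = V - {i, k}" by auto
        then show "A i (X i * ?g) = B i {i, k} (X i * mono h)"
          using i k by (simp add: U A_X \<psi>19_pair pair_P2)
      qed
      ultimately show ?thesis
        using k by (simp add: sum.remove[of V k] \<tau>_def)
    qed
  qed
qed (auto intro!: additive_sum additive_X)

section \<open>The functional of degree 42 with prescribed word values\<close>

definition \<psi>42 :: "nat set \<Rightarrow> poly2 \<Rightarrow> bit"
  where "\<psi>42 T f = (if T \<subseteq> V \<and> card T = 4 then A (the_elem (V - T)) f else 0)"

definition \<Phi> :: "poly2 \<Rightarrow> bit"
  where "\<Phi> = asm \<psi>42"

lemma additive_\<psi>42 [simp]: "additive (\<psi>42 T)"
proof -
  have "\<psi>42 T = (if T \<subseteq> V \<and> card T = 4 then A (the_elem (V - T)) else (\<lambda>f. 0))"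
    by (auto simp: \<psi>42_def fun_eq_iff)
  then show ?thesis by simp
qed

lemma \<psi>42_four: "l \<in> V \<Longrightarrow> \<psi>42 (V - {l}) f = A l f"
proof -
  assume "l \<in> V"
  then have "V - (V - {l}) = {l}" "card (V - {l}) = 4" by (auto simp: card_V)
  then show ?thesis by (simp add: \<psi>42_def)
qed

lemma \<Phi>_K: "\<Phi> \<in> K 5 42"
  unfolding \<Phi>_def
proof (rule asm_K)
  have four: "\<exists>l\<in>V. T = V - {l}" if "T \<subseteq> V" "card T = 4" for T
  proof -
    have "card (V - T) = 1" using that by (simp add: card_Diff_subset finite_subset[of _ V] card_V)
    then obtain l where "V - T = {l}" by (auto simp: card_1_singleton_iff)
    then show ?thesis using that by auto
  qed
  show "T \<subseteq> {1..5} \<and> Poly_Mapping.keys h \<subseteq> {1..5} \<and> card T + 2 * monom_deg h = 42"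
    if n: "\<psi>42 T (mono h) \<noteq> 0" for T h
  proof -
    have T: "T \<subseteq> V" "card T = 4" using n by (auto simp: \<psi>42_def split: if_splits)
    with four obtain l where l: "l \<in> V" "T = V - {l}" by blast
    with n have "A l (mono h) \<noteq> 0" by (simp add: \<psi>42_four)
    then show ?thesis
      using T funcs_mono[OF K_funcs[OF A_K[OF l(1)]], of h] by (auto simp: V_eq mons_def)
  qed
  fix T :: "nat set" and f assume "T \<subseteq> {1..5}"
  then have T: "T \<subseteq> V" by (simp add: V_eq)
  then have fin: "finite T" by (auto intro: finite_subset)
  have J: "finite J" "card (T - J) = card T - card J" "card J \<le> card T" "J \<noteq> {} \<Longrightarrow> 1 \<le> card J"
    if "J \<subseteq> T" for J
    using that fin by (auto simp: card_Diff_subset finite_subset card_mono Suc_le_eq card_gt_0_iff)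
  have le: "card T \<le> 5" using card_mono[OF _ T] by (simp add: card_V)
  then consider "card T \<le> 4" | "card T = 5" by linarith
  then show "(\<Sum>J\<in>Pow T. \<psi>42 (T - J) (xs J * St f)) = \<psi>42 T f"
  proof cases
    case 1
    have "(\<Sum>J\<in>Pow T. \<psi>42 (T - J) (xs J * St f)) = \<psi>42 T (St f)"
    proof (subst sum_Pow_0[OF fin])
      fix J assume "J \<subseteq> T" "J \<noteq> {}"
      with 1 J[of J] have "card (T - J) < 4" by linarith
      then show "\<psi>42 (T - J) (xs J * St f) = 0" by (simp add: \<psi>42_def)
    qed simp
    also have "\<dots> = \<psi>42 T f"
    proof (cases "card T = 4")
      case True
      with four T obtain l where "l \<in> V" "T = V - {l}" by blast
      then show ?thesis using K_St[OF A_K] by (simp add: \<psi>42_four)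
    qed (simp add: \<psi>42_def)
    finally show ?thesis .
  next
    case 2
    then have TV: "T = V" using T by (intro card_subset_eq) (auto simp: card_V)
    have "(\<Sum>J\<in>Pow V. \<psi>42 (V - J) (xs J * St f)) = (\<Sum>k\<in>V. \<psi>42 (V - {k}) (xs {k} * St f))"
    proof (rule sum_Pow_1)
      fix J assume "J \<subseteq> V" "card J \<noteq> 1"
      with 2 J[of J] have "card (V - J) \<noteq> 4" unfolding TV by linarith
      then show "\<psi>42 (V - J) (xs J * St f) = 0" by (simp add: \<psi>42_def)
    qed simp
    also have "\<dots> = 0" using A_sum[of "St f"] by (simp add: \<psi>42_four)
    finally show ?thesis by (simp add: TV \<psi>42_def card_V)
  qed
qed simp

lemma \<Phi>_word:
  assumes "i \<in> V" "P \<in> P2 V" "T \<in> P2 V" "p \<in> V" "q \<in> V"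
  shows "\<Phi> (word i P T p q) = s i P T p q"
proof -
  have fin: "finite (V - {i})" "finite (V - P)" "finite T"
    using assms(3) by (auto simp: P2_def card_ge_0_finite)
  have "\<Phi> (word i P T p q) = A i (xs (V - P) * (xs T * (X p * (X q)\<^sup>2)\<^sup>2)\<^sup>2)"
    unfolding word_def \<Phi>_def by (subst asm_layer) (simp_all add: \<psi>42_four assms)
  also have "\<dots> = B i P (xs T * (X p * (X q)\<^sup>2)\<^sup>2)"
    unfolding A_def by (subst asm_layer) (simp_all add: \<psi>19_pair assms)
  also have "\<dots> = C i P T (X p * X q * X q)"
    using assms(3) fin(3) by (simp add: B_layer \<psi>8_C P2_def power2_eq_square[of "X q"] mult.assoc)
  also have "\<dots> = s i P T p q"
    using assms(4,5) by (simp add: C_XXX cv_rep sym[of i P T q p])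
  finally show ?thesis .
qed

end

subsection \<open>Restricting functionals to layers\<close>

lemma K_layer_min:
  assumes \<phi>: "\<phi> \<in> K t n" and T: "finite T" "card T + 2 * m = n"
    and min: "\<And>J f. J \<subseteq> T \<Longrightarrow> J \<noteq> {} \<Longrightarrow> \<phi> (xs (T - J) * f\<^sup>2) = 0"
  shows "(\<lambda>f. \<phi> (xs T * f\<^sup>2)) \<in> K t m"
proof -
  have "\<phi> (xs T * (St f)\<^sup>2) = \<phi> (xs T * f\<^sup>2)" for f
  proof -
    have "(\<Sum>J\<in>Pow T. \<phi> (xs (T - J) * (xs J * St f)\<^sup>2)) = \<phi> (xs T * (St f)\<^sup>2)"
      by (subst sum_Pow_0[OF T(1)]) (use min in auto)
    then show ?thesis using K_layer[OF \<phi> T(1), of f] by simp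
  qed
  then show ?thesis
    using funcs_layer[OF K_funcs[OF \<phi>] T] by (simp add: K_def)
qed

text \<open>The source of all relations between adjacent layers. On a set with one letter too many,
  exactly the singletons \<open>J\<close> survive in \<open>K_layer\<close>; this proves the
  relation at \<open>St f\<close>, and \<open>funcs_St_zero\<close> extends it to every
  \<open>g\<close>.\<close>

lemma K_layer_boundary:
  assumes \<phi>: "\<phi> \<in> K t n" and T: "finite T" "card T + 1 + 2 * m = n"
    and min: "\<And>J f. J \<subseteq> T \<Longrightarrow> card J \<noteq> 1 \<Longrightarrow> \<phi> (xs (T - J) * f\<^sup>2) = 0"
  shows "(\<Sum>k\<in>T. \<phi> (xs (T - {k}) * (X k * g)\<^sup>2)) = 0"
proof -
  define \<sigma> where "\<sigma> g = (\<Sum>k\<in>T. \<phi> (xs (T - {k}) * (X k * g)\<^sup>2))" for g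
  have "(\<lambda>g. \<phi> (xs (T - {k}) * (X k * g)\<^sup>2)) \<in> funcs t m" if "k \<in> T" for k
  proof -
    have "card T \<ge> 1" using that T(1) by (auto simp: Suc_le_eq card_gt_0_iff)
    then have "card (T - {k}) + 2 * Suc m = n"
      using T that by (simp add: card_Diff_singleton)
    from funcs_X[OF funcs_layer[OF K_funcs[OF \<phi>] _ this]] show ?thesis using T(1) by simp
  qed
  then have "\<sigma> \<in> funcs t m" unfolding \<sigma>_def[abs_def] by (rule funcs_sum)
  moreover have "\<sigma> (St f) = 0" for f
  proof -
    have "(\<Sum>J\<in>Pow T. \<phi> (xs (T - J) * (xs J * St f)\<^sup>2)) = \<sigma> (St f)"
      unfolding \<sigma>_def by (subst sum_Pow_1[OF T(1)]) (use min in auto)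
    moreover have "\<phi> (xs T * f\<^sup>2) = 0" using min[of "{}" f] by simp
    ultimately show ?thesis using K_layer[OF \<phi> T(1), of f] by simp
  qed
  ultimately have "\<sigma> g = 0" by (rule funcs_St_zero)
  then show ?thesis by (simp add: \<sigma>_def)
qed

lemma V_minus_two: "five a b c d e \<Longrightarrow> V - {a, b} = {c, d, e}"
  using fiveD[of a b c d e] by (auto simp: five_V[of a b c d e])

lemma V_minus_one: "five a b c d e \<Longrightarrow> V - {a} = {b, c, d, e}"
  using fiveD[of a b c d e] by (auto simp: five_V[of a b c d e])

text \<open>In \<open>phi_null\<close>, Wood's criterion for two letters in degree 42 asks for (42 +
  2) / 2 as a sum of two powers of two.\<close>

lemma two_powers_ne: "2 ^ x + 2 ^ y \<noteq> (22 :: nat)"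
proof
  assume eq: "2 ^ x + 2 ^ y = (22 :: nat)"
  have *: "a \<le> 4" if "2 ^ a \<le> (22 :: nat)" for a
  proof (rule ccontr)
    assume "\<not> a \<le> 4"
    then have "(2 :: nat) ^ 5 \<le> 2 ^ a" by (intro power_increasing) auto
    with that show False by simp
  qed
  have "x \<in> {0, 1, 2, 3, 4}" "y \<in> {0, 1, 2, 3, 4}"
    using *[of x] *[of y] eq by auto
  with eq show False by auto
qed

text \<open>The same criterion for one letter in degree 19 asks for (19 + 1) / 2.\<close>

lemma power_ne: "2 ^ x \<noteq> (10 :: nat)"
proof
  assume eq: "2 ^ x = (10 :: nat)"
  then have "x \<le> 3"
    using power_increasing[of 4 x "2 :: nat"] by (cases "x \<le> 3") auto
  then have "x \<in> {0, 1, 2, 3}" by auto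
  with eq show False by auto
qed

section \<open>The layers of a given functional of degree 42\<close>

locale degree_42 =
  fixes \<phi> :: "poly2 \<Rightarrow> bit"
  assumes \<phi>: "\<phi> \<in> K 5 42"
begin

definition "fA i f = \<phi> (xs (V - {i}) * f\<^sup>2)"
definition "fB i P f = fA i (xs (V - P) * f\<^sup>2)"
definition "fC i P T f = fB i P (xs T * f\<^sup>2)"
definition "fZ i P l f = fB i P (xs (V - {l}) * f\<^sup>2)"

lemma phi_null: "card T \<noteq> 4 \<Longrightarrow> finite T \<Longrightarrow> \<phi> (xs T * f\<^sup>2) = 0"
proof -
  assume T: "card T \<noteq> 4" "finite T"
  show ?thesis
  proof (cases "T \<subseteq> V \<and> even (card T)")
    case True
    then have "card T \<le> 5" using card_mono[of V T] by (simp add: card_V)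
    then have c: "card T = 0 \<or> card T = 2"
    proof -
      have "card T \<in> {0,1,2,3,4,5}" using \<open>card T \<le> 5\<close> by auto
      then show ?thesis using T True by auto
    qed
    show ?thesis
    proof (rule wood[OF \<phi> T(2)])
      fix e :: "nat \<Rightarrow> nat"
      from c show "2 * (\<Sum>i\<in>T. 2 ^ e i) \<noteq> 42 + card T"
      proof
        assume "card T = 2"
        then obtain a b where "T = {a, b}" "a \<noteq> b" by (auto simp: card_2_iff)
        then show ?thesis using two_powers_ne[of "e a" "e b"] by auto
      qed (use T(2) in auto)
    qed
  next
    case False
    then have "\<not> T \<subseteq> {1..5} \<or> (\<forall>m. card T + 2 * m \<noteq> 42)"
      by (auto simp: V_eq) presburger
    then show ?thesis by (rule funcs_layer_zero[OF K_funcs[OF \<phi>] T(2)])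
  qed
qed

lemma fA_K: "i \<in> V \<Longrightarrow> fA i \<in> K 5 19"
  unfolding fA_def[abs_def]
proof (rule K_layer_min[OF \<phi>])
  fix J f assume i: "i \<in> V" and J: "J \<subseteq> V - {i}" "J \<noteq> {}"
  have "card (V - {i} - J) < card (V - {i})"
    using J by (intro psubset_card_mono) auto
  then show "\<phi> (xs (V - {i} - J) * f\<^sup>2) = 0"
    using i by (intro phi_null) (auto simp: card_V)
qed (auto simp: card_V)

lemma fA_null: "i \<in> V \<Longrightarrow> card T \<notin> {3, 5} \<Longrightarrow> finite T \<Longrightarrow> fA i (xs T * f\<^sup>2) = 0"
proof -
  assume i: "i \<in> V" and T: "card T \<notin> {3, 5}" "finite T"
  show ?thesis
  proof (cases "T \<subseteq> V \<and> odd (card T)")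
    case True
    then have "card T \<le> 5" using card_mono[of V T] by (simp add: card_V)
    then have c: "card T = 1"
    proof -
      have "card T \<in> {0,1,2,3,4,5}" using \<open>card T \<le> 5\<close> by auto
      then show ?thesis using T True by auto
    qed
    then obtain a where "T = {a}" by (auto simp: card_1_singleton_iff)
    then show ?thesis using power_ne by (intro wood[OF fA_K[OF i] T(2)]) auto
  next
    case False
    then have "\<not> T \<subseteq> {1..5} \<or> (\<forall>m. card T + 2 * m \<noteq> 19)"
      by (auto simp: V_eq) presburger
    then show ?thesis by (rule funcs_layer_zero[OF K_funcs[OF fA_K[OF i]] T(2)])
  qed
qed

lemma V_P2: "P \<in> P2 V \<Longrightarrow> card (V - P) = 3"
  by (auto simp: P2_def card_Diff_subset finite_subset[of _ V] card_V)

lemma fB_K: "i \<in> V \<Longrightarrow> P \<in> P2 V \<Longrightarrow> fB i P \<in> K 5 8"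
  unfolding fB_def[abs_def]
proof (rule K_layer_min)
  fix J f assume i: "i \<in> V" and P: "P \<in> P2 V" and J: "J \<subseteq> V - P" "J \<noteq> {}"
  have "card (V - P - J) < card (V - P)"
    using J by (intro psubset_card_mono) auto
  then show "fA i (xs (V - P - J) * f\<^sup>2) = 0"
    using i V_P2[OF P] by (intro fA_null) auto
qed (auto simp: V_P2 fA_K)

lemma fB_null: "i \<in> V \<Longrightarrow> P \<in> P2 V \<Longrightarrow> \<not> T \<subseteq> V \<or> card T \<notin> {2, 4} \<Longrightarrow> finite T \<Longrightarrow> fB i P (xs T * f\<^sup>2) = 0"
proof -
  assume i: "i \<in> V" and P: "P \<in> P2 V" and T: "\<not> T \<subseteq> V \<or> card T \<notin> {2, 4}" "finite T"
  show ?thesis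
  proof (cases "T \<subseteq> V \<and> even (card T)")
    case True
    then have "card T \<le> 5" using card_mono[of V T] by (simp add: card_V)
    then have c: "card T = 0"
    proof -
      have "card T \<in> {0,1,2,3,4,5}" using \<open>card T \<le> 5\<close> by auto
      then show ?thesis using T True by auto
    qed
    then show ?thesis using T(2) by (intro wood[OF fB_K[OF i P] T(2)]) auto
  next
    case False
    then have "\<not> T \<subseteq> {1..5} \<or> (\<forall>m. card T + 2 * m \<noteq> 8)"
      by (auto simp: V_eq) presburger
    then show ?thesis by (rule funcs_layer_zero[OF K_funcs[OF fB_K[OF i P]] T(2)])
  qed
qed

lemma fC_K: "i \<in> V \<Longrightarrow> P \<in> P2 V \<Longrightarrow> T \<in> P2 V \<Longrightarrow> fC i P T \<in> K 5 3"
  unfolding fC_def[abs_def]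
proof (rule K_layer_min)
  fix J f assume i: "i \<in> V" and P: "P \<in> P2 V" and T: "T \<in> P2 V" and J: "J \<subseteq> T" "J \<noteq> {}"
  have "finite T" "card T = 2" using T by (auto simp: P2_def card_ge_0_finite)
  moreover have "card (T - J) < card T"
    using J \<open>finite T\<close> by (intro psubset_card_mono) auto
  ultimately show "fB i P (xs (T - J) * f\<^sup>2) = 0"
    using i P by (intro fB_null) auto
qed (auto simp: fB_K P2_def card_ge_0_finite)

lemma fZ_funcs: "i \<in> V \<Longrightarrow> P \<in> P2 V \<Longrightarrow> l \<in> V \<Longrightarrow> fZ i P l \<in> funcs 5 2"
  unfolding fZ_def[abs_def] by (rule funcs_layer[OF K_funcs[OF fB_K]]) (auto simp: card_V)

lemma fA_sum: "(\<Sum>k\<in>V. fA k (X k * g)) = 0"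
  unfolding fA_def
proof (rule K_layer_boundary[OF \<phi>])
  fix J f assume J: "J \<subseteq> V" "card J \<noteq> 1"
  then have "card (V - J) = 5 - card J" "card J \<le> 5"
    using card_mono[of V J] by (auto simp: card_Diff_subset finite_subset[of _ V] card_V)
  with J(2) show "\<phi> (xs (V - J) * f\<^sup>2) = 0" by (intro phi_null) auto
qed (auto simp: card_V)

lemma fA_X: "finite U \<Longrightarrow> fA i (X k * (xs U * h\<^sup>2)) =
    (if k \<in> U then fA i (xs (U - {k}) * (X k * h)\<^sup>2) else fA i (xs (insert k U) * h\<^sup>2))"
  using X_xs[of U k] by (simp add: power_mult_distrib flip: mult.assoc)

lemma fB_X: "finite U \<Longrightarrow> fB i P (X k * (xs U * h\<^sup>2)) =
    (if k \<in> U then fB i P (xs (U - {k}) * (X k * h)\<^sup>2) else fB i P (xs (insert k U) * h\<^sup>2))"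
  using X_xs[of U k] by (simp add: power_mult_distrib flip: mult.assoc)

lemma fB_G0:
  assumes f: "five i j k x y"
  shows "fB i {j, k} h + fB j {i, k} h + fB k {i, j} h = 0"
proof -
  note D = fiveD[OF f]
  have p: "five j k i x y" "five i k j x y" "five i j k x y"
    using f by (auto simp: five_def)
  have "fA x (X x * (xs {x, y} * h\<^sup>2)) = 0" "fA y (X y * (xs {x, y} * h\<^sup>2)) = 0"
    using D by (simp_all add: fA_X insert_Diff_if fA_null del: xs_single)
  then show ?thesis
    using fA_sum[of "xs {x, y} * h\<^sup>2"] D
    by (simp add: five_V[OF f] fA_X fB_def V_minus_two[OF p(1), unfolded five_V[OF f]] V_minus_two[OF p(2), unfolded five_V[OF f]]
      V_minus_two[OF p(3), unfolded five_V[OF f]] add.assoc)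
qed

lemma fA_top: 
  assumes k: "k \<in> V"
  shows "fA k (xs V * h\<^sup>2) = (\<Sum>i\<in>V - {k}. fB i {i, k} (X i * h))"
proof -
  have "fA k (X k * (xs (V - {k}) * h\<^sup>2)) + (\<Sum>i\<in>V - {k}. fA i (X i * (xs (V - {k}) * h\<^sup>2))) = 0"
    using fA_sum[of "xs (V - {k}) * h\<^sup>2"] k by (simp add: sum.remove[of V k])
  moreover have "fA i (X i * (xs (V - {k}) * h\<^sup>2)) = fB i {i, k} (X i * h)" if "i \<in> V - {k}" for i
  proof -
    have "V - {k} - {i} = V - {i, k}" by auto
    then show ?thesis using that by (simp add: fA_X fB_def)
  qed
  moreover have "insert k (V - {k}) = V" using k by auto
  ultimately show ?thesis by (simp add: fA_X bit_add_eq_0)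
qed

lemma fB_G1:
  assumes i: "i \<in> V" and j: "j \<in> V"
  shows "(\<Sum>k\<in>V - {j}. fB i {j, k} (X k * g)) = 0"
proof -
  have "(\<Sum>k\<in>V - {j}. fA i (xs (V - {j} - {k}) * (X k * g)\<^sup>2)) = 0"
  proof (rule K_layer_boundary[OF fA_K[OF i]])
    fix J f assume J: "J \<subseteq> V - {j}" "card J \<noteq> 1"
    then have "card (V - {j} - J) = 4 - card J" "card J \<le> 4"
      using card_mono[of "V - {j}" J] j by (auto simp: card_Diff_subset finite_subset[of _ "V - {j}"] card_V)
    with J(2) show "fA i (xs (V - {j} - J) * f\<^sup>2) = 0" using i by (intro fA_null) auto
  qed (use j in \<open>auto simp: card_V\<close>)
  then show ?thesis
    by (simp add: fB_def Diff_insert2[symmetric] insert_commute)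
qed

lemma fC_T3:
  assumes f: "five a b c d e" and i: "i \<in> V" and P: "P \<in> P2 V"
  shows "fC i P {b, c} (X a * g) + fC i P {a, c} (X b * g) + fC i P {a, b} (X c * g) = 0"
proof -
  note D = fiveD[OF f]
  have "(\<Sum>k\<in>{a, b, c}. fB i P (xs ({a, b, c} - {k}) * (X k * g)\<^sup>2)) = 0"
  proof (rule K_layer_boundary[OF fB_K[OF i P]])
    fix J f assume J: "J \<subseteq> {a, b, c}" "card J \<noteq> 1"
    have "card ({a, b, c} - J) = 3 - card J" "card J \<le> 3"
      using card_mono[of "{a, b, c}" J] D J by (auto simp: card_Diff_subset finite_subset[of _ "{a, b, c}"] eval_nat_numeral)
    with J(2) show "fB i P (xs ({a, b, c} - J) * f\<^sup>2) = 0" using i P by (intro fB_null) auto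
  qed (use D in auto)
  then show ?thesis
    using D by (simp add: fC_def insert_Diff_if add.assoc)
qed

lemma fC_G0:
  assumes f: "five i j k x y" and T: "T \<in> P2 V"
  shows "fC i {j, k} T h + fC j {i, k} T h + fC k {i, j} T h = 0"
  unfolding fC_def by (rule fB_G0[OF f])

lemma fC_G1:
  assumes f: "five j l a b c" and i: "i \<in> V"
  shows "fC i {j, a} {a, l} h + fC i {j, b} {b, l} h + fC i {j, c} {c, l} h = 0"
proof -
  note D = fiveD[OF f]
  have "fB i {j, l} (X l * (xs {l} * h\<^sup>2)) = 0"
    using D i by (simp add: fB_X fB_null pair_P2 del: xs_single xs_empty)
  then show ?thesis
    using fB_G1[OF i D(1), of "xs {l} * h\<^sup>2"] D
    by (simp add: V_minus_one[OF f] fB_X fC_def insert_commute add.assoc del: xs_single)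
qed

lemma fC_G1':
  assumes f: "five j a b c d" and i: "i \<in> V"
  shows "fC i {j, a} {j, a} h + fC i {j, b} {j, b} h + fC i {j, c} {j, c} h + fC i {j, d} {j, d} h = 0"
  using fB_G1[OF i fiveD(1)[OF f], of "xs {j} * h\<^sup>2"] fiveD[OF f]
  by (simp add: V_minus_one[OF f] fB_X fC_def insert_commute add.assoc del: xs_single)

text \<open>Set to 0 outside the range of words, because \<open>three_relations\<close> asks for the
  symmetry of the last two arguments without restriction.\<close>

definition w :: "nat \<Rightarrow> nat set \<Rightarrow> nat set \<Rightarrow> nat \<Rightarrow> nat \<Rightarrow> bit"
  where "w i P T p q = (if i \<in> V \<and> P \<in> P2 V \<and> T \<in> P2 V \<and> p \<in> V \<and> q \<in> V then \<phi> (word i P T p q) else 0)"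

lemma w_fC: "i \<in> V \<Longrightarrow> P \<in> P2 V \<Longrightarrow> T \<in> P2 V \<Longrightarrow> p \<in> V \<Longrightarrow> q \<in> V \<Longrightarrow> w i P T p q = fC i P T (X p * (X q)\<^sup>2)"
  by (simp add: w_def word_def fC_def fB_def fA_def)

lemma w_sym: "w i P T p q = w i P T q p"
proof (cases "i \<in> V \<and> P \<in> P2 V \<and> T \<in> P2 V \<and> p \<in> V \<and> q \<in> V \<and> p \<noteq> q")
  case True
  have "(\<Sum>k\<in>{p, q}. fC i P T (xs ({p, q} - {k}) * (X k * 1)\<^sup>2)) = 0"
  proof (rule K_layer_boundary[where t = 5 and n = 3 and m = 0])
    fix J f assume J: "J \<subseteq> {p, q}" "card J \<noteq> 1"
    then have "card ({p, q} - J) = 2 - card J" "card J \<le> 2"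
      using card_mono[of "{p, q}" J] True by (auto simp: card_Diff_subset finite_subset[of _ "{p, q}"])
    with J(2) have "card ({p, q} - J) \<in> {0, 2}" by auto
    then have "\<forall>m. card ({p, q} - J) + 2 * m \<noteq> 3" by (auto; presburger)
    then show "fC i P T (xs ({p, q} - J) * f\<^sup>2) = 0"
      using True by (intro funcs_layer_zero[OF K_funcs[OF fC_K]]) auto
  qed (use True fC_K in auto)
  then show ?thesis
    using True by (simp add: w_fC insert_Diff_if bit_add_eq_0)
qed (auto simp: w_def)

lemma three_relations_w: "three_relations w"
proof (rule three_relations.intro)
  fix y assume y: "y \<in> V"
  show "two_relations (\<lambda>i P T x. w i P T x y)"
  proof (rule two_relations.intro)
    fix i j k l m T x assume f: "five i j k l m" and T: "T \<in> P2 V" and x: "x \<in> V"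
    show "w i {j, k} T x y + w j {i, k} T x y + w k {i, j} T x y = 0"
      using fiveD[OF f] T x y fC_G0[OF f T] by (simp add: w_fC pair_P2)
  next
    fix i j l a b c x assume f: "five j l a b c" and i: "i \<in> V" and x: "x \<in> V"
    show "w i {j, a} {a, l} x y + w i {j, b} {b, l} x y + w i {j, c} {c, l} x y = 0"
      using fiveD[OF f] i x y fC_G1[OF f i] by (simp add: w_fC pair_P2)
  next
    fix i j a b c d x assume f: "five j a b c d" and i: "i \<in> V" and x: "x \<in> V"
    show "w i {j, a} {j, a} x y + w i {j, b} {j, b} x y + w i {j, c} {j, c} x y + w i {j, d} {j, d} x y = 0"
      using fiveD[OF f] i x y fC_G1'[OF f i] by (simp add: w_fC pair_P2)
  qed
next
  show "w i P T x y = w i P T y x" for i P T x y by (rule w_sym)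
next
  fix i P a b c d e y assume f: "five a b c d e" and i: "i \<in> V" and P: "P \<in> P2 V" and y: "y \<in> V"
  show "w i P {b, c} a y + w i P {a, c} b y + w i P {a, b} c y = 0"
    using fiveD[OF f] i P y fC_T3[OF f i P, of "(X y)\<^sup>2"] by (simp add: w_fC pair_P2)
qed

subsection \<open>Words determine the functional\<close>

lemma fZ_mem:
  assumes f: "five j n a b c" and i: "i \<in> V"
  shows "fZ i {j, n} j h = fC i {j, a} {b, c} (X a * h) + fC i {j, b} {a, c} (X b * h) + fC i {j, c} {a, b} (X c * h)"
proof -
  note D = fiveD[OF f]
  have "fB i {j, n} (X n * (xs {a, b, c} * h\<^sup>2)) = fZ i {j, n} j h"
    using D by (simp add: fB_X fZ_def V_minus_one[OF f])
  then have "fZ i {j, n} j h + (fC i {j, a} {b, c} (X a * h) + fC i {j, b} {a, c} (X b * h) + fC i {j, c} {a, b} (X c * h)) = 0"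
    using fB_G1[OF i D(1), of "xs {a, b, c} * h\<^sup>2"] D
    by (simp add: V_minus_one[OF f] fB_X fC_def insert_Diff_if add.assoc)
  then show ?thesis by (simp only: bit_add_eq_0)
qed

lemma fZ_B:
  assumes f: "five j m n a b" and i: "i \<in> V"
  shows "fZ i {j, m} n h + fZ i {j, n} m h = fC i {j, a} {j, b} (X a * h) + fC i {j, b} {j, a} (X b * h)"
proof -
  note D = fiveD[OF f]
  have p: "five n j a b m" "five m j a b n"
    using f by (auto simp: five_def)
  have "fB i {j, m} (X m * (xs {j, a, b} * h\<^sup>2)) = fZ i {j, m} n h"
    "fB i {j, n} (X n * (xs {j, a, b} * h\<^sup>2)) = fZ i {j, n} m h"
    using D by (simp_all add: fB_X fZ_def V_minus_one[OF p(1)] V_minus_one[OF p(2)] insert_commute)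
  then have "fZ i {j, m} n h + fZ i {j, n} m h + (fC i {j, a} {j, b} (X a * h) + fC i {j, b} {j, a} (X b * h)) = 0"
    using fB_G1[OF i D(1), of "xs {j, a, b} * h\<^sup>2"] D
    by (simp add: V_minus_one[OF f] fB_X fC_def insert_Diff_if add.assoc)
  then show ?thesis by (simp only: bit_add_eq_0)
qed

lemma fZ_G0:
  assumes f: "five i j k x y"
  shows "fZ i {j, k} l h + fZ j {i, k} l h + fZ k {i, j} l h = 0"
  unfolding fZ_def by (rule fB_G0[OF f])

text \<open>Uniqueness of the solution \<open>ZZ\<close>: with vanishing right sides the linear
  system for the third layers of size four has only the zero solution.\<close>

lemma fZ_zero:
  assumes c: "\<And>i P T k. i \<in> V \<Longrightarrow> P \<in> P2 V \<Longrightarrow> T \<in> P2 V \<Longrightarrow> k \<in> V \<Longrightarrow> fC i P T (X k * h) = 0"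
    and i: "i \<in> V" and P: "P \<in> P2 V" and l: "l \<in> V"
  shows "fZ i P l h = 0"
proof -
  have mem: "fZ i {j, n} j h = 0" if f: "five j n a b c" and i: "i \<in> V" for i j n a b c
    using fiveD[OF f] i by (simp add: fZ_mem[OF f i] c pair_P2)
  have B: "fZ i {j, m} n h = fZ i {j, n} m h" if f: "five j m n a b" and i: "i \<in> V" for i j m n a b
    using fiveD[OF f] i fZ_B[OF f i, of h] by (simp add: c pair_P2 bit_add_eq_0)
  obtain m n a b c where f: "five m n a b c" and P': "P = {m, n}" using P by (rule P2_V_cases)
  have self: "fZ l {m, n} l h = 0" if f: "five l m n a b" for l m n a b
  proof -
    have p: "five l n m a b" "five l m n a b" using f by (auto simp: five_def)
    show ?thesis
      using fZ_G0[OF f, of l h] mem[OF p(1), of m] mem[OF p(2), of n] fiveD[OF f] by simp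
  qed
  show ?thesis
  proof (cases "l \<in> P")
    case True
    then show ?thesis using mem[OF f i] mem[OF five_swap(1)[OF f] i] by (auto simp: P' insert_commute)
  next
    case False
    then obtain x y where g: "five l m n x y"
      using V_three[of l m n] l fiveD[OF f] by (auto simp: P')
    note D = fiveD[OF g]
    have "i = l \<or> i = m \<or> i = n \<or> i = x \<or> i = y" using i by (auto simp: five_V[OF g])
    moreover have ?thesis if "i = l" using that self[OF g] by (simp add: P')
    moreover have ?thesis if "i = m"
    proof -
      have "five n m l x y" "five m n l x y" using g by (auto simp: five_def)
      then show ?thesis using B[of n m l x y m] self[of m n l x y] that D by (simp add: P' insert_commute)
    qed
    moreover have ?thesis if "i = n"
    proof -
      have "five m n l x y" "five n m l x y" using g by (auto simp: five_def)
      then show ?thesis using B[of m n l x y n] self[of n m l x y] that D by (simp add: P' insert_commute)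
    qed
    moreover have ?thesis if q: "five i m n l z" for z
    proof -
      note D = fiveD[OF q]
      have p: "five i m n l z" "five i m l n z" "five i n l m z" "five m n l i z"
        "five n m l i z" "five m n i l z" "five m l i n z" "five l m n i z" "five n l i m z" "five n l m i z"
        "five m i l n z" "five m n l i z" "five m i n l z" "five i m n l z" "five n m i l z" "five l m i n z" "five m l n i z"
        using q by (auto simp: five_def)
      define Q where "Q = {i, m, n, l}"
      \<comment> \<open>Here \<open>a\<close> and \<open>j\<close> are the letters omitted in the
        first and in the third layer, and the other two letters of \<open>Q\<close> form the pair.
        By \<open>B\<close>, \<open>y a j\<close> is independent of \<open>j\<close>; by
        \<open>fZ_G0\<close>, for each \<open>j\<close> the three values sum to zero. Any three of
        four quantities thus sum to zero, so all four are equal, and three times a quantity is the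
        quantity itself.\<close>
      define y where "y a j = fZ a (Q - {a, j}) j h" for a j
      have E: "y i n = y i l" "y i m = y i l" "y m n = y m l" "y m i = y m l" "y n m = y n l" "y n i = y n l"
        "y l m = y l n" "y l i = y l n"
        using D B[of m l n i z i] B[of n l m i z i] B[of i l n m z m] B[of n l i m z m] B[of i l m n z n] B[of m l i n z n]
          B[of i m n l z l] B[of m i n l z l] q
        by (auto simp: y_def Q_def insert_Diff_if insert_commute five_def)
      have "y i l + y m l + y n l = 0" "y i n + y m n + y l n = 0" "y i m + y n m + y l m = 0" "y m i + y n i + y l i = 0"
        using D fZ_G0[OF p(1), of l h] fZ_G0[OF p(2), of n h] fZ_G0[OF p(3), of m h] fZ_G0[OF p(4), of i h]
        by (simp_all add: y_def Q_def insert_Diff_if insert_commute)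
      then have "y i l = 0" using E
        by (metis add.commute add.left_commute bit_add_self' bit_add_eq_0)
      then show ?thesis using D by (simp add: y_def Q_def P' insert_Diff_if insert_commute)
    qed
    moreover have "five x m n l y" "five y m n l x" using g by (auto simp: five_def)
    ultimately show ?thesis by blast
  qed
qed

text \<open>The layer equation for \<open>V - {l}\<close> at a variable. Sizes leave only the empty
  set and the pairs \<open>J\<close>. In the terms with pairs, the square in \<open>St (X x)\<close>
  has too high a degree.\<close>

lemma fZ_square:
  assumes i: "i \<in> V" and P: "P \<in> P2 V" and f: "five l a b c d" and x: "x \<in> V"
  shows "fZ i P l (X x * X x) = fC i P {c, d} (X a * X b * X x) + fC i P {b, d} (X a * X c * X x) + fC i P {b, c} (X a * X d * X x)
    + fC i P {a, d} (X b * X c * X x) + fC i P {a, c} (X b * X d * X x) + fC i P {a, b} (X c * X d * X x)"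
proof -
  note D = fiveD[OF f]
  have T: "V - {l} = {a, b, c, d}" by (rule V_minus_one[OF f])
  have K: "fB i P \<in> K 5 8" using i P by (rule fB_K)
  have "(\<Sum>J\<in>Pow {a, b, c, d}. fB i P (xs ({a, b, c, d} - J) * (xs J * St (X x))\<^sup>2)) =
      fB i P (xs ({a, b, c, d} - {}) * (xs {} * St (X x))\<^sup>2) +
      (\<Sum>J\<in>P2 {a, b, c, d}. fB i P (xs ({a, b, c, d} - J) * (xs J * St (X x))\<^sup>2))"
  proof (rule sum_Pow_02)
    fix J assume J: "J \<subseteq> {a, b, c, d}" "J \<noteq> {}" "card J \<noteq> 2"
    have "card J \<ge> 1" using J finite_subset[OF J(1)] by (auto simp: Suc_le_eq card_gt_0_iff)
    moreover have "card ({a, b, c, d} - J) = 4 - card J"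
      using J D by (subst card_Diff_subset) (auto intro: finite_subset simp: eval_nat_numeral)
    ultimately have "card ({a, b, c, d} - J) \<notin> {2, 4}" using J(3) by auto
    then show "fB i P (xs ({a, b, c, d} - J) * (xs J * St (X x))\<^sup>2) = 0" using i P by (intro fB_null) auto
  qed simp
  also have "fB i P (xs ({a, b, c, d} - {}) * (xs {} * St (X x))\<^sup>2) = fZ i P l (X x) + fZ i P l (X x * X x)"
    using funcs_add[OF fZ_funcs[OF i P D(1)], of "X x" "X x * X x"] by (simp add: fZ_def T power2_eq_square[of "X x"])
  also have "(\<Sum>J\<in>P2 {a, b, c, d}. fB i P (xs ({a, b, c, d} - J) * (xs J * St (X x))\<^sup>2)) =
      (\<Sum>J\<in>P2 {a, b, c, d}. fC i P ({a, b, c, d} - J) (xs J * X x))"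
  proof (rule sum.cong[OF refl])
    fix J assume J: "J \<in> P2 {a, b, c, d}"
    have cJ: "card J = 2" "J \<subseteq> {a, b, c, d}" using J by (auto simp: P2_def)
    have "card ({a, b, c, d} - J) = 2"
      using cJ D by (subst card_Diff_subset) (auto intro: finite_subset simp: eval_nat_numeral)
    then have c: "{a, b, c, d} - J \<in> P2 V" using D by (auto simp: P2_def)
    have "xs J * (X x * X x) \<in> deg_ge (2 + (1 + 1))"
      using xs_deg_ge[of J] unfolding cJ(1) by (intro deg_ge_mult X_deg_ge)
    then have "fC i P ({a, b, c, d} - J) (xs J * (X x * X x)) = 0"
      by (intro funcs_deg_ge[OF K_funcs[OF fC_K[OF i P c]]]) simp
    then have "fC i P ({a, b, c, d} - J) (xs J * St (X x)) = fC i P ({a, b, c, d} - J) (xs J * X x)"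
      using funcs_add[OF K_funcs[OF fC_K[OF i P c]], of "xs J * X x" "xs J * (X x * X x)"]
      by (simp add: distrib_left power2_eq_square)
    then show "fB i P (xs ({a, b, c, d} - J) * (xs J * St (X x))\<^sup>2) = fC i P ({a, b, c, d} - J) (xs J * X x)"
      by (simp only: fC_def)
  qed
  also have "\<dots> = fC i P {c, d} (X a * X b * X x) + fC i P {b, d} (X a * X c * X x) + fC i P {b, c} (X a * X d * X x)
    + fC i P {a, d} (X b * X c * X x) + fC i P {a, c} (X b * X d * X x) + fC i P {a, b} (X c * X d * X x)"
    using D by (simp add: sum_P2_four xs_pair insert_Diff_if)
  finally have "fZ i P l (X x) + fZ i P l (X x * X x) + (fC i P {c, d} (X a * X b * X x) + fC i P {b, d} (X a * X c * X x) + fC i P {b, c} (X a * X d * X x)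
    + fC i P {a, d} (X b * X c * X x) + fC i P {a, c} (X b * X d * X x) + fC i P {a, b} (X c * X d * X x)) = fZ i P l (X x)"
    using K_layer[OF K, of "{a, b, c, d}" "X x"] by (simp add: fZ_def T)
  then have "fZ i P l (X x * X x) + (fC i P {c, d} (X a * X b * X x) + fC i P {b, d} (X a * X c * X x) + fC i P {b, c} (X a * X d * X x)
    + fC i P {a, d} (X b * X c * X x) + fC i P {a, c} (X b * X d * X x) + fC i P {a, b} (X c * X d * X x)) = 0"
    by (simp only: add.assoc add_cancel_left_right)
  then show ?thesis by (simp only: bit_add_eq_0)
qed

text \<open>Products with a repeated letter are words. For three different letters,
  \<open>sub\<close>, \<open>one\<close> and \<open>none\<close> treat the cases that
  \<open>T\<close> has two, one or no letter in common with them.\<close>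

lemma fC_zero:
  assumes w: "\<And>i P T p q. w i P T p q = 0" and i: "i \<in> V" and P: "P \<in> P2 V" and T: "T \<in> P2 V"
  shows "fC i P T f = 0"
proof -
  have ww: "fC i P T (X p * X q * X q) = 0" if "i \<in> V" "P \<in> P2 V" "T \<in> P2 V" "p \<in> V" "q \<in> V" for i P T p q
    using w_fC[OF that] w by (simp add: power2_eq_square mult.assoc)
  have ww': "fC i P T (X q * X p * X q) = 0" "fC i P T (X q * X q * X p) = 0"
    if "i \<in> V" "P \<in> P2 V" "T \<in> P2 V" "p \<in> V" "q \<in> V" for i P T p q
    using ww[OF that] by (simp_all only: ac_simps)
  have z: "fZ i P l (X x * X x) = 0" if "i \<in> V" "P \<in> P2 V" "l \<in> V" "x \<in> V" for i P l x
    using that ww by (intro fZ_zero) (auto simp flip: mult.assoc)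
  have T3: "fC i P {b, c} (X a * X p * X q) + fC i P {a, c} (X b * X p * X q) + fC i P {a, b} (X c * X p * X q) = 0"
    if "five a b c d e" for a b c d e p q
    using fC_T3[OF that i P, of "X p * X q"] by (simp add: mult.assoc)
  have sub: "fC i P {p, q} (X p * X q * X r) = 0" if f: "five p q r d e" for p q r d e
  proof -
    note D = fiveD[OF f]
    have "fC i P {q, r} (X p * X p * X q) = 0" "fC i P {p, r} (X q * X p * X q) = 0"
      using D i P by (simp_all add: pair_P2 ww ww')
    then show ?thesis
      using T3[OF f, of p q] by (simp add: ac_simps)
  qed
  have one: "fC i P {p, a} (X p * X b * X q) = 0" if f: "five p a b q e" for p a b q e
  proof -
    have eq: "fC i P {p, a} (X p * X b * X q) = fC i P {p, b} (X p * X a * X q)" if f: "five p a b q e" for a b q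
    proof -
      note D = fiveD[OF f]
      have "fC i P {a, b} (X p * X p * X q) = 0"
        using D i P by (simp add: pair_P2 ww')
      then have "fC i P {p, b} (X p * X a * X q) + fC i P {p, a} (X p * X b * X q) = 0"
        using T3[OF f, of p q] by (simp add: ac_simps)
      then show ?thesis by (simp only: bit_add_eq_0)
    qed
    have p: "five p a q b e" "five e p a b q" using f by (auto simp: five_def)
    note D = fiveD[OF f]
    have "fC i P {b, q} (X p * X a * X p) = 0" "fC i P {a, q} (X p * X b * X p) = 0" "fC i P {a, b} (X p * X q * X p) = 0"
      using D i P by (simp_all add: pair_P2 ww ww')
    then have "fC i P {p, q} (X a * X b * X p) + fC i P {p, b} (X a * X q * X p) + fC i P {p, a} (X b * X q * X p) = 0"
      using fZ_square[OF i P p(2) D(1)] z[OF i P D(5,1)] by simp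
    then show ?thesis
      using eq[OF f] eq[OF p(1)] by (simp add: ac_simps)
  qed
  have none: "fC i P {a, b} (X c * X d * X e) = 0" if f: "five a b c d e" for a b c d e
  proof -
    define x where "x Q = fC i P Q (xs (V - Q))" for Q
    have x: "x {a, b} = fC i P {a, b} (X c * X d * X e)" if f: "five a b c d e" for a b c d e
      using fiveD[OF f] by (simp add: x_def V_minus_two[OF f] xs_insert mult.assoc)
    have tri: "x {b, c} + x {a, c} + x {a, b} = 0" if f: "five a b c d e" for a b c d e
    proof -
      have p: "five b c a d e" "five a c b d e" "five a b c d e" using f by (auto simp: five_def)
      show ?thesis using T3[OF f, of d e] by (simp add: x[OF p(1)] x[OF p(2)] x[OF p(3)])
    qed
    \<comment> \<open>The six pairs in \<open>{a, b, c, d}\<close> sum to zero. Adding the triangles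
      on \<open>a, b, c\<close> and on \<open>a, b, d\<close> leaves \<open>{c, d}\<close> and three
      times \<open>{a, b}\<close>. Together with \<open>tri\<close> for \<open>c, d, e\<close>,
      whose three pairs all have the value of \<open>{a, b}\<close>, this value must be
      zero.\<close>
    have opp: "x {a, b} = x {c, d}" if f: "five a b c d e" for a b c d e
    proof -
      note D = fiveD[OF f]
      have p: "five e a b c d" "five a b c d e" "five a b d c e" "five c d a b e" "five b d a c e" "five b c a d e"
        "five a d b c e" "five a c b d e" using f by (auto simp: five_def)
      have "x {c, d} + x {b, d} + x {b, c} + x {a, d} + x {a, c} + x {a, b} = 0"
        using fZ_square[OF i P p(1) D(5)] z[OF i P D(5,5)]
        by (simp add: x[OF p(2)] x[OF p(4)] x[OF p(5)] x[OF p(6)] x[OF p(7)] x[OF p(8)])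
      from add_zeros[OF this add_zeros[OF tri[OF p(2)] tri[OF p(3)]]] have "x {a, b} + x {c, d} = 0"
        by (simp add: ac_simps)
      then show ?thesis by (simp only: bit_add_eq_0)
    qed
    have p: "five a b c d e" "five a b c e d" "five a b d e c" "five c d e a b"
      using f by (auto simp: five_def)
    show ?thesis
      using tri[OF p(4)] opp[OF p(1)] opp[OF p(2)] opp[OF p(3)] by (simp add: x[OF f])
  qed
  have XXX: "fC i P T (X p * X q * X r) = 0" if V: "p \<in> V" "q \<in> V" "r \<in> V" for p q r
  proof (cases "distinct [p, q, r]")
    case False
    then show ?thesis using ww[OF i P T] ww'[OF i P T] V by auto
  next
    case True
    then obtain d e where f: "five p q r d e" by (rule V_three[OF V])
    have fs: "five p q r d e" "five p r q d e" "five q r p d e" "five p d q r e" "five p e q r d" "five q d p r e"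
      "five q e p r d" "five r d p q e" "five r e p q d" "five d e p q r"
      using f by (auto simp: five_def)
    from T obtain u v where uv: "T = {u, v}" "u \<noteq> v" "u \<in> V" "v \<in> V" by (metis P2_iff)
    have "u = p \<or> u = q \<or> u = r \<or> u = d \<or> u = e" "v = p \<or> v = q \<or> v = r \<or> v = d \<or> v = e"
      using uv(3,4) unfolding five_V[OF f] by blast+
    then have "T = {p, q} \<or> T = {p, r} \<or> T = {q, r} \<or> T = {p, d} \<or> T = {p, e} \<or> T = {q, d} \<or> T = {q, e} \<or>
        T = {r, d} \<or> T = {r, e} \<or> T = {d, e}"
      unfolding uv(1) using uv(2) by (elim disjE; metis insert_commute)
    then show ?thesis
      using sub[OF fs(1)] sub[OF fs(2)] sub[OF fs(3)] one[OF fs(4)] one[OF fs(5)] one[OF fs(6)] one[OF fs(7)]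
        one[OF fs(8)] one[OF fs(9)] none[OF fs(10)]
      by (elim disjE) (simp_all add: ac_simps)
  qed
  show ?thesis
    using K_funcs[OF fC_K[OF i P T]] by (rule funcs_zeroI) (metis mons_3 XXX)
qed

theorem words_determine:
  assumes w: "\<And>i P T p q. w i P T p q = 0"
  shows "\<phi> f = 0"
proof -
  have B: "fB i P f = 0" if i: "i \<in> V" and P: "P \<in> P2 V" for i P f
  proof (rule layer_eqI[of "fB i P" "\<lambda>f. 0"])
    fix U :: "nat set" and h assume U: "finite U"
    show "fB i P (xs U * (mono h)\<^sup>2) = 0"
    proof (cases "U \<subseteq> V \<and> card U \<in> {2, 4}")
      case False
      then show ?thesis using fB_null[OF i P _ U] by blast
    next
      case True
      show ?thesis
      proof (cases "card U = 2")
        case c: True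
        then have "U \<in> P2 V" using True by (simp add: P2_def)
        then show ?thesis using fC_zero[OF w i P] by (simp add: fC_def)
      next
        case False
        then have "card (V - U) = 1" using True U by (simp add: card_Diff_subset card_V)
        then obtain l where "V - U = {l}" by (auto simp: card_1_singleton_iff)
        then have l: "l \<in> V" "U = V - {l}" using True by auto
        have "fZ i P l (mono h) = 0" using fC_zero[OF w] i P l by (intro fZ_zero) auto
        then show ?thesis by (simp add: fZ_def l)
      qed
    qed
  qed (use fB_K[OF i P] in \<open>auto simp: K_def funcs_def\<close>)
  have A: "fA i f = 0" if i: "i \<in> V" for i f
  proof (rule layer_eqI[of "fA i" "\<lambda>f. 0"])
    fix U :: "nat set" and h assume U: "finite U"
    show "fA i (xs U * (mono h)\<^sup>2) = 0"
    proof (cases "U \<subseteq> V \<and> card U \<in> {3, 5}")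
      case False
      then show ?thesis using fA_null[OF i _ U] funcs_layer_zero[OF K_funcs[OF fA_K[OF i]] U] by (auto simp: V_eq)
    next
      case True
      show ?thesis
      proof (cases "card U = 3")
        case c: True
        then have "V - U \<in> P2 V" "V - (V - U) = U" using True by (auto simp: P2_def card_Diff_subset U card_V)
        then show ?thesis using B[OF i, of "V - U" "mono h"] by (simp add: fB_def)
      next
        case False
        then have "U = V" using True by (intro card_subset_eq) (auto simp: card_V)
        moreover have "{k, i} \<in> P2 V" if "k \<in> V - {i}" for k using that i by (auto simp: P2_iff)
        ultimately show ?thesis by (simp add: fA_top[OF i] B)
      qed
    qed
  qed (use fA_K[OF i] in \<open>auto simp: K_def funcs_def\<close>)
  show ?thesis
  proof (rule layer_eqI[of \<phi> "\<lambda>f. 0"])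
    fix U :: "nat set" and h assume U: "finite U"
    show "\<phi> (xs U * (mono h)\<^sup>2) = 0"
    proof (cases "card U = 4 \<and> U \<subseteq> V")
      case False
      then show ?thesis using phi_null[OF _ U] funcs_layer_zero[OF K_funcs[OF \<phi>] U] by (auto simp: V_eq)
    next
      case True
      then have "card (V - U) = 1" using U by (simp add: card_Diff_subset card_V)
      then obtain l where "V - U = {l}" by (auto simp: card_1_singleton_iff)
      then have l: "l \<in> V" "U = V - {l}" using True by auto
      then show ?thesis using A[OF l(1), of "mono h"] by (simp add: fA_def)
    qed
  qed (use \<phi> in \<open>auto simp: K_def funcs_def\<close>)
qed

end

subsection \<open>Straightening\<close>

text \<open>
  The column \<open>V - {j, k}\<close> with \<open>j < k\<close> has the entries \<open>low j k < mid j k < high j k\<close>. In \<open>tableaux\<close> the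
  columns are \<open>V - {i}\<close>, \<open>V - {j, k}\<close>, \<open>{l, m}\<close>, \<open>{p}\<close>, \<open>{q}\<close>; those entries whose comparison is
  implied by the others are not compared.
\<close>

definition low :: "nat \<Rightarrow> nat \<Rightarrow> nat"
  where "low j k = (if 1 < j then 1 else if 2 < k then 2 else 3)"

definition mid :: "nat \<Rightarrow> nat \<Rightarrow> nat"
  where "mid j k = (if 2 < j then 2 else if 3 < k then 3 else 4)"

definition high :: "nat \<Rightarrow> nat \<Rightarrow> nat"
  where "high j k = (if 3 < j then 3 else if 4 < k then 4 else 5)"

definition tableaux :: "(nat \<times> nat \<times> nat \<times> nat \<times> nat \<times> nat \<times> nat) set"
  where "tableaux = {(i, j, k, l, m, p, q). {i, j, k, l, m, p, q} \<subseteq> V \<and> j < k \<and> l < m \<and>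
    j \<le> i \<and> low j k \<le> l \<and> mid j k \<le> m \<and> l \<le> p \<and> p \<le> q}"

lemma V_letters: "V = {1, 2, 3, 4, 5}"
  by (auto simp: V_def)

text \<open>Quantifies over the list of the five letters so that the finite check below can be
  decided by evaluation.\<close>

definition less_rest :: "nat \<Rightarrow> nat \<Rightarrow> nat \<Rightarrow> bool"
  where "less_rest c y z \<longleftrightarrow> (\<forall>a\<in>set [1..<6]. a \<noteq> c \<longrightarrow> a \<noteq> y \<longrightarrow> a \<noteq> z \<longrightarrow> c < a)"

lemma Garnir_cases_aux:
  "\<forall>j\<in>set [1..<6]. \<forall>k\<in>set [1..<6]. j < k \<longrightarrow> (\<forall>l\<in>set [1..<6]. \<forall>m\<in>set [1..<6]. l < m \<longrightarrow>
    \<not> (low j k \<le> l \<and> mid j k \<le> m) \<longrightarrow>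
    j = l \<and> less_rest j k m \<or> k = l \<and> less_rest k j m \<or> j = m \<and> less_rest j k l \<or> k = m \<and> less_rest k j l \<or>
    (j = 2 \<and> k = 3 \<and> l = 2 \<and> m = 3))"
  by code_simp

text \<open>If the columns \<open>V - {j, k}\<close> and \<open>{l, m}\<close> violate the tableau
  condition, the letter \<open>c\<close> can be exchanged by \<open>G1\<close> or \<open>G1'\<close>
  with letters \<open>a\<close> that are all larger, which increases \<open>j + k\<close>. The pair
  \<open>{2, 3}\<close> in both places is the only exception, because there the small letter 1 takes
  part in \<open>G1'\<close>.\<close>

lemma Garnir_cases:
  assumes "j \<in> V" "k \<in> V" "l \<in> V" "m \<in> V" "j < k" "l < m" "\<not> (low j k \<le> l \<and> mid j k \<le> m)"
  shows "(\<exists>c d e. {j, k} = {c, d} \<and> c \<noteq> d \<and> {l, m} = {c, e} \<and> c \<noteq> e \<and> (\<forall>a\<in>V - {c, d, e}. c < a)) \<or>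
    ({j, k} = {2, 3} \<and> {l, m} = {2, 3})"
proof -
  have V: "set [1..<6] = V" by (auto simp: V_def)
  from Garnir_cases_aux[unfolded V, rule_format, OF assms(1,2,5,3,4,6,7)]
  show ?thesis
    unfolding less_rest_def V
  proof (elim disjE conjE)
    assume c: "j = l" and lt: "\<forall>a\<in>V. a \<noteq> j \<longrightarrow> a \<noteq> k \<longrightarrow> a \<noteq> m \<longrightarrow> j < a"
    have "\<forall>a\<in>V - {j, k, m}. j < a" using lt by simp
    moreover have "{j, k} = {j, k}" "j \<noteq> k" "{l, m} = {j, m}" "j \<noteq> m"
      using assms(5,6) c by (simp_all add: insert_commute)
    ultimately show ?thesis by (intro disjI1 exI conjI)
  next
    assume c: "k = l" and lt: "\<forall>a\<in>V. a \<noteq> k \<longrightarrow> a \<noteq> j \<longrightarrow> a \<noteq> m \<longrightarrow> k < a"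
    have "\<forall>a\<in>V - {k, j, m}. k < a" using lt by simp
    moreover have "{j, k} = {k, j}" "k \<noteq> j" "{l, m} = {k, m}" "k \<noteq> m"
      using assms(5,6) c by (simp_all add: insert_commute)
    ultimately show ?thesis by (intro disjI1 exI conjI)
  next
    assume c: "j = m" and lt: "\<forall>a\<in>V. a \<noteq> j \<longrightarrow> a \<noteq> k \<longrightarrow> a \<noteq> l \<longrightarrow> j < a"
    have "\<forall>a\<in>V - {j, k, l}. j < a" using lt by simp
    moreover have "{j, k} = {j, k}" "j \<noteq> k" "{l, m} = {j, l}" "j \<noteq> l"
      using assms(5,6) c by (simp_all add: insert_commute)
    ultimately show ?thesis by (intro disjI1 exI conjI)
  next
    assume c: "k = m" and lt: "\<forall>a\<in>V. a \<noteq> k \<longrightarrow> a \<noteq> j \<longrightarrow> a \<noteq> l \<longrightarrow> k < a"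
    have "\<forall>a\<in>V - {k, j, l}. k < a" using lt by simp
    moreover have "{j, k} = {k, j}" "k \<noteq> j" "{l, m} = {k, l}" "k \<noteq> l"
      using assms(5,6) c by (simp_all add: insert_commute)
    ultimately show ?thesis by (intro disjI1 exI conjI)
  next
    assume "j = 2" "k = 3" "l = 2" "m = 3"
    then show ?thesis by simp
  qed
qed

context three_relations
begin

text \<open>\<open>G0\<close> turns a term with first index \<open>i\<close> and both pairs equal to
  \<open>{p, q}\<close> into terms with first index \<open>p\<close> and \<open>q\<close>. Collected
  by first index, these are four instances of \<open>G1\<close> centred at \<open>i\<close>.\<close>

lemma two_move:
  assumes f: "five i a b c d" and x: "x \<in> V" "y \<in> V"
  shows "s i {a, b} {a, b} x y + s i {a, c} {a, c} x y + s i {a, d} {a, d} x y +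
    s i {b, c} {b, c} x y + s i {b, d} {b, d} x y + s i {c, d} {c, d} x y = 0"
proof -
  note D = fiveD[OF f]
  have g: "five i a b c d" "five i a c b d" "five i a d b c" "five i b c a d" "five i b d a c" "five i c d a b"
    "five i b a c d" "five i c a b d" "five i d a b c"
    using f by (auto simp: five_def)
  have "s i {p, q} {p, q} x y + s p {i, q} {p, q} x y + s q {i, p} {p, q} x y = 0" if "five i p q u v" for p q u v
    using fiveD[OF that] G0[OF that _ x] by (simp add: pair_P2)
  note E = this[OF g(1)] this[OF g(2)] this[OF g(3)] this[OF g(4)] this[OF g(5)] this[OF g(6)]
  have L: "s a {i, b} {b, a} x y + s a {i, c} {c, a} x y + s a {i, d} {d, a} x y = 0"
    "s b {i, a} {a, b} x y + s b {i, c} {c, b} x y + s b {i, d} {d, b} x y = 0"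
    "s c {i, a} {a, c} x y + s c {i, b} {b, c} x y + s c {i, d} {d, c} x y = 0"
    "s d {i, a} {a, d} x y + s d {i, b} {b, d} x y + s d {i, c} {c, d} x y = 0"
    using G1[OF g(1) D(2) x] G1[OF g(7) D(3) x] G1[OF g(8) D(4) x] G1[OF g(9) D(5) x] by auto
  from add_zeros[OF E(1) add_zeros[OF E(2) add_zeros[OF E(3) add_zeros[OF E(4) add_zeros[OF E(5) add_zeros[OF E(6)
      add_zeros[OF L(1) add_zeros[OF L(2) add_zeros[OF L(3) L(4)]]]]]]]]]
  show ?thesis by (simp add: ac_simps insert_commute)
qed

text \<open>By \<open>G1'\<close> the pairs through \<open>u\<close> sum to zero, so the sum over
  the pairs avoiding \<open>u\<close> is the sum over all pairs, whatever \<open>u\<close> is; for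
  \<open>u = i\<close> it vanishes by \<open>two_move\<close>. The detour through the first layer is
  essential: adding \<open>G1'\<close> over all centres counts each pair twice and gives nothing
  over two elements.\<close>

lemma square_pairs:
  assumes f: "five u a b c d" and i: "i \<in> V" and x: "x \<in> V" "y \<in> V"
  shows "s i {a, b} {a, b} x y + s i {a, c} {a, c} x y + s i {a, d} {a, d} x y +
    s i {b, c} {b, c} x y + s i {b, d} {b, d} x y + s i {c, d} {c, d} x y = 0"
proof -
  define y' where "y' P = s i P P x y" for P
  have star: "y' {u, a} + y' {u, b} + y' {u, c} + y' {u, d} = 0" if "five u a b c d" for u a b c d
    using G1'[OF that i x] by (simp add: y'_def)
  have sum: "(\<Sum>P\<in>P2 V. y' P) = y' {a, b} + y' {a, c} + y' {a, d} + y' {b, c} + y' {b, d} + y' {c, d}"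
    if "five u a b c d" for u a b c d
    using star[OF that] unfolding sum_P2_V[OF that] by (simp add: ac_simps)
  obtain p q r t where g: "five i p q r t" using i by (rule V_one)
  have "(\<Sum>P\<in>P2 V. y' P) = 0"
    using two_move[OF g x] unfolding sum[OF g] unfolding y'_def .
  then show ?thesis unfolding sum[OF f] unfolding y'_def .
qed

text \<open>Induction on the tuple of \<open>5 - i\<close>, \<open>10 - (j + k)\<close>,
  \<open>l + m\<close> and \<open>p\<close>, ordered lexicographically and coded as a number; the
  lower entries are at most 7, 9 and 5. Each violated inequality of a tableau is repaired by the
  relation between the two columns concerned, and all its other terms have smaller rank.\<close>

lemma straighten:
  assumes zero: "\<And>i j k l m p q. (i, j, k, l, m, p, q) \<in> tableaux \<Longrightarrow> s i {j, k} {l, m} p q = 0"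
  assumes "i \<in> V" "j \<in> V" "k \<in> V" "l \<in> V" "m \<in> V" "p \<in> V" "q \<in> V" "j \<noteq> k" "l \<noteq> m"
  shows "s i {j, k} {l, m} p q = 0"
  using assms(2-)
proof (induction "1000 * (5 - i) + 100 * (10 - (j + k)) + 10 * (l + m) + p" arbitrary: i j k l m p q rule: less_induct)
  case less
  note V = less.prems
  have bd: "x \<in> V \<Longrightarrow> 1 \<le> x \<and> x \<le> 5" for x by (simp add: V_def)
  note b = bd[OF V(1)] bd[OF V(2)] bd[OF V(3)] bd[OF V(4)] bd[OF V(5)] bd[OF V(6)] bd[OF V(7)]
  have jk: "j + k \<le> 9" and lm: "l + m \<le> 9" "3 \<le> l + m" using b V(8,9) by auto
  have rank: "a < a' \<Longrightarrow> b \<le> 7 \<Longrightarrow> c \<le> 9 \<Longrightarrow> d \<le> 5 \<Longrightarrow> 1000 * a + 100 * b + 10 * c + d < 1000 * a'" for a a' b c d :: nat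
    by linarith
  have rank2: "b < b' \<Longrightarrow> c \<le> 9 \<Longrightarrow> d \<le> 5 \<Longrightarrow> a + 100 * b + 10 * c + d < a + 100 * b'" for a b b' c d :: nat
    by linarith
  have rank3: "c < c' \<Longrightarrow> d \<le> 5 \<Longrightarrow> a + 10 * c + d < a + 10 * c'" for a c c' d :: nat
    by linarith
  have IH_i: "s i' {j', k'} {l', m'} p' q' = 0"
    if "{i', j', k', l', m', p', q'} \<subseteq> V" "j' \<noteq> k'" "l' \<noteq> m'" "i < i'" for i' j' k' l' m' p' q'
  proof (rule less.hyps)
    have "5 - i' < 5 - i" "l' + m' \<le> 9" "p' \<le> 5" "10 - (j' + k') \<le> 7"
      using that bd[of i'] bd[of p'] bd[of l'] bd[of m'] bd[of j'] bd[of k'] b by auto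
    then show "1000 * (5 - i') + 100 * (10 - (j' + k')) + 10 * (l' + m') + p'
        < 1000 * (5 - i) + 100 * (10 - (j + k)) + 10 * (l + m) + p"
      using rank[of "5 - i'" "5 - i" "10 - (j' + k')" "l' + m'" p'] by (simp add: add.assoc trans_less_add1)
  qed (use that in auto)
  have IH_P: "s i {j', k'} {l', m'} p' q' = 0"
    if "{j', k', l', m', p', q'} \<subseteq> V" "j' \<noteq> k'" "l' \<noteq> m'" "j + k < j' + k'" for j' k' l' m' p' q'
  proof (rule less.hyps)
    have "10 - (j' + k') < 10 - (j + k)" "l' + m' \<le> 9" "p' \<le> 5"
      using that bd[of p'] bd[of l'] bd[of m'] bd[of j'] bd[of k'] jk by auto
    then show "1000 * (5 - i) + 100 * (10 - (j' + k')) + 10 * (l' + m') + p'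
        < 1000 * (5 - i) + 100 * (10 - (j + k)) + 10 * (l + m) + p"
      using rank2[of "10 - (j' + k')" "10 - (j + k)" "l' + m'" p' "1000 * (5 - i)"] by (simp add: add.assoc trans_less_add1)
  qed (use that V in auto)
  have IH_T: "s i {j, k} {l', m'} p' q' = 0"
    if "{l', m', p', q'} \<subseteq> V" "l' \<noteq> m'" "l' + m' < l + m" for l' m' p' q'
  proof (rule less.hyps)
    have "p' \<le> 5" using that bd[of p'] by auto
    then show "1000 * (5 - i) + 100 * (10 - (j + k)) + 10 * (l' + m') + p'
        < 1000 * (5 - i) + 100 * (10 - (j + k)) + 10 * (l + m) + p"
      using rank3[of "l' + m'" "l + m" p' "1000 * (5 - i) + 100 * (10 - (j + k))"] that by (simp add: trans_less_add1)
  qed (use that V in auto)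
  have IH_p: "s i {j, k} {l, m} p' q' = 0" if "p' \<in> V" "q' \<in> V" "p' < p" for p' q'
    by (rule less.hyps) (use that V in auto)
  obtain j0 k0 where jk0: "{j, k} = {j0, k0}" "j0 < k0" "j0 \<in> V" "k0 \<in> V" "j + k = j0 + k0"
    using V(2,3,8) by (metis insert_commute add.commute linorder_neqE_nat)
  obtain l0 m0 where lm0: "{l, m} = {l0, m0}" "l0 < m0" "l0 \<in> V" "m0 \<in> V" "l + m = l0 + m0"
    using V(4,5,9) by (metis insert_commute add.commute linorder_neqE_nat)
  have P: "{j, k} \<in> P2 V" and T: "{l, m} \<in> P2 V" using V by (auto simp: pair_P2)
  consider (i) "i < j0" | (P) "\<not> (low j0 k0 \<le> l0 \<and> mid j0 k0 \<le> m0)" | (T) "p < l0" | (p) "q < p"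
    | (std) "j0 \<le> i" "low j0 k0 \<le> l0" "mid j0 k0 \<le> m0" "l0 \<le> p" "p \<le> q"
    by linarith
  then show ?case
  proof cases
    case i
    then have d: "i \<noteq> j0" "i \<noteq> k0" "j0 \<noteq> k0" using jk0 by auto
    then obtain u v where f: "five i j0 k0 u v"
      using V_three[of i j0 k0] V(1) jk0(3,4) by auto
    have "s j0 {i, k0} {l, m} p q = 0" "s k0 {i, j0} {l, m} p q = 0"
      using d i jk0 V by (auto intro!: IH_i)
    then show ?thesis using G0[OF f T V(6,7)] by (simp add: jk0(1))
  next
    case P
    from Garnir_cases[OF jk0(3,4) lm0(3,4) jk0(2) lm0(2) P] show ?thesis
    proof (elim disjE exE conjE)
      fix c d e assume P': "{j0, k0} = {c, d}" "c \<noteq> d" "{l0, m0} = {c, e}" "c \<noteq> e" and lt: "\<forall>a\<in>V - {c, d, e}. c < a"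
      have cV: "c \<in> V" "d \<in> V" "e \<in> V" using P' jk0 lm0 by auto
      have sum: "j + k = c + d" using P'(1,2) jk0(5) by (auto simp: doubleton_eq_iff)
      have z: "s i {d, a} {a, e} p q = 0" if "a \<in> V" "a \<noteq> c" "a \<noteq> d" "a \<noteq> e" for a
        using that lt cV V sum by (intro IH_P) auto
      have eq: "s i {j, k} {l, m} p q = s i {d, c} {c, e} p q" by (simp add: jk0(1) lm0(1) P' insert_commute)
      show ?thesis
      proof (cases "e = d")
        case True
        from cV(2,1) P'(2)[symmetric] obtain u v w where f: "five d c u v w" by (rule V_two)
        have "s i {d, a} {d, a} p q = 0" if "a \<in> V" "a \<noteq> c" "a \<noteq> d" for a
          using z[of a] that True by (simp add: insert_commute)
        note y = this[of u] this[of v] this[of w]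
        show ?thesis using G1'[OF f V(1,6,7)] y fiveD[OF f] True by (simp add: eq insert_commute)
      next
        case False
        then obtain u v where f: "five d e c u v" using V_three[of d e c] cV P' by auto
        show ?thesis using G1[OF f V(1,6,7)] z[of u] z[of v] fiveD[OF f] by (simp add: eq)
      qed
    next
      \<comment> \<open>All other pairs of letters in \<open>V - {1}\<close> have sum above 5, so
        \<open>square_pairs\<close> with 1 left out reduces the rank.\<close>
      assume P': "{j0, k0} = {2, 3}" "{l0, m0} = {2, 3}"
      have f: "five 1 2 3 4 5" by (simp add: five_def V_letters)
      have mem: "2 \<in> V" "3 \<in> V" "4 \<in> V" "5 \<in> V" by (simp_all add: V_letters)
      have "j0 + k0 = 5" using P'(1) by (auto simp: doubleton_eq_iff)
      with jk0(5) have "j + k = 5" by simp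
      then have z: "s i {a, b} {a, b} p q = 0" if "a \<in> V" "b \<in> V" "a \<noteq> b" "5 < a + b" for a b
        using that V(6,7) by (intro IH_P) simp_all
      have "s i {2, 4} {2, 4} p q = 0" "s i {2, 5} {2, 5} p q = 0" "s i {3, 4} {3, 4} p q = 0"
        "s i {3, 5} {3, 5} p q = 0" "s i {4, 5} {4, 5} p q = 0"
        by (rule z; use mem in simp)+
      then show ?thesis using square_pairs[OF f V(1,6,7)] by (simp add: jk0(1) lm0(1) P')
    qed
  next
    case T
    then have d: "p \<noteq> l0" "p \<noteq> m0" "l0 \<noteq> m0" using lm0 by auto
    then obtain u v where f: "five p l0 m0 u v"
      using V_three[of p l0 m0] V(6) lm0(3,4) by auto
    have "s i {j, k} {p, m0} l0 q = 0" "s i {j, k} {p, l0} m0 q = 0"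
      using d T lm0 V by (auto intro!: IH_T)
    then show ?thesis using T3[OF f V(1) P V(7)] by (simp add: lm0(1))
  next
    case p
    then show ?thesis using IH_p[OF V(7,6)] sym by metis
  next
    case std
    then have "(i, j0, k0, l0, m0, p, q) \<in> tableaux" using jk0 lm0 V by (simp add: tableaux_def)
    then show ?thesis using zero by (simp add: jk0(1) lm0(1))
  qed
qed

lemma zero_on_tableaux:
  assumes zero: "\<And>i j k l m p q. (i, j, k, l, m, p, q) \<in> tableaux \<Longrightarrow> s i {j, k} {l, m} p q = 0"
    and "i \<in> V" "P \<in> P2 V" "T \<in> P2 V" "p \<in> V" "q \<in> V"
  shows "s i P T p q = 0"
proof -
  from assms obtain j k l m where "P = {j, k}" "j \<noteq> k" "j \<in> V" "k \<in> V" "T = {l, m}" "l \<noteq> m" "l \<in> V" "m \<in> V"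
    unfolding P2_iff by blast
  then show ?thesis using straighten[OF zero] assms by simp
qed

end

subsection \<open>Bideterminants\<close>

lemma bit_poly_add_self: "p + p = (0 :: bit poly)"
  by (rule poly_eqI) (simp only: coeff_add bit_add_self coeff_0)

lemma bit_poly_two [simp]: "(2 :: bit poly) = 0"
  using bit_poly_add_self[of 1] by (simp only: one_add_one)

text \<open>The entry in row \<open>r\<close> and column \<open>a\<close> of a generic matrix, after
  replacing its indeterminates by powers of a single one. For letters from 1 to 5 the exponents
  \<open>5 * r + a\<close> are distinct. The base 12 exceeds the number 4 + 3 + 2 + 1 + 1 = 11 of
  factors in a term of a bideterminant, so that its degree determines the entries used.\<close>

definition ent :: "nat \<Rightarrow> nat \<Rightarrow> bit poly"
  where "ent a r = monom 1 (12 ^ (5 * r + a))"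

text \<open>In characteristic two a minor is a permanent, hence independent of the order of the rows.\<close>

fun minor :: "nat \<Rightarrow> nat set \<Rightarrow> bit poly" where
  "minor 0 S = 1"
| "minor (Suc k) S = (\<Sum>a\<in>S. ent a (Suc k) * minor k (S - {a}))"

lemma minor_2: "a \<noteq> b \<Longrightarrow> minor 2 {a, b} = ent a 2 * ent b 1 + ent b 2 * ent a 1"
  by (simp add: eval_nat_numeral insert_Diff_if)

lemma minor_3: "distinct [a, b, c] \<Longrightarrow>
  minor 3 {a, b, c} = ent a 3 * minor 2 {b, c} + ent b 3 * minor 2 {a, c} + ent c 3 * minor 2 {a, b}"
  unfolding numeral_3_eq_3 minor.simps(2)[of "Suc (Suc 0)"] numeral_2_eq_2
  by (simp add: insert_Diff_if add.assoc del: minor.simps)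

lemma minor_4: "distinct [a, b, c, d] \<Longrightarrow>
  minor 4 {a, b, c, d} = ent a 4 * minor 3 {b, c, d} + ent b 4 * minor 3 {a, c, d} + ent c 4 * minor 3 {a, b, d}
    + ent d 4 * minor 3 {a, b, c}"
proof -
  have 4: "(4 :: nat) = Suc 3" by simp
  show "distinct [a, b, c, d] \<Longrightarrow> ?thesis"
  unfolding 4 minor.simps(2)
  by (simp add: insert_Diff_if add.assoc del: minor.simps)
qed

lemma minor_1_2:
  "distinct [a, b, c] \<Longrightarrow> minor 2 {b, c} * ent a 1 + minor 2 {a, c} * ent b 1 + minor 2 {a, b} * ent c 1 = 0"
  by (simp add: minor_2 algebra_simps)

lemma minor_2_3:
  "distinct [l, a, b, c] \<Longrightarrow>
    minor 3 {l, b, c} * minor 2 {a, l} + minor 3 {l, a, c} * minor 2 {b, l} + minor 3 {l, a, b} * minor 2 {c, l} = 0"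
  by (simp add: minor_3 minor_2 algebra_simps)

lemma minor_2_3':
  "distinct [j, a, b, c, d] \<Longrightarrow>
    minor 3 {b, c, d} * minor 2 {j, a} + minor 3 {a, c, d} * minor 2 {j, b} + minor 3 {a, b, d} * minor 2 {j, c}
      + minor 3 {a, b, c} * minor 2 {j, d} = 0"
  by (simp add: minor_3 minor_2 algebra_simps)

lemma minor_3_3:
  "distinct [i, j, k, l, m] \<Longrightarrow>
    minor 3 {j, k, m} * minor 3 {i, l, m} + minor 3 {i, k, m} * minor 3 {j, l, m} + minor 3 {i, j, m} * minor 3 {k, l, m} = 0"
  by (simp add: minor_3 minor_2 algebra_simps)

text \<open>Expansion along the fourth row. The terms with \<open>i\<close>, \<open>j\<close> or
  \<open>k\<close> in that row cancel in pairs; those with \<open>l\<close> and those with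
  \<open>m\<close> are instances of \<open>minor_3_3\<close>.\<close>

lemma minor_3_4:
  assumes "distinct [i, j, k, l, m]"
  shows "minor 4 {j, k, l, m} * minor 3 {i, l, m} + minor 4 {i, k, l, m} * minor 3 {j, l, m}
    + minor 4 {i, j, l, m} * minor 3 {k, l, m} = 0"
proof -
  have 1: "minor 3 {j, k, m} * minor 3 {i, l, m} + minor 3 {i, k, m} * minor 3 {j, l, m} + minor 3 {i, j, m} * minor 3 {k, l, m} = 0"
    using assms by (rule minor_3_3)
  have 2: "minor 3 {j, k, l} * minor 3 {i, m, l} + minor 3 {i, k, l} * minor 3 {j, m, l} + minor 3 {i, j, l} * minor 3 {k, m, l} = 0"
    using assms by (intro minor_3_3) auto
  have "minor 4 {j, k, l, m} * minor 3 {i, l, m} + minor 4 {i, k, l, m} * minor 3 {j, l, m}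
      + minor 4 {i, j, l, m} * minor 3 {k, l, m} =
    ent l 4 * (minor 3 {j, k, m} * minor 3 {i, l, m} + minor 3 {i, k, m} * minor 3 {j, l, m} + minor 3 {i, j, m} * minor 3 {k, l, m}) +
    ent m 4 * (minor 3 {j, k, l} * minor 3 {i, m, l} + minor 3 {i, k, l} * minor 3 {j, m, l} + minor 3 {i, j, l} * minor 3 {k, m, l})"
    using assms by (simp add: minor_4 algebra_simps insert_commute)
  then show ?thesis by (simp only: 1 2 mult_zero_right add_0)
qed

text \<open>The product of the minors on the first 4, 3, 2, 1 and 1 rows, whose columns are the
  columns of a tableau.\<close>

definition bidet :: "nat \<Rightarrow> nat set \<Rightarrow> nat set \<Rightarrow> nat \<Rightarrow> nat \<Rightarrow> bit poly"
  where "bidet i P T p q = minor 4 (V - {i}) * minor 3 (V - P) * minor 2 T * ent p 1 * ent q 1"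

text \<open>The relations hold as identities between products of minors, hence after any additive
  map to the field. The maps \<open>L\<close> used later extract sums of coefficients.\<close>

lemma three_relations_bidet:
  assumes L: "\<And>p q. L (p + q) = L p + (L q :: bit)" "L 0 = 0"
  shows "three_relations (\<lambda>i P T p q. L (bidet i P T p q))"
proof (rule three_relations.intro)
  fix y assume "y \<in> V"
  show "two_relations (\<lambda>i P T x. L (bidet i P T x y))"
  proof (rule two_relations.intro)
    fix i j k l m T x assume f: "five i j k l m"
    have g: "five i j k l m" "five j i k l m" "five k i j l m"
      "five j k i l m" "five i k j l m" "five i j k l m" using f by (auto simp: five_def)
    have "bidet i {j, k} T x y + bidet j {i, k} T x y + bidet k {i, j} T x y =
      (minor 4 {j, k, l, m} * minor 3 {i, l, m} + minor 4 {i, k, l, m} * minor 3 {j, l, m}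
        + minor 4 {i, j, l, m} * minor 3 {k, l, m}) * minor 2 T * ent x 1 * ent y 1"
      by (simp add: bidet_def V_minus_one[OF g(1)] V_minus_one[OF g(2)] V_minus_one[OF g(3)]
          V_minus_two[OF g(4)] V_minus_two[OF g(5)] V_minus_two[OF g(6)] distrib_right)
    also have "\<dots> = 0" using f by (subst minor_3_4) (auto simp: five_def)
    finally show "L (bidet i {j, k} T x y) + L (bidet j {i, k} T x y) + L (bidet k {i, j} T x y) = 0"
      by (metis L)
  next
    fix i j l a b c x assume f: "five j l a b c"
    have g: "five j a l b c" "five j b l a c" "five j c l a b" using f by (auto simp: five_def)
    have "bidet i {j, a} {a, l} x y + bidet i {j, b} {b, l} x y + bidet i {j, c} {c, l} x y =
      minor 4 (V - {i}) * (minor 3 {l, b, c} * minor 2 {a, l} + minor 3 {l, a, c} * minor 2 {b, l} + minor 3 {l, a, b} * minor 2 {c, l})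
        * ent x 1 * ent y 1"
      by (simp add: bidet_def V_minus_two[OF g(1)] V_minus_two[OF g(2)] V_minus_two[OF g(3)] algebra_simps)
    also have "\<dots> = 0" using f by (subst minor_2_3) (auto simp: five_def)
    finally show "L (bidet i {j, a} {a, l} x y) + L (bidet i {j, b} {b, l} x y) + L (bidet i {j, c} {c, l} x y) = 0"
      by (metis L)
  next
    fix i j a b c e x assume f: "five j a b c e"
    have g: "five j a b c e" "five j b a c e" "five j c a b e" "five j e a b c" using f by (auto simp: five_def)
    have "bidet i {j, a} {j, a} x y + bidet i {j, b} {j, b} x y + bidet i {j, c} {j, c} x y + bidet i {j, e} {j, e} x y =
      minor 4 (V - {i}) * (minor 3 {b, c, e} * minor 2 {j, a} + minor 3 {a, c, e} * minor 2 {j, b} + minor 3 {a, b, e} * minor 2 {j, c}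
      + minor 3 {a, b, c} * minor 2 {j, e}) * ent x 1 * ent y 1"
      by (simp add: bidet_def V_minus_two[OF g(1)] V_minus_two[OF g(2)] V_minus_two[OF g(3)] V_minus_two[OF g(4)] algebra_simps)
    also have "\<dots> = 0" using f by (subst minor_2_3') (auto simp: five_def)
    finally show "L (bidet i {j, a} {j, a} x y) + L (bidet i {j, b} {j, b} x y) + L (bidet i {j, c} {j, c} x y)
        + L (bidet i {j, e} {j, e} x y) = 0"
      by (metis L)
  qed
next
  fix i P a b c d' e y assume f: "five a b c d' e"
  have "bidet i P {b, c} a y + bidet i P {a, c} b y + bidet i P {a, b} c y =
    minor 4 (V - {i}) * minor 3 (V - P) * (minor 2 {b, c} * ent a 1 + minor 2 {a, c} * ent b 1 + minor 2 {a, b} * ent c 1) * ent y 1"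
    by (simp add: bidet_def algebra_simps)
  also have "\<dots> = 0" using f by (subst minor_1_2) (auto simp: five_def)
  finally show "L (bidet i P {b, c} a y) + L (bidet i P {a, c} b y) + L (bidet i P {a, b} c y) = 0"
    by (metis L)
qed (simp add: bidet_def ac_simps)

subsection \<open>Leading degrees\<close>

fun ldeg :: "nat \<Rightarrow> nat set \<Rightarrow> nat" where
  "ldeg 0 S = 0"
| "ldeg (Suc k) S = 12 ^ (5 * Suc k + Max S) + ldeg k (S - {Max S})"

text \<open>The leading term puts the largest letter into the last row and continues so upwards. Any
  other choice for the last row loses a factor of 12 in its power, and the rows before it contribute
  less than the smallest power of the last row.\<close>

lemma degree_minor:
  assumes "S \<subseteq> V" "card S = k"
  shows "minor k S \<noteq> 0 \<and> degree (minor k S) = ldeg k S \<and> ldeg k S < 12 ^ (5 * k + 6)"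
  using assms
proof (induction k arbitrary: S)
  case (Suc k)
  then have fin: "finite S" "S \<noteq> {}" by (auto intro: card_ge_0_finite)
  define m where "m = Max S"
  have m: "m \<in> S" "\<And>a. a \<in> S \<Longrightarrow> a \<le> m" using fin by (auto simp: m_def)
  have bd: "1 \<le> a" "a \<le> 5" if "a \<in> S" for a using that Suc.prems by (auto simp: V_def)
  have IH: "minor k (S - {a}) \<noteq> 0" "degree (minor k (S - {a})) = ldeg k (S - {a})" "ldeg k (S - {a}) < 12 ^ (5 * k + 6)"
    if "a \<in> S" for a
    using Suc.IH[of "S - {a}"] Suc.prems that fin by (auto simp: card_Diff_singleton)
  have deg: "degree (ent a (Suc k) * minor k (S - {a})) = 12 ^ (5 * Suc k + a) + ldeg k (S - {a})"
    and nz: "ent a (Suc k) * minor k (S - {a}) \<noteq> 0" if "a \<in> S" for a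
    using IH[OF that] by (auto simp: ent_def degree_mult_eq degree_monom_eq)
  let ?r = "\<Sum>a\<in>S - {m}. ent a (Suc k) * minor k (S - {a})"
  have less: "degree ?r < 12 ^ (5 * Suc k + m)"
  proof (rule degree_sum_less)
    fix a assume a: "a \<in> S - {m}"
    then have "a < m" using m(2)[of a] by auto
    have "degree (ent a (Suc k) * minor k (S - {a})) < 12 ^ (5 * Suc k + a) + 12 ^ (5 * k + 6)"
      using deg[of a] IH(3)[of a] a by simp
    also have "(12 :: nat) ^ (5 * k + 6) \<le> 12 ^ (5 * Suc k + a)"
      using bd[of a] a by (intro power_increasing) auto
    also have "(12 :: nat) ^ (5 * Suc k + a) + 12 ^ (5 * Suc k + a) \<le> 12 ^ (5 * Suc k + Suc a)"
      unfolding add_Suc_right power_Suc by simp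
    also have "\<dots> \<le> 12 ^ (5 * Suc k + m)"
      using \<open>a < m\<close> by (intro power_increasing) auto
    finally show "degree (ent a (Suc k) * minor k (S - {a})) < 12 ^ (5 * Suc k + m)" by simp
  qed simp
  have eq: "minor (Suc k) S = ent m (Suc k) * minor k (S - {m}) + ?r"
    using fin m(1) by (simp add: sum.remove)
  have "degree ?r < degree (ent m (Suc k) * minor k (S - {m}))"
    using less deg[OF m(1)] by linarith
  then have d: "degree (minor (Suc k) S) = 12 ^ (5 * Suc k + m) + ldeg k (S - {m})"
    unfolding eq using deg[OF m(1)] by (simp only: degree_add_eq_left)
  then have "minor (Suc k) S \<noteq> 0"
    by (metis add_is_0 degree_0 power_not_zero zero_neq_numeral)
  moreover have "ldeg (Suc k) S < 12 ^ (5 * Suc k + 6)"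
  proof -
    have "ldeg (Suc k) S < 12 ^ (5 * Suc k + m) + 12 ^ (5 * k + 6)"
      using IH(3)[OF m(1)] by (simp add: m_def)
    also have "(12 :: nat) ^ (5 * Suc k + m) \<le> 12 ^ (5 * Suc k + 5)"
      using bd[OF m(1)] by (intro power_increasing) auto
    also have "(12 :: nat) ^ (5 * k + 6) \<le> 12 ^ (5 * Suc k + 5)"
      by (intro power_increasing) auto
    also have "(12 :: nat) ^ (5 * Suc k + 5) + 12 ^ (5 * Suc k + 5) \<le> 12 ^ (5 * Suc k + 6)"
      by (simp add: power_add)
    finally show ?thesis by simp
  qed
  ultimately show ?case using d by (simp add: m_def)
qed simp

text \<open>At most eleven summands produce no carries in base 12. Comparing the largest exponents
  is enough, as the whole sum stays below the next power.\<close>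

lemma sum_powers_eq:
  fixes xs ys :: "nat list"
  assumes "length xs = length ys" "length xs \<le> 11" "sorted_wrt (\<ge>) xs" "sorted_wrt (\<ge>) ys"
    "(\<Sum>x\<leftarrow>xs. 12 ^ x) = (\<Sum>y\<leftarrow>ys. 12 ^ y :: nat)"
  shows "xs = ys"
  using assms
proof (induction xs ys rule: list_induct2)
  case (Cons x xs y ys)
  have small: "(\<Sum>x\<leftarrow>xs. 12 ^ x) < (12 ^ y :: nat)"
    if "x < y" "\<forall>z\<in>set xs. z \<le> x" "length xs \<le> 11" for x y :: nat and xs
  proof -
    have "(\<Sum>x\<leftarrow>xs. 12 ^ x) \<le> (\<Sum>_\<leftarrow>xs. 12 ^ x :: nat)"
      using that by (intro sum_list_mono power_increasing) auto
    also have "\<dots> \<le> 11 * 12 ^ x" using that by (simp add: sum_list_triv)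
    also have "\<dots> < (12 ^ Suc x :: nat)" by simp
    also have "\<dots> \<le> 12 ^ y" using that by (intro power_increasing) auto
    finally show ?thesis .
  qed
  have "\<not> x < y" using small[of x y "x # xs"] Cons.prems by auto
  moreover have "\<not> y < x" using small[of y x "y # ys"] Cons.prems Cons.hyps by auto
  ultimately have "x = y" by simp
  then show ?case using Cons by simp
qed simp

definition top_row :: "nat \<Rightarrow> nat \<Rightarrow> nat"
  where "top_row i r = (if r < i then r else Suc r)"

lemma ldeg_insert:
  assumes "finite S" "\<And>y. y \<in> S \<Longrightarrow> y < x"
  shows "ldeg (Suc k) (insert x S) = 12 ^ (5 * Suc k + x) + ldeg k S"
proof -
  have "Max (insert x S) = x" using assms by (intro Max_eqI) (auto intro: less_imp_le)
  moreover have "insert x S - {x} = S" using assms by auto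
  ultimately show ?thesis by simp
qed

lemma ldeg_1: "ldeg (Suc 0) {a} = 12 ^ (5 + a)"
  by (simp add: ldeg_insert)

lemma ldeg_2: "a < b \<Longrightarrow> ldeg 2 {a, b} = 12 ^ (10 + b) + 12 ^ (5 + a)"
proof -
  assume "a < b"
  then have "ldeg (Suc (Suc 0)) (insert b {a}) = 12 ^ (5 * Suc (Suc 0) + b) + ldeg (Suc 0) {a}"
    by (intro ldeg_insert) auto
  then show ?thesis by (simp only: ldeg_1 insert_commute numeral_2_eq_2 mult_Suc_right mult_0_right) simp
qed

lemma ldeg_3: "a < b \<Longrightarrow> b < c \<Longrightarrow> ldeg 3 {a, b, c} = 12 ^ (15 + c) + 12 ^ (10 + b) + 12 ^ (5 + a)"
proof -
  assume "a < b" "b < c"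
  then have "ldeg (Suc 2) (insert c {a, b}) = 12 ^ (5 * Suc 2 + c) + ldeg 2 {a, b}"
    by (intro ldeg_insert) auto
  moreover have "insert c {a, b} = {a, b, c}" by auto
  ultimately show ?thesis using ldeg_2[OF \<open>a < b\<close>] by (simp del: ldeg.simps)
qed

lemma ldeg_4: "a < b \<Longrightarrow> b < c \<Longrightarrow> c < d \<Longrightarrow>
  ldeg 4 {a, b, c, d} = 12 ^ (20 + d) + 12 ^ (15 + c) + 12 ^ (10 + b) + 12 ^ (5 + a)"
proof -
  assume "a < b" "b < c" "c < d"
  then have "ldeg (Suc 3) (insert d {a, b, c}) = 12 ^ (5 * Suc 3 + d) + ldeg 3 {a, b, c}"
    by (intro ldeg_insert) auto
  moreover have "insert d {a, b, c} = {a, b, c, d}" by auto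
  ultimately show ?thesis using ldeg_3[OF \<open>a < b\<close> \<open>b < c\<close>] by (simp del: ldeg.simps)
qed

text \<open>The exponents of the eleven entries in the leading term, row by row from the fourth to
  the first and each row from right to left. For a tableau this order is decreasing, as
  \<open>sum_powers_eq\<close> requires.\<close>

fun labels :: "nat \<times> nat \<times> nat \<times> nat \<times> nat \<times> nat \<times> nat \<Rightarrow> nat list" where
  "labels (i, j, k, l, m, p, q) =
    [20 + top_row i 4, 15 + high j k, 15 + top_row i 3, 10 + m, 10 + mid j k, 10 + top_row i 2,
     5 + q, 5 + p, 5 + l, 5 + low j k, 5 + top_row i 1]"

fun dg :: "nat \<times> nat \<times> nat \<times> nat \<times> nat \<times> nat \<times> nat \<Rightarrow> nat" where
  "dg u = (\<Sum>x\<leftarrow>labels u. 12 ^ x)"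

fun tableau_bidet :: "nat \<times> nat \<times> nat \<times> nat \<times> nat \<times> nat \<times> nat \<Rightarrow> bit poly" where
  "tableau_bidet (i, j, k, l, m, p, q) = bidet i {j, k} {l, m} p q"

lemma V_minus_i: "i \<in> V \<Longrightarrow> V - {i} = {top_row i 1, top_row i 2, top_row i 3, top_row i 4}"
  by (auto simp: V_letters top_row_def)

lemma V_minus_jk: "j \<in> V \<Longrightarrow> k \<in> V \<Longrightarrow> j < k \<Longrightarrow> V - {j, k} = {low j k, mid j k, high j k}"
  and low_mid_high: "j \<in> V \<Longrightarrow> k \<in> V \<Longrightarrow> j < k \<Longrightarrow> low j k < mid j k \<and> mid j k < high j k \<and> high j k \<le> 5"
proof -
  have VV: "set [1..<6] = V" by (auto simp: V_def)
  have *: "\<forall>j\<in>set [1..<6]. \<forall>k\<in>set [1..<6]. j < k \<longrightarrow> set [1..<6] - {j, k} = {low j k, mid j k, high j k} \<and>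
      low j k < mid j k \<and> mid j k < high j k \<and> high j k \<le> 5"
    by code_simp
  note * = *[unfolded VV, rule_format]
  show "j \<in> V \<Longrightarrow> k \<in> V \<Longrightarrow> j < k \<Longrightarrow> V - {j, k} = {low j k, mid j k, high j k}"
    using *[of j k] by blast
  show "j \<in> V \<Longrightarrow> k \<in> V \<Longrightarrow> j < k \<Longrightarrow> low j k < mid j k \<and> mid j k < high j k \<and> high j k \<le> 5"
    using *[of j k] by blast
qed

lemma degree_tableau:
  assumes "u \<in> tableaux"
  shows "tableau_bidet u \<noteq> 0" "degree (tableau_bidet u) = dg u"
proof -
  obtain i j k l m p q where u: "u = (i, j, k, l, m, p, q)" by (cases u)
  have V: "i \<in> V" "j \<in> V" "k \<in> V" "l \<in> V" "m \<in> V" "p \<in> V" "q \<in> V" "j < k" "l < m"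
    using assms by (auto simp: u tableaux_def)
  have c: "card (V - {i}) = 4" "card (V - {j, k}) = 3" "card {l, m} = 2"
    using V by (simp_all add: card_V card_Diff_subset)
  have 1: "minor 4 (V - {i}) \<noteq> 0" "degree (minor 4 (V - {i})) = ldeg 4 (V - {i})"
    and 2: "minor 3 (V - {j, k}) \<noteq> 0" "degree (minor 3 (V - {j, k})) = ldeg 3 (V - {j, k})"
    and 3: "minor 2 {l, m} \<noteq> 0" "degree (minor 2 {l, m}) = ldeg 2 {l, m}"
    using degree_minor[OF _ c(1)] degree_minor[OF _ c(2)] degree_minor[OF _ c(3)] V by auto
  have 4: "ldeg 4 (V - {i}) = 12 ^ (20 + top_row i 4) + 12 ^ (15 + top_row i 3) + 12 ^ (10 + top_row i 2) + 12 ^ (5 + top_row i 1)"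
    unfolding V_minus_i[OF V(1)] by (rule ldeg_4) (simp_all add: top_row_def)
  have 5: "ldeg 3 (V - {j, k}) = 12 ^ (15 + high j k) + 12 ^ (10 + mid j k) + 12 ^ (5 + low j k)"
    unfolding V_minus_jk[OF V(2,3,8)] using low_mid_high[OF V(2,3,8)] by (intro ldeg_3) auto
  have 6: "ent a 1 \<noteq> 0" "degree (ent a 1) = 12 ^ (5 + a)" for a
    by (simp_all add: ent_def degree_monom_eq)
  show "tableau_bidet u \<noteq> 0"
    using 1 2 3 6 by (simp add: u bidet_def)
  show "degree (tableau_bidet u) = dg u"
    using 1 2 3 6 V by (simp add: u bidet_def degree_mult_eq 4 5 ldeg_2)
qed

lemma inj_dg: "inj_on dg tableaux"
proof (rule inj_onI)
  fix u u' assume U: "u \<in> tableaux" "u' \<in> tableaux" "dg u = dg u'"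
  have sorted: "sorted_wrt (\<ge>) (labels v)" if "v \<in> tableaux" for v
  proof -
    obtain i j k l m p q where v: "v = (i, j, k, l, m, p, q)" by (cases v)
    have t: "i \<in> V" "j \<in> V" "k \<in> V" "l \<in> V" "m \<in> V" "p \<in> V" "q \<in> V" "j < k" "l < m"
      "j \<le> i" "low j k \<le> l" "mid j k \<le> m" "l \<le> p" "p \<le> q" using that by (auto simp: v tableaux_def)
    have bd: "1 \<le> x" "x \<le> 5" if "x \<in> V" for x using that by (auto simp: V_def)
    have "top_row i 1 \<le> low j k" "top_row i 2 \<le> mid j k" "top_row i 3 \<le> high j k"
      using t(8,10) bd[OF t(2)] bd[OF t(3)] by (auto simp: top_row_def low_def mid_def high_def)
    moreover have "1 \<le> top_row i 1" "top_row i 1 < top_row i 2" "top_row i 2 < top_row i 3" "top_row i 3 < top_row i 4"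
      by (auto simp: top_row_def)
    ultimately show ?thesis
      using t low_mid_high[OF t(2,3,8)] bd[OF t(7)] bd[OF t(5)] by (simp add: v)
  qed
  have len: "length (labels v) = 11" for v by (cases v) simp
  obtain i j k l m p q where u: "u = (i, j, k, l, m, p, q)" by (cases u)
  obtain i' j' k' l' m' p' q' where u': "u' = (i', j', k', l', m', p', q')" by (cases u')
  have "labels u = labels u'"
    using U(3) by (intro sum_powers_eq sorted U) (simp_all add: len del: labels.simps)
  then have eq: "top_row i 1 = top_row i' 1" "top_row i 2 = top_row i' 2" "top_row i 3 = top_row i' 3" "top_row i 4 = top_row i' 4"
    and eq': "low j k = low j' k'" "mid j k = mid j' k'" "high j k = high j' k'" and "l = l'" "m = m'" "p = p'" "q = q'"
    by (simp_all add: u u')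
  have V: "i \<in> V" "j \<in> V" "k \<in> V" "i' \<in> V" "j' \<in> V" "k' \<in> V" "j < k" "j' < k'"
    using U by (auto simp: u u' tableaux_def)
  have "V - {i} = V - {i'}" unfolding V_minus_i[OF V(1)] V_minus_i[OF V(4)] by (simp only: eq)
  then have "i = i'" using V by blast
  have "V - {j, k} = V - {j', k'}" unfolding V_minus_jk[OF V(2,3,7)] V_minus_jk[OF V(5,6,8)] by (simp add: eq')
  then have "{j, k} = {j', k'}" using V by blast
  then have "j = j'" "k = k'" using V(7,8) by (auto simp: doubleton_eq_iff)
  with \<open>i = i'\<close> \<open>l = l'\<close> \<open>m = m'\<close> \<open>p = p'\<close> \<open>q = q'\<close> show "u = u'" by (simp add: u u')
qed

subsection \<open>Counting functionals in five variables\<close>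

lemma finite_tableaux: "finite tableaux"
proof (rule finite_subset)
  show "tableaux \<subseteq> V \<times> V \<times> V \<times> V \<times> V \<times> V \<times> V" by (auto simp: tableaux_def)
qed simp

fun tableau_word :: "nat \<times> nat \<times> nat \<times> nat \<times> nat \<times> nat \<times> nat \<Rightarrow> poly2" where
  "tableau_word (i, j, k, l, m, p, q) = word i {j, k} {l, m} p q"

lemma K_42_eq_zero:
  assumes K: "\<phi> \<in> K 5 42" and zero: "\<And>u. u \<in> tableaux \<Longrightarrow> \<phi> (tableau_word u) = 0"
  shows "\<phi> f = 0"
proof -
  interpret degree_42 \<phi> by unfold_locales (rule K)
  have "w i P T p q = 0" for i P T p q
  proof (cases "i \<in> V \<and> P \<in> P2 V \<and> T \<in> P2 V \<and> p \<in> V \<and> q \<in> V")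
    case True
    show ?thesis
    proof (rule three_relations.zero_on_tableaux[OF three_relations_w])
      fix i j k l m p q assume "(i, j, k, l, m, p, q) \<in> tableaux"
      then show "w i {j, k} {l, m} p q = 0" using zero by (force simp: w_def)
    qed (use True in auto)
  qed (auto simp: w_def)
  then show ?thesis by (rule words_determine)
qed

definition support :: "(poly2 \<Rightarrow> bit) \<Rightarrow> (nat \<times> nat \<times> nat \<times> nat \<times> nat \<times> nat \<times> nat) set"
  where "support \<phi> = {u \<in> tableaux. \<phi> (tableau_word u) = 1}"

lemma inj_support: "inj_on support (K 5 42)"
proof (rule inj_onI)
  fix \<phi> \<psi> assume K: "\<phi> \<in> K 5 42" "\<psi> \<in> K 5 42" "support \<phi> = support \<psi>"
  have "\<phi> (tableau_word u) = \<psi> (tableau_word u)" if "u \<in> tableaux" for u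
    using K(3)[unfolded support_def set_eq_iff, rule_format, of u] that
    by (cases "\<phi> (tableau_word u)"; cases "\<psi> (tableau_word u)") simp_all
  then have "\<phi> f + \<psi> f = 0" for f
    using K_42_eq_zero[of "\<lambda>f. \<phi> f + \<psi> f"] K_add[OF K(1,2)] by simp
  then have "\<phi> f = \<psi> f" for f by (simp only: bit_add_eq_0)
  then show "\<phi> = \<psi>" by (rule ext)
qed

text \<open>Sums of coefficients of bideterminants are word functions, so each set of tableaux
  yields an invariant functional. The chosen coefficients are those at the leading degrees of the
  tableaux in the set.\<close>

definition realize :: "(nat \<times> nat \<times> nat \<times> nat \<times> nat \<times> nat \<times> nat) set \<Rightarrow> poly2 \<Rightarrow> bit"
  where "realize U = three_relations.\<Phi> (\<lambda>i P T p q. \<Sum>u\<in>U. coeff (bidet i P T p q) (dg u))"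

lemma realize:
  shows "realize U \<in> K 5 42"
    and "u \<in> tableaux \<Longrightarrow> realize U (tableau_word u) = (\<Sum>v\<in>U. coeff (tableau_bidet u) (dg v))"
proof -
  interpret three_relations "\<lambda>i P T p q. \<Sum>u\<in>U. coeff (bidet i P T p q) (dg u)"
    by (rule three_relations_bidet[of "\<lambda>p. \<Sum>u\<in>U. coeff p (dg u)"]) (simp_all add: sum.distrib)
  show "realize U \<in> K 5 42" unfolding realize_def by (rule \<Phi>_K)
  show "realize U (tableau_word u) = (\<Sum>v\<in>U. coeff (tableau_bidet u) (dg v))" if "u \<in> tableaux"
  proof -
    obtain i j k l m p q where u: "u = (i, j, k, l, m, p, q)" by (cases u)
    show ?thesis using that unfolding realize_def u tableau_word.simps
      by (subst \<Phi>_word) (auto simp: tableaux_def pair_P2 simp del: dg.simps)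
  qed
qed

text \<open>Triangularity. Take the tableau \<open>u\<close> of least leading degree in the
  symmetric difference. At the degrees of the other tableaux of the difference its bideterminant has
  coefficient zero, so on the word of \<open>u\<close> the two functionals differ by the leading
  coefficient.\<close>

lemma inj_realize: "inj_on realize (Pow tableaux)"
proof (rule inj_onI, rule ccontr)
  fix U U' assume U: "U \<in> Pow tableaux" "U' \<in> Pow tableaux" "realize U = realize U'" "U \<noteq> U'"
  define D where "D = (U - U') \<union> (U' - U)"
  have fin: "finite U" "finite U'" using U finite_tableaux by (auto intro: finite_subset)
  then have D: "finite D" "D \<noteq> {}" "D \<subseteq> tableaux" using U by (auto simp: D_def)
  define u where "u = arg_min_on dg D"
  have u: "u \<in> D" "\<And>v. v \<in> D \<Longrightarrow> dg u \<le> dg v"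
    using arg_min_if_finite[OF D(1,2), of dg] by (auto simp: u_def not_less)
  let ?c = "\<lambda>v. coeff (tableau_bidet u) (dg v)"
  have uT: "u \<in> tableaux" using u(1) D(3) by auto
  have zero: "?c v = 0" if "v \<in> D - {u}" for v
  proof (rule coeff_eq_0)
    have "dg u \<noteq> dg v" using inj_dg uT that D(3) by (auto simp: inj_on_def)
    then show "degree (tableau_bidet u) < dg v"
      using u(2)[of v] that degree_tableau(2)[OF uT] by simp
  qed
  have "sum ?c U + sum ?c U' = sum ?c D"
  proof -
    have "sum ?c U = sum ?c (U \<inter> U') + sum ?c (U - U')" "sum ?c U' = sum ?c (U \<inter> U') + sum ?c (U' - U)"
      using sum.Int_Diff[OF fin(1), of ?c U'] sum.Int_Diff[OF fin(2), of ?c U] by (simp_all only: Int_commute)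
    moreover have "sum ?c D = sum ?c (U - U') + sum ?c (U' - U)"
      unfolding D_def using fin by (intro sum.union_disjoint) auto
    ultimately show ?thesis by (simp only: ac_simps bit_add_self bit_add_self' add_0_right add_0_left)
  qed
  moreover have "sum ?c U = sum ?c U'" using U(3) realize(2)[OF uT] by metis
  ultimately have "sum ?c D = 0" by (simp only: bit_add_self)
  moreover have "sum ?c D = ?c u" using D(1) u(1) zero by (subst sum.remove[of _ u]) simp_all
  moreover have "?c u \<noteq> 0" using degree_tableau[OF uT] by (metis leading_coeff_0_iff)
  ultimately show False by simp
qed

lemma finite_K_42: "finite (K 5 42)"
  using inj_support by (rule inj_on_finite[of _ _ "Pow tableaux"]) (auto simp: support_def finite_tableaux)

lemma card_K_42_tableaux: "card (K 5 42) = 2 ^ card tableaux"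
proof (rule antisym)
  have "card (K 5 42) \<le> card (Pow tableaux)"
    using inj_support by (rule card_inj_on_le) (auto simp: support_def finite_tableaux)
  then show "card (K 5 42) \<le> 2 ^ card tableaux" by (simp add: card_Pow finite_tableaux)
  have "card (Pow tableaux) \<le> card (K 5 42)"
    using inj_realize by (rule card_inj_on_le) (auto simp: realize finite_K_42)
  then show "2 ^ card tableaux \<le> card (K 5 42)" by (simp add: card_Pow finite_tableaux)
qed

lemma card_pairs:
  assumes "finite A" "\<And>x. x \<in> A \<Longrightarrow> finite (B x)"
  shows "card {(x, y). x \<in> A \<and> P x \<and> y \<in> B x} = (\<Sum>x\<in>A. if P x then card (B x) else 0)"
proof -
  have "{(x, y). x \<in> A \<and> P x \<and> y \<in> B x} = (SIGMA x:{x \<in> A. P x}. B x)" by auto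
  then show ?thesis using assms by (simp add: sum.inter_filter)
qed

lemma finite_pairs: "finite A \<Longrightarrow> (\<And>x. x \<in> A \<Longrightarrow> finite (B x)) \<Longrightarrow> finite {(x, y). x \<in> A \<and> P x \<and> y \<in> B x}"
  by (rule finite_subset[of _ "SIGMA x:A. B x"]) auto

lemma card_tableaux: "card tableaux = 2520"
proof -
  \<comment> \<open>The number of pairs of letters \<open>p \<le> q\<close> with
    \<open>l \<le> p\<close>: triangular numbers.\<close>
  have cnt: "\<forall>l\<in>set [1..<6]. (\<Sum>p\<in>set [1..<6]. if l \<le> p then \<Sum>q\<in>set [1..<6]. if p \<le> q then 1 else 0 else 0) =
      (if l = 1 then 15 else if l = 2 then 10 else if l = 3 then 6 else if l = 4 then 3 else (1 :: nat))"
    by code_simp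
  have VV: "set [1..<6] = V" by (auto simp: V_def)
  have eq: "tableaux = {(i, y). i \<in> V \<and> True \<and> y \<in> {(j, y). j \<in> V \<and> j \<le> i \<and> y \<in> {(k, y). k \<in> V \<and> j < k \<and> y \<in>
      {(l, y). l \<in> V \<and> low j k \<le> l \<and> y \<in> {(m, y). m \<in> V \<and> (l < m \<and> mid j k \<le> m) \<and> y \<in>
      {(p, q). p \<in> V \<and> l \<le> p \<and> q \<in> {q \<in> V. p \<le> q}}}}}}}"
    by (auto simp: tableaux_def)
  have last: "card {q \<in> V. p \<le> q} = (\<Sum>q\<in>V. if p \<le> q then 1 else 0)" for p
    by (simp add: sum.inter_filter[symmetric])
  have "card tableaux = (\<Sum>i\<in>V. if True then (\<Sum>j\<in>V. if j \<le> i then (\<Sum>k\<in>V. if j < k then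
      (\<Sum>l\<in>V. if low j k \<le> l then (\<Sum>m\<in>V. if l < m \<and> mid j k \<le> m then
        (\<Sum>p\<in>V. if l \<le> p then \<Sum>q\<in>V. if p \<le> q then 1 else 0 else 0) else 0) else 0) else 0) else 0) else 0)"
    unfolding eq by (simp only: card_pairs finite_pairs finite_V finite_Collect_conjI disjI1 last Collect_mem_eq)
  also have "\<dots> = (\<Sum>i\<in>V. \<Sum>j\<in>V. if j \<le> i then (\<Sum>k\<in>V. if j < k then
      (\<Sum>l\<in>V. if low j k \<le> l then (\<Sum>m\<in>V. if l < m \<and> mid j k \<le> m then
        (if l = 1 then 15 else if l = 2 then 10 else if l = 3 then 6 else if l = 4 then 3 else 1) else 0) else 0) else 0) else 0)"
    unfolding if_True by (intro sum.cong if_cong refl cnt[unfolded VV, rule_format])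
  also have "\<dots> = 2520" unfolding VV[symmetric] by code_simp
  finally show ?thesis .
qed

theorem card_K_42: "card (K 5 42) = 2 ^ 2520"
  using card_K_42_tableaux by (simp only: card_tableaux)

subsection \<open>Vanishing layers in the degrees of the sequence\<close>

text \<open>Shifted by 5, the sequence is geometric with first term 42 + 5. This is the number that
  Wood's criterion compares with sums of powers of two.\<close>

lemma deg_seq_add: "deg_seq d + 5 = 47 * 2 ^ d"
proof -
  obtain m where "(2 :: nat) ^ d = Suc m" by (cases "(2 :: nat) ^ d") auto
  then show ?thesis by (simp add: deg_seq_def)
qed

lemma deg_seq_0: "deg_seq 0 = 42"
  by (simp add: deg_seq_def)

lemma deg_seq_Suc: "deg_seq (Suc d) = 5 + 2 * deg_seq d"
  using deg_seq_add[of d] deg_seq_add[of "Suc d"] by simp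

lemma deg_seq_pos: "0 < deg_seq d"
  using deg_seq_add[of d] one_le_power[of "2 :: nat" d] by linarith

lemma power_two_le_46:
  assumes "2 ^ a \<le> (46 :: nat)"
  shows "2 ^ a \<in> {1, 2, 4, 8, 16, 32 :: nat}"
proof -
  have "a < 6"
  proof (rule ccontr)
    assume "\<not> a < 6"
    then have "(2 :: nat) ^ 6 \<le> 2 ^ a" by (intro power_increasing) auto
    with assms show False by simp
  qed
  then have "a \<in> {0, 1, 2, 3, 4, 5}" by auto
  then show ?thesis by auto
qed

lemma even_power_two: "even (2 ^ a :: nat) \<longleftrightarrow> a \<noteq> 0"
  by simp

lemma not_one_power: "47 * 2 ^ d \<noteq> 2 ^ a + (1 :: nat)"
proof
  assume eq: "47 * 2 ^ d = 2 ^ a + (1 :: nat)"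
  show False
  proof (cases d)
    case 0
    then have "2 ^ a = (46 :: nat)" using eq by simp
    with power_two_le_46[of a] show False by auto
  next
    case (Suc d')
    then have "even (2 ^ a + (1 :: nat))" unfolding eq[symmetric] by simp
    then have "2 ^ a = (1 :: nat)" by (simp add: even_power_two)
    with eq one_le_power[of "2 :: nat" d] show False by linarith
  qed
qed

lemma not_two_powers: "47 * 2 ^ d \<noteq> 2 ^ a + 2 ^ b + (1 :: nat)"
proof
  assume eq: "47 * 2 ^ d = 2 ^ a + 2 ^ b + (1 :: nat)"
  show False
  proof (cases d)
    case 0
    then have eq: "2 ^ a + 2 ^ b = (46 :: nat)" using eq by simp
    then show False using power_two_le_46[of a] power_two_le_46[of b] by auto
  next
    case (Suc d')
    then have "even (2 ^ a + 2 ^ b + (1 :: nat))" unfolding eq[symmetric] by simp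
    then have "(a = 0) \<noteq> (b = 0)" by (auto simp: even_power_two)
    then obtain c where "2 ^ a + 2 ^ b = 1 + (2 ^ Suc c :: nat)"
      by (cases a; cases b) auto
    then have "47 * 2 ^ d' = 2 ^ c + (1 :: nat)" using eq Suc by simp
    then show False using not_one_power by blast
  qed
qed

text \<open>For \<open>d = 0\<close> the number 46 has four binary digits 1. For larger
  \<open>d\<close> parity forces one or all three exponents to be zero: all three give a number that
  is too small, and one leads, after halving, to two powers and a smaller \<open>d\<close>.\<close>

lemma not_three_powers: "47 * 2 ^ d \<noteq> 2 ^ a + 2 ^ b + 2 ^ c + (1 :: nat)"
proof
  assume eq: "47 * 2 ^ d = 2 ^ a + 2 ^ b + 2 ^ c + (1 :: nat)"
  show False
  proof (cases d)
    case 0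
    then have eq: "2 ^ a + 2 ^ b + 2 ^ c = (46 :: nat)" using eq by simp
    then show False using power_two_le_46[of a] power_two_le_46[of b] power_two_le_46[of c] by auto
  next
    case (Suc d')
    then have "even (2 ^ a + 2 ^ b + 2 ^ c + (1 :: nat))" unfolding eq[symmetric] by simp
    then consider "a = 0 \<and> b = 0 \<and> c = 0" | "\<exists>p q. 2 ^ a + 2 ^ b + 2 ^ c = 1 + (2 ^ Suc p + 2 ^ Suc q :: nat)"
      by (cases a; cases b; cases c) auto
    then show False
    proof cases
      case 1
      then have "2 ^ a = (1 :: nat)" "2 ^ b = (1 :: nat)" "2 ^ c = (1 :: nat)" by simp_all
      with eq one_le_power[of "2 :: nat" d] show False by linarith
    next
      case 2
      then obtain p q where "2 ^ a + 2 ^ b + 2 ^ c = 1 + (2 ^ Suc p + 2 ^ Suc q :: nat)" by blast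
      then have "47 * 2 ^ d' = 2 ^ p + 2 ^ q + (1 :: nat)" using eq Suc by simp
      then show False using not_two_powers by blast
    qed
  qed
qed

lemma not_power_plus_two: "47 * 2 ^ d \<noteq> 2 ^ a + (2 :: nat)"
proof
  assume eq: "47 * 2 ^ d = 2 ^ a + (2 :: nat)"
  show False
  proof (cases d)
    case 0
    then have "2 ^ a = (45 :: nat)" using eq by simp
    with power_two_le_46[of a] show False by auto
  next
    case (Suc d')
    then have "even (2 ^ a + (2 :: nat))" unfolding eq[symmetric] by simp
    then obtain a' where "a = Suc a'" by (cases a) auto
    then have "47 * 2 ^ d' = 2 ^ a' + (1 :: nat)" using eq Suc by simp
    then show False using not_one_power by blast
  qed
qed

text \<open>The degree is odd and there are at most six variables, so only sizes 1 and 3 remain.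
  Wood's criterion would require \<open>47 * 2 ^ d\<close> to be \<open>2 ^ a + 2\<close>, or 1 plus
  a sum of three powers of two.\<close>

lemma layer_vanish:
  assumes \<phi>: "\<phi> \<in> K t (deg_seq (Suc d))" and t: "t \<le> 6" and T: "finite T" "card T \<noteq> 5"
  shows "\<phi> (xs T * f\<^sup>2) = 0"
proof (cases "T \<subseteq> {1..t} \<and> odd (card T)")
  case False
  have "card T + 2 * m \<noteq> deg_seq (Suc d)" if "even (card T)" for m
  proof -
    have "even (card T + 2 * m)" "odd (deg_seq (Suc d))" using that by (auto simp: deg_seq_Suc)
    then show ?thesis by metis
  qed
  with False show ?thesis using funcs_layer_zero[OF K_funcs[OF \<phi>] T(1)] by blast
next
  case True
  have "card T \<le> 6" using card_mono[of "{1..t}" T] True t by simp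
  moreover have "odd (card T)" using True by blast
  ultimately have "card T = 1 \<or> card T = 3" using T(2) by presburger
  then show ?thesis
  proof
    assume c: "card T = 1"
    then obtain a where "T = {a}" by (auto simp: card_1_singleton_iff)
    have "2 * (\<Sum>i\<in>T. 2 ^ e i) \<noteq> deg_seq (Suc d) + card T" for e :: "nat \<Rightarrow> nat"
      using \<open>T = {a}\<close> deg_seq_add[of "Suc d"] not_power_plus_two[of d "e a"] by auto
    then show ?thesis using \<phi> T(1) by (intro wood[of \<phi> t])
  next
    assume c: "card T = 3"
    then obtain a b c where abc: "T = {a, b, c}" "a \<noteq> b" "a \<noteq> c" "b \<noteq> c" by (auto simp: card_3_iff)
    have "2 * (\<Sum>i\<in>T. 2 ^ e i) \<noteq> deg_seq (Suc d) + card T" for e :: "nat \<Rightarrow> nat"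
      using abc c deg_seq_add[of "Suc d"] not_three_powers[of d "e a" "e b" "e c"] by auto
    then show ?thesis using \<phi> T(1) by (intro wood[of \<phi> t])
  qed
qed

lemma sum_Pow_empty:
  fixes g :: "nat set \<Rightarrow> bit"
  assumes "finite T" "\<And>J. J \<subseteq> T \<Longrightarrow> J \<noteq> {} \<Longrightarrow> g J = 0"
  shows "(\<Sum>J\<in>Pow T. g J) = g {}"
  using assms by (subst sum.remove[of _ "{}"]) (auto intro!: sum.neutral)

lemma K_layer_five:
  assumes \<phi>: "\<phi> \<in> K t (deg_seq (Suc d))" and t: "t \<le> 6" and T: "finite T" "card T = 5"
  shows "(\<lambda>f. \<phi> (xs T * f\<^sup>2)) \<in> K t (deg_seq d)"
proof -
  have "\<phi> (xs T * (St f)\<^sup>2) = \<phi> (xs T * f\<^sup>2)" for f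
  proof -
    have "(\<Sum>J\<in>Pow T. \<phi> (xs (T - J) * (xs J * St f)\<^sup>2)) = \<phi> (xs (T - {}) * (xs {} * St f)\<^sup>2)"
    proof (rule sum_Pow_empty[OF T(1)])
      fix J assume "J \<subseteq> T" "J \<noteq> {}"
      then have "T - J \<subset> T" by blast
      then have "card (T - J) < card T" using T(1) by (rule psubset_card_mono[rotated])
      then show "\<phi> (xs (T - J) * (xs J * St f)\<^sup>2) = 0" using \<phi> t T by (intro layer_vanish[of \<phi> t d]) auto
    qed
    then show ?thesis using K_layer[OF \<phi> T(1), of f] by simp
  qed
  moreover have "(\<lambda>f. \<phi> (xs T * f\<^sup>2)) \<in> funcs t (deg_seq d)"
    using funcs_layer[OF K_funcs[OF \<phi>] T(1), of "deg_seq d"] T(2) by (simp add: deg_seq_Suc)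
  ultimately show ?thesis by (simp add: K_def)
qed

subsection \<open>Kameko's isomorphism in five variables\<close>

lemma card_K_5_Suc: "card (K 5 (deg_seq (Suc d))) = card (K 5 (deg_seq d))"
proof -
  let ?h = "\<lambda>\<phi> f. \<phi> (xs V * f\<^sup>2)"
  have V5: "V = {1..5}" by (simp add: V_def)
  have "inj_on ?h (K 5 (deg_seq (Suc d)))"
  proof (rule inj_onI)
    fix \<phi> \<psi> assume K: "\<phi> \<in> K 5 (deg_seq (Suc d))" "\<psi> \<in> K 5 (deg_seq (Suc d))" and eq: "?h \<phi> = ?h \<psi>"
    have "\<phi> (xs T * (mono m)\<^sup>2) = \<psi> (xs T * (mono m)\<^sup>2)" if T: "finite T" for T m
    proof (cases "T = V")
      case True
      then show ?thesis using fun_cong[OF eq, of "mono m"] by simp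
    next
      case False
      have zero: "\<chi> (xs T * (mono m)\<^sup>2) = 0" if "\<chi> \<in> K 5 (deg_seq (Suc d))" for \<chi>
      proof (cases "T \<subseteq> V")
        case True
        then have "card T \<noteq> 5" using False card_subset_eq[of V T] by (auto simp: card_V)
        then show ?thesis using that T by (intro layer_vanish[of \<chi> 5 d]) auto
      next
        case False
        then show ?thesis using funcs_layer_zero[OF K_funcs[OF that] T] by (simp add: V5)
      qed
      show ?thesis using zero[OF K(1)] zero[OF K(2)] by simp
    qed
    from layer_eqI[OF funcs_additive[OF K_funcs[OF K(1)]] funcs_additive[OF K_funcs[OF K(2)]] this]
    show "\<phi> = \<psi>" by (rule ext)
  qed
  moreover have "?h ` K 5 (deg_seq (Suc d)) = K 5 (deg_seq d)"
  proof (intro equalityI subsetI)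
    fix \<psi> assume "\<psi> \<in> ?h ` K 5 (deg_seq (Suc d))"
    then show "\<psi> \<in> K 5 (deg_seq d)" using K_layer_five[of _ 5 d V] by (auto simp: card_V)
  next
    fix \<psi> assume \<psi>: "\<psi> \<in> K 5 (deg_seq d)"
    note F = K_funcs[OF \<psi>]
    let ?\<psi> = "\<lambda>T. if T = V then \<psi> else (\<lambda>f. 0)"
    have "asm ?\<psi> \<in> K 5 (deg_seq (Suc d))"
    proof (rule asm_K)
      show "additive (?\<psi> T)" for T using funcs_additive[OF F] by simp
      fix T h assume nz: "?\<psi> T (mono h) \<noteq> 0"
      then have "T = V" by (auto split: if_splits)
      with nz funcs_mono[OF F, of h] show "T \<subseteq> {1..5} \<and> Poly_Mapping.keys h \<subseteq> {1..5} \<and> card T + 2 * monom_deg h = deg_seq (Suc d)"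
        by (auto simp: V5 mons_def deg_seq_Suc)
    next
      fix T f assume T: "T \<subseteq> {1..5::nat}"
      have "(\<Sum>J\<in>Pow T. ?\<psi> (T - J) (xs J * St f)) = ?\<psi> (T - {}) (xs {} * St f)"
        using T by (intro sum_Pow_empty) (auto simp: V5 intro: finite_subset)
      then show "(\<Sum>J\<in>Pow T. ?\<psi> (T - J) (xs J * St f)) = ?\<psi> T f"
        using K_St[OF \<psi>] by simp
    qed
    moreover have "\<psi> = ?h (asm ?\<psi>)"
      using funcs_additive[OF F] by (intro ext) (simp add: asm_layer)
    ultimately show "\<psi> \<in> ?h ` K 5 (deg_seq (Suc d))" by blast
  qed
  ultimately show ?thesis by (metis card_image)
qed

lemma card_K_5: "card (K 5 (deg_seq s)) = 2 ^ 2520"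
  by (induction s) (simp_all only: card_K_5_Suc deg_seq_0 card_K_42)

subsection \<open>Six variables\<close>

definition W :: "nat set"
  where "W = {1..6}"

lemma finite_W [simp]: "finite W" and card_W: "card W = 6"
  by (simp_all add: W_def)

lemma card_W_minus: "i \<in> W \<Longrightarrow> card (W - {i}) = 5"
  by (simp add: card_W)

definition sub :: "nat \<Rightarrow> (poly2 \<Rightarrow> bit) \<Rightarrow> poly2 \<Rightarrow> bit"
  where "sub i \<phi> f = \<phi> (xs (W - {i}) * f\<^sup>2)"

definition cmb :: "(nat \<Rightarrow> poly2 \<Rightarrow> bit) \<Rightarrow> poly2 \<Rightarrow> bit"
  where "cmb F = asm (\<lambda>T. if T \<subseteq> W \<and> card T = 5 then F (the_elem (W - T)) else (\<lambda>f. 0))"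

lemma five_of_six:
  assumes "T \<subseteq> W" "card T = 5"
  obtains i where "i \<in> W" "T = W - {i}"
proof -
  have "card (W - T) = 1" using assms finite_subset[OF assms(1)] by (simp add: card_Diff_subset card_W)
  then obtain i where "W - T = {i}" by (auto simp: card_1_singleton_iff)
  with assms(1) that[of i] show thesis by blast
qed

lemma sub_K: "\<phi> \<in> K 6 (deg_seq (Suc d)) \<Longrightarrow> i \<in> W \<Longrightarrow> sub i \<phi> \<in> K 6 (deg_seq d)"
  using K_layer_five[of \<phi> 6 d "W - {i}"] by (simp add: sub_def[abs_def] card_W)

lemma sum_Pow_singletons:
  fixes g :: "nat set \<Rightarrow> bit"
  assumes "finite T" "\<And>J. J \<subseteq> T \<Longrightarrow> card J \<noteq> 1 \<Longrightarrow> g J = 0"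
  shows "(\<Sum>J\<in>Pow T. g J) = (\<Sum>i\<in>T. g {i})"
proof -
  have "(\<Sum>J\<in>Pow T. g J) = (\<Sum>J\<in>(\<lambda>i. {i}) ` T. g J)"
    using assms by (intro sum.mono_neutral_right) (auto simp: card_1_singleton_iff)
  also have "\<dots> = (\<Sum>i\<in>T. g {i})" by (subst sum.reindex) auto
  finally show ?thesis .
qed

text \<open>The layer equation for all six variables: only the terms that leave five variables
  survive. It is the single condition that ties the six layers together, as \<open>cmb_K\<close>
  shows.\<close>

lemma sub_rel:
  assumes \<phi>: "\<phi> \<in> K 6 (deg_seq (Suc d))"
  shows "(\<Sum>i\<in>W. sub i \<phi> (X i * f)) = 0"
proof -
  have F: "(\<lambda>f. \<Sum>i\<in>W. sub i \<phi> (X i * f)) \<in> funcs 6 (deg_seq d - 1)"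
  proof -
    have "sub i \<phi> \<in> funcs 6 (Suc (deg_seq d - 1))" if "i \<in> W" for i
      using sub_K[OF \<phi> that] deg_seq_pos[of d] by (simp add: K_funcs)
    then have "(\<lambda>f. sub i \<phi> (X i * f)) \<in> funcs 6 (deg_seq d - 1)" if "i \<in> W" for i
      using that by (intro funcs_X)
    then show ?thesis
      by (simp add: funcs_def additive_sum)
  qed
  have "(\<Sum>i\<in>W. sub i \<phi> (X i * St f)) = 0" for f
  proof -
    have "(\<Sum>J\<in>Pow W. \<phi> (xs (W - J) * (xs J * St f)\<^sup>2)) = (\<Sum>i\<in>W. \<phi> (xs (W - {i}) * (xs {i} * St f)\<^sup>2))"
    proof (rule sum_Pow_singletons)
      fix J assume J: "J \<subseteq> W" "card J \<noteq> 1"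
      have "card J \<le> 6" using card_mono[OF _ J(1)] by (simp add: card_W)
      then have "card (W - J) \<noteq> 5" using J finite_subset[OF J(1)] by (simp add: card_Diff_subset card_W)
      then show "\<phi> (xs (W - J) * (xs J * St f)\<^sup>2) = 0" using \<phi> by (intro layer_vanish[of \<phi> 6 d]) auto
    qed simp
    moreover have "\<phi> (xs W * f\<^sup>2) = 0" using \<phi> by (intro layer_vanish[of \<phi> 6 d]) (auto simp: card_W)
    ultimately show ?thesis using K_layer[OF \<phi>, of W f] by (simp add: sub_def)
  qed
  with F show ?thesis by (rule funcs_St_zero)
qed

lemma sub_eqI:
  assumes K: "\<phi> \<in> K 6 (deg_seq (Suc d))" "\<psi> \<in> K 6 (deg_seq (Suc d))" and eq: "\<And>i. i \<in> W \<Longrightarrow> sub i \<phi> = sub i \<psi>"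
  shows "\<phi> = \<psi>"
proof -
  have "\<phi> (xs T * (mono m)\<^sup>2) = \<psi> (xs T * (mono m)\<^sup>2)" if T: "finite T" for T m
  proof (cases "T \<subseteq> W \<and> card T = 5")
    case True
    then obtain i where i: "i \<in> W" "T = W - {i}" using five_of_six by blast
    then show ?thesis using fun_cong[OF eq[OF i(1)], of "mono m"] by (simp add: sub_def)
  next
    case False
    have zero: "\<chi> (xs T * (mono m)\<^sup>2) = 0" if "\<chi> \<in> K 6 (deg_seq (Suc d))" for \<chi>
    proof (cases "T \<subseteq> W")
      case True
      then show ?thesis using False that T by (intro layer_vanish[of \<chi> 6 d]) auto
    next
      case False
      then show ?thesis using funcs_layer_zero[OF K_funcs[OF that] T] by (simp add: W_def)
    qed
    show ?thesis using zero[OF K(1)] zero[OF K(2)] by simp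
  qed
  from layer_eqI[OF funcs_additive[OF K_funcs[OF K(1)]] funcs_additive[OF K_funcs[OF K(2)]] this]
  show "\<phi> = \<psi>" by (rule ext)
qed

lemma sub_cmb: "i \<in> W \<Longrightarrow> additive (F i) \<Longrightarrow> sub i (cmb F) = F i"
proof -
  assume i: "i \<in> W" and add: "additive (F i)"
  have "W - (W - {i}) = {i}" using i by auto
  then show ?thesis
    using i add unfolding sub_def[abs_def] cmb_def by (subst asm_layer) (auto simp: card_W_minus card_W)
qed

lemma cmb_K:
  assumes F: "\<And>i. i \<in> W \<Longrightarrow> F i \<in> K 6 (deg_seq d)" and rel: "\<And>f. (\<Sum>i\<in>W. F i (X i * f)) = 0"
  shows "cmb F \<in> K 6 (deg_seq (Suc d))"
  unfolding cmb_def
proof (rule asm_K)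
  let ?\<psi> = "\<lambda>T. if T \<subseteq> W \<and> card T = 5 then F (the_elem (W - T)) else (\<lambda>f. 0)"
  have el: "?\<psi> (W - {i}) = F i" if "i \<in> W" for i
  proof -
    have "W - (W - {i}) = {i}" using that by auto
    then show ?thesis using that by (simp add: card_W_minus card_W)
  qed
  have cases: "?\<psi> T = (\<lambda>f. 0) \<or> (\<exists>i\<in>W. T = W - {i} \<and> ?\<psi> T = F i)" for T
  proof (cases "T \<subseteq> W \<and> card T = 5")
    case True
    then obtain i where "i \<in> W" "T = W - {i}" using five_of_six by blast
    then show ?thesis using el by blast
  qed auto
  show "additive (?\<psi> T)" for T
    using cases[of T] funcs_additive[OF K_funcs[OF F]] by auto
  fix T h assume nz: "?\<psi> T (mono h) \<noteq> 0"
  then obtain i where i: "i \<in> W" "T = W - {i}" "?\<psi> T = F i" using cases[of T] by auto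
  have "h \<in> mons 6 (deg_seq d)" using nz i funcs_mono[OF K_funcs[OF F[OF i(1)]], of h] by auto
  then show "T \<subseteq> {1..6} \<and> Poly_Mapping.keys h \<subseteq> {1..6} \<and> card T + 2 * monom_deg h = deg_seq (Suc d)"
    using i card_W_minus[OF i(1)] by (auto simp: W_def mons_def deg_seq_Suc)
next
  let ?\<psi> = "\<lambda>T. if T \<subseteq> W \<and> card T = 5 then F (the_elem (W - T)) else (\<lambda>f. 0)"
  have el: "?\<psi> (W - {i}) = F i" if "i \<in> W" for i
  proof -
    have "W - (W - {i}) = {i}" using that by auto
    then show ?thesis using that by (simp add: card_W_minus card_W)
  qed
  fix T f assume "T \<subseteq> {1..6::nat}"
  then have T: "T \<subseteq> W" "finite T" by (auto simp: W_def intro: finite_subset)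
  have le: "card T \<le> 6" using card_mono[OF _ T(1)] by (simp add: card_W)
  show "(\<Sum>J\<in>Pow T. ?\<psi> (T - J) (xs J * St f)) = ?\<psi> T f"
  proof (cases "card T = 6")
    case False
    have "(\<Sum>J\<in>Pow T. ?\<psi> (T - J) (xs J * St f)) = ?\<psi> (T - {}) (xs {} * St f)"
    proof (rule sum_Pow_empty[OF T(2)])
      fix J assume "J \<subseteq> T" "J \<noteq> {}"
      then have "T - J \<subset> T" by blast
      then have "card (T - J) < card T" using T(2) by (rule psubset_card_mono[rotated])
      then show "?\<psi> (T - J) (xs J * St f) = 0" using le False by auto
    qed
    also have "\<dots> = ?\<psi> T f"
    proof (cases "card T = 5")
      case True
      then obtain i where i: "i \<in> W" "T = W - {i}" using five_of_six T by blast
      have "?\<psi> T = F i" unfolding i(2) by (rule el[OF i(1)])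
      then show ?thesis using K_St[OF F[OF i(1)]] by (simp only: xs_empty Diff_empty mult_1)
    qed simp
    finally show ?thesis .
  next
    case True
    then have TW: "T = W" using T(1) by (intro card_subset_eq) (auto simp: card_W)
    have "(\<Sum>J\<in>Pow W. ?\<psi> (W - J) (xs J * St f)) = (\<Sum>i\<in>W. ?\<psi> (W - {i}) (xs {i} * St f))"
    proof (rule sum_Pow_singletons)
      fix J assume J: "J \<subseteq> W" "card J \<noteq> 1"
      have "card J \<le> 6" using card_mono[OF _ J(1)] by (simp add: card_W)
      then have "card (W - J) \<noteq> 5" using J finite_subset[OF J(1)] by (simp add: card_Diff_subset card_W)
      then show "?\<psi> (W - J) (xs J * St f) = 0" by simp
    qed simp
    also have "\<dots> = (\<Sum>i\<in>W. F i (X i * St f))" using el by simp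
    also have "\<dots> = 0" by (rule rel)
    also have "0 = ?\<psi> W f" by (simp add: card_W)
    finally show ?thesis unfolding TW .
  qed
qed

subsection \<open>Words of squares\<close>

text \<open>Restricts to one layer after the other; the letter \<open>i\<close> stands for the layer
  \<open>W - {i}\<close>, and the head of the word is the lowest layer.\<close>

fun dig :: "nat list \<Rightarrow> (poly2 \<Rightarrow> bit) \<Rightarrow> poly2 \<Rightarrow> bit" where
  "dig [] \<phi> = \<phi>"
| "dig (i # w) \<phi> = dig w (sub i \<phi>)"

lemma dig_append: "dig (v @ w) \<phi> = dig w (dig v \<phi>)"
  by (induction v arbitrary: \<phi>) simp_all

lemma dig_K:
  assumes "\<phi> \<in> K 6 (deg_seq (length w + d))" "set w \<subseteq> W"
  shows "dig w \<phi> \<in> K 6 (deg_seq d)"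
  using assms by (induction w arbitrary: \<phi>) (simp_all add: sub_K)

lemma dig_eqI:
  assumes "\<phi> \<in> K 6 (deg_seq (d + s))" "\<psi> \<in> K 6 (deg_seq (d + s))"
    "\<And>w. length w = d \<Longrightarrow> set w \<subseteq> W \<Longrightarrow> dig w \<phi> = dig w \<psi>"
  shows "\<phi> = \<psi>"
  using assms
proof (induction d arbitrary: \<phi> \<psi>)
  case 0
  then show ?case using "0.prems"(3)[of "[]"] by simp
next
  case (Suc d)
  have K: "\<phi> \<in> K 6 (deg_seq (Suc (d + s)))" "\<psi> \<in> K 6 (deg_seq (Suc (d + s)))" using Suc.prems by simp_all
  show ?case
  proof (rule sub_eqI[OF K])
    fix i assume i: "i \<in> W"
    show "sub i \<phi> = sub i \<psi>"
    proof (rule Suc.IH[OF sub_K[OF K(1) i] sub_K[OF K(2) i]])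
      fix w :: "nat list" assume "length w = d" "set w \<subseteq> W"
      then show "dig w (sub i \<phi>) = dig w (sub i \<psi>)" using Suc.prems(3)[of "i # w"] i by simp
    qed
  qed
qed

text \<open>Evaluate the relation at \<open>xs W\<close> times a square: multiplying by
  \<open>X i\<close> leaves exactly the layer \<open>W - {i}\<close> and squares the
  variable.\<close>

lemma rel_square:
  assumes "\<And>f. (\<Sum>i\<in>W. F i (X i * f)) = 0"
  shows "(\<Sum>i\<in>W. sub i (F i) (X i * f)) = 0"
proof -
  have "X i * (xs W * f\<^sup>2) = xs (W - {i}) * (X i * f)\<^sup>2" if "i \<in> W" for i
    using X_xs[OF finite_W, of i] that by (simp add: power_mult_distrib ac_simps)
  then show ?thesis using assms[of "xs W * f\<^sup>2"] by (simp add: sub_def)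
qed

text \<open>Evaluate the relation at \<open>xs (W - {i, j})\<close> times a square. Multiplication
  by another letter leaves a layer of size three, which vanishes, so only the terms of
  \<open>i\<close> and \<open>j\<close> remain.\<close>

lemma rel_swap:
  assumes rel: "\<And>f. (\<Sum>i\<in>W. F i (X i * f)) = 0" and F: "\<And>i. i \<in> W \<Longrightarrow> F i \<in> K 6 (deg_seq (Suc d))"
    and ij: "i \<in> W" "j \<in> W" "i \<noteq> j"
  shows "sub j (F i) = sub i (F j)"
proof
  fix f
  let ?T = "W - {i, j}"
  have fin: "finite ?T" by simp
  have zero: "F k (X k * (xs ?T * f\<^sup>2)) = 0" if k: "k \<in> W" "k \<noteq> i" "k \<noteq> j" for k
  proof -
    have "X k * (xs ?T * f\<^sup>2) = xs (?T - {k}) * (X k * f)\<^sup>2"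
      using X_xs[OF fin, of k] k by (simp add: power_mult_distrib ac_simps)
    moreover have "card (?T - {k}) = 3" using k ij by (simp add: card_Diff_subset card_W Diff_insert2[symmetric])
    ultimately show ?thesis using F[OF k(1)] layer_vanish[of "F k" 6 d "?T - {k}" "X k * f"] by simp
  qed
  have e: "X i * (xs ?T * f\<^sup>2) = xs (W - {j}) * f\<^sup>2" "X j * (xs ?T * f\<^sup>2) = xs (W - {i}) * f\<^sup>2"
  proof -
    have "insert i ?T = W - {j}" "insert j ?T = W - {i}" using ij by auto
    then show "X i * (xs ?T * f\<^sup>2) = xs (W - {j}) * f\<^sup>2" "X j * (xs ?T * f\<^sup>2) = xs (W - {i}) * f\<^sup>2"
      using X_xs[OF fin, of i] X_xs[OF fin, of j] by (simp_all flip: mult.assoc)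
  qed
  have "sub j (F i) f + sub i (F j) f = F i (X i * (xs ?T * f\<^sup>2)) + F j (X j * (xs ?T * f\<^sup>2))"
    by (simp only: e sub_def)
  also have "\<dots> = (\<Sum>k\<in>{i, j}. F k (X k * (xs ?T * f\<^sup>2)))"
    using ij(3) by simp
  also have "\<dots> = (\<Sum>k\<in>W. F k (X k * (xs ?T * f\<^sup>2)))"
    using ij zero by (intro sum.mono_neutral_left) auto
  also have "\<dots> = 0" by (rule rel)
  finally show "sub j (F i) f = sub i (F j) f" by (simp only: bit_add_eq_0)
qed

lemma sub_swap:
  assumes "\<phi> \<in> K 6 (deg_seq (Suc (Suc d)))" "i \<in> W" "j \<in> W"
  shows "sub j (sub i \<phi>) = sub i (sub j \<phi>)"
proof (cases "i = j")
  case False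
  from rel_swap[of "\<lambda>i. sub i \<phi>" d i j, OF sub_rel[OF assms(1)] sub_K[OF assms(1)] assms(2,3) False]
  show ?thesis .
qed simp

text \<open>The squared relation of \<open>rel_square\<close> is again of the form required by
  \<open>rel_swap\<close>; the letters are then reordered by \<open>sub_swap\<close>.\<close>

lemma sub_transfer:
  assumes \<phi>: "\<phi> \<in> K 6 (deg_seq (Suc (Suc (Suc d))))" and ij: "i \<in> W" "j \<in> W"
  shows "sub j (sub i (sub i \<phi>)) = sub j (sub j (sub i \<phi>))"
proof (cases "i = j")
  case False
  have "sub j (sub i (sub i \<phi>)) = sub i (sub j (sub j \<phi>))"
    using rel_square[of "\<lambda>i. sub i \<phi>", OF sub_rel[OF \<phi>]] sub_K[OF sub_K[OF \<phi>]] ij False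
    by (intro rel_swap[of "\<lambda>i. sub i (sub i \<phi>)" d i j]) auto
  also have "\<dots> = sub j (sub j (sub i \<phi>))"
    using sub_swap[OF \<phi> ij] sub_swap[OF sub_K[OF \<phi> ij(2)] ij] by simp
  finally show ?thesis .
qed simp

text \<open>Letters of a word may be permuted, and \<open>i i j\<close> may be replaced by
  \<open>i j j\<close>; so multiplicities can be redistributed among the letters that occur, and
  only their set remains.\<close>

lemma dig_set:
  assumes "\<phi> \<in> K 6 (deg_seq (length v + s))" "length w = length v" "set v \<subseteq> W" "set w = set v"
  shows "dig v \<phi> = dig w \<phi>"
  using assms
proof (induction "length v" arbitrary: \<phi> v w rule: less_induct)
  case less
  note \<phi> = less.prems(1)
  show ?case
  proof (cases v)
    case Nil
    then show ?thesis using less.prems by simp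
  next
    case (Cons i v')
    then obtain j w' where w: "w = j # w'" using less.prems(2) by (cases w) auto
    have W: "i \<in> W" "j \<in> W" "set v' \<subseteq> W" "set w' \<subseteq> W" "length w' = length v'"
      using less.prems Cons w by auto
    have \<phi>': "\<phi> \<in> K 6 (deg_seq (Suc (length v' + s)))" using \<phi> Cons by simp
    have IH: "dig u (sub k \<phi>) = dig u' (sub k \<phi>)"
      if "k \<in> W" "length u = length v'" "length u' = length v'" "set u \<subseteq> W" "set u' = set u" for k u u'
      using less.hyps[of u "sub k \<phi>" u'] sub_K[OF \<phi>' that(1)] that Cons by simp
    have add: "dig (k # u) \<phi> = dig (k # u') \<phi>"
      if k: "k \<in> W" "k \<notin> set u" and u: "length u = length v'" "length u' = length v'" "set u \<subseteq> W" "set u' = insert k (set u)" for k u u'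
    proof -
      \<comment> \<open>The word \<open>u'\<close> is as long as \<open>u\<close> but has the
        additional letter \<open>k\<close>, so \<open>u\<close> repeats a letter \<open>l\<close>.
        After the leading \<open>k\<close>, one copy of \<open>l\<close> can be traded for a second
        \<open>k\<close>.\<close>
      have "card (set u) < length u"
      proof -
        have "card (insert k (set u)) \<le> length u'" using card_length[of u'] u(4) by simp
        then show ?thesis using k u by simp
      qed
      then have "\<not> distinct u" using distinct_card[of u] by auto
      then obtain xs ys zs l where l: "u = xs @ [l] @ ys @ [l] @ zs" using not_distinct_decomp by blast
      define r where "r = xs @ ys @ zs"
      have r: "set (l # l # r) = set u" "length (l # l # r) = length v'" "l \<in> W" "set r \<subseteq> W"
        using l u by (auto simp: r_def)
      have \<phi>3: "\<phi> \<in> K 6 (deg_seq (Suc (Suc (Suc (length r + s)))))" using \<phi>' r(2) by (simp flip: r(2))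
      have "dig (k # u) \<phi> = dig (k # l # l # r) \<phi>"
        using IH[of k u "l # l # r"] k u r by simp
      also have "\<dots> = dig r (sub l (sub l (sub k \<phi>)))" by simp
      also have "sub l (sub l (sub k \<phi>)) = sub l (sub k (sub k \<phi>))"
        using sub_transfer[OF \<phi>3 k(1) r(3)] ..
      also have "dig r \<dots> = dig (k # k # l # r) \<phi>" by simp
      also have "\<dots> = dig (k # u') \<phi>"
        using IH[of k "k # l # r" u'] k u r by auto
      finally show ?thesis .
    qed
    have same: "dig (k # u) \<phi> = dig (k # u') \<phi>"
      if k: "k \<in> W" and u: "length u = length v'" "length u' = length v'" "set u \<subseteq> W" "set u' \<subseteq> W"
        "insert k (set u) = insert k (set u')" for k u u'
    proof -
      consider "set u = set u'" | "k \<notin> set u" "set u' = insert k (set u)" | "k \<notin> set u'" "set u = insert k (set u')"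
        using u(5) by (metis insert_absorb insert_ident)
      then show ?thesis
      proof cases
        case 1
        then show ?thesis using IH[OF k u(1-3)] by simp
      next
        case 2
        then show ?thesis using add[OF k 2(1) u(1-3)] by blast
      next
        case 3
        then show ?thesis using add[OF k 3(1) u(2,1,4)] by simp
      qed
    qed
    show ?thesis
    proof (cases "i = j")
      case True
      then show ?thesis using same[of i v' w'] W less.prems(4) Cons w by simp
    next
      case False
      then have "j \<in> set v'" using less.prems(4) Cons w by auto
      then obtain xs ys where v': "v' = xs @ j # ys" by (meson split_list)
      define r where "r = xs @ ys"
      have r: "set (j # r) = set v'" "length (j # r) = length v'" "set r \<subseteq> W"
        using v' W by (auto simp: r_def)
      have \<phi>2: "\<phi> \<in> K 6 (deg_seq (Suc (Suc (length r + s))))" using \<phi>' r(2) by (simp flip: r(2))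
      have "dig v \<phi> = dig (i # j # r) \<phi>"
        using IH[of i v' "j # r"] Cons W r by simp
      also have "\<dots> = dig (j # i # r) \<phi>"
        using sub_swap[OF \<phi>2 W(1,2)] by simp
      also have "\<dots> = dig (j # w') \<phi>"
      proof (rule same)
        show "insert j (set (i # r)) = insert j (set w')"
          using r(1) less.prems(4) Cons w by auto
      qed (use W r in auto)
      finally show ?thesis by (simp add: w)
    qed
  qed
qed

subsection \<open>Functionals from families indexed by sets\<close>

text \<open>The inverse of reading words: reading \<open>w\<close> from the built functional yields
  the member of the family at \<open>S \<union> set w\<close> (see \<open>dig_build\<close>).
  \<open>S\<close> collects the letters already read.\<close>

fun build :: "nat \<Rightarrow> (nat set \<Rightarrow> poly2 \<Rightarrow> bit) \<Rightarrow> nat set \<Rightarrow> poly2 \<Rightarrow> bit" where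
  "build 0 A S = A S"
| "build (Suc d) A S = cmb (\<lambda>i. build d A (insert i S))"

lemma cmb_layer:
  assumes "\<And>i. i \<in> W \<Longrightarrow> additive (F i)" "finite T"
  shows "cmb F (xs T * f\<^sup>2) = (if T \<subseteq> W \<and> card T = 5 then F (the_elem (W - T)) f else 0)"
proof -
  have "additive (F (the_elem (W - T)))" if T: "T \<subseteq> W" "card T = 5"
  proof -
    from five_of_six[OF T] obtain i where i: "i \<in> W" "T = W - {i}" by blast
    then have "W - T = {i}" by auto
    then show ?thesis using assms(1)[OF i(1)] by simp
  qed
  then show ?thesis using assms(2) unfolding cmb_def by (subst asm_layer) auto
qed

text \<open>\<open>cmb_K\<close> needs the relation at the previous stage, so the induction carries
  it along. At the new stage, the layer of all six letters reproduces the old relation. A layer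
  missing \<open>i\<close> and \<open>j\<close> gives two equal terms, since the order of the
  insertions is irrelevant. All other layers give zero.\<close>

lemma build_K:
  assumes A: "\<And>S. S \<subseteq> W \<Longrightarrow> A S \<in> K 6 (deg_seq s)"
    and rel: "\<And>S f. S \<subseteq> W \<Longrightarrow> (\<Sum>i\<in>W. A (insert i S) (X i * f)) = 0"
    and S: "S \<subseteq> W"
  shows "build d A S \<in> K 6 (deg_seq (d + s)) \<and> (\<forall>f. (\<Sum>i\<in>W. build d A (insert i S) (X i * f)) = 0)"
  using S
proof (induction d arbitrary: S)
  case 0
  then show ?case using A rel by simp
next
  case (Suc d)
  have IH: "build d A S \<in> K 6 (deg_seq (d + s))" "(\<Sum>i\<in>W. build d A (insert i S) (X i * f)) = 0" if "S \<subseteq> W" for S f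
    using Suc.IH[OF that] by auto
  have add: "additive (build d A S)" if "S \<subseteq> W" for S
    using IH(1)[OF that] by (simp add: K_def funcs_def)
  have KS: "build (Suc d) A S \<in> K 6 (deg_seq (Suc d + s))" if "S \<subseteq> W" for S
    using cmb_K[of "\<lambda>i. build d A (insert i S)" "d + s"] IH that by simp
  have lay: "build (Suc d) A S (xs T * f\<^sup>2) = (if T \<subseteq> W \<and> card T = 5 then build d A (insert (the_elem (W - T)) S) f else 0)"
    if "S \<subseteq> W" "finite T" for S T f
    using that cmb_layer[of "\<lambda>i. build d A (insert i S)" T f] add by simp
  have one: "build (Suc d) A S (xs (W - {i}) * f\<^sup>2) = build d A (insert i S) f" if "S \<subseteq> W" "i \<in> W" for S i f
  proof -
    have "W - (W - {i}) = {i}" using that by auto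
    then show ?thesis using lay[OF that(1), of "W - {i}" f] that by (simp add: card_W)
  qed
  note S = Suc.prems
  have zero: "(\<Sum>i\<in>W. build (Suc d) A (insert i S) (X i * (xs T * (mono h)\<^sup>2))) = 0" if T: "finite T" for T h
  proof -
    let ?f = "mono h"
    have tm: "build (Suc d) A (insert i S) (X i * (xs T * ?f\<^sup>2)) =
        (if i \<in> T then build (Suc d) A (insert i S) (xs (T - {i}) * (X i * ?f)\<^sup>2)
         else build (Suc d) A (insert i S) (xs (insert i T) * ?f\<^sup>2))" if "i \<in> W" for i
    proof -
      have "X i * (xs T * ?f\<^sup>2) = X i * xs T * ?f\<^sup>2" by (simp only: mult.assoc)
      also have "\<dots> = (if i \<in> T then xs (T - {i}) * (X i * ?f)\<^sup>2 else xs (insert i T) * ?f\<^sup>2)"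
        unfolding X_xs[OF T] by (simp add: power_mult_distrib mult.assoc)
      finally show ?thesis by (simp del: build.simps)
    qed
    consider "T = W" | (two) i j where "i \<in> W" "j \<in> W" "i \<noteq> j" "T = W - {i, j}"
      | "\<And>i. i \<in> W \<Longrightarrow> \<not> (if i \<in> T then T - {i} \<subseteq> W \<and> card (T - {i}) = 5 else insert i T \<subseteq> W \<and> card (insert i T) = 5)"
    proof (cases "T \<subseteq> W")
      case False
      then have "\<And>i. i \<in> W \<Longrightarrow> \<not> (if i \<in> T then T - {i} \<subseteq> W \<and> card (T - {i}) = 5 else insert i T \<subseteq> W \<and> card (insert i T) = 5)"
        by auto
      then show thesis by (rule that(3))
    next
      case sub: True
      show thesis
      proof (cases "card T = 6 \<or> card T = 4")
        case True
        then show thesis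
        proof
          assume "card T = 6"
          then have "T = W" using sub by (intro card_subset_eq) (auto simp: card_W)
          then show thesis by (rule that(1))
        next
          assume "card T = 4"
          then have "card (W - T) = 2" using sub T by (simp add: card_Diff_subset card_W)
          then obtain i j where "W - T = {i, j}" "i \<noteq> j" by (auto simp: card_2_iff)
          then show thesis using sub by (intro that(2)[of i j]) auto
        qed
      next
        case False
        then have "\<And>i. i \<in> W \<Longrightarrow> \<not> (if i \<in> T then T - {i} \<subseteq> W \<and> card (T - {i}) = 5 else insert i T \<subseteq> W \<and> card (insert i T) = 5)"
          using T by auto
        then show thesis by (rule that(3))
      qed
    qed
    then show ?thesis
    proof cases
      case 1
      have "(\<Sum>i\<in>W. build (Suc d) A (insert i S) (X i * (xs T * ?f\<^sup>2))) = (\<Sum>i\<in>W. build d A (insert i S) (X i * ?f))"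
        using S one by (intro sum.cong refl) (simp add: tm[unfolded 1] 1 del: build.simps)
      then show ?thesis using IH(2)[OF S] by simp
    next
      case (two i j)
      have z: "build (Suc d) A (insert k S) (X k * (xs T * ?f\<^sup>2)) = 0" if k: "k \<in> W - {i, j}" for k
      proof -
        have "card (T - {k}) = 3" using k two by (simp add: card_Diff_subset card_W Diff_insert2[symmetric])
        then show ?thesis using k S two lay[of "insert k S" "T - {k}"] by (simp add: tm[unfolded two(4)] del: build.simps)
      qed
      have "(\<Sum>k\<in>W. build (Suc d) A (insert k S) (X k * (xs T * ?f\<^sup>2))) = (\<Sum>k\<in>{i, j}. build (Suc d) A (insert k S) (X k * (xs T * ?f\<^sup>2)))"
        using z two by (intro sum.mono_neutral_right) auto
      also have "\<dots> = build (Suc d) A (insert i S) (xs (W - {j}) * ?f\<^sup>2) + build (Suc d) A (insert j S) (xs (W - {i}) * ?f\<^sup>2)"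
      proof -
        have "insert i T = W - {j}" "insert j T = W - {i}" using two by auto
        then show ?thesis using two by (simp add: tm[unfolded two(4)] del: build.simps)
      qed
      also have "\<dots> = build d A (insert j (insert i S)) ?f + build d A (insert i (insert j S)) ?f"
        using two S one by (simp del: build.simps)
      also have "\<dots> = 0" by (simp add: insert_commute)
      finally show ?thesis .
    next
      case 3
      have "build (Suc d) A (insert k S) (X k * (xs T * ?f\<^sup>2)) = 0" if k: "k \<in> W" for k
        using 3[OF k] k S T lay[of "insert k S" "T - {k}"] lay[of "insert k S" "insert k T"]
        by (cases "k \<in> T"; simp add: tm del: build.simps; blast)
      then show ?thesis by (intro sum.neutral) blast
    qed
  qed
  have "additive (\<lambda>f. \<Sum>i\<in>W. build (Suc d) A (insert i S) (X i * f))"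
    using KS S by (intro additive_sum additive_comp[OF _ additive_mult_left]) (auto simp: K_def funcs_def)
  then have "(\<Sum>i\<in>W. build (Suc d) A (insert i S) (X i * f)) = 0" for f
    using layer_eqI[of "\<lambda>f. \<Sum>i\<in>W. build (Suc d) A (insert i S) (X i * f)" "\<lambda>f. 0" f] zero by simp
  with KS[OF S] show ?case by blast
qed

lemma dig_build:
  assumes A: "\<And>S. S \<subseteq> W \<Longrightarrow> A S \<in> K 6 (deg_seq s)"
    and rel: "\<And>S f. S \<subseteq> W \<Longrightarrow> (\<Sum>i\<in>W. A (insert i S) (X i * f)) = 0"
    and "S \<subseteq> W" "set w \<subseteq> W"
  shows "dig w (build (length w) A S) = A (S \<union> set w)"
  using assms(3,4)
proof (induction w arbitrary: S)
  case (Cons i w)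
  have "additive (build (length w) A (insert i S))"
    using build_K[OF A rel, of "insert i S" "length w"] Cons.prems by (simp add: K_def funcs_def)
  then have "sub i (build (length (i # w)) A S) = build (length w) A (insert i S)"
    using Cons.prems by (simp add: sub_cmb)
  then show ?case using Cons by simp
qed simp

subsection \<open>Filling in the family at the full set\<close>

definition lf :: "nat set \<Rightarrow> poly2"
  where "lf u = (\<Sum>i\<in>u. X i)"

lemma St_lf: "St (lf u) = lf u + (lf u)\<^sup>2"
  by (simp add: lf_def St_def ev_sum sum.distrib additive.sum[OF additive_square])

lemma lf_mult_sum: "finite u \<Longrightarrow> additive \<phi> \<Longrightarrow> \<phi> (lf u * f) = (\<Sum>i\<in>u. \<phi> (X i * f))"
  by (simp add: lf_def sum_distrib_right additive.sum)

text \<open>A functional whose values on multiples of \<open>X i\<close> are given by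
  \<open>c i\<close>. On a monomial the smallest variable is divided off; the compatibility assumed
  in the next lemma makes every other choice agree.\<close>

definition divide_out :: "(nat \<Rightarrow> poly2 \<Rightarrow> bit) \<Rightarrow> poly2 \<Rightarrow> bit"
  where "divide_out c = lin (\<lambda>m. if m = 0 \<or> \<not> Poly_Mapping.keys m \<subseteq> W then 0
    else c (Min (Poly_Mapping.keys m)) (mono (m - Poly_Mapping.single (Min (Poly_Mapping.keys m)) 1)))"

lemma keys_add_single: "Poly_Mapping.keys (Poly_Mapping.single i 1 + h) = insert i (Poly_Mapping.keys (h :: monomial))"
  by (auto simp: in_keys_iff lookup_add lookup_single when_def split: if_splits)

lemma divide_out:
  assumes c: "\<And>i. i \<in> W \<Longrightarrow> c i \<in> funcs 6 n" and sym: "\<And>i j f. i \<in> W \<Longrightarrow> j \<in> W \<Longrightarrow> c i (X j * f) = c j (X i * f)"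
  shows "divide_out c \<in> funcs 6 (Suc n)" and "i \<in> W \<Longrightarrow> divide_out c (X i * f) = c i f"
proof -
  have add: "additive (divide_out c)" by (simp add: divide_out_def)
  have mono: "divide_out c (mono (Poly_Mapping.single i 1 + h)) = c i (mono h)" if i: "i \<in> W" for i h
  proof (cases "Poly_Mapping.keys h \<subseteq> W")
    case False
    then have "h \<notin> mons 6 n" by (auto simp: mons_def W_def)
    then have "c i (mono h) = 0" by (rule funcs_mono[OF c[OF i]])
    moreover have "\<not> Poly_Mapping.keys (Poly_Mapping.single i 1 + h) \<subseteq> W" using False unfolding keys_add_single by simp
    ultimately show ?thesis by (simp add: divide_out_def)
  next
    case True
    let ?m = "Poly_Mapping.single i 1 + h"
    define k where "k = Min (Poly_Mapping.keys ?m)"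
    have ne: "?m \<noteq> 0" and sub: "Poly_Mapping.keys ?m \<subseteq> W"
      using i True keys_add_single[of i h] by auto
    have k: "k \<in> Poly_Mapping.keys ?m" unfolding k_def using ne by (intro Min_in) auto
    then have kW: "k \<in> W" using sub by blast
    have e: "divide_out c (mono ?m) = c k (mono (?m - Poly_Mapping.single k 1))"
      using ne sub by (simp add: divide_out_def k_def)
    show ?thesis
    proof (cases "k = i")
      case True
      then show ?thesis using e by simp
    next
      case False
      then have kh: "k \<in> Poly_Mapping.keys h" using k by (simp only: keys_add_single) simp
      define h' where "h' = h - Poly_Mapping.single k 1"
      have h: "h = Poly_Mapping.single k 1 + h'"
        using kh by (intro poly_mapping_eqI) (auto simp: h'_def lookup_add lookup_minus lookup_single when_def in_keys_iff)
      have "?m - Poly_Mapping.single k 1 = Poly_Mapping.single i 1 + h'"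
        unfolding h add.left_commute[of "Poly_Mapping.single i 1" "Poly_Mapping.single k 1"] by (rule add_diff_cancel_left')
      then have "divide_out c (mono ?m) = c k (X i * mono h')" using e by (simp add: X_def mono_add)
      also have "\<dots> = c i (X k * mono h')" using sym kW i by blast
      also have "\<dots> = c i (mono h)" by (simp add: h X_def mono_add)
      finally show ?thesis .
    qed
  qed
  show "divide_out c (X i * f) = c i f" if i: "i \<in> W"
  proof -
    have "divide_out c (X i * mono h) = c i (mono h)" for h
      using mono[OF i, of h] by (simp add: X_def mono_add)
    from additive_eqI[OF additive_comp[OF add additive_mult_left] funcs_additive[OF c[OF i]] this]
    show ?thesis .
  qed
  show "divide_out c \<in> funcs 6 (Suc n)"
  proof (rule funcsI[OF add])
    fix m assume m: "m \<notin> mons 6 (Suc n)"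
    show "divide_out c (mono m) = 0"
    proof (cases "m = 0 \<or> \<not> Poly_Mapping.keys m \<subseteq> W")
      case True
      then show ?thesis by (simp add: divide_out_def)
    next
      case False
      then obtain i where i: "i \<in> Poly_Mapping.keys m" by (metis all_not_in_conv keys_eq_empty)
      define h where "h = m - Poly_Mapping.single i 1"
      have h: "m = Poly_Mapping.single i 1 + h"
        using i by (intro poly_mapping_eqI) (auto simp: h_def lookup_add lookup_minus lookup_single when_def in_keys_iff)
      have iW: "i \<in> W" using i False by blast
      have "h \<notin> mons 6 n"
      proof
        assume "h \<in> mons 6 n"
        then have "m \<in> mons 6 (Suc n)"
          using iW keys_add_single[of i h] unfolding h by (simp add: mons_def W_def monom_deg_add)
        with m show False by blast
      qed
      then show ?thesis using mono[OF iW, of h] funcs_mono[OF c[OF iW]] by (simp add: h)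
    qed
  qed
qed

text \<open>The member at the full set has to satisfy the relations for the index sets
  \<open>W - {i}\<close> and \<open>W\<close>. The former prescribe it on all multiples of
  variables, so the work is to show that these prescriptions are compatible, that the relation for
  \<open>W\<close> holds, and that the result is invariant.\<close>

lemma complete_family:
  assumes A: "\<And>S. S \<subseteq> W \<Longrightarrow> S \<noteq> {} \<Longrightarrow> S \<noteq> W \<Longrightarrow> A S \<in> K 6 (deg_seq s)"
    and rel: "\<And>S f. S \<subseteq> W \<Longrightarrow> card S \<le> 4 \<Longrightarrow> (\<Sum>i\<in>W. A (insert i S) (X i * f)) = 0"
  obtains e where "e \<in> K 6 (deg_seq s)"
    "\<And>i f. i \<in> W \<Longrightarrow> e (X i * f) = A (W - {i}) (lf (W - {i}) * f)"
    "\<And>f. e (lf W * f) = 0"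
proof -
  define c where "c i f = A (W - {i}) (lf (W - {i}) * f)" for i f
  obtain n where n: "deg_seq s = Suc n" using deg_seq_pos[of s] by (cases "deg_seq s") auto
  have AW: "A (W - {i}) \<in> K 6 (deg_seq s)" if "i \<in> W" for i
  proof (rule A)
    show "W - {i} \<noteq> {}" using card_W_minus[OF that] by (metis card.empty zero_neq_numeral)
  qed (use that in blast)+
  have addA: "additive (A (W - {i}))" if "i \<in> W" for i
    using AW[OF that] by (simp add: K_def funcs_def)
  have c_sum: "c i f = (\<Sum>j\<in>W - {i}. A (W - {i}) (X j * f))" if "i \<in> W" for i f
    using addA[OF that] by (simp add: c_def lf_mult_sum)
  have c: "c i \<in> funcs 6 n" if i: "i \<in> W" for i
  proof -
    have "(\<lambda>f. A (W - {i}) (X j * f)) \<in> funcs 6 n" for j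
      using K_funcs[OF AW[OF i]] by (intro funcs_X) (simp add: n)
    then have "(\<lambda>f. \<Sum>j\<in>W - {i}. A (W - {i}) (X j * f)) \<in> funcs 6 n"
      by (simp add: funcs_def additive_sum)
    moreover have "c i = (\<lambda>f. \<Sum>j\<in>W - {i}. A (W - {i}) (X j * f))" using c_sum[OF i] by (rule ext)
    ultimately show ?thesis by simp
  qed
  have sym: "c i (X j * f) = c j (X i * f)" if ij: "i \<in> W" "j \<in> W" for i j f
  proof (cases "i = j")
    case False
    define S where "S = W - {i, j}"
    define y where "y = lf S"
    have card_S: "card S = 4" using ij False by (simp add: S_def card_Diff_subset card_W)
    have S: "S \<subseteq> W" "card S = 4" "S \<noteq> {}" "S \<noteq> W" "insert i S = W - {j}" "insert j S = W - {i}" "finite S" "i \<notin> S" "j \<notin> S"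
    proof -
      show "S \<noteq> {}" using card_S by (metis card.empty zero_neq_numeral)
      show "S \<noteq> W" using card_S card_W by auto
    qed (use card_S ij False in \<open>auto simp: S_def\<close>)
    have KP: "A S \<in> K 6 (deg_seq s)" using A S by blast
    note P = funcs_add[OF K_funcs[OF KP]] and Q = funcs_add[OF K_funcs[OF AW[OF ij(2)]]] and R = funcs_add[OF K_funcs[OF AW[OF ij(1)]]]
    have r: "A S (y * f) + A (W - {j}) (X i * f) + A (W - {i}) (X j * f) = 0" for f
    proof -
      have ins: "(\<Sum>k\<in>insert i (insert j S). g k) = g i + (g j + (\<Sum>k\<in>S. g k))" for g :: "nat \<Rightarrow> bit"
        using S(7-9) False by simp
      have "W = insert i (insert j S)" using ij by (auto simp: S_def)
      then have "(\<Sum>k\<in>W. A (insert k S) (X k * f)) = (\<Sum>k\<in>insert i (insert j S). A (insert k S) (X k * f))"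
        by (rule sum.cong) simp
      also have "\<dots> = A (W - {j}) (X i * f) + (A (W - {i}) (X j * f) + (\<Sum>k\<in>S. A (insert k S) (X k * f)))"
        unfolding ins unfolding S(5,6) ..
      also have "(\<Sum>k\<in>S. A (insert k S) (X k * f)) = (\<Sum>k\<in>S. A S (X k * f))"
        by (intro sum.cong refl) (simp add: insert_absorb)
      also have "\<dots> = A S (y * f)"
        using KP S(7) by (simp add: y_def lf_mult_sum K_def funcs_def)
      finally show ?thesis using rel[OF S(1)] S(2) by (simp add: ac_simps)
    qed
    have sq: "\<chi> (z * f) = \<chi> (z * St f) + \<chi> (z\<^sup>2 * St f)" if "\<chi> \<in> K 6 (deg_seq s)" "St z = z + z\<^sup>2" for \<chi> z f
      using K_St[OF that(1), of "z * f"] that(2) funcs_add[OF K_funcs[OF that(1)]] by (simp add: distrib_right)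
    \<comment> \<open>For a linear form \<open>z\<close> with value \<chi>, invariance gives \<chi>
      \<open>(z * f)\<close> as the sum of the values at \<open>z * St f\<close> and at the square
      of \<open>z\<close> times \<open>St f\<close>. Comparing \<open>r\<close> at \<open>f\<close>
      and at \<open>St f\<close> therefore leaves its squared version on the image of
      \<open>St\<close>, and \<open>funcs_St_zero\<close> extends it to all polynomials.\<close>
    have r2: "A S (y\<^sup>2 * f) + A (W - {j}) ((X i)\<^sup>2 * f) + A (W - {i}) ((X j)\<^sup>2 * f) = 0" for f
    proof -
      let ?\<psi> = "\<lambda>f. A S (y\<^sup>2 * f) + A (W - {j}) ((X i)\<^sup>2 * f) + A (W - {i}) ((X j)\<^sup>2 * f)"
      have z: "?\<psi> (St f) = 0" for f
      proof -
        have "0 = A S (y * f) + A (W - {j}) (X i * f) + A (W - {i}) (X j * f)" using r by simp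
        also have "\<dots> = (A S (y * St f) + A (W - {j}) (X i * St f) + A (W - {i}) (X j * St f)) + ?\<psi> (St f)"
          using sq[OF KP, of y f] sq[OF AW[OF ij(2)], of "X i" f] sq[OF AW[OF ij(1)], of "X j" f]
          by (simp add: y_def St_lf ac_simps)
        finally show ?thesis using r[of "St f"] by simp
      qed
      have "0 < n" using n deg_seq_add[of s] one_le_power[of "2 :: nat" s] by linarith
      then obtain n' where n': "n = Suc n'" by (cases n) auto
      have X2: "(\<lambda>f. \<chi> (X p * (X q * f))) \<in> funcs 6 n'" if "\<chi> \<in> K 6 (deg_seq s)" for \<chi> p q
      proof -
        have "(\<lambda>f. \<chi> (X p * f)) \<in> funcs 6 (Suc n')" using K_funcs[OF that] by (intro funcs_X) (simp add: n n')
        then show ?thesis by (rule funcs_X)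
      qed
      have "?\<psi> \<in> funcs 6 n'"
      proof -
        have "(\<lambda>f. \<Sum>p\<in>S. A S (X p * (X p * f))) \<in> funcs 6 n'"
          using X2[OF KP] by (simp add: funcs_def additive_sum)
        moreover have "(\<Sum>p\<in>S. A S (X p * (X p * f))) = A S (y\<^sup>2 * f)" for f
        proof -
          have "y\<^sup>2 = (\<Sum>p\<in>S. (X p)\<^sup>2)"
            by (simp only: y_def lf_def additive.sum[OF additive_square])
          then have "y\<^sup>2 * f = (\<Sum>p\<in>S. X p * (X p * f))"
            by (simp add: sum_distrib_right) (simp add: power2_eq_square mult.assoc)
          then show ?thesis using KP by (simp add: K_def funcs_def additive.sum)
        qed
        ultimately have "(\<lambda>f. A S (y\<^sup>2 * f)) \<in> funcs 6 n'" by simp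
        with X2[OF AW[OF ij(2)], of i i] X2[OF AW[OF ij(1)], of j j] show ?thesis
          by (simp add: funcs_def additive_plus power2_eq_square mult.assoc)
      qed
      then show ?thesis using z by (rule funcs_St_zero)
    qed
    have lfj: "lf (W - {j}) = X i + y" and lfi: "lf (W - {i}) = X j + y"
      using S(5-9) by (simp_all add: y_def lf_def flip: S(5,6))
    have "c j (X i * f) + c i (X j * f) =
        A (W - {j}) ((X i)\<^sup>2 * f) + A (W - {j}) (X i * (y * f)) + (A (W - {i}) ((X j)\<^sup>2 * f) + A (W - {i}) (X j * (y * f)))"
      unfolding c_def lfj lfi by (simp add: distrib_left distrib_right Q R power2_eq_square ac_simps)
    also have "\<dots> = (A S (y\<^sup>2 * f) + A (W - {j}) ((X i)\<^sup>2 * f) + A (W - {i}) ((X j)\<^sup>2 * f)) +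
        (A S (y * (y * f)) + A (W - {j}) (X i * (y * f)) + A (W - {i}) (X j * (y * f)))"
      by (simp add: power2_eq_square ac_simps)
    also have "\<dots> = 0" unfolding r r2 by simp
    finally show ?thesis by (simp only: bit_add_eq_0)
  qed simp
  \<comment> \<open>Add the given relations over all \<open>S\<close> with at most four elements.
    For a fixed letter \<open>i\<close>, the sets that differ only in \<open>i\<close> cancel; what
    remains are the sets of four letters without \<open>i\<close>, for which
    \<open>insert i S\<close> omits exactly one letter \<open>j\<close>.\<close>
  have sum_c: "(\<Sum>i\<in>W. c i f) = 0" for f
  proof -
    define G where "G S = (\<Sum>i\<in>W. A (insert i S) (X i * f))" for S
    define \<S> where "\<S> = {S. S \<subseteq> W \<and> card S \<le> 4}"
    have fin: "finite \<S>" unfolding \<S>_def by (rule finite_subset[of _ "Pow W"]) auto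
    have "0 = (\<Sum>S\<in>\<S>. G S)" using rel by (simp add: G_def \<S>_def)
    also have "\<dots> = (\<Sum>i\<in>W. \<Sum>S\<in>\<S>. A (insert i S) (X i * f))"
      unfolding G_def by (rule sum.swap)
    also have "\<dots> = (\<Sum>i\<in>W. \<Sum>S | S \<subseteq> W - {i} \<and> card S = 4. A (insert i S) (X i * f))"
    proof (rule sum.cong[OF refl])
      fix i assume i: "i \<in> W"
      let ?g = "\<lambda>S. A (insert i S) (X i * f)"
      let ?U = "{S. S \<subseteq> W - {i} \<and> card S \<le> 3}" and ?V = "{S. S \<subseteq> W - {i} \<and> card S = 4}"
      have finU: "finite ?U" "finite ?V" by (auto intro: finite_subset[of _ "Pow W"])
      have split: "\<S> = (?U \<union> ?V) \<union> insert i ` ?U"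
      proof (intro equalityI subsetI)
        fix S assume S: "S \<in> \<S>"
        then have Sf: "finite S" by (auto simp: \<S>_def intro: finite_subset)
        show "S \<in> (?U \<union> ?V) \<union> insert i ` ?U"
        proof (cases "i \<in> S")
          case True
          then have "S = insert i (S - {i})" "S - {i} \<in> ?U" using S Sf by (auto simp: \<S>_def)
          then show ?thesis by blast
        next
          case False
          then show ?thesis using S by (auto simp: \<S>_def)
        qed
      next
        fix S assume S: "S \<in> (?U \<union> ?V) \<union> insert i ` ?U"
        have "finite S'" if "S' \<subseteq> W - {i}" for S' using that by (auto intro: finite_subset)
        then show "S \<in> \<S>" using S i by (auto simp: \<S>_def card_insert_if)
      qed
      have "(\<Sum>S\<in>\<S>. ?g S) = (\<Sum>S\<in>?U \<union> ?V. ?g S) + (\<Sum>S\<in>insert i ` ?U. ?g S)"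
        unfolding split using finU by (intro sum.union_disjoint) auto
      also have "(\<Sum>S\<in>?U \<union> ?V. ?g S) = (\<Sum>S\<in>?U. ?g S) + (\<Sum>S\<in>?V. ?g S)"
        using finU by (intro sum.union_disjoint) auto
      also have "(\<Sum>S\<in>insert i ` ?U. ?g S) = (\<Sum>S\<in>?U. ?g S)"
        by (subst sum.reindex) (auto simp: inj_on_def dest!: insert_ident[THEN iffD1, rotated 2])
      finally show "(\<Sum>S\<in>\<S>. ?g S) = (\<Sum>S\<in>?V. ?g S)" by (simp add: ac_simps)
    qed
    also have "\<dots> = (\<Sum>i\<in>W. \<Sum>j\<in>W - {i}. A (W - {j}) (X i * f))"
    proof (rule sum.cong[OF refl])
      fix i assume i: "i \<in> W"
      show "(\<Sum>S | S \<subseteq> W - {i} \<and> card S = 4. A (insert i S) (X i * f)) = (\<Sum>j\<in>W - {i}. A (W - {j}) (X i * f))"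
      proof (rule sum.reindex_bij_witness[of _ "\<lambda>j. W - {i, j}" "\<lambda>S. the_elem (W - {i} - S)"])
        fix S assume "S \<in> {S. S \<subseteq> W - {i} \<and> card S = 4}"
        then have S: "S \<subseteq> W - {i}" "card S = 4" by auto
        then have "card (W - {i} - S) = 1" using i by (subst card_Diff_subset) (auto simp: card_W intro: finite_subset)
        then obtain j where j: "W - {i} - S = {j}" by (auto simp: card_1_singleton_iff)
        then show "W - {i, the_elem (W - {i} - S)} = S" "the_elem (W - {i} - S) \<in> W - {i}" using S by auto
        have "insert i S = W - {j}" using j S i by auto
        then show "A (W - {the_elem (W - {i} - S)}) (X i * f) = A (insert i S) (X i * f)" by (simp add: j)
      next
        fix j assume j: "j \<in> W - {i}"
        have "W - {i} - (W - {i, j}) = {j}" using j by auto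
        then show "the_elem (W - {i} - (W - {i, j})) = j" by simp
        show "W - {i, j} \<in> {S. S \<subseteq> W - {i} \<and> card S = 4}" using i j by (auto simp: card_Diff_subset card_W)
      qed
    qed
    also have "\<dots> = (\<Sum>j\<in>W. \<Sum>i\<in>W - {j}. A (W - {j}) (X i * f))"
    proof -
      have "W - {i} = {j \<in> W. j \<noteq> i}" "W - {i} = {j \<in> W. i \<noteq> j}" for i by auto
      then show ?thesis
        using sum.swap_restrict[of W W "\<lambda>i j. A (W - {j}) (X i * f)" "\<lambda>i j. j \<noteq> i"] by (simp only: finite_W)
    qed
    also have "\<dots> = (\<Sum>j\<in>W. c j f)" using c_sum by simp
    finally show ?thesis by simp
  qed
  define e where "e = divide_out c"
  have e_funcs: "e \<in> funcs 6 (Suc n)" and e_X: "\<And>i f. i \<in> W \<Longrightarrow> e (X i * f) = c i f"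
    unfolding e_def using divide_out[OF c sym] by blast+
  have e_lf: "e (lf W * f) = 0" for f
    using sum_c[of f] e_X by (simp add: lf_mult_sum funcs_additive[OF e_funcs])
  have c_lf: "c i (lf W * f) = 0" if i: "i \<in> W" for i f
  proof -
    have "c i (lf W * f) = (\<Sum>j\<in>W. c i (X j * f))"
      using funcs_additive[OF c[OF i]] by (simp add: lf_mult_sum)
    also have "\<dots> = (\<Sum>j\<in>W. c j (X i * f))" using sym i by (intro sum.cong) auto
    also have "\<dots> = 0" by (rule sum_c)
    finally show ?thesis .
  qed
  have "e (St (mono m)) = e (mono m)" for m
  proof (induction m rule: mono_induct)
    case zero
    then show ?case by simp
  next
    case (add i m)
    have eq: "mono (Poly_Mapping.single i 1 + m) = X i * mono m" by (simp add: X_def mono_add)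
    show ?case
    proof (cases "i \<in> W")
      case False
      have "e (X i * f) = 0" for f
        unfolding X_def using False by (intro funcs_monomult[OF e_funcs]) (simp add: W_def)
      then show ?thesis
        unfolding eq by (simp add: distrib_right funcs_add[OF e_funcs] power2_eq_square mult.assoc)
    next
      case True
      let ?g = "mono m" and ?y = "lf (W - {i})"
      have lfW: "lf W = X i + ?y" using True by (simp add: lf_def sum.remove)
      note ca = funcs_add[OF c[OF True]]
      have "c i ?g = A (W - {i}) (St (?y * ?g))" using K_St[OF AW[OF True], of "?y * ?g"] by (simp only: c_def)
      also have "\<dots> = c i (St ?g) + c i (?y * St ?g)"
        by (simp add: St_lf c_def distrib_right additive.add[OF addA[OF True]] power2_eq_square mult.assoc)
      \<comment> \<open>The form \<open>lf W\<close> is the sum of \<open>X i\<close> and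
        \<open>?y\<close>, and \<open>c i\<close> kills its multiples, so these two factors can be
        interchanged.\<close>
      also have "c i (?y * St ?g) = c i (X i * St ?g)"
      proof -
        have "c i (X i * St ?g) + c i (?y * St ?g) = 0"
          using c_lf[OF True, of "St ?g"] by (simp add: lfW distrib_right ca)
        then show ?thesis by (simp only: bit_add_eq_0)
      qed
      finally have "c i ?g = c i (St ?g) + c i (X i * St ?g)" .
      then show ?thesis
        unfolding eq by (simp add: distrib_right funcs_add[OF e_funcs] power2_eq_square mult.assoc e_X True)
    qed
  qed
  then have "e (St p) = e p" for p
    using additive_eqI[OF additive_comp[OF funcs_additive[OF e_funcs], of St] funcs_additive[OF e_funcs]]
    by (simp add: St_def)
  then have "e \<in> K 6 (deg_seq s)" using e_funcs by (simp add: K_def n)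
  then show thesis using e_X e_lf by (intro that[of e]) (simp_all add: c_def)
qed

subsection \<open>Functionals killing a linear form\<close>

definition Ku :: "nat set \<Rightarrow> nat \<Rightarrow> (poly2 \<Rightarrow> bit) set"
  where "Ku u n = {a \<in> K 6 n. \<forall>f. a (lf u * f) = 0}"

lemma ev_St:
  assumes "\<And>j. St (h j) = h j + (h j)\<^sup>2"
  shows "ev h (St p) = St (ev h p)"
proof -
  have "ev h (St p) = ev (\<lambda>j. ev h (X j + (X j)\<^sup>2)) p" by (simp only: St_def ev_ev)
  also have "\<dots> = ev (\<lambda>j. St (h j)) p" by (simp add: assms)
  also have "\<dots> = St (ev h p)" by (simp only: St_def ev_ev)
  finally show ?thesis .
qed

lemma lf_deg: "\<forall>m\<in>Poly_Mapping.keys (lf u). monom_deg m = 1"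
proof -
  have "lf u \<in> deg_ge 1 \<inter> deg_lt 2"
    unfolding lf_def
    by (induction u rule: infinite_finite_induct) (auto simp: deg_ge_add deg_lt_add X_def mono_deg_ge mono_deg_lt, auto simp: deg_ge_def deg_lt_def)
  then show ?thesis unfolding deg_ge_def deg_lt_def by force
qed

lemma ev_linear_deg:
  assumes "\<And>j. \<forall>k\<in>Poly_Mapping.keys (h j). monom_deg k = 1"
  shows "\<forall>k\<in>Poly_Mapping.keys (ev h (mono m)). monom_deg k = monom_deg m"
proof (induction m rule: mono_induct)
  case zero
  then show ?case using keys_mono[of 0] by (simp del: keys_mono)
next
  case (add j m)
  have "mono (Poly_Mapping.single j 1 + m) = X j * mono m" by (simp add: X_def mono_add)
  then have "ev h (mono (Poly_Mapping.single j 1 + m)) = h j * ev h (mono m)" by simp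
  then show ?case using keys_mult[of "h j" "ev h (mono m)"] assms[of j] add
    by (fastforce simp: monom_deg_add)
qed

text \<open>Substituting linear forms preserves degrees. It also commutes with \<open>St\<close>,
  since \<open>St\<close> adds to a linear form its square, just as it does to a variable.\<close>

lemma K_ev:
  assumes a: "a \<in> K t n" and h: "\<And>j. \<exists>u. finite u \<and> h j = lf u"
    and out: "\<And>j f. j \<notin> {1..t'} \<Longrightarrow> a (h j * f) = 0"
  shows "(\<lambda>p. a (ev h p)) \<in> K t' n"
proof -
  note F = K_funcs[OF a]
  have St: "St (h j) = h j + (h j)\<^sup>2" for j using h[of j] St_lf by auto
  have deg: "\<forall>k\<in>Poly_Mapping.keys (h j). monom_deg k = 1" for j using h[of j] lf_deg by auto
  have zero: "a (ev h (mono m)) = 0" if m: "m \<notin> mons t' n" for m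
  proof (cases "monom_deg m = n")
    case False
    show ?thesis using F by (rule funcs_vanish) (use ev_linear_deg[where h = h and m = m, OF deg] False in \<open>auto simp: mons_def\<close>)
  next
    case True
    then have "\<not> Poly_Mapping.keys m \<subseteq> {1..t'}" using m by (simp add: mons_def)
    then obtain j where j: "j \<in> Poly_Mapping.keys m" "j \<notin> {1..t'}" by blast
    define m' where "m' = m - Poly_Mapping.single j 1"
    have "m = Poly_Mapping.single j 1 + m'"
      using j(1) by (intro poly_mapping_eqI) (auto simp: m'_def lookup_add lookup_minus lookup_single when_def in_keys_iff)
    then have "mono m = X j * mono m'" by (simp add: X_def mono_add)
    then show ?thesis using out[OF j(2)] by simp
  qed
  have "(\<lambda>p. a (ev h p)) \<in> funcs t' n"
    by (rule funcsI[OF additive_comp[OF funcs_additive[OF F] additive_ev] zero])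
  moreover have "a (ev h (St p)) = a (ev h p)" for p
    using K_St[OF a] by (simp add: ev_St[where h = h, OF St])
  ultimately show ?thesis by (simp add: K_def)
qed

lemma lf_single: "lf {i} = X i"
  by (simp add: lf_def)

text \<open>Modulo a nonzero linear form the polynomial ring in six variables is one in five
  variables, and the identification is compatible with \<open>St\<close>.\<close>

lemma card_Ku:
  assumes u: "u \<subseteq> W" "u \<noteq> {}"
  shows "card (Ku u n) = card (K 5 n)"
proof -
  from u obtain k where k: "k \<in> u" "k \<in> W" by blast
  have fin: "finite u" using u by (auto intro: finite_subset)
  \<comment> \<open>A variable \<open>k\<close> of the form is eliminated: \<sigma> replaces it by
    the sum of the other variables of \<open>u\<close>, which sends \<open>lf u\<close> to 0, and
    \<tau> renumbers to close the gap at \<open>k\<close>. The substitution \<rho> reopens the gap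
    and is a section up to multiples of \<open>lf u\<close>.\<close>
  define \<tau> where "\<tau> i = (if i < k then i else i - 1)" for i :: nat
  define \<tau>' where "\<tau>' i = (if i < k then i else i + 1)" for i :: nat
  define \<sigma> where "\<sigma> j = lf (if j = k then \<tau> ` (u - {k}) else {\<tau> j})" for j
  define \<rho> where "\<rho> j = lf {\<tau>' j}" for j
  have \<tau>': "\<tau> (\<tau>' i) = i" "\<tau>' i \<noteq> k" for i by (auto simp: \<tau>_def \<tau>'_def)
  have \<tau>: "\<tau>' (\<tau> i) = i" if "i \<noteq> k" for i using that by (auto simp: \<tau>_def \<tau>'_def)
  have inj: "inj_on \<tau> (u - {k})" by (rule inj_on_inverseI[of _ \<tau>']) (simp add: \<tau>)
  have bij: "bij_betw (\<lambda>a p. a (ev \<rho> p)) (Ku u n) (K 5 n)"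
  proof (rule bij_betw_byWitness[where f' = "\<lambda>b p. b (ev \<sigma> p)"])
    have \<sigma>\<rho>: "ev \<sigma> (ev \<rho> p) = p" for p
    proof -
      have "ev \<sigma> (\<rho> j) = X j" for j by (simp add: \<rho>_def lf_single \<sigma>_def \<tau>')
      then show ?thesis by (simp add: ev_ev ev_id)
    qed
    have \<rho>\<sigma>: "\<exists>r. ev \<rho> (ev \<sigma> (mono m)) = mono m + lf u * r" for m
    proof (induction m rule: mono_induct)
      case zero
      show ?case by (rule exI[of _ 0]) simp
    next
      case (add j m)
      then obtain r where r: "ev \<rho> (ev \<sigma> (mono m)) = mono m + lf u * r" by blast
      have "\<exists>q. ev \<rho> (\<sigma> j) = X j + lf u * q"
      proof (cases "j = k")
        case True
        have "ev \<rho> (\<sigma> j) = (\<Sum>i\<in>u - {k}. X i)"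
          using inj True by (simp add: \<sigma>_def lf_def ev_sum sum.reindex \<rho>_def lf_single \<tau>)
        also have "\<dots> = X k + lf u"
          unfolding lf_def using sum.remove[OF fin k(1), of X] by simp
        finally show ?thesis using True by (intro exI[of _ 1]) simp
      next
        case False
        then show ?thesis by (intro exI[of _ 0]) (simp add: \<sigma>_def lf_single \<rho>_def \<tau>)
      qed
      then obtain q where q: "ev \<rho> (\<sigma> j) = X j + lf u * q" by blast
      have "mono (Poly_Mapping.single j 1 + m) = X j * mono m" by (simp add: X_def mono_add)
      then show ?case
        by (intro exI[of _ "X j * r + q * mono m + lf u * q * r"]) (simp add: q r algebra_simps)
    qed
    show "\<forall>a\<in>Ku u n. (\<lambda>p. a (ev \<rho> (ev \<sigma> p))) = a"
    proof
      fix a assume "a \<in> Ku u n"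
      then have a: "a \<in> K 6 n" "\<And>f. a (lf u * f) = 0" by (auto simp: Ku_def)
      note F = K_funcs[OF a(1)]
      have "a (ev \<rho> (ev \<sigma> (mono m))) = a (mono m)" for m
      proof -
        obtain r where "ev \<rho> (ev \<sigma> (mono m)) = mono m + lf u * r" using \<rho>\<sigma> by blast
        then show ?thesis using a(2) by (simp add: funcs_add[OF F])
      qed
      from additive_eqI[OF additive_comp[OF funcs_additive[OF F] additive_comp[OF additive_ev additive_ev]] funcs_additive[OF F] this]
      show "(\<lambda>p. a (ev \<rho> (ev \<sigma> p))) = a" by (rule ext)
    qed
    show "\<forall>b\<in>K 5 n. (\<lambda>p. b (ev \<sigma> (ev \<rho> p))) = b" by (simp add: \<sigma>\<rho>)
    show "(\<lambda>a p. a (ev \<rho> p)) ` Ku u n \<subseteq> K 5 n"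
    proof (intro image_subsetI)
      fix a assume "a \<in> Ku u n"
      then have a: "a \<in> K 6 n" by (auto simp: Ku_def)
      show "(\<lambda>p. a (ev \<rho> p)) \<in> K 5 n"
      proof (rule K_ev[OF a])
        show "\<exists>u. finite u \<and> \<rho> j = lf u" for j by (rule exI[of _ "{\<tau>' j}"]) (simp add: \<rho>_def)
        fix j f assume "j \<notin> {1..5::nat}"
        then have "\<tau>' j \<notin> {1..6}" using k(2) by (auto simp: \<tau>'_def W_def)
        then show "a (\<rho> j * f) = 0"
          unfolding \<rho>_def lf_single X_def by (intro funcs_monomult[OF K_funcs[OF a]]) simp
      qed
    qed
    show "(\<lambda>b p. b (ev \<sigma> p)) ` K 5 n \<subseteq> Ku u n"
    proof (intro image_subsetI)
      fix b assume b: "b \<in> K 5 n"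
      have "(\<lambda>p. b (ev \<sigma> p)) \<in> K 6 n"
      proof (rule K_ev[OF b])
        show "\<exists>u. finite u \<and> \<sigma> j = lf u" for j
          by (rule exI[of _ "if j = k then \<tau> ` (u - {k}) else {\<tau> j}"]) (simp add: \<sigma>_def fin)
        fix j f assume j: "j \<notin> {1..6::nat}"
        then have "j \<noteq> k" "\<tau> j \<notin> {1..5}" using k(2) by (auto simp: \<tau>_def W_def)
        then show "b (\<sigma> j * f) = 0"
          by (simp add: \<sigma>_def lf_single) (simp add: X_def funcs_monomult[OF K_funcs[OF b]])
      qed
      moreover have "ev \<sigma> (lf u) = 0"
      proof -
        have "ev \<sigma> (lf u) = \<sigma> k + (\<Sum>j\<in>u - {k}. \<sigma> j)"
          using sum.remove[OF fin k(1), of \<sigma>] by (simp add: lf_def ev_sum)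
        also have "(\<Sum>j\<in>u - {k}. \<sigma> j) = \<sigma> k"
          using inj by (simp add: \<sigma>_def lf_def sum.reindex)
        finally show ?thesis by simp
      qed
      ultimately show "(\<lambda>p. b (ev \<sigma> p)) \<in> Ku u n"
        using funcs_zero[OF K_funcs[OF b]] by (simp add: Ku_def)
    qed
  qed
  then show ?thesis by (rule bij_betw_same_card)
qed

subsection \<open>Moebius inversion over the field with two elements\<close>

definition ups :: "nat set \<Rightarrow> nat set set"
  where "ups S = {u. S \<subseteq> u \<and> u \<subseteq> W}"

lemma finite_ups [simp]: "finite (ups S)"
  unfolding ups_def by (rule finite_subset[of _ "Pow W"]) auto

lemma sum_toggle:
  fixes g :: "nat set \<Rightarrow> bit"
  assumes F: "finite F" "\<And>S. S \<in> F \<Longrightarrow> insert i S \<in> F" "\<And>S. S \<in> F \<Longrightarrow> S - {i} \<in> F"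
    and g: "\<And>S. S \<in> F \<Longrightarrow> g (insert i S) = g S"
  shows "(\<Sum>S\<in>F. g S) = 0"
proof -
  let ?B = "{S \<in> F. i \<notin> S}"
  have split: "F = ?B \<union> insert i ` ?B"
  proof (intro equalityI subsetI)
    fix S assume "S \<in> F"
    then show "S \<in> ?B \<union> insert i ` ?B"
      using F(3)[of S] by (cases "i \<in> S") (auto intro!: image_eqI[of _ _ "S - {i}"])
  qed (use F(2) in auto)
  have "(\<Sum>S\<in>F. g S) = (\<Sum>S\<in>?B. g S) + (\<Sum>S\<in>insert i ` ?B. g S)"
    using F(1) by (subst split, intro sum.union_disjoint) auto
  also have "(\<Sum>S\<in>insert i ` ?B. g S) = (\<Sum>S\<in>?B. g (insert i S))"
    by (subst sum.reindex) (auto simp: inj_on_def insert_ident)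
  also have "\<dots> = (\<Sum>S\<in>?B. g S)" using g by (intro sum.cong) auto
  finally show ?thesis by simp
qed

text \<open>After exchanging the sums, \<open>f R\<close> is counted once for each set between
  \<open>S\<close> and \<open>R\<close>. This number is even unless \<open>R = S\<close>, so
  \<open>total\<close> is its own inverse.\<close>

lemma moebius:
  fixes f :: "nat set \<Rightarrow> bit"
  assumes S: "S \<subseteq> W"
  shows "(\<Sum>u\<in>ups S. \<Sum>R\<in>ups u. f R) = f S"
proof -
  have "(\<Sum>u\<in>ups S. \<Sum>R\<in>ups u. f R) = (\<Sum>u\<in>ups S. \<Sum>R\<in>{R \<in> ups S. u \<subseteq> R}. f R)"
    by (intro sum.cong) (auto simp: ups_def)
  also have "\<dots> = (\<Sum>R\<in>ups S. \<Sum>u\<in>{u \<in> ups S. u \<subseteq> R}. f R)"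
    by (rule sum.swap_restrict) simp_all
  also have "\<dots> = (\<Sum>R\<in>{S}. \<Sum>u\<in>{u \<in> ups S. u \<subseteq> R}. f R)"
  proof (rule sum.mono_neutral_right)
    show "\<forall>R\<in>ups S - {S}. (\<Sum>u\<in>{u \<in> ups S. u \<subseteq> R}. f R) = 0"
    proof
      fix R assume R: "R \<in> ups S - {S}"
      then obtain i where "i \<in> R" "i \<notin> S" by (auto simp: ups_def)
      then show "(\<Sum>u\<in>{u \<in> ups S. u \<subseteq> R}. f R) = 0"
        using R by (intro sum_toggle[of _ i]) (auto simp: ups_def)
    qed
  qed (use S in \<open>auto simp: ups_def\<close>)
  also have "\<dots> = f S"
  proof -
    have "{u \<in> ups S. u \<subseteq> S} = {S}" using S by (auto simp: ups_def)
    then show ?thesis by simp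
  qed
  finally show ?thesis .
qed

definition total :: "(nat set \<Rightarrow> poly2 \<Rightarrow> bit) \<Rightarrow> nat set \<Rightarrow> poly2 \<Rightarrow> bit"
  where "total a S f = (\<Sum>u\<in>ups S. a u f)"

lemma total_K: "(\<And>u. u \<in> ups S \<Longrightarrow> a u \<in> K t n) \<Longrightarrow> total a S \<in> K t n"
  unfolding total_def[abs_def] by (rule K_sum)

lemma total_total: "S \<subseteq> W \<Longrightarrow> total (total a) S f = a S f"
  unfolding total_def by (rule moebius)

lemma total_cong: "(\<And>u. u \<in> ups S \<Longrightarrow> a u = b u) \<Longrightarrow> total a S = total b S"
  unfolding total_def[abs_def] by simp

text \<open>Summation over supersets diagonalises the relations of the family: collecting the
  letters \<open>i\<close> of a fixed \<open>u\<close> produces the linear form of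
  \<open>u\<close>.\<close>

lemma rel_total:
  assumes a: "\<And>u. u \<in> ups S \<Longrightarrow> additive (a u)" "\<And>u f. u \<in> ups S \<Longrightarrow> a u (lf u * f) = 0"
  shows "(\<Sum>i\<in>W. total a (insert i S) (X i * f)) = 0"
proof -
  have "(\<Sum>i\<in>W. total a (insert i S) (X i * f)) = (\<Sum>i\<in>W. \<Sum>u\<in>{u \<in> ups S. i \<in> u}. a u (X i * f))"
    unfolding total_def by (intro sum.cong) (auto simp: ups_def)
  also have "\<dots> = (\<Sum>u\<in>ups S. \<Sum>i\<in>{i \<in> W. i \<in> u}. a u (X i * f))"
    by (rule sum.swap_restrict) simp_all
  also have "\<dots> = (\<Sum>u\<in>ups S. a u (lf u * f))"
  proof (rule sum.cong[OF refl])
    fix u assume u: "u \<in> ups S"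
    then have "finite u" "{i \<in> W. i \<in> u} = u" by (auto simp: ups_def intro: finite_subset)
    then show "(\<Sum>i\<in>{i \<in> W. i \<in> u}. a u (X i * f)) = a u (lf u * f)"
      using a(1)[OF u] by (simp add: lf_mult_sum)
  qed
  also have "\<dots> = 0" using a(2) by simp
  finally show ?thesis .
qed

text \<open>The converse direction. In the sum of the relations over all \<open>R\<close> containing
  \<open>u\<close>, a letter outside \<open>u\<close> contributes every term twice, while a letter
  of \<open>u\<close> is already in \<open>R\<close>.\<close>

lemma total_rel:
  assumes u: "u \<subseteq> W" and A: "\<And>R. R \<in> ups u \<Longrightarrow> additive (A R)"
    and rel: "\<And>R. R \<in> ups u \<Longrightarrow> (\<Sum>i\<in>W. A (insert i R) (X i * f)) = 0"
  shows "total A u (lf u * f) = 0"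
proof -
  have fin: "finite u" using u by (auto intro: finite_subset)
  have "0 = (\<Sum>R\<in>ups u. \<Sum>i\<in>W. A (insert i R) (X i * f))" using rel by simp
  also have "\<dots> = (\<Sum>i\<in>W. \<Sum>R\<in>ups u. A (insert i R) (X i * f))" by (rule sum.swap)
  also have "\<dots> = (\<Sum>i\<in>u. \<Sum>R\<in>ups u. A (insert i R) (X i * f))"
  proof (rule sum.mono_neutral_right)
    show "\<forall>i\<in>W - u. (\<Sum>R\<in>ups u. A (insert i R) (X i * f)) = 0"
      by (intro ballI sum_toggle) (auto simp: ups_def)
  qed (use u in auto)
  also have "\<dots> = (\<Sum>i\<in>u. \<Sum>R\<in>ups u. A R (X i * f))"
    by (intro sum.cong refl) (auto simp: ups_def insert_absorb subset_iff)
  also have "\<dots> = (\<Sum>R\<in>ups u. \<Sum>i\<in>u. A R (X i * f))" by (rule sum.swap)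
  also have "\<dots> = total A u (lf u * f)"
    using fin A by (simp add: total_def lf_mult_sum)
  finally show ?thesis by simp
qed

subsection \<open>The structure of functionals in six variables\<close>

lemma word_exists:
  assumes "finite S" "S \<noteq> {}" "card S \<le> n"
  obtains w where "length w = n" "set w = S"
proof -
  obtain xs where xs: "set xs = S" "distinct xs" using assms(1) finite_distinct_list by blast
  then have l: "length xs = card S" by (simp add: distinct_card[symmetric])
  obtain x where "x \<in> S" using assms(2) by blast
  then show thesis
    using xs l assms(3) by (intro that[of "xs @ replicate (n - length xs) x"]) (auto simp: set_replicate_conv_if)
qed

lemma funcs_eq_X:
  assumes "\<phi> \<in> funcs 6 (Suc n)" "\<psi> \<in> funcs 6 (Suc n)" "\<And>i f. i \<in> W \<Longrightarrow> \<phi> (X i * f) = \<psi> (X i * f)"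
  shows "\<phi> = \<psi>"
proof (rule funcs_eqI[OF assms(1,2)])
  fix m assume m: "m \<in> mons 6 (Suc n)"
  then have "m \<noteq> 0" by (auto simp: mons_def)
  then obtain i where i: "i \<in> Poly_Mapping.keys m" by (metis all_not_in_conv keys_eq_empty)
  define h where "h = m - Poly_Mapping.single i 1"
  have "m = Poly_Mapping.single i 1 + h"
    using i by (intro poly_mapping_eqI) (auto simp: h_def lookup_add lookup_minus lookup_single when_def in_keys_iff)
  then have "mono m = X i * mono h" by (simp add: X_def mono_add)
  moreover have "i \<in> W" using i m by (auto simp: mons_def W_def)
  ultimately show "\<phi> (mono m) = \<psi> (mono m)" using assms(3) by simp
qed

text \<open>The empty set indexes no nonzero linear form; its component is fixed to be 0.\<close>

definition ext0 :: "(nat set \<Rightarrow> poly2 \<Rightarrow> bit) \<Rightarrow> nat set \<Rightarrow> poly2 \<Rightarrow> bit"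
  where "ext0 a u = (if u = {} then (\<lambda>f. 0) else a u)"

definition glue :: "(nat set \<Rightarrow> poly2 \<Rightarrow> bit) \<Rightarrow> poly2 \<Rightarrow> bit"
  where "glue a = build 5 (total (ext0 a)) {}"

lemma family:
  assumes a: "\<And>u. u \<subseteq> W \<Longrightarrow> u \<noteq> {} \<Longrightarrow> a u \<in> Ku u n"
  shows "S \<subseteq> W \<Longrightarrow> total (ext0 a) S \<in> K 6 n"
    and "S \<subseteq> W \<Longrightarrow> (\<Sum>i\<in>W. total (ext0 a) (insert i S) (X i * f)) = 0"
proof -
  have K: "ext0 a u \<in> K 6 n" "ext0 a u (lf u * f) = 0" if "u \<in> ups S" for u S f
    using a[of u] that by (auto simp: ext0_def Ku_def ups_def)
  show "S \<subseteq> W \<Longrightarrow> total (ext0 a) S \<in> K 6 n" by (rule total_K) (rule K(1))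
  show "S \<subseteq> W \<Longrightarrow> (\<Sum>i\<in>W. total (ext0 a) (insert i S) (X i * f)) = 0"
    by (rule rel_total) (use K in \<open>auto simp: K_def funcs_def\<close>)
qed

lemma dig_glue:
  assumes a: "\<And>u. u \<subseteq> W \<Longrightarrow> u \<noteq> {} \<Longrightarrow> a u \<in> Ku u (deg_seq s)" and w: "length w = 5" "set w \<subseteq> W"
  shows "dig w (glue a) = total (ext0 a) (set w)"
proof -
  have "dig w (build (length w) (total (ext0 a)) {}) = total (ext0 a) ({} \<union> set w)"
    by (rule dig_build[where s = s]) (use family[of a, OF a] w in auto)
  then show ?thesis using w by (simp add: glue_def)
qed

lemma glue_K:
  assumes a: "\<And>u. u \<subseteq> W \<Longrightarrow> u \<noteq> {} \<Longrightarrow> a u \<in> Ku u (deg_seq s)"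
  shows "glue a \<in> K 6 (deg_seq (5 + s))"
  unfolding glue_def using build_K[where d = 5 and s = s and S = "{}" and A = "total (ext0 a)"] family[of a, OF a] by blast

text \<open>Words of length five recover the family at all nonempty proper subsets. At
  \<open>W\<close> it is recovered from the relations for \<open>W - {i}\<close>, because a
  functional of positive degree is determined by its values on multiples of variables.\<close>

lemma inj_glue: "inj_on glue (Pi\<^sub>E (Pow W - {{}}) (\<lambda>u. Ku u (deg_seq s)))"
proof (rule inj_onI)
  fix a a' assume P: "a \<in> Pi\<^sub>E (Pow W - {{}}) (\<lambda>u. Ku u (deg_seq s))" "a' \<in> Pi\<^sub>E (Pow W - {{}}) (\<lambda>u. Ku u (deg_seq s))"
    and eq: "glue a = glue a'"
  have a: "a u \<in> Ku u (deg_seq s)" "a' u \<in> Ku u (deg_seq s)" if "u \<subseteq> W" "u \<noteq> {}" for u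
    using PiE_mem[OF P(1), of u] PiE_mem[OF P(2), of u] that by auto
  let ?A = "total (ext0 a)" and ?A' = "total (ext0 a')"
  note fam = family[of a, OF a(1)] and fam' = family[of a', OF a(2)]
  have small: "?A S = ?A' S" if S: "S \<subseteq> W" "S \<noteq> {}" "S \<noteq> W" for S
  proof -
    have "card S < card W" using S(1,3) by (intro psubset_card_mono) auto
    then obtain w where w: "length w = 5" "set w = S"
      using word_exists[of S 5] S finite_subset[OF S(1)] by (auto simp: card_W)
    then show ?thesis using dig_glue[OF a(1) w(1)] dig_glue[OF a(2) w(1)] eq S by simp
  qed
  obtain n where n: "deg_seq s = Suc n" using deg_seq_pos[of s] by (cases "deg_seq s") auto
  have "?A W = ?A' W"
  proof (rule funcs_eq_X)
    show "?A W \<in> funcs 6 (Suc n)" "?A' W \<in> funcs 6 (Suc n)"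
      using fam(1)[of W] fam'(1)[of W] by (auto simp: n[symmetric] K_funcs)
    fix i f assume i: "i \<in> W"
    have ne: "W - {i} \<noteq> {}" using card_W_minus[OF i] by (metis card.empty zero_neq_numeral)
    have ex: "B W (X i * f) = (\<Sum>j\<in>W - {i}. B (W - {i}) (X j * f))"
      if "(\<Sum>j\<in>W. B (insert j (W - {i})) (X j * f)) = 0" for B :: "nat set \<Rightarrow> poly2 \<Rightarrow> bit"
    proof -
      have "(\<Sum>j\<in>W. B (insert j (W - {i})) (X j * f)) = B W (X i * f) + (\<Sum>j\<in>W - {i}. B (insert j (W - {i})) (X j * f))"
        using i by (subst sum.remove[of W i]) (simp_all add: insert_absorb)
      also have "(\<Sum>j\<in>W - {i}. B (insert j (W - {i})) (X j * f)) = (\<Sum>j\<in>W - {i}. B (W - {i}) (X j * f))"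
        by (intro sum.cong refl) (simp add: insert_absorb)
      finally have "B W (X i * f) + (\<Sum>j\<in>W - {i}. B (W - {i}) (X j * f)) = 0" using that by simp
      then show ?thesis by (simp only: bit_add_eq_0)
    qed
    have "?A (W - {i}) = ?A' (W - {i})" by (rule small) (use i ne in auto)
    then show "?A W (X i * f) = ?A' W (X i * f)"
      using ex[OF fam(2)] ex[OF fam'(2)] by simp
  qed
  with small have all: "?A S = ?A' S" if "S \<subseteq> W" "S \<noteq> {}" for S using that by blast
  show "a = a'"
  proof (rule PiE_ext[OF P])
    fix u assume "u \<in> Pow W - {{}}"
    then have u: "u \<subseteq> W" "u \<noteq> {}" by auto
    have "total ?A u = total ?A' u"
      by (rule total_cong) (use u all in \<open>auto simp: ups_def\<close>)
    then have "ext0 a u f = ext0 a' u f" for f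
      using total_total[OF u(1), of "ext0 a" f] total_total[OF u(1), of "ext0 a'" f] by simp
    then show "a u = a' u" using u by (simp add: ext0_def fun_eq_iff)
  qed
qed

text \<open>\<open>dig_set\<close> makes the family indexed by sets of letters well defined,
  \<open>complete_family\<close> adds the member at \<open>W\<close>, and \<open>total\<close>
  passes to the components at the linear forms.\<close>

lemma surj_glue:
  assumes \<phi>: "\<phi> \<in> K 6 (deg_seq (5 + s))"
  obtains a where "a \<in> Pi\<^sub>E (Pow W - {{}}) (\<lambda>u. Ku u (deg_seq s))" "glue a = \<phi>"
proof -
  define A0 where "A0 S = dig (SOME w. length w = 5 \<and> set w = S) \<phi>" for S
  have A0: "dig w \<phi> = A0 (set w)" if "length w = 5" "set w \<subseteq> W" for w
  proof -
    let ?v = "SOME v. length v = 5 \<and> set v = set w"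
    have v: "length ?v = 5 \<and> set ?v = set w" by (rule someI[of _ w]) (simp add: that)
    show ?thesis unfolding A0_def
      by (rule dig_set[where s = s]) (use \<phi> that v in auto)
  qed
  have A0_K: "A0 S \<in> K 6 (deg_seq s)" if S: "S \<subseteq> W" "S \<noteq> {}" "S \<noteq> W" for S
  proof -
    have "card S < card W" using S(1,3) by (intro psubset_card_mono) auto
    then obtain w where w: "length w = 5" "set w = S"
      using word_exists[of S 5] S finite_subset[OF S(1)] by (auto simp: card_W)
    then show ?thesis using A0[of w] dig_K[of \<phi> w s] \<phi> S by simp
  qed
  have A0_rel: "(\<Sum>i\<in>W. A0 (insert i S) (X i * f)) = 0" if S: "S \<subseteq> W" "card S \<le> 4" for S f
  proof (cases "S = {}")
    case True
    have \<phi>': "\<phi> \<in> K 6 (deg_seq (Suc (4 + s)))" using \<phi> by simp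
    \<comment> \<open>No word of length four has an empty set of letters. For \<open>S = {}\<close>
      the relation between the members at singletons is instead the relation of the lowest layer,
      squared four times by \<open>rel_square\<close>.\<close>
    have "(\<Sum>i\<in>W. sub i (sub i (sub i (sub i (sub i \<phi>)))) (X i * f)) = 0"
      by (rule rel_square[of "\<lambda>i. sub i (sub i (sub i (sub i \<phi>)))"],
          rule rel_square[of "\<lambda>i. sub i (sub i (sub i \<phi>))"],
          rule rel_square[of "\<lambda>i. sub i (sub i \<phi>)"],
          rule rel_square[of "\<lambda>i. sub i \<phi>"], rule sub_rel[OF \<phi>'])
    moreover have "sub i (sub i (sub i (sub i (sub i \<phi>)))) = A0 {i}" if "i \<in> W" for i
      using A0[of "[i, i, i, i, i]"] that by simp
    ultimately show ?thesis using True by simp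
  next
    case False
    then obtain w where w: "length w = 4" "set w = S"
      using word_exists[of S 4] S finite_subset[OF S(1)] by auto
    have "dig w \<phi> \<in> K 6 (deg_seq (Suc s))"
      using dig_K[of \<phi> w "Suc s"] \<phi> S w by simp
    then have "(\<Sum>i\<in>W. sub i (dig w \<phi>) (X i * f)) = 0" by (rule sub_rel)
    moreover have "sub i (dig w \<phi>) = A0 (insert i S)" if "i \<in> W" for i
      using A0[of "w @ [i]"] that w S by (simp add: dig_append)
    ultimately show ?thesis by simp
  qed
  obtain e where e: "e \<in> K 6 (deg_seq s)" "\<And>i f. i \<in> W \<Longrightarrow> e (X i * f) = A0 (W - {i}) (lf (W - {i}) * f)"
    "\<And>f. e (lf W * f) = 0"
    using complete_family[of A0 s] A0_K A0_rel by blast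
  define A where "A S = (if S = W then e else A0 S)" for S
  have A_K: "A S \<in> K 6 (deg_seq s)" if "S \<subseteq> W" "S \<noteq> {}" for S
    using that A0_K e(1) by (simp add: A_def)
  have addA: "additive (A S)" if "S \<subseteq> W" "S \<noteq> {}" for S
    using A_K[OF that] by (simp add: K_def funcs_def)
  have A_rel: "(\<Sum>i\<in>W. A (insert i S) (X i * f)) = 0" if S: "S \<subseteq> W" "S \<noteq> {}" for S f
  proof -
    have le: "card S \<le> 6" using card_mono[OF _ S(1)] by (simp add: card_W)
    consider "card S \<le> 4" | "card S = 5" | "card S = 6" using le by linarith
    then show ?thesis
    proof cases
      case 1
      have le5: "card (insert i S) \<le> 5" for i
        using 1 finite_subset[OF S(1)] by (simp add: card_insert_if)
      have "insert i S \<noteq> W" for i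
      proof -
        have "card (insert i S) < card W" using le5[of i] unfolding card_W by linarith
        then show ?thesis by (metis less_irrefl)
      qed
      then show ?thesis using A0_rel[OF S(1) 1] by (simp add: A_def)
    next
      case 2
      then obtain k where k: "k \<in> W" "S = W - {k}" using five_of_six S(1) by blast
      have "(\<Sum>i\<in>W. A (insert i S) (X i * f)) = A W (X k * f) + (\<Sum>i\<in>S. A (insert i S) (X i * f))"
        using k by (subst sum.remove[of W k]) (simp_all add: insert_absorb)
      also have "(\<Sum>i\<in>S. A (insert i S) (X i * f)) = (\<Sum>i\<in>S. A S (X i * f))"
        by (intro sum.cong refl) (simp add: insert_absorb)
      also have "\<dots> = A S (lf S * f)"
        using addA[OF S] finite_subset[OF S(1)] by (simp add: lf_mult_sum)
      also have "A W (X k * f) = A S (lf S * f)"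
        using e(2)[OF k(1)] k by (auto simp: A_def)
      finally show ?thesis by simp
    next
      case 3
      then have "S = W" using S(1) by (intro card_subset_eq) (auto simp: card_W)
      then have "(\<Sum>i\<in>W. A (insert i S) (X i * f)) = (\<Sum>i\<in>W. e (X i * f))"
        by (simp add: insert_absorb A_def)
      also have "\<dots> = e (lf W * f)" using e(1) by (simp add: lf_mult_sum K_def funcs_def)
      finally show ?thesis using e(3) by simp
    qed
  qed
  define a where "a = restrict (total A) (Pow W - {{}})"
  have up: "R \<subseteq> W \<and> R \<noteq> {}" if "R \<in> ups u" "u \<noteq> {}" for R u using that by (auto simp: ups_def)
  have b: "total A u \<in> Ku u (deg_seq s)" if u: "u \<subseteq> W" "u \<noteq> {}" for u
  proof -
    have "total A u \<in> K 6 (deg_seq s)"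
    proof (rule total_K)
      fix R assume "R \<in> ups u"
      with up[OF this u(2)] show "A R \<in> K 6 (deg_seq s)" using A_K[of R] by simp
    qed
    moreover have "total A u (lf u * f) = 0" for f
    proof (rule total_rel[OF u(1)])
      fix R assume R: "R \<in> ups u"
      show "additive (A R)" using up[OF R u(2)] addA[of R] by simp
      show "(\<Sum>i\<in>W. A (insert i R) (X i * f)) = 0" for f using up[OF R u(2)] A_rel[of R f] by simp
    qed
    ultimately show ?thesis by (simp add: Ku_def)
  qed
  then have a: "a \<in> Pi\<^sub>E (Pow W - {{}}) (\<lambda>u. Ku u (deg_seq s))" by (auto simp: a_def)
  have au: "a u \<in> Ku u (deg_seq s)" if "u \<subseteq> W" "u \<noteq> {}" for u using b that by (simp add: a_def)
  have "glue a = \<phi>"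
  proof (rule dig_eqI[OF glue_K[OF au] \<phi>])
    fix w :: "nat list" assume w: "length w = 5" "set w \<subseteq> W"
    have ne: "set w \<noteq> {}" using w by auto
    have nW: "set w \<noteq> W" using card_length[of w] w by (auto simp: card_W)
    have "dig w (glue a) = total (ext0 a) (set w)" using dig_glue[OF au w] .
    also have "\<dots> = total (total A) (set w)"
      by (rule total_cong) (use up[OF _ ne] in \<open>auto simp: ext0_def a_def\<close>)
    also have "\<dots> = A (set w)" using total_total[OF w(2)] by (rule ext)
    also have "\<dots> = dig w \<phi>" using A0[OF w] nW by (simp add: A_def)
    finally show "dig w (glue a) = dig w \<phi>" .
  qed
  with a show thesis by (rule that)
qed

theorem card_K_6: "card (K 6 (deg_seq (s + 5))) = (2 ^ 2520) ^ 63"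
proof -
  let ?P = "Pi\<^sub>E (Pow W - {{}}) (\<lambda>u. Ku u (deg_seq s))"
  have "bij_betw glue ?P (K 6 (deg_seq (5 + s)))"
  proof (rule bij_betw_imageI[OF inj_glue])
    show "glue ` ?P = K 6 (deg_seq (5 + s))"
    proof (intro equalityI image_subsetI subsetI)
      fix a assume a: "a \<in> ?P"
      show "glue a \<in> K 6 (deg_seq (5 + s))"
      proof (rule glue_K)
        fix u assume "u \<subseteq> W" "u \<noteq> {}"
        then show "a u \<in> Ku u (deg_seq s)" using PiE_mem[OF a, of u] by simp
      qed
    next
      fix \<phi> assume "\<phi> \<in> K 6 (deg_seq (5 + s))"
      then obtain a where "a \<in> ?P" "glue a = \<phi>" by (rule surj_glue)
      then show "\<phi> \<in> glue ` ?P" by blast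
    qed
  qed
  then have "card (K 6 (deg_seq (5 + s))) = card ?P" by (rule bij_betw_same_card[symmetric])
  also have "\<dots> = (\<Prod>u\<in>Pow W - {{}}. card (Ku u (deg_seq s)))" by (rule card_PiE) simp
  also have "\<dots> = (\<Prod>u\<in>Pow W - {{}}. 2 ^ 2520)"
  proof (rule prod.cong[OF refl])
    fix u assume "u \<in> Pow W - {{}}"
    then have u: "u \<subseteq> W" "u \<noteq> {}" by auto
    show "card (Ku u (deg_seq s)) = 2 ^ 2520" unfolding card_Ku[OF u] by (rule card_K_5)
  qed
  also have "\<dots> = (2 ^ 2520) ^ 63"
  proof -
    have "card (Pow W - {{}}) = 63" by (simp add: card_Diff_singleton card_Pow card_W)
    then show ?thesis unfolding prod_constant by (rule arg_cong)
  qed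
  finally show ?thesis by (simp only: add.commute)
qed

subsection \<open>Duality\<close>

lemma card_vectorspace_bit:
  assumes "vectorspace (class_ring :: bit ring) Q" "vectorspace.fin_dim (class_ring :: bit ring) Q"
  shows "card (carrier Q) = 2 ^ vectorspace.dim (class_ring :: bit ring) Q"
proof -
  interpret vectorspace "class_ring :: bit ring" Q by fact
  obtain A where A: "finite A" "basis A" using finite_basis_exists[OF assms(2)] by blast
  then have AC: "A \<subseteq> carrier Q" by (simp add: basis_def)
  let ?F = "A \<rightarrow>\<^sub>E carrier (class_ring :: bit ring)"
  have ex: "\<exists>!a. a \<in> ?F \<and> lincomb a A = v" if "v \<in> carrier Q" for v
    using A basis_criterion[OF A(1) AC] that by blast
  have closed: "lincomb a A \<in> carrier Q" for a
    using AC by (intro lincomb_closed) auto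
  have "bij_betw (\<lambda>a. lincomb a A) ?F (carrier Q)"
  proof (rule bij_betwI')
    fix a b assume ab: "a \<in> ?F" "b \<in> ?F"
    show "lincomb a A = lincomb b A \<longleftrightarrow> a = b"
    proof
      assume "lincomb a A = lincomb b A"
      then have P: "a \<in> ?F \<and> lincomb a A = lincomb a A" "b \<in> ?F \<and> lincomb b A = lincomb a A"
        using ab by simp_all
      show "a = b"
        using the1_equality[OF ex[OF closed[of a]], OF P(1)] the1_equality[OF ex[OF closed[of a]], OF P(2)] by (rule trans[OF sym])
    qed simp
  next
    fix v assume "v \<in> carrier Q"
    then show "\<exists>a\<in>?F. v = lincomb a A" using ex1_implies_ex[OF ex[of v]] by auto
  qed (rule closed)
  then have "card (carrier Q) = card ?F" by (rule bij_betw_same_card[symmetric])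
  also have "\<dots> = 2 ^ card A"
  proof -
    have "b \<in> {0, 1}" for b :: bit by (cases b) simp_all
    then have "(UNIV :: bit set) = {0, 1}" by blast
    then have "card (UNIV :: bit set) = card {0, 1 :: bit}" by (rule arg_cong)
    then have "card (UNIV :: bit set) = 2" by simp
    then show ?thesis using A(1) by (simp add: card_PiE)
  qed
  also have "card A = dim" using dim_basis[OF A] ..
  finally show ?thesis .
qed

section \<open>Hit polynomials and invariant functionals\<close>

lemma Sq_0: "Sq 0 (mono m) = mono m"
proof (induction m rule: mono_induct)
  case zero
  then show ?case by (simp add: Sq_one)
next
  case (add j m)
  have "mono (Poly_Mapping.single j 1 + m) = X j * mono m" by (simp add: X_def mono_add)
  then show ?case using add by (simp add: Sq_X_mult)
qed

lemma mono_hom_polys: "Poly_Mapping.keys m \<subseteq> {1..t} \<Longrightarrow> mono m \<in> hom_polys t (monom_deg m)"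
  by (simp add: hom_polys_def)

lemma funcs_Sq_zero:
  assumes "\<phi> \<in> funcs t n" "Poly_Mapping.keys m \<subseteq> {1..t}" "monom_deg m + k \<noteq> n"
  shows "\<phi> (Sq k (mono m)) = 0"
proof (rule funcs_vanish[OF assms(1)])
  fix m' assume "m' \<in> Poly_Mapping.keys (Sq k (mono m))"
  then show "m' \<notin> mons t n"
    using Sq_hom_polys[OF mono_hom_polys[OF assms(2)], of k] assms(3) by (auto simp: hom_polys_def mons_def)
qed

lemma funcs_St:
  assumes \<phi>: "\<phi> \<in> funcs t n" and m: "Poly_Mapping.keys m \<subseteq> {1..t}"
  shows "\<phi> (St (mono m)) = (if monom_deg m \<le> n then \<phi> (Sq (n - monom_deg m) (mono m)) else 0)"
proof -
  have "\<phi> (St (mono m)) = (\<Sum>k\<le>n + monom_deg m. \<phi> (Sq k (mono m)))"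
    using St_mono[of m "n + monom_deg m"] funcs_additive[OF \<phi>] by (simp add: additive.sum)
  also have "\<dots> = (if monom_deg m \<le> n then \<phi> (Sq (n - monom_deg m) (mono m)) else 0)"
  proof (cases "monom_deg m \<le> n")
    case True
    have "(\<Sum>k\<le>n + monom_deg m. \<phi> (Sq k (mono m))) = (\<Sum>k\<in>{n - monom_deg m}. \<phi> (Sq k (mono m)))"
      using True by (intro sum.mono_neutral_right) (auto intro!: funcs_Sq_zero[OF \<phi> m])
    then show ?thesis using True by simp
  next
    case False
    then show ?thesis by (auto intro!: sum.neutral funcs_Sq_zero[OF \<phi> m])
  qed
  finally show ?thesis .
qed

lemma hit_subset: "hit t n \<subseteq> hom_polys t n"
  using submodule.subset[OF submodule_hit, of t n] by (simp add: hom_space_def)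

text \<open>On a monomial, a functional of degree \<open>n\<close> sees the single component of
  \<open>St\<close> that raises its degree to \<open>n\<close>. Invariance therefore says that the
  squares of positive index into degree \<open>n\<close> are killed; squares of index zero give no
  condition.\<close>

lemma K_annihilator: "K t n = {\<phi> \<in> funcs t n. \<forall>h\<in>hit t n. \<phi> h = 0}"
proof (intro equalityI subsetI)
  fix \<phi> assume \<phi>: "\<phi> \<in> K t n"
  note F = K_funcs[OF \<phi>]
  let ?N = "{p \<in> hom_polys t n. \<phi> p = 0}"
  have "submodule (class_ring :: bit ring) ?N (hom_space t n)"
  proof (rule submodule.intro[OF hom_space_module])
    fix c :: bit and v assume v: "v \<in> ?N"
    have "c \<odot>\<^bsub>hom_space t n\<^esub> v = (if c = 0 then 0 else v)"
      by (cases c) (simp_all add: hom_space_def single_one)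
    then show "c \<odot>\<^bsub>hom_space t n\<^esub> v \<in> ?N" using v funcs_zero[OF F] by (simp add: hom_polys_def)
  qed (auto simp: hom_space_def hom_polys_add funcs_add[OF F] funcs_zero[OF F], simp add: hom_polys_def)
  moreover have "(\<Union>i\<in>{1..n}. Sq i ` hom_polys t (n - i)) \<subseteq> ?N"
  proof (intro UN_least image_subsetI)
    fix i p assume i: "i \<in> {1..n}" and p: "p \<in> hom_polys t (n - i)"
    have "\<phi> (Sq i (mono m)) = 0" if m: "m \<in> Poly_Mapping.keys p" for m
    proof -
      have m': "Poly_Mapping.keys m \<subseteq> {1..t}" "monom_deg m = n - i" using p m by (auto simp: hom_polys_def)
      have "\<phi> (Sq i (mono m)) = \<phi> (mono m)"
        using funcs_St[OF F m'(1)] K_St[OF \<phi>, of "mono m"] m'(2) i by simp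
      also have "\<dots> = 0" using m' i by (intro funcs_mono[OF F]) (auto simp: mons_def)
      finally show ?thesis .
    qed
    then have "\<phi> (Sq i p) = 0"
      using poly2_expand[of p] by (metis (no_types, lifting) Sq_sum additive.sum[OF funcs_additive[OF F]] sum.neutral)
    then show "Sq i p \<in> ?N" using Sq_hom_polys[OF p, of i] i by simp
  qed
  ultimately have "hit t n \<subseteq> ?N"
    unfolding hit_def by (rule LinearCombinations.module.span_is_subset[OF hom_space_module, rotated])
  then show "\<phi> \<in> {\<phi> \<in> funcs t n. \<forall>h\<in>hit t n. \<phi> h = 0}" using F by auto
next
  fix \<phi> assume "\<phi> \<in> {\<phi> \<in> funcs t n. \<forall>h\<in>hit t n. \<phi> h = 0}"
  then have F: "\<phi> \<in> funcs t n" and h: "\<And>h. h \<in> hit t n \<Longrightarrow> \<phi> h = 0" by auto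
  have gens: "(\<Union>i\<in>{1..n}. Sq i ` hom_polys t (n - i)) \<subseteq> hit t n"
    unfolding hit_def
  proof (rule LinearCombinations.module.in_own_span[OF hom_space_module])
    show "(\<Union>i\<in>{1..n}. Sq i ` hom_polys t (n - i)) \<subseteq> carrier (hom_space t n)"
    proof (intro UN_least image_subsetI)
      fix i p assume "i \<in> {1..n}" "p \<in> hom_polys t (n - i)"
      then show "Sq i p \<in> carrier (hom_space t n)"
        using Sq_hom_polys[of p t "n - i" i] by (simp add: hom_space_def)
    qed
  qed
  have "\<phi> (St (mono m)) = \<phi> (mono m)" for m
  proof (cases "Poly_Mapping.keys m \<subseteq> {1..t}")
    case True
    consider "monom_deg m < n" | "monom_deg m = n" | "n < monom_deg m" by linarith
    then show ?thesis
    proof cases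
      case 1
      define i where "i = n - monom_deg m"
      have "i \<in> {1..n}" "mono m \<in> hom_polys t (n - i)" using 1 mono_hom_polys[OF True] by (auto simp: i_def)
      then have "Sq i (mono m) \<in> hit t n" using gens by blast
      then have "\<phi> (Sq i (mono m)) = 0" by (rule h)
      moreover have "\<phi> (mono m) = 0" using 1 by (intro funcs_mono[OF F]) (auto simp: mons_def)
      ultimately show ?thesis using funcs_St[OF F True] 1 by (simp add: i_def)
    next
      case 2
      then show ?thesis using funcs_St[OF F True] by (simp add: Sq_0)
    next
      case 3
      then have "\<phi> (mono m) = 0" by (intro funcs_mono[OF F]) (auto simp: mons_def)
      then show ?thesis using funcs_St[OF F True] 3 by simp
    qed
  next
    case False
    then obtain j where j: "j \<in> Poly_Mapping.keys m" "j \<notin> {1..t}" by blast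
    define h where "h = m - Poly_Mapping.single j 1"
    have "m = Poly_Mapping.single j 1 + h"
      using j(1) by (intro poly_mapping_eqI) (auto simp: h_def lookup_add lookup_minus lookup_single when_def in_keys_iff)
    then have eq: "mono m = X j * mono h" by (simp add: X_def mono_add)
    have z: "\<phi> (X j * p) = 0" for p
      unfolding X_def using j(2) by (intro funcs_monomult[OF F]) simp
    have "St (mono m) = X j * ((1 + X j) * St (mono h))"
      by (simp add: eq distrib_left distrib_right power2_eq_square mult.assoc)
    then show ?thesis using z by (simp only: eq z)
  qed
  from additive_eqI[OF additive_comp[OF funcs_additive[OF F], of St] funcs_additive[OF F] this]
  have "\<phi> (St p) = \<phi> p" for p by (simp add: St_def)
  then show "\<phi> \<in> K t n" using F by (simp add: K_def)
qed

lemma bij_keys: "bij_betw Poly_Mapping.keys (hom_polys t n) (Pow (mons t n))"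
proof (rule bij_betwI')
  fix p q :: poly2
  show "Poly_Mapping.keys p = Poly_Mapping.keys q \<longleftrightarrow> p = q"
    using poly2_expand[of p] poly2_expand[of q] by metis
next
  fix p assume "p \<in> hom_polys t n"
  then show "Poly_Mapping.keys p \<in> Pow (mons t n)" by (auto simp: hom_polys_def mons_def)
next
  fix M assume M: "M \<in> Pow (mons t n)"
  have "finite M" using M finite_monomials[of "{1..t}" n] by (auto simp: mons_def intro: finite_subset)
  then have "Poly_Mapping.keys (\<Sum>m\<in>M. mono m) = M"
  proof (induction M rule: finite_induct)
    case (insert m M)
    then show ?case by (auto simp: keys_poly2_add)
  qed simp
  then show "\<exists>p\<in>hom_polys t n. M = Poly_Mapping.keys p"
    using M by (intro bexI[of _ "\<Sum>m\<in>M. mono m"]) (auto simp: hom_polys_def mons_def)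
qed

lemma finite_mons: "finite (mons t n)"
  unfolding mons_def by (rule finite_monomials) simp

lemma bij_funcs: "bij_betw (\<lambda>\<phi>. {m \<in> mons t n. \<phi> (mono m) = 1}) (funcs t n) (Pow (mons t n))"
proof (rule bij_betwI')
  fix \<phi> \<psi> assume F: "\<phi> \<in> funcs t n" "\<psi> \<in> funcs t n"
  show "{m \<in> mons t n. \<phi> (mono m) = 1} = {m \<in> mons t n. \<psi> (mono m) = 1} \<longleftrightarrow> \<phi> = \<psi>"
  proof
    assume eq: "{m \<in> mons t n. \<phi> (mono m) = 1} = {m \<in> mons t n. \<psi> (mono m) = 1}"
    show "\<phi> = \<psi>"
    proof (rule funcs_eqI[OF F])
      fix m assume "m \<in> mons t n"
      then have "\<phi> (mono m) = 1 \<longleftrightarrow> \<psi> (mono m) = 1" using eq by blast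
      then show "\<phi> (mono m) = \<psi> (mono m)" by (cases "\<phi> (mono m)"; cases "\<psi> (mono m)") simp_all
    qed
  qed simp
next
  fix M assume M: "M \<in> Pow (mons t n)"
  let ?\<phi> = "lin (\<lambda>m. if m \<in> M then 1 else 0 :: bit)"
  have "?\<phi> \<in> funcs t n" using M by (intro funcsI) auto
  then show "\<exists>\<phi>\<in>funcs t n. M = {m \<in> mons t n. \<phi> (mono m) = 1}"
    using M by (intro bexI[of _ ?\<phi>]) auto
qed auto

text \<open>The nontrivial character of the additive group of the field with two elements.\<close>

definition sgn_bit :: "bit \<Rightarrow> int"
  where "sgn_bit b = (if b = 0 then 1 else - 1)"

lemma sgn_bit_sum_zero:
  assumes inv: "\<And>x. x \<in> A \<Longrightarrow> g x \<in> A" "\<And>x. x \<in> A \<Longrightarrow> g (g x) = x" and flip: "\<And>x. x \<in> A \<Longrightarrow> b (g x) = b x + 1"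
  shows "(\<Sum>x\<in>A. sgn_bit (b x)) = 0"
proof -
  have "(\<Sum>x\<in>A. sgn_bit (b x)) = (\<Sum>x\<in>A. - sgn_bit (b x))"
  proof (rule sum.reindex_bij_witness[of _ g g])
    fix x assume x: "x \<in> A"
    show "- sgn_bit (b (g x)) = sgn_bit (b x)"
      unfolding flip[OF x] by (cases "b x") (simp_all add: sgn_bit_def)
  qed (use inv in auto)
  then show ?thesis by (simp add: sum_negf)
qed

text \<open>Sum the signs of \<phi> \<open>h\<close> over all functionals \<phi> and all hit
  polynomials \<open>h\<close>. A functional contributes the number of hit polynomials if it
  annihilates them and 0 otherwise; a hit polynomial contributes only if it is 0, and then the
  number of all functionals, which is the number of homogeneous polynomials.\<close>

lemma card_hit_K: "card (hit t n) * card (K t n) = card (hom_polys t n)"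
proof -
  let ?H = "hit t n" and ?F = "funcs t n"
  interpret H: submodule "class_ring :: bit ring" ?H "hom_space t n" by (rule submodule_hit)
  have finH: "finite ?H" using hit_subset finite_hom_polys by (rule finite_subset)
  have cF: "card ?F = card (hom_polys t n)"
    using bij_betw_same_card[OF bij_funcs] bij_betw_same_card[OF bij_keys] by metis
  have finF: "finite ?F" using bij_betw_finite[OF bij_funcs[of t n]] finite_mons by simp
  have H0: "0 \<in> ?H" and Hadd: "x + y \<in> ?H" if "x \<in> ?H" "y \<in> ?H" for x y
    using H.zero_closed H.m_closed that by (simp_all add: hom_space_def)
  have z: "0 \<in> ?H" using H.zero_closed by (simp add: hom_space_def)
  have 1: "(\<Sum>h\<in>?H. sgn_bit (\<phi> h)) = (if \<phi> \<in> K t n then int (card ?H) else 0)" if \<phi>: "\<phi> \<in> ?F" for \<phi>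
  proof (cases "\<phi> \<in> K t n")
    case True
    then show ?thesis by (simp add: K_annihilator sgn_bit_def)
  next
    case False
    then obtain h where h: "h \<in> ?H" "\<phi> h \<noteq> 0" using \<phi> by (auto simp: K_annihilator)
    have "\<phi> h = 1" using h(2) by (cases "\<phi> h") simp_all
    then have "(\<Sum>h\<in>?H. sgn_bit (\<phi> h)) = 0"
      using h(1) Hadd by (intro sgn_bit_sum_zero[of _ "\<lambda>x. x + h"]) (auto simp: funcs_add[OF \<phi>] add.assoc)
    then show ?thesis using False by simp
  qed
  have 2: "(\<Sum>\<phi>\<in>?F. sgn_bit (\<phi> h)) = (if h = 0 then int (card ?F) else 0)" if h: "h \<in> ?H" for h
  proof (cases "h = 0")
    case True
    then show ?thesis by (simp add: funcs_zero sgn_bit_def cong: sum.cong)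
  next
    case False
    then obtain m where m: "m \<in> Poly_Mapping.keys h" by (metis all_not_in_conv keys_eq_empty)
    let ?\<delta> = "lin (\<lambda>k. if k = m then 1 else 0 :: bit)"
    have mm: "m \<in> mons t n" using h hit_subset m by (fastforce simp: hom_polys_def mons_def)
    have \<delta>: "?\<delta> \<in> ?F" using mm by (intro funcsI) auto
    have "?\<delta> h = 1" using m by (simp add: lin_def)
    then have "(\<Sum>\<phi>\<in>?F. sgn_bit (\<phi> h)) = 0"
      using \<delta> by (intro sgn_bit_sum_zero[of _ "\<lambda>\<phi> p. \<phi> p + ?\<delta> p"]) (auto simp: funcs_def additive_plus add.assoc)
    then show ?thesis using False by simp
  qed
  have "(\<Sum>\<phi>\<in>?F. \<Sum>h\<in>?H. sgn_bit (\<phi> h)) = (\<Sum>h\<in>?H. \<Sum>\<phi>\<in>?F. sgn_bit (\<phi> h))"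
    by (rule sum.swap)
  also have "\<dots> = (\<Sum>h\<in>?H. if h = 0 then int (card ?F) else 0)" by (rule sum.cong[OF refl 2])
  also have "\<dots> = int (card ?F)" using finH z by simp
  also have "(\<Sum>\<phi>\<in>?F. \<Sum>h\<in>?H. sgn_bit (\<phi> h)) = (\<Sum>\<phi>\<in>?F. if \<phi> \<in> K t n then int (card ?H) else 0)"
    by (rule sum.cong[OF refl 1])
  also have "\<dots> = (\<Sum>\<phi>\<in>{\<phi> \<in> ?F. \<phi> \<in> K t n}. int (card ?H))"
    using finF by (rule sum.inter_filter[symmetric])
  also have "{\<phi> \<in> ?F. \<phi> \<in> K t n} = K t n" by (auto simp: K_funcs)
  finally have "int (card (K t n)) * int (card ?H) = int (card ?F)" by simp
  then show ?thesis using cF by (metis mult.commute of_nat_eq_iff of_nat_mult)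
qed

lemma card_QP: "card (carrier (QP t n)) = card (K t n)"
proof -
  let ?M = "hom_space t n" and ?H = "hit t n"
  interpret H: submodule "class_ring :: bit ring" ?H ?M by (rule submodule_hit)
  interpret M: Module.module "class_ring :: bit ring" ?M by (rule hom_space_module)
  interpret A: abelian_subgroup ?H ?M by (rule submodule_abelian_subgroup[OF submodule_hit])
  have c: "carrier ?M = hom_polys t n" by (simp add: hom_space_def)
  have "card (rcosets\<^bsub>add_monoid ?M\<^esub> ?H) * card ?H = Coset.order (add_monoid ?M)"
    using M.add.lagrange[OF A.a_subgroup] .
  then have "card (carrier (QP t n)) * card ?H = card (hom_polys t n)"
    by (simp add: QP_def quot_module_def A_RCOSETS_def Coset.order_def c)
  moreover have "card ?H > 0"
  proof -
    have "finite ?H" using hit_subset finite_hom_polys by (rule finite_subset)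
    moreover have "?H \<noteq> {}" using H.zero_closed by blast
    ultimately show ?thesis by (simp add: card_gt_0_iff)
  qed
  ultimately show ?thesis using card_hit_K[of t n] by (metis mult.commute mult_cancel2 less_numeral_extra(3))
qed

theorem card_K_dim: "card (K t n) = 2 ^ vectorspace.dim class_ring (QP t n)"
  using card_vectorspace_bit[OF vectorspace_QP fin_dim_QP] by (simp add: card_QP)

theorem corollary3p5:
  fixes s :: nat
  shows "vectorspace.dim class_ring (QP 6 (deg_seq (s + 5)))
           = (2 ^ 6 - 1) * vectorspace.dim class_ring (QP 5 (deg_seq s))
       \<and> (2 ^ 6 - 1) * vectorspace.dim class_ring (QP 5 (deg_seq s)) = 158760"
proof -
  have inj: "a = b" if "(2 :: nat) ^ a = 2 ^ b" for a b
    using that by (rule power_inject_exp[THEN iffD1, rotated]) simp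
  have 5: "vectorspace.dim class_ring (QP 5 (deg_seq s)) = 2520"
    by (rule inj) (rule trans[OF card_K_dim[symmetric] card_K_5])
  have "vectorspace.dim class_ring (QP 6 (deg_seq (s + 5))) = 2520 * 63"
    by (rule inj) (rule trans[OF card_K_dim[symmetric] trans[OF card_K_6 power_mult[symmetric]]])
  then show ?thesis unfolding 5 by simp
qed

end
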